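(* Let $d\ge1$ and for each $n$ consider the gas hard-core model on a box $\Lambda\subset\mathbb{Z}^d$ of side-length $n$ with fugacity $\lambda>0$ satisfying $$\lambda<\frac{1}{2d-2}\Big(1+\frac{1}{2d-2}\Big)^{2d-1}$$ (for $d=1$ the right-hand side is interpreted as $+\infty$) and an arbitrary boundary condition. Then the heat-bath dynamics has cutoff with window $O(\log\log n)$.
   Context: The gas hard-core model on $\Lambda$ with fugacity $\lambda$ is the probability measure on configurations $\sigma\in\{0,1\}^\Lambda$ having no two adjacent sites both equal to $1$ (including adjacency with outer boundary sites fixed to be $1$ by the boundary condition), with $\mu(\sigma)\propto\lambda^{\sum_{u\in\Lambda}\sigma(u)}$. A boundary condition assigns $0$ or $1$ to each site outside $\Lambda$ neighbouring $\Lambda$, or leaves it free. Heat-bath dynamics is the continuous-time chain on the admissible configurations where each site has an independent rate-one Poisson clock and when the clock at $x$ rings the spin at $x$ is resampled from its conditional distribution under $\mu$ given all other spins. $t_{\mathrm{mix}}(\epsilon)=\inf\{t:\max_{\sigma_0}\|\mathbb{P}_{\sigma_0}(X_t\in\cdot)-\mu\|_{\mathrm{TV}}\le\epsilon\}$. Cutoff: $t_{\mathrm{mix}}(\epsilon)/t_{\mathrm{mix}}(1-\epsilon)\to1$ as $n\to\infty$ for every $0<\epsilon<1$. Window $O(\log\log n)$: $\log\log n=o(t_{\mathrm{mix}}(1/e))$ and $t_{\mathrm{mix}}(\epsilon)=t_{\mathrm{mix}}(1-\epsilon)+O(\log\log n)$ for every $0<\epsilon<1$, with implicit constant that may depend on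 $\epsilon$. *)

theory Defs
  imports "HOL-Probability.Probability" "HOL-Library.Landau_Symbols"
begin

section \<open>Geometry of the lattice\<close>

type_synonym 'd site = "int ^ 'd"

definition adjacent :: "'d::finite site \<Rightarrow> 'd site \<Rightarrow> bool" where
  "adjacent u v \<longleftrightarrow> (\<Sum>i\<in>UNIV. \<bar>u $ i - v $ i\<bar>) = 1"

definition lattice_box :: "'d::finite site \<Rightarrow> nat \<Rightarrow> 'd site set" where
  "lattice_box a n = {u. \<forall>i. a $ i \<le> u $ i \<and> u $ i < a $ i + int n}"

definition outer_boundary :: "'d::finite site set \<Rightarrow> 'd site set" where
  "outer_boundary \<Lambda> = {v. v \<notin> \<Lambda> \<and> (\<exists>u\<in>\<Lambda>. adjacent u v)}"


section \<open>The hard-core model\<close>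

text \<open>In a boundary condition, \<open>None\<close> stands for a free site. Arguments \<open>\<Lambda> \<tau> lam\<close> below are
  the region, the boundary condition and the fugacity.\<close>

definition boundary_conditions :: "'d::finite site set \<Rightarrow> ('d site \<Rightarrow> nat option) set" where
  "boundary_conditions \<Lambda> = outer_boundary \<Lambda> \<rightarrow>\<^sub>E {None, Some 0, Some 1}"

definition admissible ::
  "'d::finite site set \<Rightarrow> ('d site \<Rightarrow> nat option) \<Rightarrow> ('d site \<Rightarrow> nat) set" where
  "admissible \<Lambda> \<tau> = {\<sigma> \<in> \<Lambda> \<rightarrow>\<^sub>E {0, 1}.
     (\<forall>u\<in>\<Lambda>. \<forall>v\<in>\<Lambda>. adjacent u v \<longrightarrow> \<not> (\<sigma> u = 1 \<and> \<sigma> v = 1)) \<and>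
     (\<forall>u\<in>\<Lambda>. \<forall>v\<in>outer_boundary \<Lambda>. adjacent u v \<longrightarrow> \<not> (\<sigma> u = 1 \<and> \<tau> v = Some 1))}"

definition partition_function ::
  "'d::finite site set \<Rightarrow> ('d site \<Rightarrow> nat option) \<Rightarrow> real \<Rightarrow> real" where
  "partition_function \<Lambda> \<tau> lam = (\<Sum>\<sigma>\<in>admissible \<Lambda> \<tau>. lam ^ (\<Sum>u\<in>\<Lambda>. \<sigma> u))"

text \<open>The probability mass function of the Gibbs measure, zero off the admissible set.\<close>

definition hard_core ::
  "'d::finite site set \<Rightarrow> ('d site \<Rightarrow> nat option) \<Rightarrow> real \<Rightarrow> ('d site \<Rightarrow> nat) \<Rightarrow> real" where
  "hard_core \<Lambda> \<tau> lam \<sigma> =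
     (if \<sigma> \<in> admissible \<Lambda> \<tau>
      then lam ^ (\<Sum>u\<in>\<Lambda>. \<sigma> u) / partition_function \<Lambda> \<tau> lam else 0)"


section \<open>Heat-bath dynamics\<close>

text \<open>Conditional probability of spin 1 at \<open>x\<close>, given that the spins at all other sites
  agree with \<open>\<sigma>\<close>.\<close>

definition occupation_prob ::
  "'d::finite site set \<Rightarrow> ('d site \<Rightarrow> nat option) \<Rightarrow> real \<Rightarrow> 'd site \<Rightarrow> ('d site \<Rightarrow> nat) \<Rightarrow> real"
where
  "occupation_prob \<Lambda> \<tau> lam x \<sigma> =
     hard_core \<Lambda> \<tau> lam (\<sigma>(x := 1)) /
       (hard_core \<Lambda> \<tau> lam (\<sigma>(x := 0)) + hard_core \<Lambda> \<tau> lam (\<sigma>(x := 1)))"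

text \<open>A sample point \<open>\<omega>\<close> gives, for each site \<open>x\<close> and each \<open>k\<close>, the waiting time
  \<open>fst (\<omega> (x, k))\<close> of the clock at \<open>x\<close> before its ring number \<open>k\<close> (exponential of rate one, so
  that the rings of each clock form a rate-one Poisson process) and a mark \<open>snd (\<omega> (x, k))\<close>,
  uniform on the unit interval, with which that ring resamples the spin. All of these are
  independent.\<close>

definition clock_space :: "'d::finite site set \<Rightarrow> ('d site \<times> nat \<Rightarrow> real \<times> real) measure" where
  "clock_space \<Lambda> = (\<Pi>\<^sub>M xk\<in>\<Lambda> \<times> UNIV.
     density lborel (\<lambda>s. ennreal (exponential_density 1 s)) \<Otimes>\<^sub>M uniform_measure lborel {0..1})"

definition ring_time :: "('d site \<times> nat \<Rightarrow> real \<times> real) \<Rightarrow> 'd site \<times> nat \<Rightarrow> real" where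
  "ring_time \<omega> = (\<lambda>(x, k). \<Sum>j\<le>k. fst (\<omega> (x, j)))"

definition rings_upto ::
  "'d::finite site set \<Rightarrow> ('d site \<times> nat \<Rightarrow> real \<times> real) \<Rightarrow> real \<Rightarrow> ('d site \<times> nat) set" where
  "rings_upto \<Lambda> \<omega> t = {xk \<in> \<Lambda> \<times> UNIV. ring_time \<omega> xk \<le> t}"

text \<open>The rings up to time \<open>t\<close> in chronological order. For finite \<open>\<Lambda>\<close>, almost surely there are
  finitely many of them and no two coincide; the value on the remaining null set is irrelevant.\<close>

definition ring_list ::
  "'d::finite site set \<Rightarrow> ('d site \<times> nat \<Rightarrow> real \<times> real) \<Rightarrow> real \<Rightarrow> ('d site \<times> nat) list" where
  "ring_list \<Lambda> \<omega> t =
     (if finite (rings_upto \<Lambda> \<omega> t) \<and> inj_on (ring_time \<omega>) (rings_upto \<Lambda> \<omega> t)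
      then sorted_key_list_of_set (ring_time \<omega>) (rings_upto \<Lambda> \<omega> t) else [])"

definition resample ::
  "'d::finite site set \<Rightarrow> ('d site \<Rightarrow> nat option) \<Rightarrow> real \<Rightarrow> ('d site \<times> nat \<Rightarrow> real \<times> real)
    \<Rightarrow> 'd site \<times> nat \<Rightarrow> ('d site \<Rightarrow> nat) \<Rightarrow> ('d site \<Rightarrow> nat)" where
  "resample \<Lambda> \<tau> lam \<omega> = (\<lambda>(x, k) \<sigma>.
     \<sigma>(x := (if snd (\<omega> (x, k)) < occupation_prob \<Lambda> \<tau> lam x \<sigma> then 1 else 0)))"

definition heat_bath ::
  "'d::finite site set \<Rightarrow> ('d site \<Rightarrow> nat option) \<Rightarrow> real \<Rightarrow> ('d site \<Rightarrow> nat) \<Rightarrow> real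
    \<Rightarrow> ('d site \<times> nat \<Rightarrow> real \<times> real) \<Rightarrow> ('d site \<Rightarrow> nat)" where
  "heat_bath \<Lambda> \<tau> lam \<sigma>\<^sub>0 t \<omega> = fold (resample \<Lambda> \<tau> lam \<omega>) (ring_list \<Lambda> \<omega> t) \<sigma>\<^sub>0"

definition heat_bath_prob ::
  "'d::finite site set \<Rightarrow> ('d site \<Rightarrow> nat option) \<Rightarrow> real \<Rightarrow> ('d site \<Rightarrow> nat) \<Rightarrow> real
    \<Rightarrow> ('d site \<Rightarrow> nat) \<Rightarrow> real" where
  "heat_bath_prob \<Lambda> \<tau> lam \<sigma>\<^sub>0 t \<eta> =
     measure (clock_space \<Lambda>) {\<omega> \<in> space (clock_space \<Lambda>). heat_bath \<Lambda> \<tau> lam \<sigma>\<^sub>0 t \<omega> = \<eta>}"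


section \<open>Mixing and cutoff\<close>

text \<open>Total variation distance between two mass functions on a finite set \<open>S\<close>.\<close>

definition tv_dist :: "'s set \<Rightarrow> ('s \<Rightarrow> real) \<Rightarrow> ('s \<Rightarrow> real) \<Rightarrow> real" where
  "tv_dist S p q = (\<Sum>\<eta>\<in>S. \<bar>p \<eta> - q \<eta>\<bar>) / 2"

definition t_mix ::
  "'d::finite site set \<Rightarrow> ('d site \<Rightarrow> nat option) \<Rightarrow> real \<Rightarrow> real \<Rightarrow> real" where
  "t_mix \<Lambda> \<tau> lam \<epsilon> = Inf {t. 0 \<le> t \<and>
     (MAX \<sigma>\<^sub>0\<in>admissible \<Lambda> \<tau>.
        tv_dist (admissible \<Lambda> \<tau>) (heat_bath_prob \<Lambda> \<tau> lam \<sigma>\<^sub>0 t) (hard_core \<Lambda> \<tau> lam)) \<le> \<epsilon>}"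

text \<open>In the next two definitions \<open>T n \<epsilon>\<close> is the \<open>\<epsilon>\<close>-mixing time of the \<open>n\<close>-th chain of a
  sequence.\<close>

definition cutoff :: "(nat \<Rightarrow> real \<Rightarrow> real) \<Rightarrow> bool" where
  "cutoff T \<longleftrightarrow> (\<forall>\<epsilon>. 0 < \<epsilon> \<and> \<epsilon> < 1 \<longrightarrow> (\<lambda>n. T n \<epsilon> / T n (1 - \<epsilon>)) \<longlonglongrightarrow> 1)"

definition cutoff_window :: "(nat \<Rightarrow> real \<Rightarrow> real) \<Rightarrow> (nat \<Rightarrow> real) \<Rightarrow> bool" where
  "cutoff_window T w \<longleftrightarrow> w \<in> o(\<lambda>n. T n (1 / exp 1)) \<and>
     (\<forall>\<epsilon>. 0 < \<epsilon> \<and> \<epsilon> < 1 \<longrightarrow> (\<lambda>n. T n \<epsilon> - T n (1 - \<epsilon>)) \<in> O(w))"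

end

theory Submission
  imports Defs "HOL-Real_Asymp.Real_Asymp"
begin

text \<open>Below the uniqueness threshold of the tree, Weitz's recursion contracts in the coordinates
  \<open>arsinh (sqrt R)\<close>, so on every finite region the occupation probabilities depend exponentially
  weakly on distant sites. The lattice is bipartite, so the dynamics is monotone. Censoring the
  updates on the boundaries of a shifted tiling contracts, on average over the shifts, the expected
  difference between the two extreme initial configurations; hence on a region \<open>S\<close> they have
  coalesced by time \<open>t\<close> except with probability \<open>4 * card S * exp (- c * t)\<close>.

  Write \<open>l = ln n\<close>. The chain is in equilibrium by time \<open>l\<^sup>2\<close>, and until then no information travels
  beyond distance \<open>l ^ 3\<close>. Suppose that at time \<open>t \<le> l\<^sup>2\<close> the distance to equilibrium is at most
  \<open>1 - \<epsilon>\<close>. Well separated regions evolve almost independently and Hellinger affinities multiply,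
  so the defects \<open>1 - affinity\<close> of the marginals on balls of polylogarithmic radius have a
  polylogarithmic sum. During a further time \<open>s\<close> of order \<open>ln l\<close> the local updates determine the
  spin at each site except with probability a large negative power of \<open>l\<close>. The configuration at time
  \<open>t + s\<close> is thus a function of the updates and of the configuration at time \<open>t\<close> near a sparse
  random set of sites, on which the expected defect is small; so the distance at time \<open>t + s\<close> is
  below \<open>\<epsilon>\<close>. Conversely, at time \<open>t = A * ln l\<close> each of at least \<open>n / 8\<close> even sites is biased by
  order \<open>exp (- t)\<close> when started from the top configuration, which violates the polylogarithmic bound
  on the sum of the defects. Hence all mixing times are much larger than \<open>ln l\<close>.\<close>

section \<open>Lattice geometry\<close>

text \<open>An occupied boundary site only deletes sites from the box, so the argument runs on
  arbitrary finite regions with uniform constants. The same uniformity allows the boundaries of a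
  tiling to be frozen in any state. Averaging over shifts is needed because a disagreement on a cell
  boundary may spread to a bounded mean number of sites, while one inside a cell nearly dies out; a
  site lies on the boundary for at most d of the m shifts, so a large m wins. Affinity is preferred
  to total variation because it is exactly multiplicative over independent factors: a distance
  bounded away from 1 becomes, after taking logarithms, a bound on a sum of defects. Finite speed of
  propagation says nothing directly about the Gibbs measure; equilibrium is therefore replaced by
  the law at time l^2 started from the top configuration, which is nearly a product over separated
  regions for the same reason as the law at time t. As for scales, the radius l^3 beats speed times
  l^2 as well as union bounds over n^d sites, and about l disjoint bad regions at one place are
  rarer than any negative power of n.\<close>

definition ldist :: "'d::finite site \<Rightarrow> 'd site \<Rightarrow> nat" where
  "ldist u v = nat (\<Sum>i\<in>UNIV. \<bar>u $ i - v $ i\<bar>)"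

definition lball :: "'d::finite site \<Rightarrow> nat \<Rightarrow> 'd site set" where
  "lball x r = {y. ldist x y \<le> r}"

definition nbrs :: "'d::finite site \<Rightarrow> 'd site set" where
  "nbrs v = {w. adjacent v w}"

text \<open>A colouring of the lattice with \<open>m ^ d\<close> colours in which distinct sites of
  one colour are at distance at least \<open>m\<close> (\<open>ldist_ge_of_residue_eq\<close>).
  Splitting by colour yields well separated families of sites.\<close>

definition residue :: "nat \<Rightarrow> 'd::finite site \<Rightarrow> 'd site" where
  "residue m x = (\<chi> i. x $ i mod int m)"

definition even_site :: "'d::finite site \<Rightarrow> bool" where
  "even_site x \<longleftrightarrow> even (\<Sum>i\<in>UNIV. x $ i)"

lemma int_ldist: "int (ldist u v) = (\<Sum>i\<in>UNIV. \<bar>u $ i - v $ i\<bar>)"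
  by (simp add: ldist_def sum_nonneg)

lemma adjacent_iff_ldist: "adjacent u v \<longleftrightarrow> ldist u v = 1"
  unfolding adjacent_def int_ldist[symmetric] by simp

lemma ldist_self [simp]: "ldist u u = 0"
  by (simp add: ldist_def)

lemma ldist_commute: "ldist u v = ldist v u"
  by (simp add: ldist_def abs_minus_commute)

lemma ldist_triangle: "ldist u w \<le> ldist u v + ldist v w"
proof -
  have "int (ldist u w) \<le> (\<Sum>i\<in>UNIV. \<bar>u $ i - v $ i\<bar> + \<bar>v $ i - w $ i\<bar>)"
    unfolding int_ldist by (intro sum_mono) linarith
  also have "\<dots> = int (ldist u v + ldist v w)"
    by (simp add: int_ldist sum.distrib)
  finally show ?thesis by linarith
qed

lemma abs_component_le_ldist: "\<bar>u $ i - v $ i\<bar> \<le> int (ldist u v)"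
  unfolding int_ldist by (rule member_le_sum) auto

lemma ldist_eq_0_iff [simp]: "ldist u v = 0 \<longleftrightarrow> u = v"
proof
  assume "ldist u v = 0"
  then have "u $ i = v $ i" for i
    using abs_component_le_ldist[of u i v] by simp
  then show "u = v" by (simp add: vec_eq_iff)
qed simp

lemma adjacent_commute: "adjacent u v \<longleftrightarrow> adjacent v u"
  by (simp add: adjacent_iff_ldist ldist_commute)

lemma not_adjacent_self [simp]: "\<not> adjacent u u"
  by (simp add: adjacent_iff_ldist)

lemma adjacent_even_site: "adjacent u v \<Longrightarrow> even_site u \<longleftrightarrow> \<not> even_site v"
proof -
  assume "adjacent u v"
  then have 1: "(\<Sum>i\<in>UNIV. \<bar>u $ i - v $ i\<bar>) = 1" by (simp add: adjacent_def)
  \<comment> \<open>An integer and its absolute value have the same parity.\<close>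
  have "even ((\<Sum>i\<in>UNIV. \<bar>u $ i - v $ i\<bar>) - (\<Sum>i\<in>UNIV. u $ i - v $ i))"
    unfolding sum_subtractf[symmetric]
    by (rule dvd_sum) (auto simp: abs_if)
  then show ?thesis unfolding 1 even_site_def by (auto simp: sum_subtractf)
qed

lemma finite_card_lattice_box:
  fixes a :: "'d::finite site"
  shows "finite (lattice_box a n)" and "card (lattice_box a n) = n ^ CARD('d)"
proof -
  have bij: "bij_betw (\<lambda>f. \<chi> i. f i) (Pi UNIV (\<lambda>i. {a $ i..<a $ i + int n})) (lattice_box a n)"
    by (rule bij_betw_byWitness[where f' = "vec_nth"]) (auto simp: lattice_box_def)
  have eq: "Pi UNIV (\<lambda>i. {a $ i..<a $ i + int n}) = PiE UNIV (\<lambda>i. {a $ i..<a $ i + int n})"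
    by auto
  have "finite (PiE UNIV (\<lambda>i. {a $ i..<a $ i + int n}))" by (intro finite_PiE) auto
  then show "finite (lattice_box a n)" using bij_betw_finite[OF bij] eq by simp
  show "card (lattice_box a n) = n ^ CARD('d)"
    using bij_betw_same_card[OF bij] unfolding eq by (simp add: card_PiE)
qed

lemma lball_subset_lattice_box: "lball x r \<subseteq> lattice_box (x - (\<chi> i. int r)) (2 * r + 1)"
proof
  fix y assume "y \<in> lball x r"
  then have "\<bar>x $ i - y $ i\<bar> \<le> int r" for i
    using abs_component_le_ldist[of x i y] by (simp add: lball_def)
  then have "x $ i - int r \<le> y $ i \<and> y $ i < x $ i - int r + (2 * int r + 1)" for i
    by (smt (verit))
  then show "y \<in> lattice_box (x - (\<chi> i. int r)) (2 * r + 1)"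
    by (simp add: lattice_box_def algebra_simps)
qed

lemma finite_lball [simp]: "finite (lball x r)"
  using lball_subset_lattice_box finite_card_lattice_box(1) by (rule finite_subset)

lemma card_lball: "card (lball (x :: 'd::finite site) r) \<le> (2 * r + 1) ^ CARD('d)"
  using card_mono[OF finite_card_lattice_box(1) lball_subset_lattice_box[of x r]]
  by (simp only: finite_card_lattice_box)

lemma self_in_lball [simp]: "x \<in> lball x r"
  by (simp add: lball_def)

lemma nbrs_subset_lball: "nbrs v \<subseteq> lball v 1"
  by (auto simp: nbrs_def lball_def adjacent_iff_ldist)

lemma finite_nbrs [simp]: "finite (nbrs v)"
  using nbrs_subset_lball by (rule finite_subset) simp

lemma card_nbrs: "card (nbrs (v :: 'd::finite site)) \<le> 2 * CARD('d)"
proof -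
  let ?f = "\<lambda>(i, s). \<chi> j. if j = i then v $ j + s else v $ j"
  have "nbrs v \<subseteq> ?f ` (UNIV \<times> {1, -1})"
  proof
    fix w assume "w \<in> nbrs v"
    then have 1: "(\<Sum>i\<in>UNIV. \<bar>v $ i - w $ i\<bar>) = 1" by (simp add: nbrs_def adjacent_def)
    obtain i where i: "\<bar>v $ i - w $ i\<bar> \<noteq> 0"
    proof (rule ccontr)
      assume "\<not> thesis"
      with that have "\<And>i. \<bar>v $ i - w $ i\<bar> = 0" by blast
      then show False using 1 by simp
    qed
    have "(\<Sum>j\<in>UNIV. \<bar>v $ j - w $ j\<bar>) = \<bar>v $ i - w $ i\<bar> + (\<Sum>j\<in>UNIV - {i}. \<bar>v $ j - w $ j\<bar>)"
      by (rule sum.remove) auto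
    moreover have "0 \<le> (\<Sum>j\<in>UNIV - {i}. \<bar>v $ j - w $ j\<bar>)" by (rule sum_nonneg) auto
    ultimately have vi: "\<bar>v $ i - w $ i\<bar> = 1" and rest: "(\<Sum>j\<in>UNIV - {i}. \<bar>v $ j - w $ j\<bar>) = 0"
      using 1 i by linarith+
    have "\<forall>j\<in>UNIV - {i}. \<bar>v $ j - w $ j\<bar> = 0"
      using rest by (subst sum_nonneg_eq_0_iff[symmetric]) simp_all
    then have "w = ?f (i, w $ i - v $ i)" by (simp add: vec_eq_iff)
    moreover have "w $ i - v $ i = 1 \<or> w $ i - v $ i = -1" using vi by linarith
    then have "(i, w $ i - v $ i) \<in> UNIV \<times> {1, -1}" by blast
    ultimately show "w \<in> ?f ` (UNIV \<times> {1, -1})" by (rule image_eqI)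
  qed
  then have "card (nbrs v) \<le> card (?f ` (UNIV \<times> {1, -1}))"
    by (intro card_mono) auto
  also have "\<dots> \<le> card ((UNIV :: 'd set) \<times> {1 :: int, -1})"
    by (rule card_image_le) auto
  finally show ?thesis by (simp add: card_cartesian_product)
qed

lemma residue_in_lattice_box: "m > 0 \<Longrightarrow> residue m x \<in> lattice_box 0 m"
  by (simp add: residue_def lattice_box_def)

lemma card_residues:
  fixes S :: "'d::finite site set"
  assumes "m > 0"
  shows "finite (residue m ` S)" "card (residue m ` S) \<le> m ^ CARD('d)"
proof -
  have sub: "residue m ` S \<subseteq> lattice_box 0 m" using residue_in_lattice_box[OF assms] by auto
  then show "finite (residue m ` S)" by (rule finite_subset[OF _ finite_card_lattice_box(1)])
  show "card (residue m ` S) \<le> m ^ CARD('d)"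
    using card_mono[OF finite_card_lattice_box(1) sub] by (simp add: finite_card_lattice_box)
qed

lemma ldist_ge_of_residue_eq:
  assumes "residue m x = residue m y" "x \<noteq> y"
  shows "m \<le> ldist x y"
proof -
  obtain i where i: "x $ i \<noteq> y $ i" using assms(2) by (auto simp: vec_eq_iff)
  have "x $ i mod int m = y $ i mod int m"
    using assms(1) by (auto simp: residue_def vec_eq_iff)
  then have "int m dvd x $ i - y $ i" by (simp add: mod_eq_dvd_iff)
  then have "int m \<le> \<bar>x $ i - y $ i\<bar>" using i by (intro zdvd_imp_le) auto
  also have "\<dots> \<le> int (ldist x y)" by (rule abs_component_le_ldist)
  finally show ?thesis by simp
qed

lemma disjoint_lballs: "2 * r < ldist x y \<Longrightarrow> lball x r \<inter> lball y r = {}"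
proof (rule ccontr)
  assume "2 * r < ldist x y" "lball x r \<inter> lball y r \<noteq> {}"
  then obtain z where "ldist x z \<le> r" "ldist y z \<le> r" by (auto simp: lball_def)
  then show False using ldist_triangle[of x y z] \<open>2 * r < ldist x y\<close> ldist_commute[of y z] by linarith
qed


section \<open>Decay of correlations in the hard-core model\<close>

text \<open>Conditioning on spins only deletes sites: an empty site disappears, an occupied one
  disappears together with its neighbours. Independent sets of arbitrary finite regions therefore
  cover all boundary conditions.\<close>

definition indep_sets :: "'d::finite site set \<Rightarrow> 'd site set set" where
  "indep_sets S = {I. I \<subseteq> S \<and> (\<forall>u\<in>I. \<forall>v\<in>I. \<not> adjacent u v)}"

lemma finite_indep_sets [simp]: "finite S \<Longrightarrow> finite (indep_sets S)"
  by (auto simp: indep_sets_def intro: finite_subset[of _ "Pow S"])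

lemma empty_in_indep_sets [simp]: "{} \<in> indep_sets S"
  by (simp add: indep_sets_def)

locale hardcore =
  fixes lam :: real
  assumes lam_pos: "0 < lam"
begin

definition Zpart :: "'d::finite site set \<Rightarrow> real" where
  "Zpart S = (\<Sum>I\<in>indep_sets S. lam ^ card I)"

text \<open>The odds of occupied against empty at \<open>v\<close> in the model on
  \<open>insert v S\<close>.\<close>

definition ratio :: "'d::finite site set \<Rightarrow> 'd site \<Rightarrow> real" where
  "ratio S v = lam * Zpart (S - {v} - nbrs v) / Zpart (S - {v})"

definition occ :: "'d::finite site set \<Rightarrow> 'd site \<Rightarrow> real" where
  "occ S v = (\<Sum>I | I \<in> indep_sets S \<and> v \<in> I. lam ^ card I) / Zpart S"

lemma Zpart_ge_1:
  fixes S :: "'d::finite site set"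
  assumes "finite S"
  shows "1 \<le> Zpart S"
proof -
  from assms have "(\<Sum>I\<in>{{} :: 'd site set}. lam ^ card I) \<le> Zpart S"
    unfolding Zpart_def using lam_pos by (intro sum_mono2) auto
  then show ?thesis by simp
qed

lemma Zpart_pos: "finite S \<Longrightarrow> 0 < Zpart S"
  using Zpart_ge_1[of S] by linarith

lemma Zpart_mono: "finite S \<Longrightarrow> T \<subseteq> S \<Longrightarrow> Zpart T \<le> Zpart S"
  unfolding Zpart_def using lam_pos by (intro sum_mono2) (auto simp: indep_sets_def)

lemma sum_indep_sets_containing:
  assumes "finite S" "v \<in> S"
  shows "(\<Sum>I | I \<in> indep_sets S \<and> v \<in> I. lam ^ card I) = lam * Zpart (S - {v} - nbrs v)"
proof -
  have bij: "bij_betw (insert v) (indep_sets (S - {v} - nbrs v)) {I \<in> indep_sets S. v \<in> I}"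
    by (rule bij_betw_byWitness[where f' = "\<lambda>I. I - {v}"])
      (use assms in \<open>auto simp: indep_sets_def nbrs_def adjacent_commute\<close>)
  have "(\<Sum>I | I \<in> indep_sets S \<and> v \<in> I. lam ^ card I)
      = (\<Sum>I\<in>indep_sets (S - {v} - nbrs v). lam ^ card (insert v I))"
    by (rule sum.reindex_bij_betw[OF bij, symmetric])
  also have "\<dots> = (\<Sum>I\<in>indep_sets (S - {v} - nbrs v). lam * lam ^ card I)"
  proof (rule sum.cong[OF refl])
    fix I assume "I \<in> indep_sets (S - {v} - nbrs v)"
    then have "v \<notin> I" "finite I" using assms by (auto simp: indep_sets_def intro: finite_subset)
    then show "lam ^ card (insert v I) = lam * lam ^ card I" by simp
  qed
  finally show ?thesis by (simp add: Zpart_def sum_distrib_left)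
qed

lemma Zpart_remove:
  assumes "finite S" "v \<in> S"
  shows "Zpart S = Zpart (S - {v}) + lam * Zpart (S - {v} - nbrs v)"
proof -
  have "indep_sets S = indep_sets (S - {v}) \<union> {I \<in> indep_sets S. v \<in> I}"
    by (auto simp: indep_sets_def)
  then have "Zpart S = (\<Sum>I\<in>indep_sets (S - {v}) \<union> {I \<in> indep_sets S. v \<in> I}. lam ^ card I)"
    by (simp add: Zpart_def)
  also have "\<dots> = Zpart (S - {v}) + (\<Sum>I | I \<in> indep_sets S \<and> v \<in> I. lam ^ card I)"
    unfolding Zpart_def using assms by (intro sum.union_disjoint) (auto simp: indep_sets_def)
  finally show ?thesis using assms by (simp add: sum_indep_sets_containing)
qed

lemma ratio_nonneg: "finite S \<Longrightarrow> 0 \<le> ratio S v"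
  using lam_pos Zpart_pos[of "S - {v}"] Zpart_pos[of "S - {v} - nbrs v"] by (simp add: ratio_def)

lemma ratio_le: "finite S \<Longrightarrow> ratio S v \<le> lam"
  using lam_pos Zpart_pos[of "S - {v}"] Zpart_mono[of "S - {v}" "S - {v} - nbrs v"]
  by (simp add: ratio_def divide_simps)

lemma Zpart_remove_ratio:
  assumes "finite S" "v \<in> S"
  shows "Zpart S = Zpart (S - {v}) * (1 + ratio S v)"
  using Zpart_remove[OF assms] Zpart_pos[of "S - {v}"] assms(1) by (simp add: ratio_def field_simps)

lemma occ_eq_ratio:
  assumes "finite S" "v \<in> S"
  shows "occ S v = ratio S v / (1 + ratio S v)"
proof -
  have "lam * Zpart (S - {v} - nbrs v) = Zpart (S - {v}) * ratio S v"
    using Zpart_pos[of "S - {v}"] assms(1) by (simp add: ratio_def)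
  then show ?thesis
    using Zpart_pos[of "S - {v}"] assms(1)
    by (simp add: occ_def sum_indep_sets_containing[OF assms] Zpart_remove_ratio[OF assms])
qed

text \<open>The sites are deleted one at a time, so each factor is an odds ratio in the region left
  by the earlier deletions. This is where the order of \<open>ws\<close> enters the
  recursion.\<close>

lemma Zpart_remove_list:
  assumes "finite T" "distinct ws" "set ws \<subseteq> T"
  shows "Zpart T = Zpart (T - set ws) *
    (\<Prod>i<length ws. 1 + ratio (T - set (take i ws)) (ws ! i))"
  using assms
proof (induction ws rule: rev_induct)
  case (snoc w ws)
  have "Zpart T = Zpart (T - set ws) * (\<Prod>i<length ws. 1 + ratio (T - set (take i ws)) (ws ! i))"
    using snoc by simp
  also have "Zpart (T - set ws) = Zpart (T - set ws - {w}) * (1 + ratio (T - set ws) w)"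
    using snoc.prems by (intro Zpart_remove_ratio) auto
  also have "T - set ws - {w} = T - set (ws @ [w])" by auto
  finally show ?case by (simp add: nth_append)
qed simp

text \<open>Weitz's recursion. Conditioning a site to be empty deletes it, so the pruned
  self-avoiding-walk tree is encoded by the successive deletions below.\<close>

lemma ratio_recursion:
  assumes "finite S" "distinct ws" "set ws = nbrs v \<inter> S"
  shows "ratio S v = lam / (\<Prod>i<length ws. 1 + ratio (S - {v} - set (take i ws)) (ws ! i))"
proof -
  let ?P = "\<Prod>i<length ws. 1 + ratio (S - {v} - set (take i ws)) (ws ! i)"
  have "set ws \<subseteq> S - {v}" using assms(3) by (auto simp: nbrs_def)
  then have "Zpart (S - {v}) = Zpart (S - {v} - set ws) * ?P"
    using assms by (intro Zpart_remove_list) auto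
  moreover have "S - {v} - set ws = S - {v} - nbrs v" using assms(3) by auto
  moreover have "0 < Zpart (S - {v} - nbrs v)" using assms(1) by (intro Zpart_pos) auto
  ultimately show ?thesis by (simp add: ratio_def)
qed

end

text \<open>Bernoulli's inequality is tight exactly at the fixed point of the critical recursion.\<close>

lemma critical_fugacity_bound:
  fixes z :: real
  assumes "b \<ge> 2" "0 \<le> z" "z \<le> 1"
  shows "1 / (real b - 1) * (1 + 1 / (real b - 1)) ^ b * z ^ b * ((real b)\<^sup>2 * (1 - z) - 1) \<le> 1"
proof (cases "z = 0")
  case True
  with assms(1) show ?thesis by (simp add: power_0_left)
next
  case False
  with assms have z: "z > 0" by simp
  define q where "q = real b / (real b - 1)"
  have b1: "real b - 1 > 0" using assms(1) by simp
  have q: "q > 0" "1 + 1 / (real b - 1) = q" using b1 by (simp_all add: q_def field_simps)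
  \<comment> \<open>\<open>u = 1\<close>, the case of equality, means
    \<open>z = (b - 1) / b\<close>, which is \<open>1 / (1 + R)\<close> at the critical fixed point
    \<open>R = 1 / (b - 1)\<close>.\<close>
  define u where "u = 1 / (q * z)"
  have u: "u > 0" using z q by (simp add: u_def)
  have "1 + real (b + 1) * (u - 1) \<le> (1 + (u - 1)) ^ (b + 1)"
    using u by (intro Bernoulli_inequality) simp
  then have "(q * z) ^ (b + 1) * (1 + real (b + 1) * (u - 1)) \<le> (q * z) ^ (b + 1) * u ^ (b + 1)"
    using z q by (intro mult_left_mono) auto
  also have "\<dots> = 1" using z q by (simp add: u_def power_mult_distrib[symmetric])
  also have "(q * z) ^ (b + 1) * (1 + real (b + 1) * (u - 1))
      = q ^ b * z ^ b * (q * z * (1 + real (b + 1) * (u - 1)))"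
    by (simp add: power_mult_distrib algebra_simps)
  also have "q * z * (1 + real (b + 1) * (u - 1)) = 1 / (real b - 1) * ((real b)\<^sup>2 * (1 - z) - 1)"
  proof -
    have "q * z * (1 + real (b + 1) * (u - 1)) = q * z * (- real b) + (real b + 1) * (q * z * u)"
      by (simp add: algebra_simps)
    also have "q * z * u = 1" using z q by (simp add: u_def)
    also have "q * z * (- real b) + (real b + 1) * 1
        = 1 / (real b - 1) * ((real b)\<^sup>2 * (1 - z) - 1)"
      using b1 by (simp add: q_def field_simps power2_eq_square)
    finally show ?thesis .
  qed
  finally show ?thesis unfolding q(2) by (simp add: mult_ac)
qed

text \<open>Let \<open>r\<close> be the ratio of \<open>lam\<close> to the critical fugacity and
  \<open>f = lam * z ^ b\<close>. The critical inequality, scaled by \<open>r\<close>, bounds the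
  left side by \<open>r + f\<close>. Since \<open>f \<le> lam\<close>, the quotient
  \<open>(r + f) / (1 + f)\<close> is at most \<open>(r + lam) / (1 + lam) < 1\<close>, and this is
  the square of \<open>\<kappa>\<close>. For \<open>b = 1\<close>, in dimension one, the bound holds
  with \<open>r = 0\<close> for every \<open>lam\<close>.\<close>

lemma subcritical_contraction:
  fixes lam :: real
  assumes "0 < lam" "b \<ge> 1"
    and sub: "b \<ge> 2 \<Longrightarrow> lam < 1 / (real b - 1) * (1 + 1 / (real b - 1)) ^ b"
  shows "\<exists>\<kappa>. 0 < \<kappa> \<and> \<kappa> < 1 \<and>
    (\<forall>z. 0 \<le> z \<and> z \<le> 1 \<longrightarrow> lam * z ^ b * ((real b)\<^sup>2 * (1 - z)) \<le> \<kappa>\<^sup>2 * (1 + lam * z ^ b))"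
proof -
  define r where "r = (if b = 1 then 0 else lam / (1 / (real b - 1) * (1 + 1 / (real b - 1)) ^ b))"
  have key: "lam * z ^ b * ((real b)\<^sup>2 * (1 - z) - 1) \<le> r" if "0 \<le> z" "z \<le> 1" for z
  proof (cases "b = 1")
    case True
    then show ?thesis using that assms by (simp add: r_def mult_nonneg_nonpos)
  next
    case False
    then have b: "b \<ge> 2" using assms by simp
    define lc where "lc = 1 / (real b - 1) * (1 + 1 / (real b - 1)) ^ b"
    have lc: "lc > 0" using b unfolding lc_def by (intro mult_pos_pos zero_less_power add_pos_pos) auto
    have "lc * z ^ b * ((real b)\<^sup>2 * (1 - z) - 1) \<le> 1"
      unfolding lc_def using critical_fugacity_bound[OF b that] .
    then have "lam / lc * (lc * z ^ b * ((real b)\<^sup>2 * (1 - z) - 1)) \<le> lam / lc * 1"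
      using lc assms by (intro mult_left_mono) auto
    moreover have "r = lam / lc" using False by (simp add: r_def lc_def)
    ultimately show ?thesis using lc by (simp add: mult_ac)
  qed
  have r: "0 \<le> r" "r < 1"
  proof -
    have "b \<ge> 2 \<Longrightarrow> 1 / (real b - 1) * (1 + 1 / (real b - 1)) ^ b > 0" using sub assms by fastforce
    then show "0 \<le> r" "r < 1" using sub assms by (auto simp: r_def divide_simps)
  qed
  define \<kappa> where "\<kappa> = sqrt ((r + lam) / (1 + lam))"
  have k2: "\<kappa>\<^sup>2 = (r + lam) / (1 + lam)" using r assms by (simp add: \<kappa>_def)
  have "0 < \<kappa>" "\<kappa> < 1" using r assms by (auto simp: \<kappa>_def)
  moreover have "lam * z ^ b * ((real b)\<^sup>2 * (1 - z)) \<le> \<kappa>\<^sup>2 * (1 + lam * z ^ b)"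
    if z: "0 \<le> z" "z \<le> 1" for z
  proof -
    define f where "f = lam * z ^ b"
    have f: "0 \<le> f" "f \<le> lam" using z assms by (auto simp: f_def mult_le_cancel_left2 power_le_one)
    have "f * ((real b)\<^sup>2 * (1 - z)) \<le> r + f" using key[OF z] by (simp add: f_def algebra_simps)
    also have "(r + f) * (1 + lam) \<le> (r + lam) * (1 + f)"
    proof -
      have "(1 - r) * f \<le> (1 - r) * lam" using f r by (intro mult_left_mono) auto
      then show ?thesis by (simp add: algebra_simps)
    qed
    then have "r + f \<le> \<kappa>\<^sup>2 * (1 + f)" using assms by (simp add: k2 field_simps)
    finally show ?thesis by (simp add: f_def)
  qed
  ultimately show ?thesis by blast
qed

text \<open>The left side is the l1 norm of the gradient of \<open>recursion_map\<close>.
  Cauchy-Schwarz passes to the squares \<open>1 - y i\<close>, and the arithmetic-geometric mean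
  inequality replaces the \<open>y i\<close> by their geometric mean \<open>z\<close>. So equal
  arguments are the worst case, and for them \<open>contr\<close> is the claim.\<close>

lemma tanh_sum_bound:
  fixes h :: "nat \<Rightarrow> real"
  assumes "k \<le> b" "b \<ge> 1" "0 < lam" "0 \<le> \<kappa>"
    and contr: "\<And>z. 0 \<le> z \<Longrightarrow> z \<le> 1 \<Longrightarrow>
      lam * z ^ b * ((real b)\<^sup>2 * (1 - z)) \<le> \<kappa>\<^sup>2 * (1 + lam * z ^ b)"
    and A: "A\<^sup>2 = lam * (\<Prod>i<k. 1 / (cosh (h i))\<^sup>2)" "0 \<le> A"
  shows "A / sqrt (A\<^sup>2 + 1) * (\<Sum>i<k. \<bar>tanh (h i)\<bar>) \<le> \<kappa>"
proof -
  \<comment> \<open>The \<open>k\<close> children are padded to \<open>b\<close>: a missing child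
    has \<open>y = 1\<close>, which changes neither the product nor the sum of the
    \<open>1 - y i\<close>.\<close>
  define y where "y i = (if i < k then 1 / (cosh (h i))\<^sup>2 else 1)" for i
  have y: "0 < y i" "y i \<le> 1" for i
    using cosh_real_ge_1[of "h i"] by (auto simp: y_def divide_simps one_le_power)
  have th: "\<bar>tanh (h i)\<bar>\<^sup>2 = 1 - y i" if "i < k" for i
  proof -
    have "(cosh (h i))\<^sup>2 \<noteq> 0" by simp
    then show ?thesis using that by (simp add: y_def tanh_def power_divide sinh_square_eq diff_divide_distrib)
  qed
  define z where "z = (\<Prod>i<b. y i) powr (1 / real b)"
  have prod_y: "(\<Prod>i<b. y i) = (\<Prod>i<k. 1 / (cosh (h i))\<^sup>2)"
    using assms(1) by (intro prod.mono_neutral_cong_right) (auto simp: y_def)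
  have P: "0 < (\<Prod>i<b. y i)" "(\<Prod>i<b. y i) \<le> 1"
    using y by (simp_all add: prod_pos prod_le_1 less_imp_le)
  have zb: "z ^ b = (\<Prod>i<b. y i)"
    using P assms(2) by (simp add: z_def powr_realpow[symmetric] powr_powr less_imp_neq[symmetric])
  have z: "0 \<le> z" "z \<le> 1" using P by (auto simp: z_def powr_le1)
  have AM: "real b * z \<le> (\<Sum>i<b. y i)"
  proof -
    have "z \<le> (\<Sum>i<b. y i / real b)"
      using arith_geom_mean[of "{..<b}" y] y assms(2) by (simp add: z_def less_imp_le lessThan_empty_iff)
    also have "\<dots> = (\<Sum>i<b. y i) / real b" by (simp add: sum_divide_distrib)
    finally show ?thesis using assms(2) by (simp add: field_simps)
  qed
  have "(\<Sum>i<k. \<bar>tanh (h i)\<bar>)\<^sup>2 \<le> (\<Sum>i<k. \<bar>tanh (h i)\<bar>\<^sup>2) * real (card {..<k})"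
    by (rule sum_squared_le_sum_of_squares) 
  also have "\<dots> \<le> (\<Sum>i<b. 1 - y i) * real b"
  proof (rule mult_mono)
    have "(\<Sum>i<k. \<bar>tanh (h i)\<bar>\<^sup>2) = (\<Sum>i<k. 1 - y i)" using th by (intro sum.cong) auto
    also have "\<dots> \<le> (\<Sum>i<b. 1 - y i)" using assms(1) y by (intro sum_mono2) auto
    finally show "(\<Sum>i<k. \<bar>tanh (h i)\<bar>\<^sup>2) \<le> (\<Sum>i<b. 1 - y i)" .
  qed (use assms y in \<open>auto intro!: sum_nonneg\<close>)
  also have "\<dots> \<le> (real b)\<^sup>2 * (1 - z)"
  proof -
    have "(\<Sum>i<b. 1 - y i) \<le> real b * (1 - z)" using AM by (simp add: sum_subtractf algebra_simps)
    then have "(\<Sum>i<b. 1 - y i) * real b \<le> real b * (1 - z) * real b" by (intro mult_right_mono) auto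
    then show ?thesis by (simp add: power2_eq_square mult_ac)
  qed
  finally have S2: "(\<Sum>i<k. \<bar>tanh (h i)\<bar>)\<^sup>2 \<le> (real b)\<^sup>2 * (1 - z)" .
  have A2: "A\<^sup>2 = lam * z ^ b" using A zb prod_y by simp
  have "(A / sqrt (A\<^sup>2 + 1) * (\<Sum>i<k. \<bar>tanh (h i)\<bar>))\<^sup>2
      = A\<^sup>2 * (\<Sum>i<k. \<bar>tanh (h i)\<bar>)\<^sup>2 / (A\<^sup>2 + 1)"
    by (simp add: power_mult_distrib power_divide)
  also have "\<dots> \<le> A\<^sup>2 * ((real b)\<^sup>2 * (1 - z)) / (A\<^sup>2 + 1)"
    using S2 by (intro divide_right_mono mult_left_mono) auto
  also have "\<dots> \<le> \<kappa>\<^sup>2"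
  proof -
    have "A\<^sup>2 + 1 > 0" by (simp add: add_nonneg_pos)
    then show ?thesis using contr[OF z] A2 by (simp add: field_simps)
  qed
  finally show ?thesis using assms(4) by (rule power2_le_imp_le)
qed

text \<open>In the coordinates \<open>arsinh (sqrt R)\<close> the recursion \<open>R = lam / (\<Prod>i. 1 + R\<^sub>i)\<close> becomes
  the map below.\<close>

definition recursion_map :: "real \<Rightarrow> nat \<Rightarrow> (nat \<Rightarrow> real) \<Rightarrow> real" where
  "recursion_map lam k s = arsinh (sqrt lam * (\<Prod>i<k. 1 / cosh (s i)))"

text \<open>Mean value theorem along the segment from \<open>s'\<close> to \<open>s\<close>. The
  hypothesis \<open>bound\<close> controls the l1 norm of the gradient at every point of the
  segment, so a sup-norm distance grows by at most the factor \<open>K\<close>.\<close>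

lemma recursion_map_lipschitz:
  fixes s s' :: "nat \<Rightarrow> real"
  assumes "0 < lam" and d: "\<And>i. i < k \<Longrightarrow> \<bar>s i - s' i\<bar> \<le> \<delta>" and "0 \<le> \<delta>"
    and bound: "\<And>h A. A\<^sup>2 = lam * (\<Prod>i<k. 1 / (cosh (h i))\<^sup>2) \<Longrightarrow> 0 \<le> A \<Longrightarrow>
      A / sqrt (A\<^sup>2 + 1) * (\<Sum>i<k. \<bar>tanh (h i)\<bar>) \<le> K"
  shows "\<bar>recursion_map lam k s - recursion_map lam k s'\<bar> \<le> K * \<delta>"
proof -
  define h where "h u i = s' i + u * (s i - s' i)" for u :: real and i
  \<comment> \<open>The product is written as the exponential of a sum of logarithms, whose
    derivative produces the \<open>tanh\<close> terms.\<close>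
  define A where "A u = sqrt lam * exp (- (\<Sum>i<k. ln (cosh (h u i))))" for u
  define g where "g u = arsinh (A u)" for u
  define g' where "g' u = 1 / sqrt ((A u)\<^sup>2 + 1) * (A u * - (\<Sum>i<k. tanh (h u i) * (s i - s' i)))" for u
  have Aeq: "A u = sqrt lam * (\<Prod>i<k. 1 / cosh (h u i))" for u
    by (simp add: A_def exp_minus exp_sum prod_dividef inverse_eq_divide)
  have g: "g 1 = recursion_map lam k s" "g 0 = recursion_map lam k s'"
    by (simp_all add: g_def Aeq recursion_map_def h_def)
  have der: "(g has_real_derivative g' u) (at u)" for u
  proof -
    have "((\<lambda>u. ln (cosh (h u i))) has_real_derivative tanh (h u i) * (s i - s' i)) (at u)" for i
      unfolding h_def by (auto intro!: derivative_eq_intros simp: tanh_def)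
    then have "((\<lambda>u. \<Sum>i<k. ln (cosh (h u i))) has_real_derivative
        (\<Sum>i<k. tanh (h u i) * (s i - s' i))) (at u)"
      by (intro DERIV_sum) auto
    from DERIV_cmult[OF DERIV_chain2[OF DERIV_exp DERIV_minus[OF this]], of "sqrt lam"]
    have "(A has_real_derivative (A u * - (\<Sum>i<k. tanh (h u i) * (s i - s' i)))) (at u)"
      unfolding A_def by (simp add: mult_ac)
    then show ?thesis unfolding g_def g'_def
      by (rule DERIV_chain2[OF arsinh_real_has_field_derivative])
  qed
  have "\<exists>u>0. u < 1 \<and> g 1 - g 0 = (1 - 0) * g' u"
    by (rule MVT2) (use der in auto)
  then obtain u where u: "g 1 - g 0 = g' u" by auto
  have A0: "0 \<le> A u" using assms(1) by (simp add: A_def)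
  have "\<bar>g' u\<bar> = A u / sqrt ((A u)\<^sup>2 + 1) * \<bar>\<Sum>i<k. tanh (h u i) * (s i - s' i)\<bar>"
    using A0 by (simp add: g'_def abs_mult)
  also have "\<dots> \<le> A u / sqrt ((A u)\<^sup>2 + 1) * (\<Sum>i<k. \<bar>tanh (h u i)\<bar> * \<delta>)"
    using A0 d by (intro mult_left_mono order_trans[OF sum_abs] sum_mono)
      (auto simp: abs_mult intro!: mult_left_mono)
  also have "\<dots> = A u / sqrt ((A u)\<^sup>2 + 1) * (\<Sum>i<k. \<bar>tanh (h u i)\<bar>) * \<delta>"
    by (simp add: sum_distrib_right)
  also have "\<dots> \<le> K * \<delta>"
  proof (intro mult_right_mono bound)
    show "(A u)\<^sup>2 = lam * (\<Prod>i<k. 1 / (cosh (h u i))\<^sup>2)"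
      using assms(1) by (simp add: Aeq power_mult_distrib prod_power_distrib power_divide)
  qed (use A0 assms in auto)
  finally show ?thesis using u g by simp
qed

section \<open>From the contraction of angles to decay of occupation probabilities\<close>

context hardcore
begin

definition angle :: "'d::finite site set \<Rightarrow> 'd site \<Rightarrow> real" where
  "angle S v = arsinh (sqrt (ratio S v))"

lemma cosh_angle: "finite S \<Longrightarrow> cosh (angle S v) = sqrt (1 + ratio S v)"
  using ratio_nonneg[of S v] by (simp add: angle_def cosh_arsinh_real add.commute)

lemma angle_bounds: "finite S \<Longrightarrow> 0 \<le> angle S v \<and> angle S v \<le> arsinh (sqrt lam)"
proof -
  assume S: "finite S"
  have "arsinh 0 \<le> arsinh (sqrt (ratio S v))" "arsinh (sqrt (ratio S v)) \<le> arsinh (sqrt lam)"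
    using ratio_nonneg[OF S, of v] ratio_le[OF S, of v] lam_pos
    by (simp_all add: not_less[symmetric] del: arsinh_0)
  then show ?thesis by (simp add: angle_def)
qed

lemma occ_eq_tanh_angle:
  assumes "finite S" "v \<in> S"
  shows "occ S v = (tanh (angle S v))\<^sup>2"
proof -
  have "(tanh (angle S v))\<^sup>2 = ((cosh (angle S v))\<^sup>2 - 1) / (cosh (angle S v))\<^sup>2"
    by (simp add: tanh_def power_divide cosh_square_eq)
  then show ?thesis using ratio_nonneg[of S v] assms
    by (simp add: occ_eq_ratio cosh_angle)
qed

lemma real_sqrt_prod: "sqrt (\<Prod>i\<in>A. f i) = (\<Prod>i\<in>A. sqrt (f i))" for f :: "'b \<Rightarrow> real"
  by (induction A rule: infinite_finite_induct) (auto simp: real_sqrt_mult)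

lemma angle_recursion:
  assumes "finite S" "distinct ws" "set ws = nbrs v \<inter> S"
  shows "angle S v = recursion_map lam (length ws) (\<lambda>i. angle (S - {v} - set (take i ws)) (ws ! i))"
proof -
  have "sqrt (ratio S v) = sqrt lam * (\<Prod>i<length ws. 1 / sqrt (1 + ratio (S - {v} - set (take i ws)) (ws ! i)))"
    unfolding ratio_recursion[OF assms] by (simp add: real_sqrt_divide prod_dividef real_sqrt_prod)
  also have "(\<Prod>i<length ws. 1 / sqrt (1 + ratio (S - {v} - set (take i ws)) (ws ! i)))
      = (\<Prod>i<length ws. 1 / cosh (angle (S - {v} - set (take i ws)) (ws ! i)))"
    using assms by (simp add: cosh_angle)
  finally show ?thesis by (simp add: angle_def recursion_map_def)
qed

text \<open>One level of the tree. Both regions agree near \<open>v\<close>, so one enumeration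
  \<open>ws\<close> of the neighbours serves both. In \<open>IH\<close> the condition
  \<open>v \<notin> T\<close> remembers that the parent has been deleted; it is what leaves a child
  with at most \<open>2d - 1\<close> neighbours.\<close>

lemma angle_step:
  assumes fin: "finite S" "finite S'" and eq: "S \<inter> lball v (Suc r) = S' \<inter> lball v (Suc r)"
    and deg: "card (nbrs v \<inter> S) \<le> k"
    and bound: "\<And>h A k'. k' \<le> k \<Longrightarrow> A\<^sup>2 = lam * (\<Prod>i<k'. 1 / (cosh (h i))\<^sup>2) \<Longrightarrow> 0 \<le> A \<Longrightarrow>
      A / sqrt (A\<^sup>2 + 1) * (\<Sum>i<k'. \<bar>tanh (h i)\<bar>) \<le> K"
    and IH: "\<And>T T' w. finite T \<Longrightarrow> finite T' \<Longrightarrow> w \<in> nbrs v \<Longrightarrow> v \<notin> T \<Longrightarrow>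
      T \<inter> lball w r = T' \<inter> lball w r \<Longrightarrow> \<bar>angle T w - angle T' w\<bar> \<le> \<delta>"
    and "0 \<le> \<delta>"
  shows "\<bar>angle S v - angle S' v\<bar> \<le> K * \<delta>"
proof -
  obtain ws where ws: "set ws = nbrs v \<inter> S" "distinct ws"
    using finite_distinct_list[of "nbrs v \<inter> S"] by auto
  have "nbrs v \<subseteq> lball v (Suc r)" using nbrs_subset_lball[of v] by (auto simp: lball_def)
  then have ws': "set ws = nbrs v \<inter> S'" using eq ws by auto
  have len: "length ws \<le> k" using deg ws distinct_card[of ws] by simp
  show ?thesis
    unfolding angle_recursion[OF fin(1) ws(2,1)] angle_recursion[OF fin(2) ws(2) ws']
  proof (rule recursion_map_lipschitz[OF lam_pos])
    fix i assume i: "i < length ws"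
    then have w: "ws ! i \<in> nbrs v" using ws(1) nth_mem[OF i] by auto
    have "lball (ws ! i) r \<subseteq> lball v (Suc r)"
    proof
      fix z assume "z \<in> lball (ws ! i) r"
      then show "z \<in> lball v (Suc r)" using w ldist_triangle[of v z "ws ! i"]
        by (auto simp: lball_def nbrs_def adjacent_iff_ldist)
    qed
    then show "\<bar>angle (S - {v} - set (take i ws)) (ws ! i) - angle (S' - {v} - set (take i ws)) (ws ! i)\<bar> \<le> \<delta>"
      using fin w eq by (intro IH) auto
  qed (use bound[OF len] \<open>0 \<le> \<delta>\<close> in auto)
qed

text \<open>Below the root each vertex has at most \<open>b = 2d - 1\<close> children, so every
  level contracts by \<open>\<kappa>\<close>. The root may have \<open>2d\<close> children and is
  treated with the crude gradient bound \<open>2d\<close>. The remaining factor 2 is a Lipschitz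
  constant of \<open>tanh\<close> squared, which turns angles into probabilities.\<close>

lemma occ_decay:
  fixes S S' :: "'d::finite site set"
  assumes b: "Suc b = 2 * CARD('d)" and \<kappa>: "0 < \<kappa>"
    and contr: "\<And>z. 0 \<le> z \<Longrightarrow> z \<le> 1 \<Longrightarrow>
      lam * z ^ b * ((real b)\<^sup>2 * (1 - z)) \<le> \<kappa>\<^sup>2 * (1 + lam * z ^ b)"
    and fin: "finite S" "finite S'" and eq: "S \<inter> lball v (Suc r) = S' \<inter> lball v (Suc r)"
  shows "\<bar>occ S v - occ S' v\<bar> \<le> 4 * real CARD('d) * arsinh (sqrt lam) * \<kappa> ^ r"
proof -
  have b1: "b \<ge> 1" using b by (cases b) auto
  have s0: "0 \<le> arsinh (sqrt lam)" using lam_pos by (simp add: not_less[symmetric])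
  have child: "\<bar>angle T w - angle T' w\<bar> \<le> arsinh (sqrt lam) * \<kappa> ^ r"
    if "finite T" "finite T'" "w \<in> nbrs u" "u \<notin> T" "T \<inter> lball w r = T' \<inter> lball w r" for T T' u and w :: "'d site"
    using that
  proof (induction r arbitrary: T T' w u)
    case 0
    then show ?case using angle_bounds[of T w] angle_bounds[of T' w] by (simp add: abs_le_iff)
  next
    case (Suc r)
    have "u \<in> nbrs w" using Suc.prems by (simp add: nbrs_def adjacent_commute)
    then have "nbrs w \<inter> T \<subseteq> nbrs w - {u}" "card (nbrs w - {u}) = card (nbrs w) - 1"
      using Suc.prems by auto
    then have "card (nbrs w \<inter> T) \<le> card (nbrs w) - 1"
      using card_mono[of "nbrs w - {u}" "nbrs w \<inter> T"] by auto
    then have deg: "card (nbrs w \<inter> T) \<le> b" using card_nbrs[of w] b by linarith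
    have "\<bar>angle T w - angle T' w\<bar> \<le> \<kappa> * (arsinh (sqrt lam) * \<kappa> ^ r)"
    proof (rule angle_step[OF Suc.prems(1,2,5) deg])
      show "A / sqrt (A\<^sup>2 + 1) * (\<Sum>i<k'. \<bar>tanh (h i)\<bar>) \<le> \<kappa>"
        if "k' \<le> b" "A\<^sup>2 = lam * (\<Prod>i<k'. 1 / (cosh (h i))\<^sup>2)" "0 \<le> A" for h A k'
        using that b1 lam_pos \<kappa> contr by (intro tanh_sum_bound) auto
    qed (use Suc.IH s0 \<kappa> in auto)
    then show ?case by (simp add: mult_ac)
  qed
  have "\<bar>angle S v - angle S' v\<bar> \<le> real (2 * CARD('d)) * (arsinh (sqrt lam) * \<kappa> ^ r)"
  proof (rule angle_step[OF fin eq])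
    show "card (nbrs v \<inter> S) \<le> 2 * CARD('d)"
      using card_nbrs[of v] card_mono[of "nbrs v" "nbrs v \<inter> S"] by auto
    show "A / sqrt (A\<^sup>2 + 1) * (\<Sum>i<k'. \<bar>tanh (h i)\<bar>) \<le> real (2 * CARD('d))"
      if "k' \<le> 2 * CARD('d)" "0 \<le> A" for h :: "nat \<Rightarrow> real" and A k'
    proof -
      have "A \<le> sqrt (A\<^sup>2 + 1)" by (rule real_le_rsqrt) simp
      then have 1: "A / sqrt (A\<^sup>2 + 1) \<le> 1" by (simp add: divide_le_eq_1 add_nonneg_pos)
      have "(\<Sum>i<k'. \<bar>tanh (h i)\<bar>) \<le> (\<Sum>i<k'. 1)"
      proof (rule sum_mono)
        fix i show "\<bar>tanh (h i)\<bar> \<le> 1" using tanh_real_bounds[of "h i"] by (simp add: abs_le_iff)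
      qed
      then have "A / sqrt (A\<^sup>2 + 1) * (\<Sum>i<k'. \<bar>tanh (h i)\<bar>) \<le> 1 * real k'"
        using 1 that(2) by (intro mult_mono) (auto intro!: sum_nonneg)
      then show ?thesis using that(1) by linarith
    qed
  qed (use child s0 \<kappa> in auto)
  also have "\<dots> = 2 * real CARD('d) * arsinh (sqrt lam) * \<kappa> ^ r" by simp
  finally have ang: "\<bar>angle S v - angle S' v\<bar> \<le> 2 * real CARD('d) * arsinh (sqrt lam) * \<kappa> ^ r" .
  have tanh_mono_lip: "\<bar>tanh y - tanh x\<bar> \<le> y - x" if "x < y" for x y :: real
  proof -
    have "\<exists>z>x. z < y \<and> tanh y - tanh x = (y - x) * (1 - (tanh z)\<^sup>2)"
      by (rule MVT2[OF that]) (auto intro!: derivative_eq_intros)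
    then obtain z where z: "tanh y - tanh x = (y - x) * (1 - (tanh z)\<^sup>2)" by blast
    have "\<bar>tanh z\<bar> \<le> 1" using tanh_real_bounds[of z] by (simp add: abs_le_iff)
    then have "(tanh z)\<^sup>2 \<le> 1" by (simp add: abs_square_le_1)
    moreover have "0 \<le> (tanh z)\<^sup>2" by simp
    ultimately have "\<bar>1 - (tanh z)\<^sup>2\<bar> \<le> 1" unfolding abs_le_iff by linarith
    then have "(y - x) * \<bar>1 - (tanh z)\<^sup>2\<bar> \<le> (y - x) * 1"
      using that by (intro mult_left_mono) auto
    moreover have "\<bar>tanh y - tanh x\<bar> = (y - x) * \<bar>1 - (tanh z)\<^sup>2\<bar>"
      unfolding z abs_mult using that by (simp only: abs_of_pos diff_gt_0_iff_gt)
    ultimately show ?thesis by simp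
  qed
  have tanh_lip: "\<bar>tanh x - tanh y\<bar> \<le> \<bar>x - y\<bar>" for x y :: real
    using tanh_mono_lip[of x y] tanh_mono_lip[of y x] by (cases x y rule: linorder_cases) auto
  have v_iff: "v \<in> S \<longleftrightarrow> v \<in> S'" using eq self_in_lball[of v "Suc r"] by blast
  show ?thesis
  proof (cases "v \<in> S")
    case True
    then have v': "v \<in> S'" using v_iff by simp
    let ?x = "tanh (angle S v)" and ?y = "tanh (angle S' v)"
    have "\<bar>occ S v - occ S' v\<bar> = \<bar>?x + ?y\<bar> * \<bar>?x - ?y\<bar>"
      unfolding occ_eq_tanh_angle[OF fin(1) True] occ_eq_tanh_angle[OF fin(2) v'] abs_mult[symmetric]
      by (rule arg_cong[of _ _ abs]) (simp add: power2_eq_square algebra_simps)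
    also have "\<dots> \<le> 2 * \<bar>angle S v - angle S' v\<bar>"
    proof (rule mult_mono)
      show "\<bar>?x + ?y\<bar> \<le> 2"
        using tanh_real_bounds[of "angle S v"] tanh_real_bounds[of "angle S' v"] by auto
    qed (use tanh_lip in auto)
    finally show ?thesis using ang by simp
  next
    case False
    then have "v \<notin> S'" using v_iff by simp
    then have "occ S v = 0" "occ S' v = 0" using False by (auto simp: occ_def indep_sets_def intro!: sum.neutral)
    then show ?thesis using s0 \<kappa> by simp
  qed
qed

end

section \<open>Random update sequences\<close>

text \<open>A configuration is the set of its occupied sites; an update \<open>(x, b)\<close> tries to occupy \<open>x\<close>
  if \<open>b\<close> holds and empties it otherwise. The heat-bath dynamics on a region \<open>S\<close> up to time \<open>t\<close>
  applies a random list of updates.\<close>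

definition upd :: "'d::finite site \<times> bool \<Rightarrow> 'd site set \<Rightarrow> 'd site set" where
  "upd u I = (if snd u \<and> (\<forall>y\<in>I. \<not> adjacent (fst u) y) then insert (fst u) I else I - {fst u})"

definition run :: "('d::finite site \<times> bool) list \<Rightarrow> 'd site set \<Rightarrow> 'd site set" where
  "run l I = fold upd l I"

definition restr :: "'d::finite site set \<Rightarrow> ('d site \<times> bool) list \<Rightarrow> ('d site \<times> bool) list" where
  "restr A l = filter (\<lambda>u. fst u \<in> A) l"

lemma run_simps [simp]: "run [] I = I" "run (u # l) I = run l (upd u I)"
  by (simp_all add: run_def)

lemma run_append: "run (l @ l') I = run l' (run l I)"
  by (simp add: run_def)

lemma restr_simps [simp]:
  "restr A [] = []" "restr A (u # l) = (if fst u \<in> A then u # restr A l else restr A l)"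
  by (simp_all add: restr_def)

lemma restr_append: "restr A (l @ l') = restr A l @ restr A l'"
  by (simp add: restr_def)

lemma restr_restr: "restr A (restr B l) = restr (A \<inter> B) l"
  by (simp add: restr_def conj_commute)

lemma fst_set_restr: "fst ` set (restr A l) \<subseteq> A"
  by (auto simp: restr_def)

lemma restr_id: "fst ` set l \<subseteq> A \<Longrightarrow> restr A l = l"
  unfolding restr_def by (rule filter_True) auto

lemma upd_indep_sets: "I \<in> indep_sets S \<Longrightarrow> fst u \<in> S \<Longrightarrow> upd u I \<in> indep_sets S"
  by (auto simp: upd_def indep_sets_def adjacent_commute)

lemma run_indep_sets: "fst ` set l \<subseteq> S \<Longrightarrow> I \<in> indep_sets S \<Longrightarrow> run l I \<in> indep_sets S"
  by (induction l arbitrary: I) (auto intro: upd_indep_sets)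

lemma upd_other: "y \<noteq> fst u \<Longrightarrow> y \<in> upd u I \<longleftrightarrow> y \<in> I"
  by (simp add: upd_def)

lemma run_other: "y \<notin> fst ` set l \<Longrightarrow> y \<in> run l I \<longleftrightarrow> y \<in> I"
  by (induction l arbitrary: I) (auto simp: upd_other)

lemma prob_eq_sum_pmf:
  assumes "finite F" "\<And>x. x \<in> set_pmf M \<Longrightarrow> x \<in> X \<longleftrightarrow> x \<in> F"
  shows "measure_pmf.prob M X = sum (pmf M) F"
proof -
  have "measure_pmf.prob M X = measure_pmf.prob M F"
    using assms(2) by (intro measure_prob_cong_0) (auto simp: pmf_eq_0_set_pmf)
  then show ?thesis using assms(1) by (simp add: measure_measure_pmf_finite)
qed

lemma pmf_replicate_pmf:
  "pmf (replicate_pmf k p) l = (if length l = k then prod_list (map (pmf p) l) else 0)"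
proof (induction k arbitrary: l)
  case 0
  then show ?case by (auto simp: pmf_return indicator_def)
next
  case (Suc k)
  have eq: "replicate_pmf (Suc k) p = map_pmf (\<lambda>(x, xs). x # xs) (pair_pmf p (replicate_pmf k p))"
    by (simp add: pair_pmf_def map_bind_pmf map_pmf_def bind_assoc_pmf bind_return_pmf)
  show ?case
  proof (cases l)
    case Nil
    then have "l \<notin> set_pmf (replicate_pmf (Suc k) p)" by (auto simp: set_replicate_pmf)
    then show ?thesis using Nil by (simp add: pmf_eq_0_set_pmf)
  next
    case (Cons x xs)
    have "inj (\<lambda>(x, xs). x # xs :: 'a list)" by (auto simp: inj_def)
    from pmf_map_inj'[OF this, of "pair_pmf p (replicate_pmf k p)" "(x, xs)"]
    show ?thesis unfolding eq Cons using Suc.IH[of xs] by (simp add: pmf_pair)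
  qed
qed

section \<open>Poisson lists of marked rings and the speed of propagation\<close>

context hardcore
begin

text \<open>The conditional probability of occupation when no neighbour is occupied. A site with an
  occupied neighbour becomes or stays empty whatever its mark, so the marks can be drawn
  independently of the configuration.\<close>

definition mark_prob :: real where
  "mark_prob = lam / (1 + lam)"

definition mark_weight :: "bool \<Rightarrow> real" where
  "mark_weight b = (if b then lam else 1) / (1 + lam)"

definition ring_pmf :: "'d::finite site set \<Rightarrow> ('d site \<times> bool) pmf" where
  "ring_pmf S = pair_pmf (pmf_of_set S) (bernoulli_pmf mark_prob)"

text \<open>The superposition of independent rate-one clocks: a Poisson number of rings, each at a
  uniform site. Only the order of the rings is kept, not their times. The first branch covers rates
  that are not positive, for which \<open>poisson_pmf\<close> is not specified.\<close>

definition updates :: "'d::finite site set \<Rightarrow> real \<Rightarrow> ('d site \<times> bool) list pmf" where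
  "updates S t = (if S = {} \<or> t \<le> 0 then return_pmf [] else
     bind_pmf (poisson_pmf (real (card S) * t)) (\<lambda>k. replicate_pmf k (ring_pmf S)))"

lemma mark_weight_nonneg [simp]: "0 \<le> mark_weight b"
  using lam_pos by (simp add: mark_weight_def)

lemma mark_weight_pos: "0 < mark_weight b"
  using lam_pos by (simp add: mark_weight_def)

lemma mark_weight_sum: "mark_weight True + mark_weight False = 1"
  using lam_pos by (simp add: mark_weight_def add_divide_distrib[symmetric] add.commute)

lemma pmf_bernoulli_mark: "pmf (bernoulli_pmf mark_prob) b = mark_weight b"
proof -
  have "0 \<le> mark_prob" "mark_prob \<le> 1" using lam_pos by (auto simp: mark_prob_def)
  then show ?thesis using lam_pos
    by (cases b) (auto simp: mark_prob_def mark_weight_def field_simps)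
qed

lemma pmf_ring_pmf:
  assumes "finite S" "S \<noteq> {}"
  shows "pmf (ring_pmf S) u = (if fst u \<in> S then mark_weight (snd u) / real (card S) else 0)"
  using assms by (cases u) (auto simp: ring_pmf_def pmf_pair pmf_bernoulli_mark pmf_of_set)

lemma set_ring_pmf: "finite S \<Longrightarrow> S \<noteq> {} \<Longrightarrow> set_pmf (ring_pmf S) = S \<times> UNIV"
proof -
  assume S: "finite S" "S \<noteq> {}"
  have "mark_weight b \<noteq> 0" for b using mark_weight_pos[of b] by simp
  then show ?thesis using S by (auto simp: set_pmf_iff pmf_ring_pmf[OF S] split: if_splits)
qed

lemma prod_list_pmf_ring_pmf:
  assumes "finite S" "S \<noteq> {}"
  shows "prod_list (map (pmf (ring_pmf S)) l) = (if fst ` set l \<subseteq> S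
    then prod_list (map (\<lambda>u. mark_weight (snd u)) l) / real (card S) ^ length l else 0)"
  by (induction l) (auto simp: pmf_ring_pmf[OF assms])

text \<open>The powers of \<open>card S\<close> in the Poisson weight and in the uniform choice of
  sites cancel. The remaining formula is the source of independence over disjoint regions and over
  successive time intervals.\<close>

lemma pmf_updates:
  assumes "finite S" "0 \<le> t"
  shows "pmf (updates S t) l = (if fst ` set l \<subseteq> S
    then exp (- (real (card S) * t)) * t ^ length l / fact (length l)
      * prod_list (map (\<lambda>u. mark_weight (snd u)) l) else 0)"
proof (cases "S = {} \<or> t \<le> 0")
  case True
  then show ?thesis using assms by (cases l) (auto simp: updates_def pmf_return)
next
  case False
  have r: "0 < real (card S) * t" using False assms by (auto simp: card_gt_0_iff)
  have c: "real (card S) \<noteq> 0" using False assms by simp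
  have "pmf (updates S t) l = (\<Sum>k\<in>{length l}. pmf (replicate_pmf k (ring_pmf S)) l
      * pmf (poisson_pmf (real (card S) * t)) k)"
    using False by (simp add: updates_def pmf_bind)
      (subst integral_measure_pmf_real[of "{length l}"], auto simp: pmf_replicate_pmf split: if_splits)
  also have "\<dots> = (if fst ` set l \<subseteq> S
    then exp (- (real (card S) * t)) * t ^ length l / fact (length l)
      * prod_list (map (\<lambda>u. mark_weight (snd u)) l) else 0)"
    using False assms c r
    by (simp add: pmf_replicate_pmf pmf_poisson prod_list_pmf_ring_pmf power_mult_distrib)
  finally show ?thesis .
qed

lemma set_updates: "finite S \<Longrightarrow> 0 \<le> t \<Longrightarrow> l \<in> set_pmf (updates S t) \<Longrightarrow> fst ` set l \<subseteq> S"
  by (auto simp: set_pmf_iff pmf_updates split: if_splits)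

lemma updates_0 [simp]: "updates S 0 = return_pmf []"
  by (simp add: updates_def)

text \<open>The lists with two prescribed restrictions are the shuffles of these restrictions. Their
  number is a binomial coefficient, which turns the factorial of the total length into the product
  of two factorials.\<close>

lemma updates_split:
  fixes A B :: "'d::finite site set"
  assumes fin: "finite A" "finite B" and disj: "A \<inter> B = {}" and t: "0 \<le> t"
  shows "map_pmf (\<lambda>l. (restr A l, restr B l)) (updates (A \<union> B) t) = pair_pmf (updates A t) (updates B t)"
proof (rule pmf_eqI)
  fix p :: "('d site \<times> bool) list \<times> ('d site \<times> bool) list"
  obtain l1 l2 where p: "p = (l1, l2)" by (cases p)
  let ?f = "\<lambda>l. (restr A l, restr B l)"
  let ?w = "\<lambda>l. prod_list (map (\<lambda>u :: 'd site \<times> bool. mark_weight (snd u)) l)"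
  show "pmf (map_pmf ?f (updates (A \<union> B) t)) p = pmf (pair_pmf (updates A t) (updates B t)) p"
  proof (cases "fst ` set l1 \<subseteq> A \<and> fst ` set l2 \<subseteq> B")
    case True
    then have l12: "fst ` set l1 \<subseteq> A" "fst ` set l2 \<subseteq> B" by auto
    have disj': "set l1 \<inter> set l2 = {}" using l12 disj by blast
    have f1: "filter (\<lambda>u. fst u \<in> A) l2 = []" "filter (\<lambda>u. fst u \<in> B) l1 = []"
      "filter (\<lambda>u. fst u \<in> A) l1 = l1" "filter (\<lambda>u. fst u \<in> B) l2 = l2"
      using l12 disj by (auto simp: filter_empty_conv filter_id_conv)
    have sh: "?f l = (l1, l2) \<longleftrightarrow> l \<in> shuffles l1 l2" if l: "fst ` set l \<subseteq> A \<union> B" for l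
    proof
      assume "?f l = (l1, l2)"
      moreover have "restr B l = filter (\<lambda>u. fst u \<notin> A) l"
        unfolding restr_def using l disj by (intro filter_cong) auto
      ultimately show "l \<in> shuffles l1 l2"
        using partition_in_shuffles[of l "\<lambda>u. fst u \<in> A"] by (simp add: restr_def)
    next
      assume l: "l \<in> shuffles l1 l2"
      then have "filter (\<lambda>u. fst u \<in> A) l \<in> shuffles l1 []" "filter (\<lambda>u. fst u \<in> B) l \<in> shuffles [] l2"
        using f1 filter_shuffles[of "\<lambda>u. fst u \<in> A" l1 l2] filter_shuffles[of "\<lambda>u. fst u \<in> B" l1 l2]
        by auto
      then show "?f l = (l1, l2)" by (simp add: restr_def)
    qed
    have "pmf (map_pmf ?f (updates (A \<union> B) t)) p = sum (pmf (updates (A \<union> B) t)) (shuffles l1 l2)"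
      unfolding pmf_map p
    proof (rule prob_eq_sum_pmf)
      fix l assume "l \<in> set_pmf (updates (A \<union> B) t)"
      then have "fst ` set l \<subseteq> A \<union> B" using fin t by (intro set_updates) auto
      then show "(l \<in> ?f -` {(l1, l2)}) = (l \<in> shuffles l1 l2)" using sh[of l] by auto
    qed simp
    also have "\<dots> = (\<Sum>l\<in>shuffles l1 l2. exp (- (real (card (A \<union> B)) * t))
        * t ^ (length l1 + length l2) / fact (length l1 + length l2) * (?w l1 * ?w l2))"
    proof (rule sum.cong[OF refl])
      fix l assume l: "l \<in> shuffles l1 l2"
      have sub: "fst ` set l \<subseteq> A \<union> B" using set_shuffles[OF l] l12 by auto
      have "?w l = ?w l1 * ?w l2"
        using l by (induction l1 l2 arbitrary: l rule: shuffles.induct) (auto simp: mult_ac)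
      then show "pmf (updates (A \<union> B) t) l = exp (- (real (card (A \<union> B)) * t))
        * t ^ (length l1 + length l2) / fact (length l1 + length l2) * (?w l1 * ?w l2)"
        using sub fin t by (simp add: pmf_updates length_shuffles[OF l])
    qed
    also have "\<dots> = real ((length l1 + length l2) choose length l1) / fact (length l1 + length l2)
        * exp (- (real (card (A \<union> B)) * t)) * t ^ (length l1 + length l2) * (?w l1 * ?w l2)"
      by (simp add: card_disjoint_shuffles[OF disj'])
    also have "real ((length l1 + length l2) choose length l1) / fact (length l1 + length l2)
        = 1 / (fact (length l1) * fact (length l2))"
      by (subst binomial_fact) auto
    also have "real (card (A \<union> B)) = real (card A) + real (card B)"
      using fin disj by (simp add: card_Un_disjoint)
    finally show ?thesis
      unfolding p pmf_pair using l12 fin t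
      by (simp add: pmf_updates power_add distrib_right exp_add[symmetric] exp_diff exp_minus field_simps)
  next
    case False
    have "?f l \<noteq> (l1, l2)" for l
      using False fst_set_restr[of A l] fst_set_restr[of B l] by (simp only: prod.inject) blast
    then have "pmf (map_pmf ?f (updates (A \<union> B) t)) p = sum (pmf (updates (A \<union> B) t)) {}"
      unfolding pmf_map p by (intro prob_eq_sum_pmf) simp_all
    then show ?thesis unfolding p pmf_pair using False fin t by (auto simp: pmf_updates)
  qed
qed

lemma updates_restr:
  assumes "finite S" "A \<subseteq> S" "0 \<le> t"
  shows "map_pmf (restr A) (updates S t) = updates A t"
proof -
  have "A \<union> (S - A) = S" using assms by auto
  then have "map_pmf fst (map_pmf (\<lambda>l. (restr A l, restr (S - A) l)) (updates S t)) = updates A t"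
    using updates_split[of A "S - A" t] assms finite_subset[OF assms(2,1)]
    by (simp add: map_fst_pair_pmf Int_Diff)
  then show ?thesis by (simp add: map_pmf_comp)
qed

text \<open>Many disjoint regions at once. The maps \<open>h i\<close> extract what is needed from
  each region, and \<open>dflt\<close> outside \<open>K\<close> matches the convention of
  \<open>Pi_pmf\<close>.\<close>

lemma updates_split_family:
  assumes "finite K" "finite S" "0 \<le> t" "\<And>i. i \<in> K \<Longrightarrow> A i \<subseteq> S"
    and "\<And>i j. i \<in> K \<Longrightarrow> j \<in> K \<Longrightarrow> i \<noteq> j \<Longrightarrow> A i \<inter> A j = {}"
  shows "map_pmf (\<lambda>l i. if i \<in> K then h i (restr (A i) l) else dflt) (updates S t)
    = Pi_pmf K dflt (\<lambda>i. map_pmf (h i) (updates (A i) t))"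
  using assms
proof (induction K arbitrary: S rule: finite_induct)
  case empty
  then show ?case by (simp add: map_pmf_const)
next
  case (insert x K)
  let ?B = "S - A x"
  have fin: "finite (A x)" "finite ?B" using insert.prems by (auto intro: finite_subset)
  have S: "A x \<union> ?B = S" using insert.prems by auto
  have sub: "A i \<subseteq> ?B" if "i \<in> K" for i
    using that insert.prems(3)[of i] insert.prems(4)[of i x] insert.hyps by fastforce
  have "map_pmf (\<lambda>l i. if i \<in> insert x K then h i (restr (A i) l) else dflt) (updates S t)
    = map_pmf (\<lambda>(y, f). f(x := y)) (map_pmf (\<lambda>(l1, l2). (h x l1, \<lambda>i. if i \<in> K then h i (restr (A i) l2) else dflt))
        (map_pmf (\<lambda>l. (restr (A x) l, restr ?B l)) (updates (A x \<union> ?B) t)))"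
    unfolding S map_pmf_comp
  proof (rule map_pmf_cong[OF refl])
    fix l
    have "restr (A i) (restr ?B l) = restr (A i) l" if "i \<in> K" for i
      using sub[OF that] by (simp add: restr_restr Int_absorb2)
    then show "(\<lambda>i. if i \<in> insert x K then h i (restr (A i) l) else dflt) =
      (case case (restr (A x) l, restr ?B l) of (l1, l2) \<Rightarrow> (h x l1, \<lambda>i. if i \<in> K then h i (restr (A i) l2) else dflt) of
        (y, f) \<Rightarrow> f(x := y))"
      using insert.hyps by (auto simp: fun_eq_iff)
  qed
  also have "\<dots> = map_pmf (\<lambda>(y, f). f(x := y)) (pair_pmf (map_pmf (h x) (updates (A x) t))
      (map_pmf (\<lambda>l i. if i \<in> K then h i (restr (A i) l) else dflt) (updates ?B t)))"
    using fin insert.prems by (subst updates_split) (auto simp: map_pair)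
  also have "map_pmf (\<lambda>l i. if i \<in> K then h i (restr (A i) l) else dflt) (updates ?B t)
      = Pi_pmf K dflt (\<lambda>i. map_pmf (h i) (updates (A i) t))"
    using insert.prems sub fin by (intro insert.IH) auto
  finally show ?case by (simp only: Pi_pmf_insert[OF insert.hyps])
qed

text \<open>A list can be cut at any position; summing the weights over all cuts is the binomial
  expansion of \<open>(s + t) ^ length l\<close>.\<close>

lemma updates_append:
  fixes S :: "'d::finite site set"
  assumes "finite S" "0 \<le> s" "0 \<le> t"
  shows "map_pmf (\<lambda>(a, b). a @ b) (pair_pmf (updates S s) (updates S t)) = updates S (s + t)"
proof (rule pmf_eqI)
  fix l :: "('d site \<times> bool) list"
  let ?n = "length l" and ?c = "real (card S)"
  let ?w = "\<lambda>l. prod_list (map (\<lambda>u :: 'd site \<times> bool. mark_weight (snd u)) l)"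
  let ?F = "(\<lambda>j. (take j l, drop j l)) ` {..?n}"
  have inj: "inj_on (\<lambda>j. (take j l, drop j l)) {..?n}"
    by (rule inj_onI) (metis atMost_iff length_take min_absorb2 prod.inject)
  have "pmf (map_pmf (\<lambda>(a, b). a @ b) (pair_pmf (updates S s) (updates S t))) l
      = sum (pmf (pair_pmf (updates S s) (updates S t))) ?F"
    unfolding pmf_map
  proof (rule prob_eq_sum_pmf)
    fix p :: "('d site \<times> bool) list \<times> ('d site \<times> bool) list"
    obtain a b where p: "p = (a, b)" by (cases p)
    show "(p \<in> (\<lambda>(a, b). a @ b) -` {l}) = (p \<in> ?F)"
      unfolding p by (auto intro!: rev_image_eqI[of "length a"])
  qed simp
  also have "\<dots> = (\<Sum>j\<le>?n. pmf (updates S s) (take j l) * pmf (updates S t) (drop j l))"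
    by (subst sum.reindex[OF inj]) (simp add: pmf_pair)
  also have "\<dots> = pmf (updates S (s + t)) l"
  proof (cases "fst ` set l \<subseteq> S")
    case True
    have "(\<Sum>j\<le>?n. pmf (updates S s) (take j l) * pmf (updates S t) (drop j l))
        = (\<Sum>j\<le>?n. exp (- (?c * (s + t))) * ?w l / fact ?n * (real (?n choose j) * s ^ j * t ^ (?n - j)))"
    proof (rule sum.cong[OF refl])
      fix j assume "j \<in> {..?n}"
      then have j: "j \<le> ?n" by simp
      have sub: "fst ` set (take j l) \<subseteq> S" "fst ` set (drop j l) \<subseteq> S"
        using True set_take_subset[of j l] set_drop_subset[of j l] by auto
      have w: "?w (take j l) * ?w (drop j l) = ?w l"
        by (metis append_take_drop_id map_append prod_list.append)
      have e: "exp (- (?c * s)) * exp (- (?c * t)) = exp (- (?c * (s + t)))"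
        by (simp add: exp_add[symmetric] algebra_simps)
      have b: "real (?n choose j) / fact ?n = 1 / (fact j * fact (?n - j))"
        using j by (subst binomial_fact) auto
      have "pmf (updates S s) (take j l) * pmf (updates S t) (drop j l)
          = (exp (- (?c * s)) * exp (- (?c * t))) * (?w (take j l) * ?w (drop j l))
            * (1 / (fact j * fact (?n - j))) * (s ^ j * t ^ (?n - j))"
        using sub assms j by (simp add: pmf_updates)
      then show "pmf (updates S s) (take j l) * pmf (updates S t) (drop j l)
        = exp (- (?c * (s + t))) * ?w l / fact ?n * (real (?n choose j) * s ^ j * t ^ (?n - j))"
        unfolding w e b[symmetric] by simp
    qed
    also have "\<dots> = exp (- (?c * (s + t))) * ?w l / fact ?n * (s + t) ^ ?n"
      by (simp add: binomial_ring sum_distrib_left)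
    finally show ?thesis using True assms by (simp add: pmf_updates)
  next
    case False
    have "\<not> fst ` set (take j l) \<subseteq> S \<or> \<not> fst ` set (drop j l) \<subseteq> S" for j
    proof (rule ccontr)
      assume *: "\<not> ?thesis"
      have "set l = set (take j l) \<union> set (drop j l)" by (metis append_take_drop_id set_append)
      with * False show False by auto
    qed
    then have "pmf (updates S s) (take j l) * pmf (updates S t) (drop j l) = 0" for j
      using assms by (auto simp: pmf_updates)
    then have "(\<Sum>j\<le>?n. pmf (updates S s) (take j l) * pmf (updates S t) (drop j l)) = 0"
      by (simp only: sum.neutral_const)
    then show ?thesis using False assms by (simp add: pmf_updates)
  qed
  finally show "pmf (map_pmf (\<lambda>(a, b). a @ b) (pair_pmf (updates S s) (updates S t))) l
    = pmf (updates S (s + t)) l" .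
qed


text \<open>A Markov bound: by \<open>step\<close> one ring multiplies the mean of \<open>G\<close>
  by at most \<open>1 + C / card S\<close>, and over a Poisson number of rings of mean
  \<open>card S * t\<close> these factors average to \<open>exp (C * t)\<close>, whatever the size
  of \<open>S\<close>. The predicate \<open>V\<close> is an invariant of the states along the
  run.\<close>

lemma updates_growth:
  fixes f :: "'d::finite site \<times> bool \<Rightarrow> 's \<Rightarrow> 's" and G :: "'s \<Rightarrow> real"
  assumes S: "finite S" and "0 \<le> t" "0 \<le> C" and nonneg: "\<And>s. 0 \<le> G s"
    and step: "\<And>s. V s \<Longrightarrow> (\<Sum>u\<in>S \<times> UNIV. mark_weight (snd u) * G (f u s)) \<le> (real (card S) + C) * G s"
    and inv_step: "\<And>s u. V s \<Longrightarrow> fst u \<in> S \<Longrightarrow> V (f u s)"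
    and "V s"
  shows "measure_pmf.prob (updates S t) {l. 1 \<le> G (fold f l s)} \<le> exp (C * t) * G s"
proof (cases "S = {} \<or> t \<le> 0")
  case True
  have "indicator {l. 1 \<le> G (fold f l s)} [] \<le> G s" using nonneg[of s] by (auto simp: indicator_def)
  also have "G s = 1 * G s" by simp
  also have "\<dots> \<le> exp (C * t) * G s" using nonneg assms by (intro mult_right_mono) auto
  finally show ?thesis using True by (simp add: updates_def)
next
  case False
  define n where "n = real (card S)"
  define r where "r = 1 + C / n"
  have n: "0 < n" using False S by (simp add: n_def card_gt_0_iff)
  have r: "0 \<le> r" using n assms by (simp add: r_def)
  have ne: "S \<noteq> {}" using False by simp
  have repl: "emeasure (measure_pmf (replicate_pmf k (ring_pmf S))) {l. 1 \<le> G (fold f l s)} \<le> ennreal (r ^ k * G s)"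
    if "V s" for k s
    using that
  proof (induction k arbitrary: s)
    case 0
    then show ?case using nonneg[of s] by (auto simp: indicator_def)
  next
    case (Suc k)
    have "emeasure (measure_pmf (replicate_pmf (Suc k) (ring_pmf S))) {l. 1 \<le> G (fold f l s)}
      = (\<integral>\<^sup>+u. emeasure (measure_pmf (replicate_pmf k (ring_pmf S))) {l. 1 \<le> G (fold f l (f u s))} \<partial>ring_pmf S)"
      by (simp add: map_pmf_def[symmetric] vimage_def)
    also have "\<dots> \<le> (\<integral>\<^sup>+u. ennreal (r ^ k * G (f u s)) \<partial>ring_pmf S)"
      using Suc.prems inv_step by (intro nn_integral_mono_AE AE_pmfI Suc.IH) (auto simp: set_ring_pmf[OF S ne])
    also have "\<dots> = (\<Sum>u\<in>S \<times> UNIV. ennreal (r ^ k * G (f u s)) * ennreal (pmf (ring_pmf S) u))"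
      using S by (subst nn_integral_measure_pmf_finite) (auto simp: set_ring_pmf[OF S ne])
    also have "\<dots> = ennreal (\<Sum>u\<in>S \<times> UNIV. r ^ k * G (f u s) * pmf (ring_pmf S) u)"
      using r nonneg by (subst sum_ennreal[symmetric]) (auto simp: ennreal_mult)
    also have "(\<Sum>u\<in>S \<times> UNIV. r ^ k * G (f u s) * pmf (ring_pmf S) u)
      = r ^ k / n * (\<Sum>u\<in>S \<times> UNIV. mark_weight (snd u) * G (f u s))"
      unfolding sum_distrib_left
      by (intro sum.cong) (auto simp: pmf_ring_pmf[OF S ne] n_def)
    also have "\<dots> \<le> r ^ k / n * ((n + C) * G s)"
      using step[OF Suc.prems] n r unfolding n_def[symmetric] by (intro mult_left_mono) auto
    also have "\<dots> = r ^ Suc k * G s" using n by (simp add: r_def field_simps)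
    finally show ?case by (simp add: ennreal_leI)
  qed
  have rate: "0 < n * t" using n False by simp
  have "emeasure (measure_pmf (updates S t)) {l. 1 \<le> G (fold f l s)}
      = (\<integral>\<^sup>+k. emeasure (measure_pmf (replicate_pmf k (ring_pmf S))) {l. 1 \<le> G (fold f l s)} \<partial>poisson_pmf (n * t))"
    using False by (simp add: updates_def n_def)
  also have "\<dots> \<le> (\<integral>\<^sup>+k. ennreal (r ^ k * G s) \<partial>poisson_pmf (n * t))"
    using repl[OF \<open>V s\<close>] by (intro nn_integral_mono)
  also have "\<dots> = (\<Sum>k. ennreal ((n * t) ^ k / fact k * exp (- (n * t)) * (r ^ k * G s)))"
    unfolding nn_integral_measure_pmf nn_integral_count_space_nat
  proof (rule suminf_cong)
    fix k
    have "0 \<le> r ^ k * G s" using r nonneg by (intro mult_nonneg_nonneg) auto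
    then show "ennreal (pmf (poisson_pmf (n * t)) k) * ennreal (r ^ k * G s)
      = ennreal ((n * t) ^ k / fact k * exp (- (n * t)) * (r ^ k * G s))"
      unfolding pmf_poisson[OF rate] by (rule ennreal_mult''[symmetric])
  qed
  also have "\<dots> = ennreal (exp (C * t) * G s)"
  proof (rule suminf_ennreal_eq)
    have "(\<lambda>k. (r * (n * t)) ^ k /\<^sub>R fact k) sums exp (r * (n * t))" by (rule exp_converges)
    then have "(\<lambda>k. exp (- (n * t)) * G s * ((r * (n * t)) ^ k /\<^sub>R fact k)) sums
        (exp (- (n * t)) * G s * exp (r * (n * t)))" by (rule sums_mult)
    moreover have "exp (- (n * t)) * G s * exp (r * (n * t)) = exp (C * t) * G s"
    proof -
      have "r * (n * t) = n * t + C * t" using n by (simp add: r_def field_simps)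
      then show ?thesis by (simp add: exp_add exp_minus)
    qed
    moreover have "(n * t) ^ k / fact k * exp (- (n * t)) * (r ^ k * G s)
        = exp (- (n * t)) * G s * ((r * (n * t)) ^ k /\<^sub>R fact k)" for k
      by (simp add: power_mult_distrib divide_inverse)
    ultimately show "(\<lambda>k. (n * t) ^ k / fact k * exp (- (n * t)) * (r ^ k * G s)) sums (exp (C * t) * G s)"
      by (simp only:)
    show "0 \<le> (n * t) ^ k / fact k * exp (- (n * t)) * (r ^ k * G s)" for k
      using rate r nonneg by (intro mult_nonneg_nonneg divide_nonneg_nonneg) auto
  qed
  finally show ?thesis
    using nonneg by (simp add: measure_pmf.emeasure_eq_measure ennreal_le_iff)
qed

text \<open>The disagreements between the dynamics on \<open>S\<close> and on a smaller
  region \<open>B\<close> are weighted by \<open>exp (- ldist x y)\<close>, which an update at a site next to \<open>y\<close>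
  multiplies by at most \<open>exp 1\<close>.\<close>

lemma propagation_bound:
  fixes S B :: "'d::finite site set"
  assumes S: "finite S" and t: "0 \<le> t" and B: "B \<subseteq> S" "S \<inter> lball x r \<subseteq> B" and I: "I \<in> indep_sets S"
  shows "measure_pmf.prob (updates S t) {l. (x \<in> run l I) \<noteq> (x \<in> run (restr B l) (I \<inter> B))}
    \<le> exp (2 * real CARD('d) * exp 1 * t - real r) * real (card S)"
proof (cases "x \<in> S")
  case False
  have "measure_pmf.prob (updates S t) {l. (x \<in> run l I) \<noteq> (x \<in> run (restr B l) (I \<inter> B))} = 0"
    unfolding measure_pmf_zero_iff
  proof -
    have "(x \<in> run l I) = (x \<in> run (restr B l) (I \<inter> B))" if "l \<in> set_pmf (updates S t)" for l
    proof -
      have "fst ` set l \<subseteq> S" using set_updates[OF S t that] .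
      then have "x \<notin> fst ` set l" "x \<notin> fst ` set (restr B l)" "x \<notin> I" "x \<notin> B"
        using False I B fst_set_restr[of B l] by (auto simp: indep_sets_def)
      then show ?thesis by (simp add: run_other)
    qed
    then show "set_pmf (updates S t) \<inter> {l. (x \<in> run l I) \<noteq> (x \<in> run (restr B l) (I \<inter> B))} = {}"
      by blast
  qed
  then show ?thesis by simp
next
  case xS: True
  \<comment> \<open>Sites outside \<open>B\<close> count as disagreeing from the start. Then a new
    disagreement always has a disagreeing neighbour, and all initial weight lies at distance more
    than \<open>r\<close> from \<open>x\<close>.\<close>
  define D where "D p = {y \<in> S. y \<notin> B \<or> (y \<in> fst p) \<noteq> (y \<in> snd p)}" for p :: "'d site set \<times> 'd site set"
  define \<phi> where "\<phi> y = exp (- real (ldist x y))" for y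
  define G where "G p = (\<Sum>y\<in>D p. \<phi> y)" for p
  define f where "f u p = (upd u (fst p), if fst u \<in> B then upd u (snd p) else snd p)"
    for u :: "'d site \<times> bool" and p
  define inv where "inv p \<longleftrightarrow> fst p \<subseteq> S \<and> snd p \<subseteq> B" for p :: "'d site set \<times> 'd site set"
  have finD: "finite (D p)" for p using S by (simp add: D_def)
  have \<phi>0: "0 \<le> \<phi> y" for y by (simp add: \<phi>_def)
  have fold_f: "fold f l (I, J) = (run l I, run (restr B l) J)" for l I J
    by (induction l arbitrary: I J) (auto simp: f_def)
  have one: "G (f (v, b) p) \<le> G p + (\<Sum>y\<in>D p \<inter> nbrs v. exp 1 * \<phi> y)" if p: "inv p" and v: "v \<in> S" for v b p
  proof (cases "v \<in> D (f (v, b) p) - D p")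
    case False
    have "D (f (v, b) p) \<subseteq> D p"
    proof
      fix y assume y: "y \<in> D (f (v, b) p)"
      show "y \<in> D p"
      proof (cases "y = v")
        case False
        then show ?thesis using y by (auto simp: D_def f_def upd_other split: if_splits)
      qed (use y False in auto)
    qed
    then have "G (f (v, b) p) \<le> G p" unfolding G_def using finD \<phi>0 by (intro sum_mono2) auto
    moreover have "0 \<le> (\<Sum>y\<in>D p \<inter> nbrs v. exp 1 * \<phi> y)" using \<phi>0 by (intro sum_nonneg) auto
    ultimately show ?thesis by linarith
  next
    case True
    then have vB: "v \<in> B" by (auto simp: D_def)
    have "D (f (v, b) p) \<subseteq> insert v (D p)"
      by (auto simp: D_def f_def upd_other split: if_splits)
    then have "G (f (v, b) p) \<le> (\<Sum>y\<in>insert v (D p). \<phi> y)"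
      unfolding G_def using finD \<phi>0 by (intro sum_mono2) auto
    also have "\<dots> = \<phi> v + G p" using True finD by (simp add: G_def)
    also have "\<phi> v \<le> (\<Sum>y\<in>D p \<inter> nbrs v. exp 1 * \<phi> y)"
    proof -
      have "\<exists>y. y \<in> D p \<inter> nbrs v"
      proof (rule ccontr)
        assume none: "\<not> ?thesis"
        have "y \<in> fst p \<longleftrightarrow> y \<in> snd p" if "adjacent v y" for y
          using none that p B by (auto simp: D_def nbrs_def inv_def)
        then have "(\<forall>y\<in>fst p. \<not> adjacent v y) \<longleftrightarrow> (\<forall>y\<in>snd p. \<not> adjacent v y)" by blast
        then have "v \<notin> D (f (v, b) p)" using vB by (simp add: D_def f_def upd_def)
        then show False using True by simp
      qed
      then obtain y where y: "y \<in> D p \<inter> nbrs v" by blast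
      have "ldist x y \<le> ldist x v + 1" using y ldist_triangle[of x y v]
        by (simp add: nbrs_def adjacent_iff_ldist)
      then have "\<phi> v \<le> exp 1 * \<phi> y" by (simp add: \<phi>_def exp_add[symmetric])
      also have "\<dots> \<le> (\<Sum>y\<in>D p \<inter> nbrs v. exp 1 * \<phi> y)"
        using y \<phi>0 finD by (intro member_le_sum) auto
      finally show ?thesis .
    qed
    finally show ?thesis by simp
  qed
  have "measure_pmf.prob (updates S t) {l. 1 \<le> G (fold f l (I, I \<inter> B))}
      \<le> exp (2 * real CARD('d) * exp 1 * t) * G (I, I \<inter> B)"
  proof (rule updates_growth[where V = inv])
    fix p assume p: "inv p"
    have "(\<Sum>u\<in>S \<times> UNIV. mark_weight (snd u) * G (f u p))
        = (\<Sum>v\<in>S. mark_weight True * G (f (v, True) p) + mark_weight False * G (f (v, False) p))"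
      by (simp add: sum.cartesian_product' UNIV_bool add.commute)
    also have "\<dots> \<le> (\<Sum>v\<in>S. G p + (\<Sum>y\<in>D p \<inter> nbrs v. exp 1 * \<phi> y))"
    proof (rule sum_mono)
      fix v assume "v \<in> S"
      let ?H = "G p + (\<Sum>y\<in>D p \<inter> nbrs v. exp 1 * \<phi> y)"
      have "mark_weight True * G (f (v, True) p) + mark_weight False * G (f (v, False) p)
          \<le> mark_weight True * ?H + mark_weight False * ?H"
        using one[OF p \<open>v \<in> S\<close>] by (intro add_mono mult_left_mono) auto
      also have "\<dots> = ?H" using mark_weight_sum by (simp add: distrib_right[symmetric])
      finally show "mark_weight True * G (f (v, True) p) + mark_weight False * G (f (v, False) p) \<le> ?H" .
    qed
    also have "\<dots> = real (card S) * G p + (\<Sum>v\<in>S. \<Sum>y\<in>D p \<inter> nbrs v. exp 1 * \<phi> y)"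
      by (simp add: sum.distrib)
    also have "(\<Sum>v\<in>S. \<Sum>y\<in>D p \<inter> nbrs v. exp 1 * \<phi> y) = (\<Sum>v\<in>S. \<Sum>y\<in>D p. if y \<in> nbrs v then exp 1 * \<phi> y else 0)"
      using finD by (simp add: sum.inter_restrict)
    also have "\<dots> = (\<Sum>y\<in>D p. \<Sum>v\<in>S. if y \<in> nbrs v then exp 1 * \<phi> y else 0)" by (rule sum.swap)
    also have "\<dots> = (\<Sum>y\<in>D p. real (card (S \<inter> nbrs y)) * (exp 1 * \<phi> y))"
    proof (rule sum.cong[OF refl])
      fix y
      have "(\<Sum>v\<in>S. if y \<in> nbrs v then exp 1 * \<phi> y else 0) = (\<Sum>v\<in>S. if v \<in> nbrs y then exp 1 * \<phi> y else 0)"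
        by (simp add: nbrs_def adjacent_commute)
      also have "\<dots> = (\<Sum>v\<in>S \<inter> nbrs y. exp 1 * \<phi> y)" by (rule sum.inter_restrict[OF S, symmetric])
      finally show "(\<Sum>v\<in>S. if y \<in> nbrs v then exp 1 * \<phi> y else 0) = real (card (S \<inter> nbrs y)) * (exp 1 * \<phi> y)"
        by simp
    qed
    \<comment> \<open>A disagreement at \<open>y\<close> can be passed on only by rings at its at
      most \<open>2d\<close> neighbours, which gives the growth rate \<open>2d\<close> times
      \<open>exp 1\<close>.\<close>
    also have "\<dots> \<le> (\<Sum>y\<in>D p. real (2 * CARD('d)) * (exp 1 * \<phi> y))"
    proof (rule sum_mono)
      fix y
      have "card (S \<inter> nbrs y) \<le> 2 * CARD('d)"
        using card_mono[of "nbrs y" "S \<inter> nbrs y"] card_nbrs[of y] by simp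
      then have "real (card (S \<inter> nbrs y)) \<le> real (2 * CARD('d))" by (simp only: of_nat_le_iff)
      then show "real (card (S \<inter> nbrs y)) * (exp 1 * \<phi> y) \<le> real (2 * CARD('d)) * (exp 1 * \<phi> y)"
        using \<phi>0 by (intro mult_right_mono) auto
    qed
    also have "\<dots> = 2 * real CARD('d) * exp 1 * G p" by (simp add: G_def sum_distrib_left mult_ac)
    finally show "(\<Sum>u\<in>S \<times> UNIV. mark_weight (snd u) * G (f u p)) \<le> (real (card S) + 2 * real CARD('d) * exp 1) * G p"
      by (simp add: distrib_right)
  next
    fix p and u :: "'d site \<times> bool" assume "inv p" "fst u \<in> S"
    then show "inv (f u p)" by (auto simp: inv_def f_def upd_def)
  qed (use S t \<phi>0 I B in \<open>auto simp: G_def inv_def indep_sets_def intro!: sum_nonneg\<close>)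
  also have "G (I, I \<inter> B) \<le> real (card S) * exp (- real r)"
  proof -
    have "G (I, I \<inter> B) \<le> (\<Sum>y\<in>D (I, I \<inter> B). exp (- real r))"
      unfolding G_def using B by (intro sum_mono) (auto simp: D_def \<phi>_def lball_def)
    also have "\<dots> = real (card (D (I, I \<inter> B))) * exp (- real r)" by simp
    also have "\<dots> \<le> real (card S) * exp (- real r)"
      using S by (intro mult_right_mono) (auto simp: D_def intro!: card_mono)
    finally show ?thesis .
  qed
  finally have main: "measure_pmf.prob (updates S t) {l. 1 \<le> G (fold f l (I, I \<inter> B))}
      \<le> exp (2 * real CARD('d) * exp 1 * t - real r) * real (card S)"
    by (simp add: exp_diff exp_minus field_simps)
  have "{l. (x \<in> run l I) \<noteq> (x \<in> run (restr B l) (I \<inter> B))} \<subseteq> {l. 1 \<le> G (fold f l (I, I \<inter> B))}"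
  proof
    fix l assume "l \<in> {l. (x \<in> run l I) \<noteq> (x \<in> run (restr B l) (I \<inter> B))}"
    then have "x \<in> D (fold f l (I, I \<inter> B))" using xS by (simp add: D_def fold_f)
    then have "\<phi> x \<le> G (fold f l (I, I \<inter> B))" unfolding G_def using finD \<phi>0 by (intro member_le_sum) auto
    then show "l \<in> {l. 1 \<le> G (fold f l (I, I \<inter> B))}" by (simp add: \<phi>_def)
  qed
  then have "measure_pmf.prob (updates S t) {l. (x \<in> run l I) \<noteq> (x \<in> run (restr B l) (I \<inter> B))}
      \<le> measure_pmf.prob (updates S t) {l. 1 \<le> G (fold f l (I, I \<inter> B))}"
    by (intro measure_pmf.finite_measure_mono) auto
  then show ?thesis using main by linarith
qed

end

section \<open>Monotonicity, reversibility and censoring\<close>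

lemma integrable_pmf_bounded:
  fixes f :: "'a \<Rightarrow> real"
  assumes "\<And>x. \<bar>f x\<bar> \<le> B"
  shows "integrable (measure_pmf M) f"
  by (rule measure_pmf.integrable_const_bound[where B = B]) (use assms in auto)

lemma abs_expectation_le:
  fixes f :: "'a \<Rightarrow> real"
  assumes "\<And>x. \<bar>f x\<bar> \<le> B"
  shows "\<bar>measure_pmf.expectation M f\<bar> \<le> B"
proof -
  have "\<bar>measure_pmf.expectation M f\<bar> \<le> measure_pmf.expectation M (\<lambda>x. \<bar>f x\<bar>)"
    by (rule integral_abs_bound)
  also have "\<dots> \<le> measure_pmf.expectation M (\<lambda>_. B)"
  proof (rule integral_mono)
    show "integrable (measure_pmf M) (\<lambda>x. \<bar>f x\<bar>)"
      by (rule integrable_pmf_bounded[where B = B]) (use assms in auto)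
  qed (use assms in auto)
  finally show ?thesis by simp
qed

lemma expectation_bind_pmf:
  fixes f :: "'a \<Rightarrow> real"
  assumes "\<And>x. \<bar>f x\<bar> \<le> B"
  shows "measure_pmf.expectation (bind_pmf M N) f = measure_pmf.expectation M (\<lambda>x. measure_pmf.expectation (N x) f)"
proof -
  have B: "0 \<le> B" using abs_ge_zero[of "f undefined"] assms[of undefined] by (rule order_trans)
  \<comment> \<open>Adding \<open>B\<close> makes the integrand nonnegative, so the iterated
    \<open>nn_integral\<close> over \<open>bind_pmf\<close> is available.\<close>
  let ?g = "\<lambda>x. f x + B"
  have g: "0 \<le> ?g x" "\<bar>?g x\<bar> \<le> 2 * B" for x using assms[of x] by (auto simp: abs_le_iff)
  have int: "integrable (measure_pmf P) ?g" for P by (rule integrable_pmf_bounded[OF g(2)])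
  have intf: "integrable (measure_pmf P) f" for P by (rule integrable_pmf_bounded[OF assms])
  have E0: "0 \<le> measure_pmf.expectation P ?g" for P using g by (intro Bochner_Integration.integral_nonneg) auto
  have "ennreal (measure_pmf.expectation (bind_pmf M N) ?g) = (\<integral>\<^sup>+x. ennreal (?g x) \<partial>bind_pmf M N)"
    by (intro nn_integral_eq_integral[symmetric] int) (use g in auto)
  also have "\<dots> = (\<integral>\<^sup>+x. \<integral>\<^sup>+y. ennreal (?g y) \<partial>N x \<partial>M)" by simp
  also have "\<dots> = (\<integral>\<^sup>+x. ennreal (measure_pmf.expectation (N x) ?g) \<partial>M)"
    by (intro nn_integral_cong nn_integral_eq_integral int) (use g in auto)
  also have "\<dots> = ennreal (measure_pmf.expectation M (\<lambda>x. measure_pmf.expectation (N x) ?g))"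
    using E0 by (intro nn_integral_eq_integral integrable_pmf_bounded[where B = "2 * B"] abs_expectation_le g) auto
  finally have "measure_pmf.expectation (bind_pmf M N) ?g
      = measure_pmf.expectation M (\<lambda>x. measure_pmf.expectation (N x) ?g)"
    by (subst (asm) ennreal_inj) (use E0 in \<open>auto intro!: Bochner_Integration.integral_nonneg\<close>)
  then show ?thesis
    using intf integrable_pmf_bounded[where M = M and f = "\<lambda>x. measure_pmf.expectation (N x) f", OF abs_expectation_le[OF assms]]
    by simp
qed

text \<open>The lattice is bipartite, so the hard-core dynamics is monotone once the order is reversed
  on the odd sites.\<close>

definition conf_le :: "'d::finite site set \<Rightarrow> 'd site set \<Rightarrow> bool" where
  "conf_le I J \<longleftrightarrow> (\<forall>x. if even_site x then x \<in> I \<longrightarrow> x \<in> J else x \<in> J \<longrightarrow> x \<in> I)"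

definition top_conf :: "'d::finite site set \<Rightarrow> 'd site set" where
  "top_conf S = {x \<in> S. even_site x}"

definition bot_conf :: "'d::finite site set \<Rightarrow> 'd site set" where
  "bot_conf S = {x \<in> S. \<not> even_site x}"

definition increasing :: "'d::finite site set \<Rightarrow> ('d site set \<Rightarrow> real) \<Rightarrow> bool" where
  "increasing S f \<longleftrightarrow> (\<forall>I\<in>indep_sets S. \<forall>J\<in>indep_sets S. conf_le I J \<longrightarrow> f I \<le> f J)"

lemma conf_le_refl [simp]: "conf_le I I"
  by (simp add: conf_le_def)

lemma conf_le_antisym: "conf_le I J \<Longrightarrow> conf_le J I \<Longrightarrow> I = J"
  unfolding conf_le_def by (metis set_eqI)

text \<open>The neighbours of an even site are odd, where the order is reversed: the larger
  configuration has fewer of them occupied and so blocks the site less. Odd sites are treated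
  symmetrically.\<close>

lemma upd_mono:
  assumes "conf_le I J"
  shows "conf_le (upd u I) (upd u J)"
proof -
  obtain x b where u: "u = (x, b)" by (cases u)
  have le: "y \<in> I \<Longrightarrow> y \<in> J" if "even_site y" for y using assms that by (metis conf_le_def)
  have ge: "y \<in> J \<Longrightarrow> y \<in> I" if "\<not> even_site y" for y using assms that by (metis conf_le_def)
  have other: "y \<in> upd u I \<longleftrightarrow> y \<in> I" "y \<in> upd u J \<longleftrightarrow> y \<in> J" if "y \<noteq> x" for y
    using that u by (simp_all add: upd_other)
  have self: "x \<in> upd u I \<longleftrightarrow> b \<and> (\<forall>y\<in>I. \<not> adjacent x y)" "x \<in> upd u J \<longleftrightarrow> b \<and> (\<forall>y\<in>J. \<not> adjacent x y)"
    by (auto simp: u upd_def)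
  show ?thesis
  proof (cases "even_site x")
    case True
    then have "x \<in> upd u I \<longrightarrow> x \<in> upd u J"
      unfolding self using ge adjacent_even_site[of x] by blast
    then show ?thesis unfolding conf_le_def using other le ge True by (metis (full_types))
  next
    case False
    then have "x \<in> upd u J \<longrightarrow> x \<in> upd u I"
      unfolding self using le adjacent_even_site[of x] by blast
    then show ?thesis unfolding conf_le_def using other le ge False by (metis (full_types))
  qed
qed

lemma run_mono: "conf_le I J \<Longrightarrow> conf_le (run l I) (run l J)"
  by (induction l arbitrary: I J) (auto intro: upd_mono)

lemma top_conf_indep [simp]: "top_conf S \<in> indep_sets S"
  and bot_conf_indep [simp]: "bot_conf S \<in> indep_sets S"
  using adjacent_even_site by (auto simp: top_conf_def bot_conf_def indep_sets_def)

lemma conf_le_top: "I \<subseteq> S \<Longrightarrow> conf_le I (top_conf S)"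
  and conf_le_bot: "I \<subseteq> S \<Longrightarrow> conf_le (bot_conf S) I"
  by (auto simp: conf_le_def top_conf_def bot_conf_def)

lemma bot_le_top: "conf_le (bot_conf S) (top_conf S)"
  by (auto simp: conf_le_def top_conf_def bot_conf_def)

lemma run_coalesced:
  assumes "run l (top_conf S) = run l (bot_conf S)" "I \<subseteq> S"
  shows "run l I = run l (top_conf S)"
  using run_mono[OF conf_le_top[OF assms(2)], of l] run_mono[OF conf_le_bot[OF assms(2)], of l] assms(1)
  by (metis conf_le_antisym)

text \<open>Sandwiching at a single site: agreement of the two extreme runs at \<open>x\<close>
  alone already makes the spin at \<open>x\<close> independent of the initial configuration.\<close>

lemma run_coalesced_at:
  assumes "x \<in> run l (top_conf S) \<longleftrightarrow> x \<in> run l (bot_conf S)" "I \<subseteq> S"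
  shows "x \<in> run l I \<longleftrightarrow> x \<in> run l (top_conf S)"
  using run_mono[OF conf_le_top[OF assms(2)], of l] run_mono[OF conf_le_bot[OF assms(2)], of l] assms(1)
  unfolding conf_le_def by (cases "even_site x") metis+

section \<open>Gibbs averages and single-site operators\<close>

context hardcore
begin

definition gibbs_sum :: "'d::finite site set \<Rightarrow> ('d site set \<Rightarrow> real) \<Rightarrow> real" where
  "gibbs_sum S f = (\<Sum>I\<in>indep_sets S. lam ^ card I * f I)"

text \<open>For \<open>x \<in> S\<close> and \<open>I\<close> in \<open>indep_sets S\<close> this is
  the conditional expectation of \<open>f\<close> under the Gibbs measure given all spins except the
  one at \<open>x\<close>.\<close>

definition site_op :: "'d::finite site \<Rightarrow> ('d site set \<Rightarrow> real) \<Rightarrow> 'd site set \<Rightarrow> real" where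
  "site_op x f I = mark_weight True * f (upd (x, True) I) + mark_weight False * f (upd (x, False) I)"

lemma gibbs_sum_mono: "(\<And>I. I \<in> indep_sets S \<Longrightarrow> f I \<le> g I) \<Longrightarrow> gibbs_sum S f \<le> gibbs_sum S g"
  unfolding gibbs_sum_def using lam_pos by (intro sum_mono mult_left_mono) auto

text \<open>Independent sets are grouped by their part outside \<open>x\<close>. In the first sum
  \<open>x\<close> is blocked; in the second it is free, and its two states carry relative weights 1
  and \<open>lam\<close>.\<close>

lemma gibbs_sum_split:
  assumes "finite S" "x \<in> S"
  shows "gibbs_sum S h =
    (\<Sum>I | I \<in> indep_sets S \<and> x \<notin> I \<and> (\<exists>y\<in>I. adjacent x y). lam ^ card I * h I)
    + (\<Sum>I | I \<in> indep_sets S \<and> x \<notin> I \<and> (\<forall>y\<in>I. \<not> adjacent x y). lam ^ card I * (h I + lam * h (insert x I)))"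
proof -
  let ?W = "{I \<in> indep_sets S. x \<notin> I \<and> (\<exists>y\<in>I. adjacent x y)}"
  let ?V = "{I \<in> indep_sets S. x \<notin> I \<and> (\<forall>y\<in>I. \<not> adjacent x y)}"
  have eq: "indep_sets S = ?W \<union> (?V \<union> {I \<in> indep_sets S. x \<in> I})" by auto
  have bij: "bij_betw (insert x) ?V {I \<in> indep_sets S. x \<in> I}"
    by (rule bij_betw_byWitness[where f' = "\<lambda>I. I - {x}"])
      (use assms in \<open>auto simp: indep_sets_def adjacent_commute\<close>)
  have fin: "finite I" if "I \<in> indep_sets S" for I
    using that assms(1) by (auto simp: indep_sets_def intro: finite_subset)
  have "(\<Sum>I | I \<in> indep_sets S \<and> x \<in> I. lam ^ card I * h I) = (\<Sum>I\<in>?V. lam ^ card (insert x I) * h (insert x I))"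
    by (rule sum.reindex_bij_betw[OF bij, symmetric])
  also have "\<dots> = (\<Sum>I\<in>?V. lam ^ card I * (lam * h (insert x I)))"
    using fin by (intro sum.cong) auto
  finally have V: "(\<Sum>I | I \<in> indep_sets S \<and> x \<in> I. lam ^ card I * h I) = (\<Sum>I\<in>?V. lam ^ card I * (lam * h (insert x I)))" .
  have "gibbs_sum S h = (\<Sum>I\<in>?W \<union> (?V \<union> {I \<in> indep_sets S. x \<in> I}). lam ^ card I * h I)"
    unfolding gibbs_sum_def using eq by simp
  also have "\<dots> = (\<Sum>I\<in>?W. lam ^ card I * h I) + (\<Sum>I\<in>?V \<union> {I \<in> indep_sets S. x \<in> I}. lam ^ card I * h I)"
    using assms(1) by (intro sum.union_disjoint) auto
  also have "(\<Sum>I\<in>?V \<union> {I \<in> indep_sets S. x \<in> I}. lam ^ card I * h I)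
      = (\<Sum>I\<in>?V. lam ^ card I * h I) + (\<Sum>I | I \<in> indep_sets S \<and> x \<in> I. lam ^ card I * h I)"
    using assms(1) by (intro sum.union_disjoint) auto
  finally show ?thesis unfolding V by (simp add: sum.distrib[symmetric] distrib_left)
qed

lemma site_op_blocked: "x \<notin> I \<Longrightarrow> \<exists>y\<in>I. adjacent x y \<Longrightarrow> site_op x f I = f I"
  using mark_weight_sum by (auto simp: site_op_def upd_def distrib_right[symmetric])

lemma site_op_free:
  assumes "x \<notin> I" "\<forall>y\<in>I. \<not> adjacent x y"
  shows "site_op x f I = (f I + lam * f (insert x I)) / (1 + lam)"
    and "site_op x f (insert x I) = (f I + lam * f (insert x I)) / (1 + lam)"
  using assms lam_pos by (auto simp: site_op_def upd_def mark_weight_def add_divide_distrib)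

text \<open>\<open>site_op x g\<close> does not depend on the spin at \<open>x\<close>, so
  \<open>f\<close> may be replaced by its conditional expectation. As the right side is symmetric in
  \<open>f\<close> and \<open>g\<close>, self-adjointness follows.\<close>

lemma gibbs_sum_site_op_right:
  assumes "finite S" "x \<in> S"
  shows "gibbs_sum S (\<lambda>I. f I * site_op x g I) = gibbs_sum S (\<lambda>I. site_op x f I * site_op x g I)"
  unfolding gibbs_sum_split[OF assms]
proof (intro arg_cong2[of _ _ _ _ "(+)"] sum.cong refl)
  fix I assume "I \<in> {I \<in> indep_sets S. x \<notin> I \<and> (\<forall>y\<in>I. \<not> adjacent x y)}"
  then have I: "x \<notin> I" "\<forall>y\<in>I. \<not> adjacent x y" by auto
  have "f I + lam * f (insert x I) = (1 + lam) * site_op x f I"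
    using lam_pos site_op_free(1)[OF I, of f] by simp
  then have "f I * site_op x g I + lam * (f (insert x I) * site_op x g I) = (1 + lam) * site_op x f I * site_op x g I"
    by (metis distrib_right mult.assoc)
  then show "lam ^ card I * (f I * site_op x g I + lam * (f (insert x I) * site_op x g (insert x I)))
    = lam ^ card I * (site_op x f I * site_op x g I + lam * (site_op x f (insert x I) * site_op x g (insert x I)))"
    unfolding site_op_free(2)[OF I] site_op_free(1)[OF I, symmetric] by (simp add: algebra_simps)
qed (auto simp: site_op_blocked)

lemma gibbs_sum_site_op_swap:
  assumes "finite S" "x \<in> S"
  shows "gibbs_sum S (\<lambda>I. f I * site_op x g I) = gibbs_sum S (\<lambda>I. site_op x f I * g I)"
  using gibbs_sum_site_op_right[OF assms, of f g] gibbs_sum_site_op_right[OF assms, of g f]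
  by (simp add: mult.commute)

text \<open>The gap is a mean of conditional covariances given the spins off \<open>x\<close>. Both
  functions are monotone in the same direction in the one remaining spin, so each covariance is
  nonnegative.\<close>

lemma gibbs_sum_site_op_le:
  assumes "finite S" "x \<in> S" and inc: "increasing S f" "increasing S g"
  shows "gibbs_sum S (\<lambda>I. f I * site_op x g I) \<le> gibbs_sum S (\<lambda>I. f I * g I)"
proof -
  let ?W = "{I \<in> indep_sets S. x \<notin> I \<and> (\<exists>y\<in>I. adjacent x y)}"
  let ?V = "{I \<in> indep_sets S. x \<notin> I \<and> (\<forall>y\<in>I. \<not> adjacent x y)}"
  have W: "(\<Sum>I\<in>?W. lam ^ card I * (site_op x f I * site_op x g I)) = (\<Sum>I\<in>?W. lam ^ card I * (f I * g I))"
    by (intro sum.cong refl) (auto simp: site_op_blocked)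
  have V: "(\<Sum>I\<in>?V. lam ^ card I * (site_op x f I * site_op x g I + lam * (site_op x f (insert x I) * site_op x g (insert x I))))
      \<le> (\<Sum>I\<in>?V. lam ^ card I * (f I * g I + lam * (f (insert x I) * g (insert x I))))"
  proof (rule sum_mono)
    fix I assume "I \<in> {I \<in> indep_sets S. x \<notin> I \<and> (\<forall>y\<in>I. \<not> adjacent x y)}"
    then have I: "x \<notin> I" "\<forall>y\<in>I. \<not> adjacent x y" and ind: "I \<in> indep_sets S" by auto
    then have ind': "insert x I \<in> indep_sets S" using assms(2) by (auto simp: indep_sets_def adjacent_commute)
    have "0 \<le> (f (insert x I) - f I) * (g (insert x I) - g I)"
    proof (cases "even_site x")
      case True
      then have "conf_le I (insert x I)" by (auto simp: conf_le_def)
      then show ?thesis using inc ind ind' by (auto simp: increasing_def)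
    next
      case False
      then have "conf_le (insert x I) I" by (auto simp: conf_le_def)
      then show ?thesis using inc ind ind' by (auto simp: increasing_def mult_nonpos_nonpos)
    qed
    then have "0 \<le> lam * ((f (insert x I) - f I) * (g (insert x I) - g I))" using lam_pos by simp
    also have "\<dots> = (1 + lam) * (f I * g I + lam * (f (insert x I) * g (insert x I)))
        - (f I + lam * f (insert x I)) * (g I + lam * g (insert x I))"
      by (simp add: algebra_simps)
    finally have "(f I + lam * f (insert x I)) * (g I + lam * g (insert x I)) / (1 + lam)
        \<le> f I * g I + lam * (f (insert x I) * g (insert x I))"
      using lam_pos by (simp add: divide_le_eq mult.commute)
    moreover have "site_op x f I * site_op x g I + lam * (site_op x f (insert x I) * site_op x g (insert x I))
        = (f I + lam * f (insert x I)) * (g I + lam * g (insert x I)) / (1 + lam)"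
    proof -
      let ?a = "f I + lam * f (insert x I)" and ?b = "g I + lam * g (insert x I)"
      have "site_op x f I * site_op x g I + lam * (site_op x f (insert x I) * site_op x g (insert x I))
          = (1 + lam) * (?a / (1 + lam) * (?b / (1 + lam)))"
        unfolding site_op_free[OF I] by (simp only: distrib_right mult_1_left)
      also have "\<dots> = ?a * ?b / (1 + lam)" using lam_pos by simp
      finally show ?thesis .
    qed
    ultimately have "site_op x f I * site_op x g I + lam * (site_op x f (insert x I) * site_op x g (insert x I))
      \<le> f I * g I + lam * (f (insert x I) * g (insert x I))" by simp
    then show "lam ^ card I * (site_op x f I * site_op x g I + lam * (site_op x f (insert x I) * site_op x g (insert x I)))
        \<le> lam ^ card I * (f I * g I + lam * (f (insert x I) * g (insert x I)))"
      using lam_pos by (intro mult_left_mono) auto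
  qed
  show ?thesis
    unfolding gibbs_sum_site_op_right[OF assms(1,2), of f g]
      gibbs_sum_split[OF assms(1,2), of "\<lambda>I. site_op x f I * site_op x g I"]
      gibbs_sum_split[OF assms(1,2), of "\<lambda>I. f I * g I"] W
    by (rule add_left_mono[OF V])
qed

lemma increasing_site_op: "x \<in> S \<Longrightarrow> increasing S f \<Longrightarrow> increasing S (site_op x f)"
proof -
  assume x: "x \<in> S" and f: "increasing S f"
  have "f (upd (x, b) I) \<le> f (upd (x, b) J)"
    if "I \<in> indep_sets S" "J \<in> indep_sets S" "conf_le I J" for I J b
    using f that x upd_indep_sets[of I S "(x, b)"] upd_indep_sets[of J S "(x, b)"] upd_mono[of I J "(x, b)"]
    by (simp add: increasing_def)
  then have "site_op x f I \<le> site_op x f J"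
    if "I \<in> indep_sets S" "J \<in> indep_sets S" "conf_le I J" for I J
    unfolding site_op_def using that by (intro add_mono mult_left_mono mark_weight_nonneg)
  then show "increasing S (site_op x f)" by (simp add: increasing_def)
qed

text \<open>One ring of a uniformly chosen clock of \<open>S\<close>, ignored outside
  \<open>A\<close>. Ignored rings are still counted, so that the censored and the uncensored
  dynamics have the same distribution of the number of rings and can be compared ring by
  ring.\<close>

definition step_op :: "'d::finite site set \<Rightarrow> 'd site set \<Rightarrow> ('d site set \<Rightarrow> real) \<Rightarrow> 'd site set \<Rightarrow> real" where
  "step_op S A f I = (\<Sum>x\<in>S. if x \<in> A then site_op x f I else f I) / real (card S)"

definition evolve :: "'d::finite site set \<Rightarrow> 'd site set \<Rightarrow> real \<Rightarrow> ('d site set \<Rightarrow> real) \<Rightarrow> 'd site set \<Rightarrow> real" where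
  "evolve S A t f I = measure_pmf.expectation (updates S t) (\<lambda>l. f (run (restr A l) I))"

definition length_pmf :: "'d::finite site set \<Rightarrow> real \<Rightarrow> nat pmf" where
  "length_pmf S t = (if S = {} \<or> t \<le> 0 then return_pmf 0 else poisson_pmf (real (card S) * t))"

lemma updates_eq_bind: "updates S t = bind_pmf (length_pmf S t) (\<lambda>k. replicate_pmf k (ring_pmf S))"
  by (simp add: updates_def length_pmf_def bind_return_pmf)

lemma expectation_replicate_ring_pmf:
  assumes "finite S" "S \<noteq> {}" and B: "\<And>I. \<bar>f I\<bar> \<le> B"
  shows "measure_pmf.expectation (replicate_pmf k (ring_pmf S)) (\<lambda>l. f (run (restr A l) I)) = (step_op S A ^^ k) f I"
proof (induction k arbitrary: I)
  case (Suc k)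
  let ?h = "\<lambda>u. (step_op S A ^^ k) f (if fst u \<in> A then upd u I else I)"
  have "measure_pmf.expectation (replicate_pmf (Suc k) (ring_pmf S)) (\<lambda>l. f (run (restr A l) I))
      = measure_pmf.expectation (ring_pmf S) (\<lambda>u. measure_pmf.expectation
          (map_pmf ((#) u) (replicate_pmf k (ring_pmf S))) (\<lambda>l. f (run (restr A l) I)))"
    unfolding replicate_pmf.simps map_pmf_def[symmetric]
    by (rule expectation_bind_pmf[where B = B]) (rule B)
  also have "\<dots> = measure_pmf.expectation (ring_pmf S) ?h"
  proof (rule Bochner_Integration.integral_cong[OF refl])
    fix u
    show "measure_pmf.expectation (map_pmf ((#) u) (replicate_pmf k (ring_pmf S))) (\<lambda>l. f (run (restr A l) I)) = ?h u"
      using Suc.IH[of "upd u I"] Suc.IH[of I] by (cases "fst u \<in> A") simp_all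
  qed
  also have "\<dots> = (\<Sum>u\<in>S \<times> UNIV. ?h u * pmf (ring_pmf S) u)"
    using assms by (intro integral_measure_pmf_real) (auto simp: set_ring_pmf)
  also have "\<dots> = (\<Sum>x\<in>S. \<Sum>b\<in>UNIV. ?h (x, b) * (mark_weight b / real (card S)))"
    using assms by (simp add: sum.cartesian_product' pmf_ring_pmf)
  also have "\<dots> = (\<Sum>x\<in>S. (if x \<in> A then site_op x ((step_op S A ^^ k) f) I else (step_op S A ^^ k) f I) / real (card S))"
  proof (rule sum.cong[OF refl])
    fix x
    let ?c = "(step_op S A ^^ k) f I"
    have "(\<Sum>b\<in>UNIV. ?h (x, b) * (mark_weight b / real (card S)))
        = (mark_weight True * ?h (x, True) + mark_weight False * ?h (x, False)) / real (card S)"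
      by (simp add: UNIV_bool add_divide_distrib mult.commute)
    moreover have "mark_weight True * ?c + mark_weight False * ?c = ?c"
      unfolding distrib_right[symmetric] mark_weight_sum by simp
    ultimately show "(\<Sum>b\<in>UNIV. ?h (x, b) * (mark_weight b / real (card S)))
        = (if x \<in> A then site_op x ((step_op S A ^^ k) f) I else ?c) / real (card S)"
      by (simp add: site_op_def)
  qed
  also have "\<dots> = (step_op S A ^^ Suc k) f I" by (simp add: step_op_def sum_divide_distrib)
  finally show ?case .
qed simp

lemma evolve_eq:
  assumes "finite S" and B: "\<And>I. \<bar>f I\<bar> \<le> B"
  shows "evolve S A t f I = measure_pmf.expectation (length_pmf S t) (\<lambda>k. (step_op S A ^^ k) f I)"
proof (cases "S = {}")
  case True
  then show ?thesis by (simp add: evolve_def updates_def length_pmf_def)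
next
  case False
  have "evolve S A t f I = measure_pmf.expectation (length_pmf S t)
      (\<lambda>k. measure_pmf.expectation (replicate_pmf k (ring_pmf S)) (\<lambda>l. f (run (restr A l) I)))"
    unfolding evolve_def updates_eq_bind by (rule expectation_bind_pmf[where B = B]) (rule B)
  then show ?thesis by (simp add: expectation_replicate_ring_pmf[where f = f and B = B, OF assms(1) False B])
qed

lemma step_op_bounded:
  assumes "finite S" "S \<noteq> {}" "\<And>I. \<bar>f I\<bar> \<le> B"
  shows "\<bar>(step_op S A ^^ k) f I\<bar> \<le> B"
  unfolding expectation_replicate_ring_pmf[where f = f and B = B, OF assms, symmetric]
  by (rule abs_expectation_le) (rule assms)

lemma gibbs_sum_evolve:
  assumes "finite S" and B: "\<And>I. \<bar>g I\<bar> \<le> B"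
  shows "gibbs_sum S (\<lambda>I. f I * evolve S A t g I)
    = measure_pmf.expectation (length_pmf S t) (\<lambda>k. gibbs_sum S (\<lambda>I. f I * (step_op S A ^^ k) g I))"
    and "integrable (length_pmf S t) (\<lambda>k. gibbs_sum S (\<lambda>I. f I * (step_op S A ^^ k) g I))"
proof -
  have int: "integrable (length_pmf S t) (\<lambda>k. (step_op S A ^^ k) g I)" for I
  proof (cases "S = {}")
    case True
    then show ?thesis by (auto simp: length_pmf_def intro!: integrable_measure_pmf_finite)
  next
    case False
    then show ?thesis by (intro integrable_pmf_bounded[where B = B] step_op_bounded assms)
  qed
  show "integrable (length_pmf S t) (\<lambda>k. gibbs_sum S (\<lambda>I. f I * (step_op S A ^^ k) g I))"
    unfolding gibbs_sum_def using int by (intro Bochner_Integration.integrable_sum integrable_mult_right) auto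
  show "gibbs_sum S (\<lambda>I. f I * evolve S A t g I)
    = measure_pmf.expectation (length_pmf S t) (\<lambda>k. gibbs_sum S (\<lambda>I. f I * (step_op S A ^^ k) g I))"
    unfolding gibbs_sum_def evolve_eq[where f = g and B = B, OF assms]
    using int by (subst Bochner_Integration.integral_sum) (auto simp: mult.assoc[symmetric])
qed

lemma gibbs_sum_step_op:
  "gibbs_sum S (\<lambda>I. f I * step_op S A g I)
    = (\<Sum>x\<in>S. if x \<in> A then gibbs_sum S (\<lambda>I. f I * site_op x g I) else gibbs_sum S (\<lambda>I. f I * g I)) / real (card S)"
proof -
  have "gibbs_sum S (\<lambda>I. f I * step_op S A g I)
      = (\<Sum>I\<in>indep_sets S. \<Sum>x\<in>S. lam ^ card I * (f I * (if x \<in> A then site_op x g I else g I)) / real (card S))"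
    unfolding gibbs_sum_def step_op_def by (simp add: sum_divide_distrib sum_distrib_left)
  also have "\<dots> = (\<Sum>x\<in>S. (if x \<in> A then gibbs_sum S (\<lambda>I. f I * site_op x g I) else gibbs_sum S (\<lambda>I. f I * g I)) / real (card S))"
    unfolding gibbs_sum_def by (subst sum.swap) (intro sum.cong, auto simp: sum_divide_distrib)
  finally show ?thesis by (simp add: sum_divide_distrib)
qed

lemma gibbs_sum_commute: "gibbs_sum S (\<lambda>I. f I * g I) = gibbs_sum S (\<lambda>I. g I * f I)"
  by (simp add: mult.commute)

lemma gibbs_sum_step_op_swap:
  assumes "finite S"
  shows "gibbs_sum S (\<lambda>I. f I * step_op S A g I) = gibbs_sum S (\<lambda>I. step_op S A f I * g I)"
proof -
  have "gibbs_sum S (\<lambda>I. f I * site_op x g I) = gibbs_sum S (\<lambda>I. g I * site_op x f I)" if "x \<in> S" for x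
    unfolding gibbs_sum_site_op_swap[OF assms that, of f g] by (rule gibbs_sum_commute)
  then have "gibbs_sum S (\<lambda>I. f I * step_op S A g I) = gibbs_sum S (\<lambda>I. g I * step_op S A f I)"
    unfolding gibbs_sum_step_op gibbs_sum_commute[of S f g]
    by (intro arg_cong2[of _ _ _ _ "(/)"] sum.cong refl) simp
  also have "\<dots> = gibbs_sum S (\<lambda>I. step_op S A f I * g I)" by (rule gibbs_sum_commute)
  finally show ?thesis .
qed

lemma gibbs_sum_step_op_power_swap:
  assumes "finite S"
  shows "gibbs_sum S (\<lambda>I. f I * (step_op S A ^^ k) g I) = gibbs_sum S (\<lambda>I. (step_op S A ^^ k) f I * g I)"
proof (induction k arbitrary: f)
  case (Suc k)
  have "gibbs_sum S (\<lambda>I. f I * (step_op S A ^^ Suc k) g I) = gibbs_sum S (\<lambda>I. step_op S A f I * (step_op S A ^^ k) g I)"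
    by (simp add: gibbs_sum_step_op_swap[OF assms])
  also have "\<dots> = gibbs_sum S (\<lambda>I. (step_op S A ^^ k) (step_op S A f) I * g I)"
    by (rule Suc.IH)
  finally show ?case by (simp add: funpow_swap1)
qed simp

lemma evolve_reversible:
  assumes "finite S" "\<And>I. \<bar>f I\<bar> \<le> B" "\<And>I. \<bar>g I\<bar> \<le> B'"
  shows "gibbs_sum S (\<lambda>I. f I * evolve S A t g I) = gibbs_sum S (\<lambda>I. evolve S A t f I * g I)"
proof -
  have "gibbs_sum S (\<lambda>I. evolve S A t f I * g I) = gibbs_sum S (\<lambda>I. g I * evolve S A t f I)"
    by (rule gibbs_sum_commute)
  also have "\<dots> = measure_pmf.expectation (length_pmf S t) (\<lambda>k. gibbs_sum S (\<lambda>I. g I * (step_op S A ^^ k) f I))"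
    by (rule gibbs_sum_evolve(1)[where B = B, OF assms(1,2)])
  also have "\<dots> = measure_pmf.expectation (length_pmf S t) (\<lambda>k. gibbs_sum S (\<lambda>I. f I * (step_op S A ^^ k) g I))"
    unfolding gibbs_sum_step_op_power_swap[OF assms(1), of f] by (simp only: mult.commute)
  also have "\<dots> = gibbs_sum S (\<lambda>I. f I * evolve S A t g I)"
    by (rule gibbs_sum_evolve(1)[where B = B', OF assms(1,3), symmetric])
  finally show ?thesis by (rule sym)
qed

lemma evolve_const: "evolve S A t (\<lambda>_. c) I = c"
  by (simp add: evolve_def)

lemma gibbs_sum_evolve_invariant:
  assumes "finite S" "\<And>I. \<bar>g I\<bar> \<le> B"
  shows "gibbs_sum S (evolve S A t g) = gibbs_sum S g"
  using evolve_reversible[of S "\<lambda>_. 1" 1 g B A t] assms by (simp add: evolve_const)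

lemma increasing_step_op:
  assumes "increasing S f"
  shows "increasing S (step_op S A f)"
proof -
  have "(if x \<in> A then site_op x f I else f I) \<le> (if x \<in> A then site_op x f J else f J)"
    if "x \<in> S" "I \<in> indep_sets S" "J \<in> indep_sets S" "conf_le I J" for x I J
    using assms increasing_site_op[OF that(1) assms] that(2-4) by (simp add: increasing_def)
  then show ?thesis
    unfolding step_op_def increasing_def[of S "\<lambda>I. _ I / _"]
    by (intro ballI impI divide_right_mono sum_mono) simp_all
qed

lemma increasing_step_op_power: "increasing S f \<Longrightarrow> increasing S ((step_op S A ^^ k) f)"
  by (induction k) (auto intro: increasing_step_op)

lemma increasing_evolve:
  assumes "finite S" "\<And>I. \<bar>f I\<bar> \<le> B" "increasing S f" "0 \<le> t"
  shows "increasing S (evolve S A t f)"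
  unfolding increasing_def evolve_def
proof (intro ballI impI integral_mono_AE)
  fix I J assume IJ: "I \<in> indep_sets S" "J \<in> indep_sets S" "conf_le I J"
  show "AE l in updates S t. f (run (restr A l) I) \<le> f (run (restr A l) J)"
  proof (rule AE_pmfI)
    fix l assume "l \<in> set_pmf (updates S t)"
    then have "fst ` set l \<subseteq> S" using assms by (intro set_updates) auto
    then have "fst ` set (restr A l) \<subseteq> S" by (auto simp: restr_def)
    then show "f (run (restr A l) I) \<le> f (run (restr A l) J)"
      using assms(3) IJ run_indep_sets[of "restr A l" S I] run_indep_sets[of "restr A l" S J] run_mono[OF IJ(3)]
      by (simp add: increasing_def)
  qed
qed (rule integrable_pmf_bounded, rule assms)+

text \<open>The censoring inequality of Peres and Winkler, with \<open>f\<close> the initial density with respect to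
  the Gibbs measure.\<close>

lemma censoring_power:
  assumes "finite S" "increasing S f" "increasing S g"
  shows "gibbs_sum S (\<lambda>I. f I * (step_op S S ^^ k) g I) \<le> gibbs_sum S (\<lambda>I. f I * (step_op S A ^^ k) g I)"
  using assms(2)
proof (induction k arbitrary: f)
  case (Suc k)
  let ?G = "(step_op S A ^^ k) g"
  have inc: "increasing S ?G" by (rule increasing_step_op_power[OF assms(3)])
  \<comment> \<open>The site operator is moved onto \<open>f\<close>, which stays increasing, so
    that the induction hypothesis applies; then it is moved back. If \<open>x\<close> is censored,
    \<open>gibbs_sum_site_op_le\<close> removes it altogether.\<close>
  have site: "gibbs_sum S (\<lambda>I. f I * site_op x ((step_op S S ^^ k) g) I) \<le>
      (if x \<in> A then gibbs_sum S (\<lambda>I. f I * site_op x ?G I) else gibbs_sum S (\<lambda>I. f I * ?G I))"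
    if x: "x \<in> S" for x
  proof -
    have "gibbs_sum S (\<lambda>I. f I * site_op x ((step_op S S ^^ k) g) I)
        = gibbs_sum S (\<lambda>I. site_op x f I * (step_op S S ^^ k) g I)"
      by (rule gibbs_sum_site_op_swap[OF assms(1) x])
    also have "\<dots> \<le> gibbs_sum S (\<lambda>I. site_op x f I * ?G I)"
      by (intro Suc.IH increasing_site_op x Suc.prems)
    also have "\<dots> = gibbs_sum S (\<lambda>I. f I * site_op x ?G I)"
      by (rule gibbs_sum_site_op_swap[OF assms(1) x, symmetric])
    finally have 1: "gibbs_sum S (\<lambda>I. f I * site_op x ((step_op S S ^^ k) g) I) \<le> gibbs_sum S (\<lambda>I. f I * site_op x ?G I)" .
    with gibbs_sum_site_op_le[OF assms(1) x Suc.prems inc] show ?thesis by simp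
  qed
  show ?case
    unfolding funpow.simps comp_def gibbs_sum_step_op
    by (intro divide_right_mono sum_mono) (use site in simp_all)
qed simp

lemma censoring:
  assumes "finite S" "\<And>I. \<bar>g I\<bar> \<le> B" "increasing S f" "increasing S g"
  shows "gibbs_sum S (\<lambda>I. f I * evolve S S t g I) \<le> gibbs_sum S (\<lambda>I. f I * evolve S A t g I)"
proof -
  note E = gibbs_sum_evolve[where g = g and B = B, OF assms(1,2)]
  show ?thesis
    unfolding E(1) by (rule integral_mono[OF E(2) E(2) censoring_power[OF assms(1,3,4)]])
qed

end

section \<open>Coalescence of the dynamics\<close>

lemma expectation_of_bool: "measure_pmf.expectation M (\<lambda>x. of_bool (P x)) = measure_pmf.prob M {x. P x}"
proof -
  have "measure_pmf.expectation M (\<lambda>x. of_bool (P x) :: real) = measure_pmf.expectation M (indicator {x. P x})"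
    by (intro Bochner_Integration.integral_cong refl) (simp add: indicator_def)
  then show ?thesis by simp
qed

lemma run_empty_marks: "run (map (\<lambda>x. (x, False)) xs) I = I - set xs"
  by (induction xs arbitrary: I) (auto simp: upd_def)

lemma run_frozen:
  assumes "fst ` set l \<subseteq> B" "J \<subseteq> R" "F \<inter> B = {}" and R: "R = {w \<in> B. \<forall>y\<in>F. \<not> adjacent w y}"
  shows "run l (F \<union> J) = F \<union> run (restr R l) J"
  using assms(1,2)
proof (induction l arbitrary: J)
  case (Cons u l)
  have u: "fst u \<in> B" and l: "fst ` set l \<subseteq> B" using Cons.prems by auto
  have uF: "fst u \<notin> F" using u assms(3) by auto
  show ?case
  proof (cases "fst u \<in> R")
    case True
    then have "upd u (F \<union> J) = F \<union> upd u J" using uF R by (auto simp: upd_def)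
    moreover have "upd u J \<subseteq> R" using True Cons.prems by (auto simp: upd_def)
    ultimately show ?thesis using True Cons.IH[OF l, of "upd u J"] by simp
  next
    case False
    then have "\<exists>y\<in>F \<union> J. adjacent (fst u) y" using u R by auto
    moreover have "fst u \<notin> F \<union> J" using False uF Cons.prems by auto
    ultimately have "upd u (F \<union> J) = F \<union> J" by (auto simp: upd_def)
    then show ?thesis using False Cons.IH[OF l Cons.prems(2)] by simp
  qed
qed simp

text \<open>Updates in \<open>A - B\<close> change only spins there, and no site of \<open>B\<close>
  is adjacent to these. This is why the cells of a censored tiling evolve separately.\<close>

lemma run_local:
  assumes "B \<subseteq> A" and sep: "\<And>v w. v \<in> B \<Longrightarrow> w \<in> A - B \<Longrightarrow> \<not> adjacent v w"
    and "\<And>z. z \<notin> A - B \<Longrightarrow> z \<in> I \<longleftrightarrow> z \<in> J" and "z \<notin> A - B"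
  shows "z \<in> run (restr A l) I \<longleftrightarrow> z \<in> run (restr B l) J"
  using assms(3,4)
proof (induction l arbitrary: I J z)
  case (Cons u l)
  show ?case
  proof (cases "fst u \<in> B")
    case True
    have nb: "(\<forall>y\<in>I. \<not> adjacent (fst u) y) \<longleftrightarrow> (\<forall>y\<in>J. \<not> adjacent (fst u) y)"
      using Cons.prems(1) sep[OF True] by blast
    have eq: "z \<in> upd u I \<longleftrightarrow> z \<in> upd u J" if "z \<notin> A - B" for z
      using Cons.prems(1)[OF that] nb by (auto simp: upd_def)
    show ?thesis using True assms(1) Cons.IH[OF eq Cons.prems(2)] by auto
  next
    case False
    show ?thesis
    proof (cases "fst u \<in> A")
      case True
      have eq: "z \<in> upd u I \<longleftrightarrow> z \<in> J" if "z \<notin> A - B" for z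
      proof -
        have "z \<noteq> fst u" using that True False by auto
        then show ?thesis using Cons.prems(1)[OF that] by (simp add: upd_other)
      qed
      show ?thesis using True False Cons.IH[OF eq Cons.prems(2)] by simp
    next
      case notA: False
      show ?thesis using notA False Cons.IH[OF Cons.prems] by simp
    qed
  qed
qed simp

text \<open>The interiors of the cells of a cubic tiling with side \<open>m\<close>, shifted by
  \<open>j\<close> in every direction. The sites with some coordinate congruent to \<open>j\<close>
  form the walls; censoring removes their updates.\<close>

definition tile :: "nat \<Rightarrow> nat \<Rightarrow> 'd::finite site set" where
  "tile m j = {x. \<forall>i. x $ i mod int m \<noteq> int j}"

text \<open>The index of the cell of a site. Sites of \<open>tile m j\<close> in different cells are
  separated by a wall.\<close>

definition cell :: "nat \<Rightarrow> nat \<Rightarrow> 'd::finite site \<Rightarrow> 'd site" where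
  "cell m j x = (\<chi> i. (x $ i - int j) div int m)"

text \<open>If neighbouring integers have different quotients, the larger one is congruent to
  \<open>j\<close>, so the corresponding site lies on a wall.\<close>

lemma adjacent_cell_eq:
  assumes "j < m" "x \<in> tile m j" "y \<in> tile m j" "adjacent x y"
  shows "cell m j x = cell m j y"
proof -
  have step: "(a - int j) div int m \<le> (b - int j) div int m"
    if ab: "\<bar>a - b\<bar> \<le> 1" and a: "a mod int m \<noteq> int j" for a b :: int
  proof (rule ccontr)
    assume "\<not> ?thesis"
    then have lt: "(b - int j) div int m + 1 \<le> (a - int j) div int m" by simp
    have m: "0 < int m" using assms(1) by simp
    let ?q = "(a - int j) div int m"
    have 1: "?q * int m \<le> a - int j"
      using pos_mod_sign[OF m, of "a - int j"] div_mult_mod_eq[of "a - int j" "int m"] by linarith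
    have "b - int j < (b - int j) div int m * int m + int m"
      using pos_mod_bound[OF m, of "b - int j"] div_mult_mod_eq[of "b - int j" "int m"] by linarith
    also have "\<dots> = ((b - int j) div int m + 1) * int m" by (simp add: distrib_right)
    also have "\<dots> \<le> ?q * int m" using lt m by (intro mult_right_mono) auto
    finally have "b - int j < ?q * int m" .
    then have "a - int j = ?q * int m" using 1 ab by linarith
    then have "a = int j + ?q * int m" by simp
    then have "a mod int m = int j mod int m" by (metis mod_mult_self1)
    then show False using a assms(1) by simp
  qed
  have "\<bar>x $ i - y $ i\<bar> \<le> 1" for i
    using abs_component_le_ldist[of x i y] assms(4) by (simp add: adjacent_iff_ldist)
  then have "(x $ i - int j) div int m = (y $ i - int j) div int m" for i
    using step[of "x $ i" "y $ i"] step[of "y $ i" "x $ i"] assms(2,3)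
    by (intro antisym) (auto simp: tile_def abs_minus_commute)
  then show ?thesis by (simp add: cell_def)
qed

lemma card_cell:
  fixes A :: "'d::finite site set"
  assumes "0 < m"
  shows "card {w \<in> A. cell m j w = c} \<le> m ^ CARD('d)" and "finite {w \<in> A. cell m j w = c}"
proof -
  have sub: "{w \<in> A. cell m j w = c} \<subseteq> lattice_box (\<chi> i. c $ i * int m + int j) m"
  proof
    fix w assume "w \<in> {w \<in> A. cell m j w = c}"
    then have c: "c $ i = (w $ i - int j) div int m" for i by (auto simp: cell_def)
    have "c $ i * int m + int j \<le> w $ i \<and> w $ i < c $ i * int m + int j + int m" for i
      unfolding c using assms div_mult_mod_eq[of "w $ i - int j" "int m"]
        pos_mod_bound[of "int m" "w $ i - int j"] pos_mod_sign[of "int m" "w $ i - int j"] by linarith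
    then show "w \<in> lattice_box (\<chi> i. c $ i * int m + int j) m" by (simp add: lattice_box_def)
  qed
  show "finite {w \<in> A. cell m j w = c}"
    by (rule finite_subset[OF sub finite_card_lattice_box(1)])
  show "card {w \<in> A. cell m j w = c} \<le> m ^ CARD('d)"
    using card_mono[OF finite_card_lattice_box(1) sub] by (simp add: finite_card_lattice_box)
qed

text \<open>A site is on a wall only if the shift equals one of its \<open>d\<close> coordinates
  modulo \<open>m\<close>.\<close>

lemma card_tiles_missing:
  "card {j \<in> {..<m}. (y :: 'd::finite site) \<notin> tile m j} \<le> CARD('d)"
proof -
  have "{j \<in> {..<m}. y \<notin> tile m j} \<subseteq> (\<lambda>i. nat (y $ i mod int m)) ` UNIV"
  proof
    fix j assume "j \<in> {j \<in> {..<m}. y \<notin> tile m j}"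
    then obtain i where "y $ i mod int m = int j" by (auto simp: tile_def)
    then have "j = nat (y $ i mod int m)" by simp
    then show "j \<in> (\<lambda>i. nat (y $ i mod int m)) ` UNIV" by (rule image_eqI) simp
  qed
  then have "card {j \<in> {..<m}. y \<notin> tile m j} \<le> card ((\<lambda>i. nat (y $ i mod int m)) ` UNIV)"
    by (intro card_mono) auto
  also have "\<dots> \<le> CARD('d)" by (rule card_image_le) simp
  finally show ?thesis .
qed

text \<open>The l1 distance makes the summand a product over coordinates; each factor is a two-sided
  geometric series, bounded by \<open>2 / (1 - \<kappa>)\<close>.\<close>

lemma sum_power_ldist:
  fixes S :: "'d::finite site set" and \<kappa> :: real
  assumes "finite S" "0 \<le> \<kappa>" "\<kappa> < 1"
  shows "(\<Sum>z\<in>S. \<kappa> ^ ldist z y) \<le> (2 / (1 - \<kappa>)) ^ CARD('d)"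
proof -
  define r where "r = Max (insert 0 ((\<lambda>z. ldist z y) ` S))"
  have r: "ldist z y \<le> r" if "z \<in> S" for z using that assms(1) by (auto simp: r_def)
  let ?I = "\<lambda>i. {y $ i - int r..y $ i + int r}"
  have one: "(\<Sum>j\<in>?I i. \<kappa> ^ nat \<bar>j - y $ i\<bar>) \<le> 2 / (1 - \<kappa>)" for i
  proof -
    have sub: "?I i \<subseteq> (\<lambda>k. y $ i + int k) ` {..r} \<union> (\<lambda>k. y $ i - int k) ` {..r}"
    proof
      fix j assume j: "j \<in> ?I i"
      show "j \<in> (\<lambda>k. y $ i + int k) ` {..r} \<union> (\<lambda>k. y $ i - int k) ` {..r}"
      proof (cases "j \<ge> y $ i")
        case True
        then have "j = y $ i + int (nat (j - y $ i))" "nat (j - y $ i) \<in> {..r}" using j by auto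
        then show ?thesis by blast
      next
        case False
        then have "j = y $ i - int (nat (y $ i - j))" "nat (y $ i - j) \<in> {..r}" using j by auto
        then show ?thesis by blast
      qed
    qed
    have geo: "(\<Sum>k\<le>r. \<kappa> ^ k) \<le> 1 / (1 - \<kappa>)"
    proof -
      have "(\<Sum>k\<le>r. \<kappa> ^ k) = (1 - \<kappa> ^ Suc r) / (1 - \<kappa>)" using assms by (simp add: sum_gp0)
      also have "\<dots> \<le> 1 / (1 - \<kappa>)" using assms by (intro divide_right_mono) auto
      finally show ?thesis .
    qed
    have "(\<Sum>j\<in>?I i. \<kappa> ^ nat \<bar>j - y $ i\<bar>)
        \<le> (\<Sum>j\<in>(\<lambda>k. y $ i + int k) ` {..r} \<union> (\<lambda>k. y $ i - int k) ` {..r}. \<kappa> ^ nat \<bar>j - y $ i\<bar>)"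
      using sub assms by (intro sum_mono2) auto
    also have "\<dots> \<le> (\<Sum>j\<in>(\<lambda>k. y $ i + int k) ` {..r}. \<kappa> ^ nat \<bar>j - y $ i\<bar>) + (\<Sum>j\<in>(\<lambda>k. y $ i - int k) ` {..r}. \<kappa> ^ nat \<bar>j - y $ i\<bar>)"
    proof -
      let ?f = "\<lambda>j. \<kappa> ^ nat \<bar>j - y $ i\<bar>"
      let ?A = "(\<lambda>k. y $ i + int k) ` {..r}" and ?B = "(\<lambda>k. y $ i - int k) ` {..r}"
      have "sum ?f (?A \<union> ?B) + sum ?f (?A \<inter> ?B) = sum ?f ?A + sum ?f ?B"
        by (rule sum.union_inter) auto
      moreover have "0 \<le> sum ?f (?A \<inter> ?B)" using assms by (intro sum_nonneg) auto
      ultimately show ?thesis by linarith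
    qed
    also have "\<dots> = (\<Sum>k\<le>r. \<kappa> ^ k) + (\<Sum>k\<le>r. \<kappa> ^ k)"
      by (intro arg_cong2[of _ _ _ _ "(+)"]; subst sum.reindex) (auto simp: inj_on_def)
    also have "\<dots> \<le> 2 / (1 - \<kappa>)" using geo by simp
    finally show ?thesis .
  qed
  have ldist_nat: "ldist z y = (\<Sum>i\<in>UNIV. nat \<bar>z $ i - y $ i\<bar>)" for z
  proof -
    have "int (ldist z y) = int (\<Sum>i\<in>UNIV. nat \<bar>z $ i - y $ i\<bar>)" by (simp add: int_ldist)
    then show ?thesis by (simp only: of_nat_eq_iff)
  qed
  have "(\<Sum>f\<in>vec_nth ` S. \<Prod>i\<in>UNIV. \<kappa> ^ nat \<bar>f i - y $ i\<bar>)
      = (\<Sum>z\<in>S. \<Prod>i\<in>UNIV. \<kappa> ^ nat \<bar>z $ i - y $ i\<bar>)"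
    by (subst sum.reindex) (auto simp: inj_on_def vec_eq_iff)
  then have "(\<Sum>z\<in>S. \<kappa> ^ ldist z y) = (\<Sum>f\<in>vec_nth ` S. \<Prod>i\<in>UNIV. \<kappa> ^ nat \<bar>f i - y $ i\<bar>)"
    by (simp add: ldist_nat power_sum)
  also have "\<dots> \<le> (\<Sum>f\<in>PiE UNIV ?I. \<Prod>i\<in>UNIV. \<kappa> ^ nat \<bar>f i - y $ i\<bar>)"
  proof (rule sum_mono2)
    show "vec_nth ` S \<subseteq> PiE UNIV ?I"
    proof
      fix f assume "f \<in> vec_nth ` S"
      then obtain z where z: "z \<in> S" "f = vec_nth z" by blast
      have "\<bar>z $ i - y $ i\<bar> \<le> int r" for i using r[OF z(1)] abs_component_le_ldist[of z i y] by simp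
      then have "f i \<in> ?I i" for i using z(2) by (simp add: abs_le_iff) (smt (verit))
      then show "f \<in> PiE UNIV ?I" by (simp add: PiE_iff)
    qed
  qed (use assms in \<open>auto intro!: finite_PiE prod_nonneg\<close>)
  also have "\<dots> = (\<Prod>i\<in>UNIV. \<Sum>j\<in>?I i. \<kappa> ^ nat \<bar>j - y $ i\<bar>)"
    by (rule prod_sum_PiE[symmetric]) auto
  also have "\<dots> \<le> (\<Prod>i\<in>(UNIV :: 'd set). 2 / (1 - \<kappa>))"
    using one assms by (intro prod_mono) (auto intro!: sum_nonneg)
  finally show ?thesis by simp
qed

section \<open>Equilibration inside a single cell\<close>

context hardcore
begin

text \<open>The probability that in unit time the clocks of \<open>M\<close> sites ring exactly once
  each, in a prescribed order, with all marks \<open>False\<close>. This empties the region. The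
  value decreases in \<open>M\<close>, so it also bounds from below the chance for smaller
  regions.\<close>

definition kill_prob :: "nat \<Rightarrow> real" where
  "kill_prob M = exp (- real M) * mark_weight False ^ M / fact M"

lemma kill_prob_bounds: "0 < kill_prob M" "kill_prob M \<le> 1"
proof -
  show "0 < kill_prob M" using mark_weight_pos by (simp add: kill_prob_def)
  have "mark_weight False ^ M \<le> 1" using lam_pos by (intro power_le_one) (auto simp: mark_weight_def)
  then have "exp (- real M) * mark_weight False ^ M \<le> 1 * 1" by (intro mult_mono) auto
  also have "1 * 1 \<le> (fact M :: real)" by simp
  finally show "kill_prob M \<le> 1" by (simp add: kill_prob_def divide_le_eq_1)
qed

lemma prob_kill:
  fixes R :: "'d::finite site set"
  assumes "finite R" "card R \<le> M"
  shows "kill_prob M \<le> measure_pmf.prob (updates R 1) {l. \<forall>I. I \<subseteq> R \<longrightarrow> run l I = {}}"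
proof -
  obtain xs where xs: "set xs = R" "distinct xs" using finite_distinct_list[OF assms(1)] by blast
  let ?l = "map (\<lambda>x. (x, False)) xs"
  have len: "length xs = card R" using xs distinct_card by fastforce
  have "kill_prob M \<le> exp (- real (card R)) * mark_weight False ^ card R / fact (card R)"
    unfolding kill_prob_def
  proof (intro frac_le mult_mono)
    show "mark_weight False ^ M \<le> mark_weight False ^ card R"
      using assms(2) lam_pos by (intro power_decreasing) (auto simp: mark_weight_def)
    show "(fact (card R) :: real) \<le> fact M" using assms(2) by (rule fact_mono)
  qed (use assms in auto)
  also have "\<dots> = pmf (updates R 1) ?l"
  proof -
    have "prod_list (map (\<lambda>u. mark_weight (snd u)) (map (\<lambda>x :: 'd site. (x, False)) ys)) = mark_weight False ^ length ys" for ys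
      by (induction ys) auto
    moreover have "fst ` set ?l \<subseteq> R" using xs by auto
    ultimately show ?thesis
      unfolding pmf_updates[OF assms(1) zero_le_one] len[symmetric] by simp
  qed
  also have "\<dots> = measure_pmf.prob (updates R 1) {?l}" by (simp add: pmf.rep_eq)
  also have "\<dots> \<le> measure_pmf.prob (updates R 1) {l. \<forall>I. I \<subseteq> R \<longrightarrow> run l I = {}}"
    using xs by (intro measure_pmf.finite_measure_mono) (auto simp: run_empty_marks)
  finally show ?thesis .
qed

text \<open>Each unit of time has an independent chance of emptying the region, after which the
  initial configuration no longer matters.\<close>

lemma prob_not_forgetting:
  assumes "finite R" "card R \<le> M"
  shows "measure_pmf.prob (updates R (real k)) {l. \<exists>I\<in>indep_sets R. \<exists>J\<in>indep_sets R. run l I \<noteq> run l J}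
    \<le> (1 - kill_prob M) ^ k"
proof (induction k)
  case (Suc k)
  let ?N = "{l. \<exists>I\<in>indep_sets R. \<exists>J\<in>indep_sets R. run l I \<noteq> run l J}"
  let ?K = "{l. \<forall>I. I \<subseteq> R \<longrightarrow> run l I = {}}"
  have "updates R (real (Suc k)) = map_pmf (\<lambda>(a, b). a @ b) (pair_pmf (updates R (real k)) (updates R 1))"
    using updates_append[of R "real k" 1] assms by (simp add: add.commute)
  then have "measure_pmf.prob (updates R (real (Suc k))) ?N
      = measure_pmf.prob (pair_pmf (updates R (real k)) (updates R 1)) ((\<lambda>(a, b). a @ b) -` ?N)"
    by simp
  also have "\<dots> \<le> measure_pmf.prob (pair_pmf (updates R (real k)) (updates R 1)) (?N \<times> - ?K)"
  proof (rule measure_pmf.finite_measure_mono_AE)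
    show "AE p in pair_pmf (updates R (real k)) (updates R 1). p \<in> (\<lambda>(a, b). a @ b) -` ?N \<longrightarrow> p \<in> ?N \<times> - ?K"
    proof (intro AE_pmfI impI)
      fix p assume p: "p \<in> set_pmf (pair_pmf (updates R (real k)) (updates R 1))" "p \<in> (\<lambda>(a, b). a @ b) -` ?N"
      obtain a b where ab: "p = (a, b)" by (cases p)
      have a: "fst ` set a \<subseteq> R" using p set_updates[of R "real k" a] assms by (simp add: ab)
      obtain I J where IJ: "I \<in> indep_sets R" "J \<in> indep_sets R" "run b (run a I) \<noteq> run b (run a J)"
        using p(2) by (auto simp: ab run_append)
      have "run a I \<subseteq> R" "run a J \<subseteq> R"
        using run_indep_sets[OF a IJ(1)] run_indep_sets[OF a IJ(2)] by (auto simp: indep_sets_def)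
      then have "b \<notin> ?K" using IJ(3) by fastforce
      moreover have "run a I \<noteq> run a J" using IJ(3) by metis
      then have "a \<in> ?N" using IJ(1,2) by blast
      ultimately show "p \<in> ?N \<times> - ?K" by (simp add: ab)
    qed
  qed simp
  also have "\<dots> = measure_pmf.prob (updates R (real k)) ?N * measure_pmf.prob (updates R 1) (- ?K)"
    by (rule measure_pmf_prob_product) auto
  also have "\<dots> \<le> (1 - kill_prob M) ^ k * (1 - kill_prob M)"
  proof (rule mult_mono)
    show "measure_pmf.prob (updates R 1) (- ?K) \<le> 1 - kill_prob M"
      using prob_kill[OF assms] measure_pmf.prob_compl[of ?K "updates R 1"] by (simp add: Compl_eq_Diff_UNIV)
  qed (use Suc.IH kill_prob_bounds[of M] in auto)
  finally show ?case by (simp add: mult.commute)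
qed simp

definition site_prob :: "'d::finite site set \<Rightarrow> 'd site set \<Rightarrow> real \<Rightarrow> 'd site set \<Rightarrow> 'd site \<Rightarrow> real" where
  "site_prob S A t I z = measure_pmf.prob (updates S t) {l. z \<in> run (restr A l) I}"

lemma site_prob_eq_evolve: "site_prob S A t I z = evolve S A t (\<lambda>I. of_bool (z \<in> I)) I"
  by (simp add: site_prob_def evolve_def expectation_of_bool)

lemma gibbs_sum_of_bool: "finite S \<Longrightarrow> gibbs_sum S (\<lambda>I. of_bool (z \<in> I)) = Zpart S * occ S z"
proof -
  assume S: "finite S"
  have "gibbs_sum S (\<lambda>I. of_bool (z \<in> I)) = (\<Sum>I\<in>indep_sets S. if z \<in> I then lam ^ card I else 0)"
    unfolding gibbs_sum_def by (intro sum.cong) auto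
  also have "\<dots> = (\<Sum>I | I \<in> indep_sets S \<and> z \<in> I. lam ^ card I)"
    using S by (simp add: sum.inter_filter)
  also have "\<dots> = Zpart S * occ S z" using Zpart_pos[OF S] by (simp add: occ_def)
  finally show ?thesis .
qed

lemma gibbs_sum_const: "gibbs_sum S (\<lambda>_. c) = Zpart S * c"
  by (simp add: gibbs_sum_def Zpart_def sum_distrib_right)

lemma occ_bounds: "finite S \<Longrightarrow> 0 \<le> occ S v" "finite S \<Longrightarrow> occ S v \<le> 1"
proof -
  assume S: "finite S"
  have "gibbs_sum S (\<lambda>I. of_bool (v \<in> I)) \<le> gibbs_sum S (\<lambda>_. 1)" "gibbs_sum S (\<lambda>_. 0) \<le> gibbs_sum S (\<lambda>I. of_bool (v \<in> I))"
    by (intro gibbs_sum_mono; simp)+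
  then show "0 \<le> occ S v" "occ S v \<le> 1"
    unfolding gibbs_sum_of_bool[OF S] gibbs_sum_const using Zpart_pos[OF S] by (simp_all add: zero_le_mult_iff)
qed

text \<open>By invariance \<open>occ R z\<close> is the Gibbs average of \<open>site_prob\<close>
  over initial configurations, and forgetting puts all values of \<open>site_prob\<close> within
  \<open>(1 - kill_prob M) ^ k\<close> of each other.\<close>

lemma site_prob_equilibrium:
  assumes "finite R" "card R \<le> M" "I \<in> indep_sets R"
  shows "\<bar>site_prob R R (real k) I z - occ R z\<bar> \<le> (1 - kill_prob M) ^ k"
proof -
  let ?P = "\<lambda>I. site_prob R R (real k) I z" and ?\<delta> = "(1 - kill_prob M) ^ k"
  let ?U = "updates R (real k)"
  have close: "?P J \<le> ?P J' + ?\<delta>" if J: "J \<in> indep_sets R" "J' \<in> indep_sets R" for J J'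
  proof -
    have "?P J \<le> measure_pmf.prob ?U ({l. z \<in> run (restr R l) J'} \<union> {l. \<exists>I\<in>indep_sets R. \<exists>J\<in>indep_sets R. run l I \<noteq> run l J})"
      unfolding site_prob_def
    proof (rule measure_pmf.finite_measure_mono_AE, intro AE_pmfI impI)
      fix l assume "l \<in> set_pmf ?U" "l \<in> {l. z \<in> run (restr R l) J}"
      moreover from this have "restr R l = l" using assms(1) by (intro restr_id set_updates) auto
      ultimately show "l \<in> {l. z \<in> run (restr R l) J'} \<union> {l. \<exists>I\<in>indep_sets R. \<exists>J\<in>indep_sets R. run l I \<noteq> run l J}"
        using J by auto
    qed simp
    also have "\<dots> \<le> ?P J' + measure_pmf.prob ?U {l. \<exists>I\<in>indep_sets R. \<exists>J\<in>indep_sets R. run l I \<noteq> run l J}"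
      unfolding site_prob_def by (rule measure_Un_le) auto
    also have "\<dots> \<le> ?P J' + ?\<delta>" using prob_not_forgetting[OF assms(1,2)] by simp
    finally show ?thesis .
  qed
  have "gibbs_sum R (evolve R R (real k) (\<lambda>I. of_bool (z \<in> I))) = gibbs_sum R (\<lambda>I. of_bool (z \<in> I))"
    by (rule gibbs_sum_evolve_invariant[where B = 1]) (use assms in auto)
  then have inv: "gibbs_sum R ?P = Zpart R * occ R z"
    unfolding gibbs_sum_of_bool[OF assms(1)] site_prob_eq_evolve[symmetric] .
  have "gibbs_sum R (\<lambda>_. ?P I - ?\<delta>) \<le> gibbs_sum R ?P" "gibbs_sum R ?P \<le> gibbs_sum R (\<lambda>_. ?P I + ?\<delta>)"
    using close[OF assms(3)] close[OF _ assms(3)] by (intro gibbs_sum_mono; force simp: diff_le_eq)+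
  then have "?P I - ?\<delta> \<le> occ R z" "occ R z \<le> ?P I + ?\<delta>"
    unfolding inv gibbs_sum_const using Zpart_pos[OF assms(1)] by simp_all
  then show ?thesis by linarith
qed

text \<open>Inside a cell the rest of the configuration matters only through the sites it blocks, so
  the censored dynamics becomes free dynamics on the unblocked part \<open>R\<close>, a region to
  which decay of correlations applies.\<close>

lemma site_prob_block:
  fixes B :: "'d::finite site set"
  assumes "finite S" "B \<subseteq> A" "A \<subseteq> S" "z \<in> B" "0 \<le> t" and sep: "\<And>v w. v \<in> B \<Longrightarrow> w \<in> A - B \<Longrightarrow> \<not> adjacent v w"
    and R: "R = {w \<in> B. \<forall>y\<in>I - B. \<not> adjacent w y}" and I: "I \<in> indep_sets S"
  shows "site_prob S A t I z = site_prob R R t (I \<inter> R) z"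
proof -
  have RB: "R \<subseteq> B" "R \<subseteq> S" using R assms by auto
  have IR: "I \<inter> B \<subseteq> R" using I R by (auto simp: indep_sets_def)
  have "z \<in> run (restr A l) I \<longleftrightarrow> z \<in> run (restr R (restr R l)) (I \<inter> R)" for l
  proof -
    have "z \<in> run (restr A l) I \<longleftrightarrow> z \<in> run (restr B l) I"
      by (rule run_local[OF assms(2) sep]) (use assms(4) in auto)
    also have "run (restr B l) I = run (restr B l) ((I - B) \<union> (I \<inter> R))"
    proof -
      have "I = (I - B) \<union> (I \<inter> R)" using IR RB by auto
      then show ?thesis by simp
    qed
    also have "\<dots> = (I - B) \<union> run (restr R (restr B l)) (I \<inter> R)"
      by (rule run_frozen[OF fst_set_restr _ _ R]) auto
    also have "restr R (restr B l) = restr R (restr R l)" using RB by (simp add: restr_restr Int_absorb2)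
    finally show ?thesis using assms(4) by auto
  qed
  then have "site_prob S A t I z = measure_pmf.prob (map_pmf (restr R) (updates S t)) {l. z \<in> run (restr R l) (I \<inter> R)}"
    by (simp add: site_prob_def vimage_def)
  then show ?thesis using updates_restr[OF assms(1) RB(2) assms(5)] by (simp add: site_prob_def)
qed

end

definition site_sign :: "'d::finite site \<Rightarrow> real" where
  "site_sign z = (if even_site z then 1 else -1)"

text \<open>For comparable configurations the difference of heights counts the sites of
  \<open>S\<close> where they disagree. It turns the disagreements of the two extreme runs into
  expectations of one increasing function.\<close>

definition height :: "'d::finite site set \<Rightarrow> 'd site set \<Rightarrow> real" where
  "height S I = (\<Sum>z\<in>S. site_sign z * of_bool (z \<in> I))"

lemma abs_site_sign [simp]: "\<bar>site_sign z\<bar> = 1"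
  by (simp add: site_sign_def)

lemma abs_height_le: "\<bar>height S I\<bar> \<le> real (card S)"
proof -
  have "\<bar>height S I\<bar> \<le> (\<Sum>z\<in>S. \<bar>site_sign z * of_bool (z \<in> I)\<bar>)" unfolding height_def by (rule sum_abs)
  also have "\<dots> \<le> (\<Sum>z\<in>S. 1)" by (intro sum_mono) (simp add: abs_mult)
  finally show ?thesis by simp
qed

lemma site_sign_of_bool_mono: "conf_le I J \<Longrightarrow> site_sign z * of_bool (z \<in> I) \<le> site_sign z * of_bool (z \<in> J)"
  unfolding conf_le_def site_sign_def by (cases "even_site z") (auto dest: spec[of _ z])

lemma height_mono: "conf_le I J \<Longrightarrow> height S I \<le> height S J"
  unfolding height_def by (intro sum_mono site_sign_of_bool_mono)

lemma height_diff_ge_1: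
  assumes "finite S" "conf_le I J" "I \<subseteq> S" "J \<subseteq> S" "I \<noteq> J"
  shows "1 \<le> height S J - height S I"
proof -
  obtain z where z: "z \<in> S" "(z \<in> I) \<noteq> (z \<in> J)" using assms by blast
  have d: "height S J - height S I = (\<Sum>z\<in>S. site_sign z * of_bool (z \<in> J) - site_sign z * of_bool (z \<in> I))"
    by (simp add: height_def sum_subtractf)
  have "site_sign z * of_bool (z \<in> J) - site_sign z * of_bool (z \<in> I) \<ge> 1"
    using site_sign_of_bool_mono[OF assms(2), of z] z(2) by (auto simp: site_sign_def split: if_splits)
  also have "site_sign z * of_bool (z \<in> J) - site_sign z * of_bool (z \<in> I) \<le> height S J - height S I"
    unfolding d using z(1) assms(1) site_sign_of_bool_mono[OF assms(2)]
    by (intro member_le_sum) auto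
  finally show ?thesis .
qed

text \<open>Any two comparable configurations are joined by increasing single flips: the odd sites
  of \<open>I - J\<close> are removed first, then the even sites of \<open>J - I\<close> are added.
  In this order every intermediate set is independent, because the odd neighbours of an added site
  are already those of \<open>J\<close>.\<close>

lemma increasing_by_single_flips:
  assumes "finite S"
    and flip: "\<And>I J y. I \<in> indep_sets S \<Longrightarrow> J \<in> indep_sets S \<Longrightarrow> conf_le I J \<Longrightarrow> y \<in> S \<Longrightarrow>
      (\<And>z. z \<noteq> y \<Longrightarrow> z \<in> I \<longleftrightarrow> z \<in> J) \<Longrightarrow> (y \<in> I) \<noteq> (y \<in> J) \<Longrightarrow> f I \<le> f J"
  shows "increasing S f"
  unfolding increasing_def
proof (intro ballI impI)
  fix I J assume "I \<in> indep_sets S" "J \<in> indep_sets S" "conf_le I J"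
  then show "f I \<le> f J"
  proof (induction "card ((I - J) \<union> (J - I))" arbitrary: I rule: less_induct)
    case less
    have sub: "I \<subseteq> S" "J \<subseteq> S" using less.prems by (auto simp: indep_sets_def)
    have fin: "finite ((I - J) \<union> (J - I))" using sub assms(1) by (auto intro: finite_subset)
    show ?case
    proof (cases "I = J")
      case False
      obtain I' y where I': "I' \<in> indep_sets S" "conf_le I I'" "conf_le I' J" "y \<in> S"
        "\<And>z. z \<noteq> y \<Longrightarrow> z \<in> I \<longleftrightarrow> z \<in> I'" "(y \<in> I) \<noteq> (y \<in> I')" "(y \<in> I) \<noteq> (y \<in> J)" "y \<in> I' \<longleftrightarrow> y \<in> J"
      proof (cases "\<exists>y. \<not> even_site y \<and> y \<in> I - J")
        case True
        then obtain y where y: "\<not> even_site y" "y \<in> I" "y \<notin> J" by blast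
        have "I - {y} \<in> indep_sets S" using less.prems by (auto simp: indep_sets_def)
        moreover have "conf_le I (I - {y})" using y by (auto simp: conf_le_def)
        moreover have "conf_le (I - {y}) J" using y less.prems(3) by (auto simp: conf_le_def)
        ultimately show thesis using y sub by (intro that[of "I - {y}" y]) auto
      next
        case noodd: False
        have odd: "z \<in> I \<longleftrightarrow> z \<in> J" if "\<not> even_site z" for z
          using noodd that less.prems(3) unfolding conf_le_def by auto
        have even: "z \<in> I \<Longrightarrow> z \<in> J" if "even_site z" for z
          using that less.prems(3) unfolding conf_le_def by auto
        obtain y where y: "y \<in> J" "y \<notin> I" using False odd even by blast
        have ey: "even_site y" using odd[of y] y by auto
        have nadj: "\<not> adjacent y z" "\<not> adjacent z y" if "z \<in> I" for z
        proof -
          have "\<not> adjacent y z"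
          proof
            assume "adjacent y z"
            then have "\<not> even_site z" using ey adjacent_even_site[of y z] by simp
            then have "z \<in> J" using odd that by simp
            then show False using \<open>adjacent y z\<close> y less.prems(2) by (auto simp: indep_sets_def)
          qed
          then show "\<not> adjacent y z" "\<not> adjacent z y" by (auto simp: adjacent_commute)
        qed
        have "insert y I \<in> indep_sets S"
          using less.prems(1) nadj y sub by (auto simp: indep_sets_def)
        moreover have "conf_le I (insert y I)" using ey by (auto simp: conf_le_def)
        moreover have "conf_le (insert y I) J" using y ey less.prems(3) by (auto simp: conf_le_def)
        ultimately show thesis using y sub by (intro that[of "insert y I" y]) auto
      qed
      have "z \<in> (I' - J) \<union> (J - I') \<longleftrightarrow> z \<in> (I - J) \<union> (J - I) - {y}" for z
        using I'(5)[of z] I'(8) by (cases "z = y") auto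
      then have "(I' - J) \<union> (J - I') = (I - J) \<union> (J - I) - {y}" by (rule set_eqI)
      moreover have "y \<in> (I - J) \<union> (J - I)" using I'(7) by blast
      ultimately have "card ((I' - J) \<union> (J - I')) < card ((I - J) \<union> (J - I))"
        using fin by (metis card_Diff1_less)
      then have "f I' \<le> f J" using less.hyps I'(1,3) less.prems(2) by blast
      moreover have "f I \<le> f I'" by (rule flip[OF less.prems(1) I'(1,2,4,5,6)])
      ultimately show ?thesis by simp
    qed simp
  qed
qed

section \<open>Contraction of the height and coalescence\<close>

context hardcore
begin

lemma evolve_height:
  assumes "finite S"
  shows "evolve S A t (height S) I = (\<Sum>z\<in>S. site_sign z * site_prob S A t I z)"
proof -
  have "evolve S A t (height S) I = (\<Sum>z\<in>S. measure_pmf.expectation (updates S t) (\<lambda>l. site_sign z * of_bool (z \<in> run (restr A l) I)))"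
    unfolding evolve_def height_def
    by (intro Bochner_Integration.integral_sum integrable_pmf_bounded[where B = 1]) (simp add: abs_mult)
  also have "\<dots> = (\<Sum>z\<in>S. site_sign z * site_prob S A t I z)"
    by (simp add: site_prob_def expectation_of_bool)
  finally show ?thesis .
qed

lemma evolve_add:
  assumes "finite S" "0 \<le> s" "0 \<le> t" "\<And>I. \<bar>g I\<bar> \<le> B"
  shows "evolve S S (s + t) g I = evolve S S s (evolve S S t g) I"
proof -
  have "evolve S S (s + t) g I = measure_pmf.expectation (pair_pmf (updates S s) (updates S t)) (\<lambda>(a, b). g (run (restr S b) (run (restr S a) I)))"
    unfolding evolve_def updates_append[OF assms(1-3), symmetric]
    by (simp add: case_prod_unfold restr_append run_append)
  also have "\<dots> = measure_pmf.expectation (updates S s) (\<lambda>a. measure_pmf.expectation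
      (map_pmf (Pair a) (updates S t)) (\<lambda>(a, b). g (run (restr S b) (run (restr S a) I))))"
    unfolding pair_pmf_def map_pmf_def[symmetric]
    by (rule expectation_bind_pmf[where B = B]) (use assms in auto)
  finally show ?thesis by (simp add: evolve_def)
qed

lemma abs_evolve_le: "(\<And>I. \<bar>g I\<bar> \<le> B) \<Longrightarrow> \<bar>evolve S A t g I\<bar> \<le> B"
  unfolding evolve_def by (rule abs_expectation_le)

text \<open>A disagreement at \<open>y\<close> disappears, up to \<open>2 \<delta>\<close> per site, if \<open>y\<close> lies inside a cell of the
  tiling, and creates a bounded number of disagreements if it lies on the boundary of a cell.\<close>

lemma single_flip_influence:
  fixes S :: "'d::finite site set" and m j k :: nat
  defines "A \<equiv> S \<inter> tile m j" and "\<delta> \<equiv> (1 - kill_prob (m ^ CARD('d))) ^ k"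
  assumes S: "finite S" and jm: "j < m" and y: "y \<in> S"
    and IJ: "I \<in> indep_sets S" "J \<in> indep_sets S" and eq: "\<And>z. z \<noteq> y \<Longrightarrow> z \<in> I \<longleftrightarrow> z \<in> J"
    and \<kappa>: "0 < \<kappa>" "\<kappa> < 1" "1 \<le> C"
    and decay: "\<And>(T :: 'd site set) T' v r. finite T \<Longrightarrow> finite T' \<Longrightarrow> T \<inter> lball v r = T' \<inter> lball v r \<Longrightarrow>
      \<bar>occ T v - occ T' v\<bar> \<le> C * \<kappa> ^ r"
  shows "y \<in> tile m j \<Longrightarrow> (\<Sum>z\<in>S. \<bar>site_prob S A (real k) I z - site_prob S A (real k) J z\<bar>) \<le> 2 * \<delta> * real m ^ CARD('d)"
    and "y \<notin> tile m j \<Longrightarrow> (\<Sum>z\<in>S. \<bar>site_prob S A (real k) I z - site_prob S A (real k) J z\<bar>)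
      \<le> 1 + 4 * real CARD('d) * \<delta> * real m ^ CARD('d) + C * ((2 / (1 - \<kappa>)) ^ CARD('d) / \<kappa>\<^sup>2)"
proof -
  define q where "q K z = site_prob S A (real k) K z" for K z
  define Bl where "Bl z = {w \<in> A. cell m j w = cell m j z}" for z
  \<comment> \<open>The sites of the cell of \<open>z\<close> that the configuration outside the
    cell does not block. The cell evolves as the free model on this region.\<close>
  define Rg where "Rg K z = {w \<in> Bl z. \<forall>u\<in>K - Bl z. \<not> adjacent w u}" for K z
  have m0: "0 < m" using jm by simp
  have AS: "A \<subseteq> S" by (simp add: A_def)
  have BlA: "Bl z \<subseteq> A" for z by (auto simp: Bl_def)
  have finBl: "finite (Bl z)" for z unfolding Bl_def by (rule card_cell(2)[OF m0])
  have cardBl: "card (Bl z) \<le> m ^ CARD('d)" for z unfolding Bl_def by (rule card_cell(1)[OF m0])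
  have RgBl: "Rg K z \<subseteq> Bl z" for K z by (auto simp: Rg_def)
  have finRg: "finite (Rg K z)" for K z using RgBl finBl by (rule finite_subset)
  have cardRg: "card (Rg K z) \<le> m ^ CARD('d)" for K z
    using card_mono[OF finBl RgBl[of K z]] cardBl[of z] by linarith
  have sep: "\<not> adjacent v w" if "v \<in> Bl z" "w \<in> A - Bl z" for v w z
  proof
    assume "adjacent v w"
    then have "cell m j v = cell m j w" using that BlA by (intro adjacent_cell_eq[OF jm]) (auto simp: A_def Bl_def)
    then show False using that by (auto simp: Bl_def)
  qed
  have q_block: "q K z = site_prob (Rg K z) (Rg K z) (real k) (K \<inter> Rg K z) z" if "z \<in> A" "K \<in> indep_sets S" for K z
    unfolding q_def
    by (rule site_prob_block[OF S BlA[of z] AS _ _ sep _ that(2)]) (use that(1) in \<open>auto simp: Bl_def Rg_def\<close>)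
  have q_eq: "\<bar>q K z - occ (Rg K z) z\<bar> \<le> \<delta>" if "z \<in> A" "K \<in> indep_sets S" for K z
    unfolding q_block[OF that] \<delta>_def using that(2)
    by (intro site_prob_equilibrium finRg cardRg) (auto simp: indep_sets_def)
  have q_outside: "q K z = of_bool (z \<in> K)" if "z \<notin> A" for K z
  proof -
    have "z \<in> run (restr A l) K \<longleftrightarrow> z \<in> K" for l
      using fst_set_restr[of A l] that by (intro run_other) auto
    then show ?thesis by (simp add: q_def site_prob_def)
  qed
  have zero: "q I z = q J z" if z: "z \<in> A" "y \<notin> Bl z" "\<And>w. w \<in> Bl z \<Longrightarrow> \<not> adjacent w y" for z
  proof -
    have "Rg I z = Rg J z" unfolding Rg_def using eq z(3) by (intro Collect_cong conj_cong refl) (metis DiffD1 DiffD2 DiffI)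
    moreover have "x \<in> I \<longleftrightarrow> x \<in> J" if "x \<in> Rg J z" for x
      using that z(2) RgBl[of J z] by (intro eq) auto
    then have "I \<inter> Rg J z = J \<inter> Rg J z" by blast
    ultimately show ?thesis by (simp add: q_block z(1) IJ)
  qed
  have inside: "\<bar>q I z - q J z\<bar> \<le> 2 * \<delta>" if z: "z \<in> A" "y \<in> Bl z" for z
  proof -
    have "x \<in> I \<longleftrightarrow> x \<in> J" if "x \<notin> Bl z" for x using that z(2) by (intro eq) auto
    then have "I - Bl z = J - Bl z" by blast
    then have "Rg I z = Rg J z" by (simp add: Rg_def)
    then show ?thesis using q_eq[OF z(1) IJ(1)] q_eq[OF z(1) IJ(2)] by auto
  qed
  have general: "\<bar>q I z - q J z\<bar> \<le> 2 * \<delta> + C * (\<kappa> ^ ldist z y / \<kappa>\<^sup>2)" if z: "z \<in> A" for z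
  proof -
    have "\<bar>occ (Rg I z) z - occ (Rg J z) z\<bar> \<le> C * (\<kappa> ^ ldist z y / \<kappa>\<^sup>2)"
    proof (cases "2 \<le> ldist z y")
      case True
      \<comment> \<open>The two regions differ only at neighbours of \<open>y\<close>, all at
        distance at least \<open>ldist z y - 1\<close> from \<open>z\<close>; hence they agree on
        the closed ball whose radius is one less than that.\<close>
      define r where "r = ldist z y - 2"
      have "Rg I z \<inter> lball z r = Rg J z \<inter> lball z r"
      proof -
        have "\<not> adjacent w y" if "w \<in> lball z r" for w
        proof
          assume "adjacent w y"
          then show False using that True ldist_triangle[of z y w] by (simp add: lball_def adjacent_iff_ldist r_def)
        qed
        then have "w \<in> Rg I z \<longleftrightarrow> w \<in> Rg J z" if "w \<in> lball z r" for w
          using that eq unfolding Rg_def mem_Collect_eq by (metis DiffD1 DiffD2 DiffI)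
        then show ?thesis by blast
      qed
      then have "\<bar>occ (Rg I z) z - occ (Rg J z) z\<bar> \<le> C * \<kappa> ^ r" by (rule decay[OF finRg finRg])
      also have "\<kappa> ^ r = \<kappa> ^ ldist z y / \<kappa>\<^sup>2" using True \<kappa> by (simp add: r_def power_diff)
      finally show ?thesis .
    next
      case False
      have "\<bar>occ (Rg I z) z - occ (Rg J z) z\<bar> \<le> 1"
        using occ_bounds[OF finRg[of I z], of z] occ_bounds[OF finRg[of J z], of z] by linarith
      also have "1 \<le> C * (\<kappa> ^ ldist z y / \<kappa>\<^sup>2)"
      proof -
        have "\<kappa>\<^sup>2 \<le> \<kappa> ^ ldist z y" using False \<kappa> by (intro power_decreasing) auto
        then have "1 \<le> \<kappa> ^ ldist z y / \<kappa>\<^sup>2" using \<kappa> by simp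
        then have "1 * 1 \<le> C * (\<kappa> ^ ldist z y / \<kappa>\<^sup>2)" using \<kappa> by (intro mult_mono) auto
        then show ?thesis by simp
      qed
      finally show ?thesis .
    qed
    then show ?thesis using q_eq[OF z IJ(1)] q_eq[OF z IJ(2)] by linarith
  qed
  have \<delta>0: "0 \<le> \<delta>" using kill_prob_bounds[of "m ^ CARD('d)"] by (simp add: \<delta>_def)
  show "(\<Sum>z\<in>S. \<bar>site_prob S A (real k) I z - site_prob S A (real k) J z\<bar>) \<le> 2 * \<delta> * real m ^ CARD('d)"
    if yt: "y \<in> tile m j"
  proof -
    have yA: "y \<in> A" using y yt by (simp add: A_def)
    have z0: "\<bar>q I z - q J z\<bar> = 0" if z: "z \<in> S - Bl y" for z
    proof (cases "z \<in> A")
      case True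
      have "y \<notin> Bl z" using z True by (auto simp: Bl_def)
      moreover from this have "\<not> adjacent w y" if "w \<in> Bl z" for w using sep[OF that] yA by blast
      ultimately show ?thesis using zero[OF True] by simp
    next
      case False
      then have "z \<noteq> y" using yA by auto
      then show ?thesis using q_outside[OF False] eq by simp
    qed
    have "(\<Sum>z\<in>S. \<bar>q I z - q J z\<bar>) = (\<Sum>z\<in>Bl y. \<bar>q I z - q J z\<bar>)"
      using S BlA[of y] AS z0 by (intro sum.mono_neutral_right) auto
    also have "\<dots> \<le> (\<Sum>z\<in>Bl y. 2 * \<delta>)"
      using inside BlA yA by (intro sum_mono) (auto simp: Bl_def)
    also have "\<dots> = real (card (Bl y)) * (2 * \<delta>)" by simp
    also have "\<dots> \<le> real (m ^ CARD('d)) * (2 * \<delta>)"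
      using cardBl[of y] \<delta>0 by (intro mult_right_mono) (auto simp only: of_nat_le_iff)
    finally show ?thesis by (simp add: q_def mult_ac)
  qed
  show "(\<Sum>z\<in>S. \<bar>site_prob S A (real k) I z - site_prob S A (real k) J z\<bar>)
      \<le> 1 + 4 * real CARD('d) * \<delta> * real m ^ CARD('d) + C * ((2 / (1 - \<kappa>)) ^ CARD('d) / \<kappa>\<^sup>2)"
    if yt: "y \<notin> tile m j"
  proof -
    have yA: "y \<notin> A" using yt by (simp add: A_def)
    \<comment> \<open>A wall site acts only on the cells that contain one of its neighbours, at most
      \<open>2d\<close> of them.\<close>
    define N where "N = (\<Union>w\<in>nbrs y. {z \<in> A. cell m j z = cell m j w})"
    have finN: "finite N" unfolding N_def by (intro finite_UN_I finite_nbrs card_cell(2)[OF m0])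
    have NA: "N \<subseteq> A" by (auto simp: N_def)
    have cardN: "real (card N) \<le> real (2 * CARD('d)) * real m ^ CARD('d)"
    proof -
      have "card N \<le> (\<Sum>w\<in>nbrs y. card {z \<in> A. cell m j z = cell m j w})" unfolding N_def by (rule card_UN_le) simp
      also have "\<dots> \<le> (\<Sum>w\<in>nbrs y. m ^ CARD('d))" by (intro sum_mono card_cell(1)[OF m0])
      also have "\<dots> \<le> 2 * CARD('d) * m ^ CARD('d)" using card_nbrs[of y] by simp
      finally have "real (card N) \<le> real (2 * CARD('d) * m ^ CARD('d))" by (simp only: of_nat_le_iff)
      then show ?thesis by simp
    qed
    have z0: "\<bar>q I z - q J z\<bar> = 0" if z: "z \<in> S - insert y N" for z
    proof (cases "z \<in> A")
      case True
      have "y \<notin> Bl z" using yA BlA by auto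
      moreover have "\<not> adjacent w y" if "w \<in> Bl z" for w
      proof
        assume "adjacent w y"
        then have "w \<in> nbrs y" by (simp add: nbrs_def adjacent_commute)
        then show False using that z True by (auto simp: Bl_def N_def)
      qed
      ultimately show ?thesis using zero[OF True] by simp
    next
      case False
      then show ?thesis using q_outside[OF False] eq z by simp
    qed
    have "(\<Sum>z\<in>S. \<bar>q I z - q J z\<bar>) = (\<Sum>z\<in>insert y N. \<bar>q I z - q J z\<bar>)"
      using S NA AS z0 y finN by (intro sum.mono_neutral_right) auto
    also have "\<dots> = \<bar>q I y - q J y\<bar> + (\<Sum>z\<in>N. \<bar>q I z - q J z\<bar>)"
      using finN NA yA by (subst sum.insert) auto
    also have "\<dots> \<le> 1 + (\<Sum>z\<in>N. 2 * \<delta> + C * (\<kappa> ^ ldist z y / \<kappa>\<^sup>2))"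
      using q_outside[OF yA] general NA by (intro add_mono sum_mono) auto
    also have "\<dots> = 1 + real (card N) * (2 * \<delta>) + C * ((\<Sum>z\<in>N. \<kappa> ^ ldist z y) / \<kappa>\<^sup>2)"
      by (simp add: sum.distrib sum_distrib_left sum_divide_distrib)
    also have "\<dots> \<le> 1 + real (2 * CARD('d)) * real m ^ CARD('d) * (2 * \<delta>) + C * ((2 / (1 - \<kappa>)) ^ CARD('d) / \<kappa>\<^sup>2)"
      using cardN \<delta>0 \<kappa> sum_power_ldist[OF finN, of \<kappa> y]
      by (intro add_mono mult_right_mono mult_left_mono divide_right_mono order_refl) auto
    finally show ?thesis by (simp add: q_def mult_ac)
  qed
qed

text \<open>Monotonicity of this function says that, averaged over the \<open>m\<close> shifts, the
  censored dynamics at least halves the height difference of comparable configurations. First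
  \<open>m\<close> is chosen so large that the bad shifts, at most \<open>d\<close> of
  \<open>m\<close>, are harmless; then \<open>k\<close> is chosen so that cells of side
  \<open>m\<close> are almost in equilibrium.\<close>

lemma height_contraction:
  assumes \<kappa>: "0 < \<kappa>" "\<kappa> < 1" "1 \<le> C"
    and decay: "\<And>(T :: 'd::finite site set) T' v r. finite T \<Longrightarrow> finite T' \<Longrightarrow> T \<inter> lball v r = T' \<inter> lball v r \<Longrightarrow>
      \<bar>occ T v - occ T' v\<bar> \<le> C * \<kappa> ^ r"
  shows "\<exists>m k. 0 < m \<and> 0 < k \<and> (\<forall>S :: 'd site set. finite S \<longrightarrow> increasing S (\<lambda>I.
    real m / 2 * height S I - (\<Sum>j<m. evolve S (S \<inter> tile m j) (real k) (height S) I)))"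
proof -
  define d where "d = real CARD('d)"
  define K where "K = 1 + C * ((2 / (1 - \<kappa>)) ^ CARD('d) / \<kappa>\<^sup>2)"
  have d1: "1 \<le> d" by (simp add: d_def Suc_leI)
  have K0: "0 \<le> K" using \<kappa> by (auto simp: K_def intro!: add_nonneg_nonneg mult_nonneg_nonneg divide_nonneg_nonneg)
  \<comment> \<open>This makes the cost of wall sites, \<open>d * K\<close>, at most
    \<open>m / 4\<close>.\<close>
  obtain m :: nat where m: "4 * d * K + 1 \<le> real m" using real_arch_simple by blast
  have "0 \<le> 4 * d * K" using d1 K0 by simp
  then have m1: "1 \<le> real m" using m by linarith
  then have m0: "0 < m" by (cases m) auto
  define M where "M = real m ^ CARD('d)"
  have M1: "1 \<le> M" unfolding M_def using m1 by (rule one_le_power)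
  define p where "p = 1 - kill_prob (m ^ CARD('d))"
  have p: "0 \<le> p" "p < 1" using kill_prob_bounds[of "m ^ CARD('d)"] by (auto simp: p_def)
  \<comment> \<open>Chosen so that all errors from incomplete equilibration sum to the other
    \<open>m / 4\<close>.\<close>
  define \<epsilon> where "\<epsilon> = 1 / (M * (8 + 16 * d\<^sup>2))"
  have \<epsilon>: "0 < \<epsilon>" using M1 d1 by (auto simp: \<epsilon>_def intro!: mult_pos_pos add_pos_nonneg)
  obtain k0 where k0: "p ^ k0 < \<epsilon>" using real_arch_pow_inv[OF \<epsilon> p(2)] by blast
  define k where "k = Suc k0"
  have k: "p ^ k \<le> \<epsilon>"
  proof -
    have "p ^ k \<le> p ^ k0" unfolding k_def using p by (intro power_decreasing) auto
    then show ?thesis using k0 by simp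
  qed
  have small: "real m * (2 * p ^ k * M) + d * (K + 4 * d * p ^ k * M) \<le> real m / 2"
  proof -
    have "real m * (2 * p ^ k * M) + d * (K + 4 * d * p ^ k * M) = d * K + p ^ k * (M * (2 * real m + 4 * d\<^sup>2))"
      by (simp add: algebra_simps power2_eq_square)
    also have "\<dots> \<le> d * K + \<epsilon> * (M * (2 * real m + 4 * d\<^sup>2))"
      using k M1 by (intro add_left_mono mult_right_mono) auto
    also have "\<dots> \<le> d * K + \<epsilon> * (M * (real m * (2 + 4 * d\<^sup>2)))"
    proof -
      have "1 * (4 * d\<^sup>2) \<le> real m * (4 * d\<^sup>2)" using m1 by (intro mult_right_mono) auto
      then have "2 * real m + 4 * d\<^sup>2 \<le> real m * (2 + 4 * d\<^sup>2)" by (simp add: algebra_simps)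
      then show ?thesis using \<epsilon> M1 by (intro add_left_mono mult_left_mono) auto
    qed
    also have "\<epsilon> * (M * (real m * (2 + 4 * d\<^sup>2))) = real m / 4"
    proof -
      define D where "D = 2 + 4 * d\<^sup>2"
      have "D > 0" "8 + 16 * d\<^sup>2 = 4 * D" by (simp_all add: D_def add_pos_nonneg)
      then show ?thesis using M1 unfolding \<epsilon>_def D_def[symmetric] by (simp add: field_simps)
    qed
    also have "d * K \<le> real m / 4" using m by simp
    finally show ?thesis by simp
  qed
  have "increasing S (\<lambda>I. real m / 2 * height S I - (\<Sum>j<m. evolve S (S \<inter> tile m j) (real k) (height S) I))"
    if S: "finite S" for S :: "'d site set"
  proof (rule increasing_by_single_flips[OF S])
    fix I J y assume IJ: "I \<in> indep_sets S" "J \<in> indep_sets S" "conf_le I J" "y \<in> S"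
      and eq: "\<And>z. z \<noteq> y \<Longrightarrow> z \<in> I \<longleftrightarrow> z \<in> J" and ne: "(y \<in> I) \<noteq> (y \<in> J)"
    let ?q = "\<lambda>j. site_prob S (S \<inter> tile m j) (real k)"
    let ?b = "\<lambda>j. 2 * p ^ k * M + (if y \<notin> tile m j then K + 4 * d * p ^ k * M else 0)"
    have one: "evolve S (S \<inter> tile m j) (real k) (height S) J - evolve S (S \<inter> tile m j) (real k) (height S) I \<le> ?b j"
      if j: "j < m" for j
    proof -
      have "evolve S (S \<inter> tile m j) (real k) (height S) J - evolve S (S \<inter> tile m j) (real k) (height S) I
          = (\<Sum>z\<in>S. site_sign z * (?q j J z - ?q j I z))"
        unfolding evolve_height[OF S] by (simp add: sum_subtractf right_diff_distrib)
      also have "\<dots> \<le> (\<Sum>z\<in>S. \<bar>?q j I z - ?q j J z\<bar>)"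
        by (intro sum_mono) (auto simp: site_sign_def)
      also have "\<dots> \<le> ?b j"
      proof (cases "y \<in> tile m j")
        case True
        have "(\<Sum>z\<in>S. \<bar>?q j I z - ?q j J z\<bar>) \<le> 2 * p ^ k * M"
          unfolding p_def M_def by (rule single_flip_influence(1)[OF S j IJ(4,1,2) _ \<kappa> _ True]) (fact eq, fact decay)
        then show ?thesis using True by simp
      next
        case False
        have "0 \<le> 2 * p ^ k * M" using p M1 by simp
        moreover have "(\<Sum>z\<in>S. \<bar>?q j I z - ?q j J z\<bar>) \<le> K + 4 * d * p ^ k * M"
        proof -
          have "(\<Sum>z\<in>S. \<bar>?q j I z - ?q j J z\<bar>) \<le> 1 + 4 * d * p ^ k * M + C * ((2 / (1 - \<kappa>)) ^ CARD('d) / \<kappa>\<^sup>2)"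
            unfolding p_def M_def d_def
            by (rule single_flip_influence(2)[OF S j IJ(4,1,2) _ \<kappa> _ False]) (fact eq, fact decay)
          then show ?thesis by (simp add: K_def)
        qed
        ultimately have "(\<Sum>z\<in>S. \<bar>?q j I z - ?q j J z\<bar>) \<le> 2 * p ^ k * M + (K + 4 * d * p ^ k * M)"
          by linarith
        then show ?thesis using False by simp
      qed
      finally show ?thesis .
    qed
    have "(\<Sum>j<m. evolve S (S \<inter> tile m j) (real k) (height S) J) - (\<Sum>j<m. evolve S (S \<inter> tile m j) (real k) (height S) I)
        \<le> (\<Sum>j<m. ?b j)"
      unfolding sum_subtractf[symmetric] using one by (intro sum_mono) auto
    also have "\<dots> = real m * (2 * p ^ k * M) + real (card {j \<in> {..<m}. y \<notin> tile m j}) * (K + 4 * d * p ^ k * M)"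
      by (simp add: sum.distrib sum.If_cases Int_def)
    also have "\<dots> \<le> real m * (2 * p ^ k * M) + d * (K + 4 * d * p ^ k * M)"
      using card_tiles_missing[of m y] p M1 K0 d1 unfolding d_def
      by (intro add_left_mono mult_right_mono add_nonneg_nonneg mult_nonneg_nonneg) auto
    also have "\<dots> \<le> real m / 2" by (rule small)
    also have "\<dots> \<le> real m / 2 * (height S J - height S I)"
    proof -
      have "I \<noteq> J" using ne by auto
      then have "1 \<le> height S J - height S I"
        using IJ by (intro height_diff_ge_1[OF S]) (auto simp: indep_sets_def)
      then have "real m / 2 * 1 \<le> real m / 2 * (height S J - height S I)" by (intro mult_left_mono) auto
      then show ?thesis by simp
    qed
    finally show "real m / 2 * height S I - (\<Sum>j<m. evolve S (S \<inter> tile m j) (real k) (height S) I)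
      \<le> real m / 2 * height S J - (\<Sum>j<m. evolve S (S \<inter> tile m j) (real k) (height S) J)"
      by (simp add: right_diff_distrib)
  qed
  moreover have "0 < k" by (simp add: k_def)
  ultimately show ?thesis using m0 by blast
qed

text \<open>Reversibility turns evaluation at a starting point \<open>I\<close> into a Gibbs pairing
  with the evolved indicator of \<open>I\<close>, the form in which \<open>censoring\<close> can be
  applied.\<close>

lemma evolve_extreme:
  assumes "finite S" and g: "\<And>I. \<bar>g I\<bar> \<le> B" and "I \<in> indep_sets S"
  shows "lam ^ card I * evolve S S t g I = gibbs_sum S (\<lambda>J. evolve S S t (\<lambda>J. of_bool (J = I)) J * g J)"
proof -
  have "gibbs_sum S (\<lambda>J. of_bool (J = I) * evolve S S t g J)
      = (\<Sum>J\<in>indep_sets S. if J = I then lam ^ card I * evolve S S t g I else 0)"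
    unfolding gibbs_sum_def by (intro sum.cong) auto
  also have "\<dots> = lam ^ card I * evolve S S t g I"
    using assms by simp
  finally show ?thesis
    using evolve_reversible[of S "\<lambda>J. of_bool (J = I)" 1 g B S t] assms by simp
qed

text \<open>The indicator of the greatest configuration is increasing and stays so under the
  dynamics; it plays the role of the density in \<open>censoring\<close>.\<close>

lemma evolve_top_censored:
  assumes S: "finite S" and t: "0 \<le> t" and g: "\<And>I. \<bar>g I\<bar> \<le> B" and inc: "increasing S g"
  shows "evolve S S t (evolve S S s g) (top_conf S) \<le> evolve S S t (evolve S A s g) (top_conf S)"
proof -
  let ?f = "evolve S S t (\<lambda>J. of_bool (J = top_conf S))"
  have "increasing S (\<lambda>J. of_bool (J = top_conf S))"
    unfolding increasing_def using conf_le_top by (auto simp: indep_sets_def dest: conf_le_antisym)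
  then have "increasing S ?f" using S t by (intro increasing_evolve[where B = 1]) auto
  then have "gibbs_sum S (\<lambda>J. ?f J * evolve S S s g J) \<le> gibbs_sum S (\<lambda>J. ?f J * evolve S A s g J)"
    using S inc by (intro censoring[where B = B] g)
  then have "lam ^ card (top_conf S) * evolve S S t (evolve S S s g) (top_conf S)
      \<le> lam ^ card (top_conf S) * evolve S S t (evolve S A s g) (top_conf S)"
    using S by (simp add: evolve_extreme[where B = B] abs_evolve_le g)
  then show ?thesis using lam_pos by simp
qed

lemma evolve_bot_censored:
  assumes S: "finite S" and t: "0 \<le> t" and g: "\<And>I. \<bar>g I\<bar> \<le> B" and inc: "increasing S g"
  shows "evolve S S t (evolve S A s g) (bot_conf S) \<le> evolve S S t (evolve S S s g) (bot_conf S)"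
proof -
  let ?f = "evolve S S t (\<lambda>J. of_bool (J = bot_conf S))"
  \<comment> \<open>The indicator of the least configuration is decreasing, so its negative is used
    and the inequality is reversed.\<close>
  let ?h = "evolve S S t (\<lambda>J. - of_bool (J = bot_conf S))"
  have h: "?h J = - ?f J" for J by (simp add: evolve_def)
  have "increasing S (\<lambda>J. - of_bool (J = bot_conf S))"
    unfolding increasing_def using conf_le_bot by (auto simp: indep_sets_def dest: conf_le_antisym)
  then have "increasing S ?h" using S t by (intro increasing_evolve[where B = 1]) auto
  then have "gibbs_sum S (\<lambda>J. ?h J * evolve S S s g J) \<le> gibbs_sum S (\<lambda>J. ?h J * evolve S A s g J)"
    using S inc by (intro censoring[where B = B] g)
  then have "gibbs_sum S (\<lambda>J. ?f J * evolve S A s g J) \<le> gibbs_sum S (\<lambda>J. ?f J * evolve S S s g J)"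
    unfolding h by (simp add: gibbs_sum_def sum_negf)
  then have "lam ^ card (bot_conf S) * evolve S S t (evolve S A s g) (bot_conf S)
      \<le> lam ^ card (bot_conf S) * evolve S S t (evolve S S s g) (bot_conf S)"
    using S by (simp add: evolve_extreme[where B = B] abs_evolve_le g)
  then show ?thesis using lam_pos by simp
qed

text \<open>Both extreme runs use the same updates. By monotonicity this one number bounds the
  distance to equilibrium and also the probability that the spin at a given site is still
  undetermined.\<close>

definition not_coalesced :: "'d::finite site set \<Rightarrow> real \<Rightarrow> real" where
  "not_coalesced S t = measure_pmf.prob (updates S t) {l. run l (top_conf S) \<noteq> run l (bot_conf S)}"

lemma not_coalesced_antimono:
  assumes "finite S" "0 \<le> s" "s \<le> t"
  shows "not_coalesced S t \<le> not_coalesced S s"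
proof -
  let ?N = "{l. run l (top_conf S) \<noteq> run l (bot_conf S)}"
  have "not_coalesced S t = measure_pmf.prob (pair_pmf (updates S s) (updates S (t - s))) ((\<lambda>(a, b). a @ b) -` ?N)"
  proof -
    have "updates S t = map_pmf (\<lambda>(a, b). a @ b) (pair_pmf (updates S s) (updates S (t - s)))"
      using updates_append[of S s "t - s"] assms by simp
    then show ?thesis unfolding not_coalesced_def by (simp only: measure_map_pmf)
  qed
  also have "\<dots> \<le> measure_pmf.prob (pair_pmf (updates S s) (updates S (t - s))) (fst -` ?N)"
    by (intro measure_pmf.finite_measure_mono) (auto simp: run_append)
  also have "\<dots> = measure_pmf.prob (map_pmf fst (pair_pmf (updates S s) (updates S (t - s)))) ?N" by simp
  finally show ?thesis unfolding not_coalesced_def by (simp only: map_fst_pair_pmf)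
qed

lemma not_coalesced_le_height:
  assumes S: "finite S" and t: "0 \<le> t"
  shows "not_coalesced S t \<le> evolve S S t (height S) (top_conf S) - evolve S S t (height S) (bot_conf S)"
proof -
  let ?N = "{l. run l (top_conf S) \<noteq> run l (bot_conf S)}"
  have int: "integrable (updates S t) (\<lambda>l. height S (run (restr S l) I))" for I
    by (rule integrable_pmf_bounded[OF abs_height_le])
  have "not_coalesced S t = measure_pmf.expectation (updates S t) (\<lambda>l. of_bool (l \<in> ?N))"
    unfolding not_coalesced_def expectation_of_bool by simp
  also have "\<dots> \<le> measure_pmf.expectation (updates S t)
      (\<lambda>l. height S (run (restr S l) (top_conf S)) - height S (run (restr S l) (bot_conf S)))"
  proof (intro integral_mono_AE AE_pmfI Bochner_Integration.integrable_diff int)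
    fix l assume "l \<in> set_pmf (updates S t)"
    then have l: "fst ` set l \<subseteq> S" using S t by (intro set_updates) auto
    have le: "conf_le (run l (bot_conf S)) (run l (top_conf S))" by (rule run_mono[OF bot_le_top])
    have "run l (bot_conf S) \<subseteq> S" "run l (top_conf S) \<subseteq> S"
      using run_indep_sets[OF l bot_conf_indep] run_indep_sets[OF l top_conf_indep] by (auto simp: indep_sets_def)
    then show "of_bool (l \<in> ?N) \<le> height S (run (restr S l) (top_conf S)) - height S (run (restr S l) (bot_conf S))"
      using height_diff_ge_1[OF S le] height_mono[OF le, of S] restr_id[OF l] by auto
  qed (rule integrable_pmf_bounded[where B = 1], simp)
  also have "\<dots> = evolve S S t (height S) (top_conf S) - evolve S S t (height S) (bot_conf S)"
    unfolding evolve_def using int by (intro Bochner_Integration.integral_diff) auto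
  finally show ?thesis .
qed

text \<open>Censoring the last \<open>k\<close> units of time can only increase the gap, for each
  shift \<open>j\<close> separately. Hence the true gap is at most the average of the censored gaps,
  and it is this average that contracts.\<close>

lemma height_gap_contraction:
  assumes S: "finite S" and t: "0 \<le> t" and m: "0 < m"
    and inc: "increasing S (\<lambda>I. real m / 2 * height S I - (\<Sum>j<m. evolve S (S \<inter> tile m j) (real k) (height S) I))"
  shows "evolve S S (t + real k) (height S) (top_conf S) - evolve S S (t + real k) (height S) (bot_conf S)
    \<le> (evolve S S t (height S) (top_conf S) - evolve S S t (height S) (bot_conf S)) / 2"
proof -
  let ?H = "height S" and ?T = "top_conf S" and ?B = "bot_conf S"
  let ?Q = "\<lambda>j. evolve S (S \<inter> tile m j) (real k) ?H"
  let ?c = "real (card S)"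
  have incH: "increasing S ?H" by (auto simp: increasing_def intro: height_mono)
  have Qb: "\<bar>?Q j I\<bar> \<le> ?c" for j I by (rule abs_evolve_le[OF abs_height_le])
  have add: "evolve S S (t + real k) ?H I = evolve S S t (evolve S S (real k) ?H) I" for I
    by (rule evolve_add[where B = ?c, OF S t _ abs_height_le]) simp
  have int: "integrable (updates S t) (\<lambda>l. ?Q j (run (restr S l) I))" for j I by (rule integrable_pmf_bounded[OF Qb])
  have intH: "integrable (updates S t) (\<lambda>l. ?H (run (restr S l) I))" for I by (rule integrable_pmf_bounded[OF abs_height_le])
  have "real m * (evolve S S (t + real k) ?H ?T - evolve S S (t + real k) ?H ?B)
      = (\<Sum>j<m. evolve S S t (evolve S S (real k) ?H) ?T - evolve S S t (evolve S S (real k) ?H) ?B)"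
    by (simp add: add)
  also have "\<dots> \<le> (\<Sum>j<m. evolve S S t (?Q j) ?T - evolve S S t (?Q j) ?B)"
    by (intro sum_mono diff_mono evolve_top_censored[where B = ?c] evolve_bot_censored[where B = ?c] S t abs_height_le incH)
  also have "\<dots> = measure_pmf.expectation (updates S t)
      (\<lambda>l. \<Sum>j<m. ?Q j (run (restr S l) ?T) - ?Q j (run (restr S l) ?B))"
    using int by (simp add: evolve_def)
  also have "\<dots> \<le> measure_pmf.expectation (updates S t)
      (\<lambda>l. real m / 2 * (?H (run (restr S l) ?T) - ?H (run (restr S l) ?B)))"
  proof (intro integral_mono_AE AE_pmfI Bochner_Integration.integrable_sum Bochner_Integration.integrable_diff
      integrable_mult_right int intH)
    fix l
    have l: "fst ` set (restr S l) \<subseteq> S" by (rule fst_set_restr)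
    have le: "conf_le (run (restr S l) ?B) (run (restr S l) ?T)" by (rule run_mono[OF bot_le_top])
    show "(\<Sum>j<m. ?Q j (run (restr S l) ?T) - ?Q j (run (restr S l) ?B))
        \<le> real m / 2 * (?H (run (restr S l) ?T) - ?H (run (restr S l) ?B))"
      using inc[unfolded increasing_def, rule_format, OF run_indep_sets[OF l bot_conf_indep] run_indep_sets[OF l top_conf_indep] le]
      by (simp add: sum_subtractf right_diff_distrib)
  qed
  also have "\<dots> = real m / 2 * (evolve S S t ?H ?T - evolve S S t ?H ?B)"
    using intH by (simp add: evolve_def)
  finally show ?thesis using m by simp
qed

text \<open>Runs that differ have heights at least 1 apart, so \<open>not_coalesced\<close> is at
  most the mean gap. This gap starts at no more than \<open>2 * card S\<close> and halves in every
  period \<open>k\<close>; rounding \<open>t\<close> down to whole periods costs the remaining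
  factor 2.\<close>

theorem coalescence_bound:
  assumes \<kappa>: "0 < \<kappa>" "\<kappa> < 1" "1 \<le> C"
    and decay: "\<And>(T :: 'd::finite site set) T' v r. finite T \<Longrightarrow> finite T' \<Longrightarrow> T \<inter> lball v r = T' \<inter> lball v r \<Longrightarrow>
      \<bar>occ T v - occ T' v\<bar> \<le> C * \<kappa> ^ r"
  shows "\<exists>c>0. \<forall>(S :: 'd site set) t. finite S \<longrightarrow> 0 \<le> t \<longrightarrow>
    not_coalesced S t \<le> 4 * real (card S) * exp (- c * t)"
proof -
  obtain m k where mk: "0 < m" "0 < k" and inc: "\<And>S :: 'd site set. finite S \<Longrightarrow> increasing S (\<lambda>I.
    real m / 2 * height S I - (\<Sum>j<m. evolve S (S \<inter> tile m j) (real k) (height S) I))"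
    using height_contraction[OF \<kappa> decay] by blast
  define c where "c = ln 2 / real k"
  have "not_coalesced S t \<le> 4 * real (card S) * exp (- c * t)" if S: "finite S" and t: "0 \<le> t" for S :: "'d site set" and t
  proof -
    let ?D = "\<lambda>t. evolve S S t (height S) (top_conf S) - evolve S S t (height S) (bot_conf S)"
    have D: "?D (real i * real k) \<le> 2 * real (card S) / 2 ^ i" for i
    proof (induction i)
      case 0
      show ?case using abs_height_le[of S "top_conf S"] abs_height_le[of S "bot_conf S"] by (simp add: evolve_def)
    next
      case (Suc i)
      have "?D (real (Suc i) * real k) \<le> ?D (real i * real k) / 2"
        using height_gap_contraction[OF S _ mk(1) inc[OF S], of "real i * real k"] by (simp add: algebra_simps)
      then show ?case using Suc.IH by simp
    qed
    define i where "i = nat \<lfloor>t / real k\<rfloor>"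
    have i: "real i \<le> t / real k" "t / real k < real i + 1"
      using t mk by (simp_all add: i_def)
    have "not_coalesced S t \<le> not_coalesced S (real i * real k)"
      using i(1) mk by (intro not_coalesced_antimono S) (auto simp: field_simps)
    also have "\<dots> \<le> ?D (real i * real k)" by (intro not_coalesced_le_height S) simp
    also have "\<dots> \<le> 2 * real (card S) / 2 ^ i" by (rule D)
    also have "\<dots> \<le> 4 * real (card S) * exp (- c * t)"
    proof -
      have "c * t = t / real k * ln 2" by (simp add: c_def)
      also have "\<dots> \<le> (real i + 1) * ln 2" using i(2) by (intro mult_right_mono) auto
      finally have "exp (- ((real i + 1) * ln 2)) \<le> exp (- c * t)" by simp
      moreover have "exp (- ((real i + 1) * ln 2)) = 1 / (2 * 2 ^ i)"
      proof -
        have "exp ((real i + 1) * ln 2) = (2 :: real) ^ Suc i"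
          by (simp add: distrib_right exp_add exp_of_nat_mult)
        then show ?thesis unfolding exp_minus by (simp add: inverse_eq_divide)
      qed
      ultimately have "4 * real (card S) * (1 / (2 * 2 ^ i)) \<le> 4 * real (card S) * exp (- c * t)"
        by (intro mult_left_mono) auto
      then show ?thesis by simp
    qed
    finally show ?thesis .
  qed
  moreover have "0 < c" using mk by (simp add: c_def)
  ultimately show ?thesis by blast
qed

end

section \<open>Total variation and Hellinger affinity\<close>

text \<open>A \<open>sum\<close> over an infinite set is 0, so this and \<open>affinity\<close>, the
  Bhattacharyya coefficient, are used with finite supports only.\<close>

definition tv :: "'a pmf \<Rightarrow> 'a pmf \<Rightarrow> real" where
  "tv p q = (\<Sum>x\<in>set_pmf p \<union> set_pmf q. \<bar>pmf p x - pmf q x\<bar>) / 2"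

definition affinity :: "'a pmf \<Rightarrow> 'a pmf \<Rightarrow> real" where
  "affinity p q = (\<Sum>x\<in>set_pmf p \<union> set_pmf q. sqrt (pmf p x * pmf q x))"

lemma tv_eq_sum:
  assumes "finite F" "set_pmf p \<subseteq> F" "set_pmf q \<subseteq> F"
  shows "tv p q = (\<Sum>x\<in>F. \<bar>pmf p x - pmf q x\<bar>) / 2"
  unfolding tv_def using assms
  by (intro arg_cong2[of _ _ _ _ "(/)"] sum.mono_neutral_left) (auto simp: set_pmf_iff)

lemma affinity_eq_sum:
  assumes "finite F" "set_pmf p \<subseteq> F" "set_pmf q \<subseteq> F"
  shows "affinity p q = (\<Sum>x\<in>F. sqrt (pmf p x * pmf q x))"
  unfolding affinity_def using assms
  by (intro sum.mono_neutral_left) (auto simp: pmf_eq_0_set_pmf)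

lemma prob_eq_sum_superset:
  assumes "finite F" "set_pmf p \<subseteq> F"
  shows "measure_pmf.prob p A = (\<Sum>x\<in>F \<inter> A. pmf p x)"
  using assms by (intro prob_eq_sum_pmf) auto

lemma tv_nonneg: "0 \<le> tv p q"
  by (simp add: tv_def sum_nonneg)

lemma tv_sym: "tv p q = tv q p"
  by (simp add: tv_def abs_minus_commute Un_commute)

lemma tv_triangle:
  assumes "finite (set_pmf p)" "finite (set_pmf q)" "finite (set_pmf r)"
  shows "tv p r \<le> tv p q + tv q r"
proof -
  let ?F = "set_pmf p \<union> set_pmf q \<union> set_pmf r"
  have "(\<Sum>x\<in>?F. \<bar>pmf p x - pmf r x\<bar>) \<le> (\<Sum>x\<in>?F. \<bar>pmf p x - pmf q x\<bar> + \<bar>pmf q x - pmf r x\<bar>)"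
    by (intro sum_mono) auto
  moreover have "finite ?F" "set_pmf p \<subseteq> ?F" "set_pmf q \<subseteq> ?F" "set_pmf r \<subseteq> ?F" using assms by auto
  ultimately show ?thesis
    using tv_eq_sum[of ?F p r] tv_eq_sum[of ?F p q] tv_eq_sum[of ?F q r] by (simp add: sum.distrib)
qed

lemma prob_diff_le_tv:
  assumes "finite (set_pmf p)" "finite (set_pmf q)"
  shows "measure_pmf.prob p A - measure_pmf.prob q A \<le> tv p q"
proof -
  let ?F = "set_pmf p \<union> set_pmf q"
  have F: "finite ?F" using assms by auto
  have 1: "(\<Sum>x\<in>?F. pmf p x) = 1" "(\<Sum>x\<in>?F. pmf q x) = 1"
    using F by (auto intro!: sum_pmf_eq_1)
  let ?d = "\<lambda>x. pmf p x - pmf q x"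
  have split: "(\<Sum>x\<in>?F. g x) = (\<Sum>x\<in>?F \<inter> A. g x) + (\<Sum>x\<in>?F - A. g x)" for g :: "'a \<Rightarrow> real"
    using F by (subst sum.union_disjoint[symmetric]) (auto intro: sum.cong)
  have 0: "(\<Sum>x\<in>?F \<inter> A. ?d x) + (\<Sum>x\<in>?F - A. ?d x) = 0"
    unfolding split[symmetric] using 1 by (simp add: sum_subtractf)
  have le: "(\<Sum>x\<in>?F \<inter> A. ?d x) \<le> (\<Sum>x\<in>?F \<inter> A. \<bar>?d x\<bar>)" "- (\<Sum>x\<in>?F - A. ?d x) \<le> (\<Sum>x\<in>?F - A. \<bar>?d x\<bar>)"
    unfolding sum_negf[symmetric] by (intro sum_mono; simp)+
  have "measure_pmf.prob p A - measure_pmf.prob q A = (\<Sum>x\<in>?F \<inter> A. ?d x)"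
    using prob_eq_sum_superset[OF F, of p A] prob_eq_sum_superset[OF F, of q A] by (simp add: sum_subtractf)
  moreover have "2 * tv p q = (\<Sum>x\<in>?F \<inter> A. \<bar>?d x\<bar>) + (\<Sum>x\<in>?F - A. \<bar>?d x\<bar>)"
    unfolding tv_def split[symmetric] by simp
  ultimately show ?thesis using le 0 by linarith
qed

lemma tv_eq_prob_diff:
  assumes "finite (set_pmf p)" "finite (set_pmf q)"
  shows "\<exists>A. tv p q = measure_pmf.prob p A - measure_pmf.prob q A"
proof -
  let ?F = "set_pmf p \<union> set_pmf q" and ?A = "{x. pmf q x \<le> pmf p x}"
  have F: "finite ?F" using assms by auto
  have 1: "(\<Sum>x\<in>?F. pmf p x) = 1" "(\<Sum>x\<in>?F. pmf q x) = 1"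
    using F by (auto intro!: sum_pmf_eq_1)
  let ?d = "\<lambda>x. pmf p x - pmf q x"
  have split: "(\<Sum>x\<in>?F. g x) = (\<Sum>x\<in>?F \<inter> ?A. g x) + (\<Sum>x\<in>?F - ?A. g x)" for g :: "'a \<Rightarrow> real"
    using F by (subst sum.union_disjoint[symmetric]) (auto intro: sum.cong)
  have 0: "(\<Sum>x\<in>?F \<inter> ?A. ?d x) + (\<Sum>x\<in>?F - ?A. ?d x) = 0"
    unfolding split[symmetric] using 1 by (simp add: sum_subtractf)
  have "(\<Sum>x\<in>?F \<inter> ?A. \<bar>?d x\<bar>) = (\<Sum>x\<in>?F \<inter> ?A. ?d x)" by (intro sum.cong) auto
  moreover have "(\<Sum>x\<in>?F - ?A. \<bar>?d x\<bar>) = - (\<Sum>x\<in>?F - ?A. ?d x)"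
    unfolding sum_negf[symmetric] by (intro sum.cong) auto
  moreover have "2 * tv p q = (\<Sum>x\<in>?F \<inter> ?A. \<bar>?d x\<bar>) + (\<Sum>x\<in>?F - ?A. \<bar>?d x\<bar>)"
    unfolding tv_def split[symmetric] by simp
  moreover have "measure_pmf.prob p ?A - measure_pmf.prob q ?A = (\<Sum>x\<in>?F \<inter> ?A. ?d x)"
    using prob_eq_sum_superset[OF F, of p ?A] prob_eq_sum_superset[OF F, of q ?A] by (simp add: sum_subtractf)
  ultimately have "tv p q = measure_pmf.prob p ?A - measure_pmf.prob q ?A" using 0 by linarith
  then show ?thesis by blast
qed

lemma tv_leI:
  assumes "finite (set_pmf p)" "finite (set_pmf q)"
    and "\<And>A. measure_pmf.prob p A - measure_pmf.prob q A \<le> c"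
  shows "tv p q \<le> c"
  using tv_eq_prob_diff[OF assms(1,2)] assms(3) by metis

lemma tv_le_1: "finite (set_pmf p) \<Longrightarrow> finite (set_pmf q) \<Longrightarrow> tv p q \<le> 1"
  by (rule tv_leI) (auto intro: order_trans[OF diff_mono[OF measure_pmf.prob_le_1 measure_nonneg]])

lemma tv_map:
  assumes "finite (set_pmf p)" "finite (set_pmf q)"
  shows "tv (map_pmf f p) (map_pmf f q) \<le> tv p q"
  using assms by (intro tv_leI) (auto intro: prob_diff_le_tv)

lemma tv_coupling:
  assumes "finite (set_pmf (map_pmf f L))" "finite (set_pmf (map_pmf g L))"
  shows "tv (map_pmf f L) (map_pmf g L) \<le> measure_pmf.prob L {l. f l \<noteq> g l}"
proof (rule tv_leI[OF assms])
  fix A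
  have "measure_pmf.prob L (f -` A) \<le> measure_pmf.prob L (g -` A \<union> {l. f l \<noteq> g l})"
    by (intro measure_pmf.finite_measure_mono) auto
  also have "\<dots> \<le> measure_pmf.prob L (g -` A) + measure_pmf.prob L {l. f l \<noteq> g l}"
    by (rule measure_Un_le) auto
  finally show "measure_pmf.prob (map_pmf f L) A - measure_pmf.prob (map_pmf g L) A \<le> measure_pmf.prob L {l. f l \<noteq> g l}"
    by simp
qed

lemma prob_bind_pmf: "measure_pmf.prob (bind_pmf M N) A = measure_pmf.expectation M (\<lambda>x. measure_pmf.prob (N x) A)"
proof -
  have "measure_pmf.prob (bind_pmf M N) A = measure_pmf.expectation (bind_pmf M N) (\<lambda>x. of_bool (x \<in> A))"
    by (simp add: expectation_of_bool)
  also have "\<dots> = measure_pmf.expectation M (\<lambda>x. measure_pmf.expectation (N x) (\<lambda>y. of_bool (y \<in> A)))"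
    by (rule expectation_bind_pmf[where B = 1]) simp
  finally show ?thesis by (simp add: expectation_of_bool)
qed

lemma integrable_prob: "integrable (measure_pmf M) (\<lambda>x. measure_pmf.prob (N x) A)"
  by (rule integrable_pmf_bounded[where B = 1]) simp

text \<open>Joint convexity: the distance of two mixtures with the same mixing law is at most the
  mean distance of their components.\<close>

lemma tv_bind_le:
  assumes fin: "finite (set_pmf (bind_pmf M N))" "finite (set_pmf (bind_pmf M N'))"
    and g: "integrable (measure_pmf M) g" "\<And>x. x \<in> set_pmf M \<Longrightarrow> tv (N x) (N' x) \<le> g x"
  shows "tv (bind_pmf M N) (bind_pmf M N') \<le> measure_pmf.expectation M g"
proof (rule tv_leI[OF fin])
  fix A
  have f: "finite (set_pmf (N x))" "finite (set_pmf (N' x))" if "x \<in> set_pmf M" for x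
    by (rule finite_subset[OF _ fin(1)], use that in auto) (rule finite_subset[OF _ fin(2)], use that in auto)
  have "measure_pmf.prob (bind_pmf M N) A - measure_pmf.prob (bind_pmf M N') A
      = measure_pmf.expectation M (\<lambda>x. measure_pmf.prob (N x) A - measure_pmf.prob (N' x) A)"
    by (simp add: prob_bind_pmf integrable_prob)
  also have "\<dots> \<le> measure_pmf.expectation M g"
  proof (intro integral_mono_AE AE_pmfI g(1) Bochner_Integration.integrable_diff integrable_prob)
    fix x assume x: "x \<in> set_pmf M"
    show "measure_pmf.prob (N x) A - measure_pmf.prob (N' x) A \<le> g x"
      using prob_diff_le_tv[OF f[OF x], of A] g(2)[OF x] by simp
  qed
  finally show "measure_pmf.prob (bind_pmf M N) A - measure_pmf.prob (bind_pmf M N') A \<le> measure_pmf.expectation M g" .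
qed

lemma cauchy_schwarz_sum:
  fixes f g :: "'a \<Rightarrow> real"
  shows "(\<Sum>x\<in>F. f x * g x) \<le> sqrt (\<Sum>x\<in>F. (f x)\<^sup>2) * sqrt (\<Sum>x\<in>F. (g x)\<^sup>2)"
proof -
  have "(\<Sum>x\<in>F. f x * g x) \<le> (\<Sum>x\<in>F. \<bar>f x\<bar> * \<bar>g x\<bar>)"
    by (intro sum_mono) (metis abs_ge_self abs_mult)
  also have "\<dots> \<le> L2_set f F * L2_set g F" by (rule L2_set_mult_ineq)
  finally show ?thesis by (simp add: L2_set_def)
qed

lemma affinity_nonneg: "0 \<le> affinity p q"
  by (simp add: affinity_def sum_nonneg)

lemma affinity_le_1:
  assumes "finite (set_pmf p)" "finite (set_pmf q)"
  shows "affinity p q \<le> 1"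
proof -
  let ?F = "set_pmf p \<union> set_pmf q"
  have "affinity p q = (\<Sum>x\<in>?F. sqrt (pmf p x) * sqrt (pmf q x))" by (simp add: affinity_def real_sqrt_mult)
  also have "\<dots> \<le> sqrt (\<Sum>x\<in>?F. (sqrt (pmf p x))\<^sup>2) * sqrt (\<Sum>x\<in>?F. (sqrt (pmf q x))\<^sup>2)"
    by (rule cauchy_schwarz_sum)
  also have "\<dots> = 1" using assms by (simp add: sum_pmf_eq_1)
  finally show ?thesis .
qed

text \<open>\<open>1 - tv p q\<close> is the sum of the pointwise minima, and a minimum is at most
  the geometric mean.\<close>

lemma one_minus_tv_le_affinity:
  assumes "finite (set_pmf p)" "finite (set_pmf q)"
  shows "1 - tv p q \<le> affinity p q"
proof -
  let ?F = "set_pmf p \<union> set_pmf q"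
  have F: "finite ?F" using assms by auto
  have 1: "(\<Sum>x\<in>?F. pmf p x) = 1" "(\<Sum>x\<in>?F. pmf q x) = 1"
    using F by (auto intro!: sum_pmf_eq_1)
  have "1 - tv p q = (\<Sum>x\<in>?F. (pmf p x + pmf q x - \<bar>pmf p x - pmf q x\<bar>) / 2)"
    using 1 by (simp add: tv_def sum.distrib sum_subtractf sum_divide_distrib[symmetric] diff_divide_distrib add_divide_distrib)
  also have "\<dots> \<le> affinity p q"
    unfolding affinity_def
  proof (rule sum_mono)
    fix x
    have "(pmf p x + pmf q x - \<bar>pmf p x - pmf q x\<bar>) / 2 = min (pmf p x) (pmf q x)" by (simp add: min_def abs_if)
    also have "\<dots> \<le> sqrt (pmf p x * pmf q x)"
      by (rule real_le_rsqrt) (auto simp: power2_eq_square intro!: mult_mono)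
    finally show "(pmf p x + pmf q x - \<bar>pmf p x - pmf q x\<bar>) / 2 \<le> sqrt (pmf p x * pmf q x)" .
  qed
  finally show ?thesis .
qed

text \<open>Factor the difference of the weights into the difference and the sum of their square
  roots and apply Cauchy-Schwarz.\<close>

lemma tv_squared_le_affinity:
  assumes "finite (set_pmf p)" "finite (set_pmf q)"
  shows "(tv p q)\<^sup>2 \<le> 2 * (1 - affinity p q)"
proof -
  let ?F = "set_pmf p \<union> set_pmf q"
  let ?p = "\<lambda>x. sqrt (pmf p x)" and ?q = "\<lambda>x. sqrt (pmf q x)"
  have 1: "(\<Sum>x\<in>?F. pmf p x) = 1" "(\<Sum>x\<in>?F. pmf q x) = 1"
    using assms by (auto intro!: sum_pmf_eq_1)
  have minus: "(\<Sum>x\<in>?F. \<bar>?p x - ?q x\<bar>\<^sup>2) = 2 - 2 * affinity p q"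
    using 1 by (simp add: power2_diff sum.distrib sum_subtractf affinity_def real_sqrt_mult sum_distrib_left mult.assoc)
  have plus: "(\<Sum>x\<in>?F. \<bar>?p x + ?q x\<bar>\<^sup>2) = 2 + 2 * affinity p q"
    using 1 by (simp add: power2_sum sum.distrib affinity_def real_sqrt_mult sum_distrib_left mult.assoc)
  have "2 * tv p q = (\<Sum>x\<in>?F. \<bar>?p x - ?q x\<bar> * \<bar>?p x + ?q x\<bar>)"
    unfolding tv_def abs_mult[symmetric] by (simp add: algebra_simps)
  also have "\<dots> \<le> sqrt (2 - 2 * affinity p q) * sqrt (2 + 2 * affinity p q)"
    unfolding minus[symmetric] plus[symmetric] by (rule cauchy_schwarz_sum)
  finally have "(2 * tv p q)\<^sup>2 \<le> (sqrt (2 - 2 * affinity p q) * sqrt (2 + 2 * affinity p q))\<^sup>2"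
    using tv_nonneg by (intro power_mono) auto
  also have "\<dots> = (2 - 2 * affinity p q) * (2 + 2 * affinity p q)"
    using affinity_le_1[OF assms] affinity_nonneg[of p q] by (simp add: power_mult_distrib)
  also have "\<dots> \<le> (2 - 2 * affinity p q) * 4"
    using affinity_le_1[OF assms] by (intro mult_left_mono) auto
  finally show ?thesis by (simp add: power_mult_distrib)
qed

text \<open>Cauchy-Schwarz on each fibre of \<open>f\<close>.\<close>

lemma affinity_map:
  assumes "finite (set_pmf p)" "finite (set_pmf q)"
  shows "affinity p q \<le> affinity (map_pmf f p) (map_pmf f q)"
proof -
  let ?F = "set_pmf p \<union> set_pmf q"
  have F: "finite ?F" using assms by auto
  have pm: "pmf (map_pmf f p) y = (\<Sum>x | x \<in> ?F \<and> f x = y. pmf p x)" "pmf (map_pmf f q) y = (\<Sum>x | x \<in> ?F \<and> f x = y. pmf q x)" for y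
    unfolding pmf_map by (intro prob_eq_sum_pmf; use F in auto)+
  have "affinity p q = (\<Sum>y\<in>f ` ?F. \<Sum>x | x \<in> ?F \<and> f x = y. sqrt (pmf p x * pmf q x))"
    unfolding affinity_def by (rule sum.image_gen[OF F])
  also have "\<dots> \<le> (\<Sum>y\<in>f ` ?F. sqrt (pmf (map_pmf f p) y * pmf (map_pmf f q) y))"
  proof (rule sum_mono)
    fix y
    have "(\<Sum>x | x \<in> ?F \<and> f x = y. sqrt (pmf p x) * sqrt (pmf q x))
        \<le> sqrt (\<Sum>x | x \<in> ?F \<and> f x = y. (sqrt (pmf p x))\<^sup>2) * sqrt (\<Sum>x | x \<in> ?F \<and> f x = y. (sqrt (pmf q x))\<^sup>2)"
      by (rule cauchy_schwarz_sum)
    then show "(\<Sum>x | x \<in> ?F \<and> f x = y. sqrt (pmf p x * pmf q x)) \<le> sqrt (pmf (map_pmf f p) y * pmf (map_pmf f q) y)"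
      by (simp add: pm real_sqrt_mult)
  qed
  also have "\<dots> = affinity (map_pmf f p) (map_pmf f q)"
    using F by (intro affinity_eq_sum[symmetric]) auto
  finally show ?thesis .
qed

lemma affinity_pair:
  assumes "finite (set_pmf p)" "finite (set_pmf q)" "finite (set_pmf p')" "finite (set_pmf q')"
  shows "affinity (pair_pmf p p') (pair_pmf q q') = affinity p q * affinity p' q'"
proof -
  let ?F = "set_pmf p \<union> set_pmf q" and ?F' = "set_pmf p' \<union> set_pmf q'"
  have "affinity (pair_pmf p p') (pair_pmf q q')
      = (\<Sum>x\<in>?F \<times> ?F'. sqrt (pmf (pair_pmf p p') x * pmf (pair_pmf q q') x))"
    using assms by (intro affinity_eq_sum) auto
  also have "\<dots> = (\<Sum>x\<in>?F. \<Sum>y\<in>?F'. sqrt (pmf p x * pmf q x) * sqrt (pmf p' y * pmf q' y))"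
    by (simp add: sum.cartesian_product' pmf_pair real_sqrt_mult[symmetric] mult_ac)
  finally show ?thesis by (simp add: affinity_def sum_product)
qed

lemma finite_set_Pi_pmf:
  assumes "finite K" "\<And>i. i \<in> K \<Longrightarrow> finite (set_pmf (p i))"
  shows "finite (set_pmf (Pi_pmf K d p))"
  using assms by (simp add: set_Pi_pmf finite_PiE_dflt)

text \<open>Splitting off one coordinate is invertible on the supports, so
  \<open>affinity_map\<close> used in both directions gives equality with the affinity of a pair,
  which factors.\<close>

lemma affinity_Pi_pmf:
  assumes "finite K" "\<And>i. i \<in> K \<Longrightarrow> finite (set_pmf (p i))" "\<And>i. i \<in> K \<Longrightarrow> finite (set_pmf (q i))"
  shows "affinity (Pi_pmf K d p) (Pi_pmf K d q) = (\<Prod>i\<in>K. affinity (p i) (q i))"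
  using assms
proof (induction K rule: finite_induct)
  case empty
  then show ?case by (simp add: affinity_def)
next
  case (insert x K)
  have fin: "finite (set_pmf (Pi_pmf K d p))" "finite (set_pmf (Pi_pmf K d q))"
    "finite (set_pmf (Pi_pmf (insert x K) d p))" "finite (set_pmf (Pi_pmf (insert x K) d q))"
    by (intro finite_set_Pi_pmf; use insert in auto)+
  have fwd: "Pi_pmf (insert x K) d r = map_pmf (\<lambda>(y, f). f(x := y)) (pair_pmf (r x) (Pi_pmf K d r))" for r
    using insert.hyps by (rule Pi_pmf_insert)
  have bwd: "map_pmf (\<lambda>f. (f x, f(x := d))) (Pi_pmf (insert x K) d r) = pair_pmf (r x) (Pi_pmf K d r)" for r :: "'a \<Rightarrow> 'b pmf"
  proof -
    have "map_pmf (\<lambda>f. (f x, f(x := d))) (Pi_pmf (insert x K) d r)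
        = map_pmf id (pair_pmf (r x) (Pi_pmf K d r))"
      unfolding fwd map_pmf_comp
    proof (rule map_pmf_cong[OF refl])
      fix z assume "z \<in> set_pmf (pair_pmf (r x) (Pi_pmf K d r))"
      then have "snd z x = d" using set_Pi_pmf_subset[OF insert.hyps(1), of d r] insert.hyps(2) by auto
      then show "((case z of (y, f) \<Rightarrow> f(x := y)) x, (case z of (y, f) \<Rightarrow> f(x := y))(x := d)) = id z"
        by (cases z) auto
    qed
    then show ?thesis by simp
  qed
  have "affinity (Pi_pmf (insert x K) d p) (Pi_pmf (insert x K) d q)
      = affinity (pair_pmf (p x) (Pi_pmf K d p)) (pair_pmf (q x) (Pi_pmf K d q))"
  proof (rule antisym)
    show "affinity (Pi_pmf (insert x K) d p) (Pi_pmf (insert x K) d q)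
        \<le> affinity (pair_pmf (p x) (Pi_pmf K d p)) (pair_pmf (q x) (Pi_pmf K d q))"
      unfolding bwd[symmetric] by (rule affinity_map) (use fin in auto)
    show "affinity (pair_pmf (p x) (Pi_pmf K d p)) (pair_pmf (q x) (Pi_pmf K d q))
        \<le> affinity (Pi_pmf (insert x K) d p) (Pi_pmf (insert x K) d q)"
      unfolding fwd using fin insert.prems by (intro affinity_map) auto
  qed
  also have "\<dots> = affinity (p x) (q x) * (\<Prod>i\<in>K. affinity (p i) (q i))"
    using fin insert by (subst affinity_pair) auto
  finally show ?case using insert.hyps by simp
qed

text \<open>Cauchy-Schwarz together with the bound of the squared difference of square roots by the
  absolute difference of the weights. The price is the square root of a total variation
  distance.\<close>

lemma affinity_perturb:
  assumes "finite (set_pmf p)" "finite (set_pmf p')" "finite (set_pmf q)"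
  shows "affinity p q \<le> affinity p' q + sqrt (2 * tv p p')"
proof -
  let ?F = "set_pmf p \<union> set_pmf p' \<union> set_pmf q"
  have F: "finite ?F" using assms by auto
  have sub: "set_pmf p \<subseteq> ?F" "set_pmf p' \<subseteq> ?F" "set_pmf q \<subseteq> ?F" by auto
  have "affinity p q - affinity p' q = (\<Sum>x\<in>?F. (sqrt (pmf p x) - sqrt (pmf p' x)) * sqrt (pmf q x))"
    using affinity_eq_sum[OF F sub(1,3)] affinity_eq_sum[OF F sub(2,3)]
    by (simp add: real_sqrt_mult sum_subtractf left_diff_distrib)
  also have "\<dots> \<le> sqrt (\<Sum>x\<in>?F. (sqrt (pmf p x) - sqrt (pmf p' x))\<^sup>2) * sqrt (\<Sum>x\<in>?F. (sqrt (pmf q x))\<^sup>2)"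
    by (rule cauchy_schwarz_sum)
  also have "(\<Sum>x\<in>?F. (sqrt (pmf q x))\<^sup>2) = 1" using F by (simp add: sum_pmf_eq_1)
  also have "(\<Sum>x\<in>?F. (sqrt (pmf p x) - sqrt (pmf p' x))\<^sup>2) \<le> (\<Sum>x\<in>?F. \<bar>pmf p x - pmf p' x\<bar>)"
  proof (rule sum_mono)
    fix x
    let ?a = "sqrt (pmf p x)" and ?b = "sqrt (pmf p' x)"
    have "(?a - ?b)\<^sup>2 = \<bar>?a - ?b\<bar> * \<bar>?a - ?b\<bar>" by (simp add: power2_eq_square)
    also have "\<dots> \<le> \<bar>?a - ?b\<bar> * \<bar>?a + ?b\<bar>"
    proof (rule mult_left_mono)
      have "0 \<le> ?a" "0 \<le> ?b" by simp_all
      then show "\<bar>?a - ?b\<bar> \<le> \<bar>?a + ?b\<bar>" by linarith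
    qed simp
    also have "\<dots> = \<bar>pmf p x - pmf p' x\<bar>"
      unfolding abs_mult[symmetric] by (simp add: algebra_simps)
    finally show "(?a - ?b)\<^sup>2 \<le> \<bar>pmf p x - pmf p' x\<bar>" .
  qed
  then have "sqrt (\<Sum>x\<in>?F. (sqrt (pmf p x) - sqrt (pmf p' x))\<^sup>2) * sqrt 1 \<le> sqrt (2 * tv p p')"
    using tv_eq_sum[OF F sub(1,2)] by simp
  finally show ?thesis by simp
qed

lemma affinity_sym: "affinity p q = affinity q p"
  by (simp add: affinity_def Un_commute mult.commute)

lemma affinity_perturb_both:
  assumes "finite (set_pmf p)" "finite (set_pmf p')" "finite (set_pmf q)" "finite (set_pmf q')"
    and "tv p p' \<le> e" "tv q q' \<le> e"
  shows "affinity p q \<le> affinity p' q' + 2 * sqrt (2 * e)"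
proof -
  have "sqrt (2 * tv p p') \<le> sqrt (2 * e)" "sqrt (2 * tv q q') \<le> sqrt (2 * e)" using assms by auto
  then show ?thesis
    using affinity_perturb[OF assms(1-3)] affinity_perturb[OF assms(3,4,2)]
      affinity_sym[of p' q] affinity_sym[of p' q'] by linarith
qed

lemma one_minus_prod_le:
  fixes b :: "'a \<Rightarrow> real"
  assumes "finite K" "\<And>i. i \<in> K \<Longrightarrow> 0 \<le> b i" "\<And>i. i \<in> K \<Longrightarrow> b i \<le> 1"
  shows "1 - (\<Prod>i\<in>K. b i) \<le> (\<Sum>i\<in>K. 1 - b i)"
  using assms
proof (induction K rule: finite_induct)
  case (insert x K)
  have P: "0 \<le> (\<Prod>i\<in>K. b i)" "(\<Prod>i\<in>K. b i) \<le> 1" using insert.prems by (auto intro: prod_nonneg prod_le_1)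
  have "(1 - b x) * (\<Prod>i\<in>K. b i) \<le> (1 - b x) * 1" using P insert.prems by (intro mult_left_mono) auto
  then show ?case using insert by (simp add: algebra_simps)
qed simp

text \<open>Since \<open>1 - b \<le> - ln b\<close>, a product of affinities bounded away from 0
  bounds the sum of all defects.\<close>

lemma sum_one_minus_le_ln_prod:
  fixes b :: "'a \<Rightarrow> real"
  assumes "finite K" "\<And>i. i \<in> K \<Longrightarrow> 0 \<le> b i" "0 < e" "e \<le> (\<Prod>i\<in>K. b i)"
  shows "(\<Sum>i\<in>K. 1 - b i) \<le> ln (1 / e)"
proof -
  have "(\<Prod>i\<in>K. b i) \<noteq> 0" using assms by linarith
  then have pos: "0 < b i" if "i \<in> K" for i using assms(1,2) that by (metis order_less_le prod_zero)
  then have nz: "b i \<noteq> 0" if "i \<in> K" for i using that by fastforce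
  have "(\<Sum>i\<in>K. 1 - b i) \<le> (\<Sum>i\<in>K. - ln (b i))"
    using pos by (intro sum_mono) (metis diff_le_eq le_diff_eq minus_diff_eq neg_le_iff_le add.commute ln_le_minus_one)
  also have "\<dots> = - ln (\<Prod>i\<in>K. b i)" using assms(1) nz by (simp add: ln_prod sum_negf)
  also have "\<dots> \<le> - ln e" using assms by simp
  finally show ?thesis using assms(3) by (simp add: ln_div)
qed

section \<open>Approximate independence of distant regions\<close>

text \<open>The clusters are the components of the graph joining sites of \<open>W\<close> at
  distance at most \<open>D\<close>. A component leaving the ball of radius \<open>D * k\<close>
  around one of its sites would, since each edge advances by at most \<open>D\<close>, meet each of
  the \<open>k\<close> annuli of width \<open>D\<close>; with the centre this makes
  \<open>k + 1\<close> sites, too many.\<close>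

lemma clusters:
  fixes W :: "'d::finite site set"
  assumes W: "finite W" and sparse: "\<And>x. x \<in> W \<Longrightarrow> card (W \<inter> lball x (D * k)) \<le> k"
  obtains R Cl where "R \<subseteq> W" "\<And>x. x \<in> R \<Longrightarrow> Cl x \<subseteq> W \<inter> lball x (D * k)" "W = (\<Union>x\<in>R. Cl x)"
    "\<And>x x' y y'. x \<in> R \<Longrightarrow> x' \<in> R \<Longrightarrow> x \<noteq> x' \<Longrightarrow> y \<in> Cl x \<Longrightarrow> y' \<in> Cl x' \<Longrightarrow> D < ldist y y'"
proof -
  define E where "E = {(x, y). x \<in> W \<and> y \<in> W \<and> ldist x y \<le> D}"
  have symE: "sym E" by (auto simp: E_def sym_def ldist_commute)
  have EW: "y \<in> W" if "(x, y) \<in> E\<^sup>*" "x \<in> W" for x y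
    using that by (induction rule: rtrancl_induct) (auto simp: E_def)
  have annulus: "\<exists>z\<in>W. D * j < ldist x z \<and> ldist x z \<le> D * (j + 1)"
    if "x \<in> W" "(x, y) \<in> E\<^sup>*" "D * j < ldist x y" for x y j
    using that(2,3)
  proof (induction rule: rtrancl_induct)
    case base
    then show ?case by simp
  next
    case (step y z)
    show ?case
    proof (cases "D * j < ldist x y")
      case False
      have "ldist x z \<le> ldist x y + ldist y z" by (rule ldist_triangle)
      also have "\<dots> \<le> D * j + D" using step.hyps(2) False by (intro add_mono) (auto simp: E_def)
      finally have "ldist x z \<le> D * (j + 1)" by simp
      then show ?thesis using step.prems step.hyps(2) by (auto simp: E_def)
    qed (rule step.IH)
  qed
  have near: "ldist x y \<le> D * k" if x: "x \<in> W" "(x, y) \<in> E\<^sup>*" for x y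
  proof (rule ccontr)
    assume far: "\<not> ldist x y \<le> D * k"
    have "\<exists>z\<in>W. D * j < ldist x z \<and> ldist x z \<le> D * (j + 1)" if "j < k" for j
    proof (rule annulus[OF x])
      have "D * j \<le> D * k" using that by (intro mult_left_mono) auto
      then show "D * j < ldist x y" using far by linarith
    qed
    then obtain z where z: "\<And>j. j < k \<Longrightarrow> z j \<in> W \<and> D * j < ldist x (z j) \<and> ldist x (z j) \<le> D * (j + 1)"
      by metis
    have lt: "ldist x (z i) < ldist x (z j)" if "i < j" "j < k" for i j
    proof -
      have "D * (i + 1) \<le> D * j" using that by (intro mult_left_mono) auto
      then show ?thesis using z[of i] z[of j] that by linarith
    qed
    then have inj: "inj_on z {..<k}" by (intro linorder_inj_onI) force+
    have "x \<notin> z ` {..<k}" using z by fastforce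
    then have "card (insert x (z ` {..<k})) = k + 1" using card_image[OF inj] by simp
    moreover have "insert x (z ` {..<k}) \<subseteq> W \<inter> lball x (D * k)"
    proof -
      have "ldist x (z j) \<le> D * k" if "j < k" for j
      proof -
        have "D * (j + 1) \<le> D * k" using that by (intro mult_left_mono) auto
        then show ?thesis using z[OF that] by linarith
      qed
      then show ?thesis using z x(1) by (auto simp: lball_def)
    qed
    ultimately have "k + 1 \<le> card (W \<inter> lball x (D * k))" using W by (metis card_mono finite_Int)
    then show False using sparse[OF x(1)] by simp
  qed
  define rep where "rep x = (SOME y. y \<in> E\<^sup>* `` {x})" for x
  have rep: "(x, rep x) \<in> E\<^sup>*" for x
    unfolding rep_def using someI[of "\<lambda>y. y \<in> E\<^sup>* `` {x}" x] by simp
  have sym': "(y, x) \<in> E\<^sup>*" if "(x, y) \<in> E\<^sup>*" for x y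
    using sym_rtrancl[OF symE] that by (auto dest: symD)
  have rep_eq: "rep x = rep y" if "(x, y) \<in> E\<^sup>*" for x y
  proof -
    have "E\<^sup>* `` {x} = E\<^sup>* `` {y}" using that sym' by (auto intro: rtrancl_trans)
    then show ?thesis by (simp add: rep_def)
  qed
  show thesis
  proof
    show "rep ` W \<subseteq> W" using rep EW by auto
    show "{y \<in> W. rep y = x} \<subseteq> W \<inter> lball x (D * k)" if "x \<in> rep ` W" for x
    proof
      fix y assume "y \<in> {y \<in> W. rep y = x}"
      then have "y \<in> W" "(x, y) \<in> E\<^sup>*" using sym'[OF rep[of y]] by auto
      moreover have "x \<in> W" using that rep EW by auto
      ultimately show "y \<in> W \<inter> lball x (D * k)" using near by (simp add: lball_def)
    qed
    show "W = (\<Union>x\<in>rep ` W. {y \<in> W. rep y = x})" by auto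
    fix x x' y y' assume "x \<noteq> x'" "y \<in> {y \<in> W. rep y = x}" "y' \<in> {y \<in> W. rep y = x'}"
    then show "D < ldist y y'" using rep_eq[of y y'] by (auto simp: E_def not_less[symmetric])
  qed
qed

section \<open>Laws on separated regions are nearly independent\<close>

context hardcore
begin

definition law :: "'d::finite site set \<Rightarrow> real \<Rightarrow> 'd site set \<Rightarrow> 'd site set pmf" where
  "law S t I = map_pmf (\<lambda>l. run l I) (updates S t)"

text \<open>The bound of \<open>propagation_bound\<close> summed over all sites of \<open>S\<close>:
  the chance that some site is influenced from further than \<open>r\<close> within time
  \<open>t\<close>.\<close>

definition leak :: "'d::finite site set \<Rightarrow> real \<Rightarrow> nat \<Rightarrow> real" where
  "leak S t r = (real (card S))\<^sup>2 * exp (2 * real CARD('d) * exp 1 * t - real r)"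

lemma leak_nonneg: "0 \<le> leak S t r"
  by (simp add: leak_def)

lemma leak_mono: "t \<le> t' \<Longrightarrow> leak S t r \<le> leak S t' r"
  by (auto simp: leak_def intro!: mult_left_mono)

lemma set_law:
  assumes "finite S" "0 \<le> t" "I \<in> indep_sets S"
  shows "set_pmf (law S t I) \<subseteq> indep_sets S"
  using assms run_indep_sets[OF set_updates] by (auto simp: law_def)

lemma finite_set_law:
  assumes "finite S" "0 \<le> t" "I \<in> indep_sets S"
  shows "finite (set_pmf (law S t I))"
  using finite_subset[OF set_law[OF assms] finite_indep_sets[OF assms(1)]] .

lemma law_add:
  assumes "finite S" "0 \<le> s" "0 \<le> t"
  shows "law S (t + s) I = bind_pmf (updates S s) (\<lambda>l. map_pmf (run l) (law S t I))"
proof -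
  have "law S (t + s) I = map_pmf (\<lambda>(a, b). run b (run a I)) (pair_pmf (updates S t) (updates S s))"
    unfolding law_def updates_append[OF assms(1,3,2), symmetric] map_pmf_comp
    by (intro map_pmf_cong refl) (auto simp: run_append)
  also have "\<dots> = bind_pmf (updates S s) (\<lambda>l. map_pmf (run l) (law S t I))"
    unfolding pair_pmf_def law_def map_pmf_def bind_assoc_pmf bind_return_pmf
    by (subst bind_commute_pmf) (simp add: bind_return_pmf)
  finally show ?thesis .
qed

definition proj :: "'i set \<Rightarrow> ('i \<Rightarrow> 'd::finite site set) \<Rightarrow> 'd site set \<Rightarrow> 'i \<Rightarrow> 'd site set" where
  "proj K A J = (\<lambda>i. if i \<in> K then J \<inter> A i else {})"

definition region_law :: "real \<Rightarrow> 'd::finite site set \<Rightarrow> ('i \<Rightarrow> 'd site set) \<Rightarrow> ('i \<Rightarrow> 'd site set) \<Rightarrow> 'i \<Rightarrow> 'd site set pmf" where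
  "region_law t I A G i = map_pmf (\<lambda>l. run l (I \<inter> G i) \<inter> A i) (updates (G i) t)"

lemma finite_set_region_law:
  assumes "finite (G i)" "0 \<le> t" "finite (A i)"
  shows "finite (set_pmf (region_law t I A G i))"
  by (rule finite_subset[of _ "Pow (A i)"]) (use assms in \<open>auto simp: region_law_def\<close>)

lemma finite_set_proj_law:
  assumes "finite S" "0 \<le> t" "I \<in> indep_sets S"
  shows "finite (set_pmf (map_pmf (proj K A) (law S t I)))"
  using finite_set_law[OF assms] by simp

text \<open>\<open>G i\<close> is a halo of width \<open>r\<close> around the observed set
  \<open>A i\<close>. Halos are disjoint, so the updates in them are independent.\<close>

definition separated :: "'d::finite site set \<Rightarrow> 'i set \<Rightarrow> ('i \<Rightarrow> 'd site set) \<Rightarrow> ('i \<Rightarrow> 'd site set) \<Rightarrow> nat \<Rightarrow> bool" where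
  "separated S K A G r \<longleftrightarrow> finite K \<and> (\<forall>i\<in>K. G i \<subseteq> S) \<and> (\<forall>i\<in>K. \<forall>j\<in>K. i \<noteq> j \<longrightarrow> G i \<inter> G j = {}) \<and>
    (\<forall>i\<in>K. \<forall>x\<in>A i. x \<in> S \<and> S \<inter> lball x r \<subseteq> G i)"

lemma separatedD:
  assumes "separated S K A G r" "finite S" "i \<in> K"
  shows "A i \<subseteq> G i" "finite (A i)" "finite (G i)"
proof -
  show AG: "A i \<subseteq> G i"
  proof
    fix x assume "x \<in> A i"
    then have "x \<in> S" "S \<inter> lball x r \<subseteq> G i" using assms by (auto simp: separated_def)
    then show "x \<in> G i" using self_in_lball[of x r] by blast
  qed
  show "finite (G i)" using assms by (auto simp: separated_def intro: finite_subset)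
  with AG show "finite (A i)" by (rule finite_subset)
qed

text \<open>Run the dynamics on all of \<open>S\<close> and on each halo alone with the same
  updates. The halo runs are independent by \<open>updates_split_family\<close>, and the two
  constructions differ on some \<open>A i\<close> only if information has crossed a halo.\<close>

lemma law_approx_product:
  fixes S :: "'d::finite site set" and A G :: "'i \<Rightarrow> 'd site set"
  assumes S: "finite S" and t: "0 \<le> t" and I: "I \<in> indep_sets S" and sep: "separated S K A G r"
  shows "tv (map_pmf (proj K A) (law S t I)) (Pi_pmf K {} (region_law t I A G)) \<le> leak S t r"
proof -
  have K: "finite K" and G: "\<And>i. i \<in> K \<Longrightarrow> G i \<subseteq> S"
    "\<And>i j. i \<in> K \<Longrightarrow> j \<in> K \<Longrightarrow> i \<noteq> j \<Longrightarrow> G i \<inter> G j = {}"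
    and A: "\<And>i x. i \<in> K \<Longrightarrow> x \<in> A i \<Longrightarrow> x \<in> S \<and> S \<inter> lball x r \<subseteq> G i"
    using sep by (simp_all add: separated_def)
  note AG = separatedD(1)[OF sep S]
  have AS: "A i \<subseteq> S" if "i \<in> K" for i using A[OF that] by auto
  note fin = separatedD(2,3)[OF sep S]
  let ?f = "\<lambda>l. proj K A (run l I)"
  let ?g = "\<lambda>l i. if i \<in> K then run (restr (G i) l) (I \<inter> G i) \<inter> A i else {}"
  let ?bad = "\<lambda>x l. \<exists>i\<in>K. x \<in> A i \<and> (x \<in> run l I) \<noteq> (x \<in> run (restr (G i) l) (I \<inter> G i))"
  have g: "map_pmf ?g (updates S t) = Pi_pmf K {} (region_law t I A G)"
    unfolding region_law_def[abs_def]
    using updates_split_family[OF K S t G(1) G(2), where dflt = "{}" and h = "\<lambda>i l. run l (I \<inter> G i) \<inter> A i"] by simp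
  have f: "map_pmf ?f (updates S t) = map_pmf (proj K A) (law S t I)"
    by (simp add: law_def map_pmf_comp)
  have "tv (map_pmf ?f (updates S t)) (map_pmf ?g (updates S t)) \<le> measure_pmf.prob (updates S t) {l. ?f l \<noteq> ?g l}"
  proof (rule tv_coupling)
    show "finite (set_pmf (map_pmf ?f (updates S t)))" unfolding f by (rule finite_set_proj_law[OF S t I])
    show "finite (set_pmf (map_pmf ?g (updates S t)))"
      unfolding g using K fin t by (intro finite_set_Pi_pmf finite_set_region_law)
  qed
  also have "\<dots> \<le> measure_pmf.prob (updates S t) (\<Union>x\<in>S. {l. ?bad x l})"
  proof (intro measure_pmf.finite_measure_mono)
    show "{l. ?f l \<noteq> ?g l} \<subseteq> (\<Union>x\<in>S. {l. ?bad x l})"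
    proof
      fix l assume "l \<in> {l. ?f l \<noteq> ?g l}"
      then obtain i where "?f l i \<noteq> ?g l i" by (auto simp: fun_eq_iff)
      then have i: "i \<in> K" "run l I \<inter> A i \<noteq> run (restr (G i) l) (I \<inter> G i) \<inter> A i"
        by (auto simp: proj_def split: if_splits)
      then obtain x where "x \<in> A i" "(x \<in> run l I) \<noteq> (x \<in> run (restr (G i) l) (I \<inter> G i))" by blast
      then show "l \<in> (\<Union>x\<in>S. {l. ?bad x l})" using i(1) AS by blast
    qed
  qed simp
  also have "\<dots> \<le> (\<Sum>x\<in>S. measure_pmf.prob (updates S t) {l. ?bad x l})"
    using S by (intro measure_pmf.finite_measure_subadditive_finite) auto
  also have "\<dots> \<le> (\<Sum>x\<in>S. exp (2 * real CARD('d) * exp 1 * t - real r) * real (card S))"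
  proof (rule sum_mono)
    fix x assume "x \<in> S"
    show "measure_pmf.prob (updates S t) {l. ?bad x l} \<le> exp (2 * real CARD('d) * exp 1 * t - real r) * real (card S)"
    proof (cases "\<exists>i\<in>K. x \<in> A i")
      case True
      then obtain i where i: "i \<in> K" "x \<in> A i" by blast
      have uniq: "j = i" if "j \<in> K" "x \<in> A j" for j
        using G(2)[OF i(1) that(1)] AG[OF i(1)] AG[OF that(1)] i that by blast
      have "{l. ?bad x l} = {l. (x \<in> run l I) \<noteq> (x \<in> run (restr (G i) l) (I \<inter> G i))}"
        using uniq i by blast
      then show ?thesis
        using propagation_bound[OF S t G(1)[OF i(1)] _ I, of x r] A[OF i] by simp
    next
      case False
      then have none: "{l. ?bad x l} = {}" by blast
      show ?thesis unfolding none by simp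
    qed
  qed
  also have "\<dots> = leak S t r" by (simp add: leak_def power2_eq_square)
  finally show ?thesis unfolding f g .
qed

lemma region_law_approx:
  fixes S :: "'d::finite site set" and A G :: "'i \<Rightarrow> 'd site set"
  assumes S: "finite S" and t: "0 \<le> t" and I: "I \<in> indep_sets S" and sep: "separated S K A G r" and i: "i \<in> K"
  shows "tv (map_pmf (\<lambda>J. J \<inter> A i) (law S t I)) (region_law t I A G i) \<le> leak S t r"
proof -
  have K: "finite K" using sep by (simp add: separated_def)
  note fin = separatedD(2,3)[OF sep S]
  have "map_pmf (\<lambda>f. f i) (map_pmf (proj K A) (law S t I)) = map_pmf (\<lambda>J. J \<inter> A i) (law S t I)"
    using i by (simp add: map_pmf_comp proj_def)
  moreover have "map_pmf (\<lambda>f. f i) (Pi_pmf K {} (region_law t I A G)) = region_law t I A G i"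
    using i K by (simp add: Pi_pmf_component)
  moreover have "tv (map_pmf (\<lambda>f. f i) (map_pmf (proj K A) (law S t I))) (map_pmf (\<lambda>f. f i) (Pi_pmf K {} (region_law t I A G)))
      \<le> tv (map_pmf (proj K A) (law S t I)) (Pi_pmf K {} (region_law t I A G))"
    using K fin t finite_set_law[OF S t I] by (intro tv_map finite_set_Pi_pmf finite_set_region_law) auto
  ultimately show ?thesis using law_approx_product[OF S t I sep] by simp
qed

text \<open>Both laws are within \<open>e\<close> of products. The products then have distance at
  most \<open>1 - \<epsilon> / 2\<close>, so their affinity, a product over \<open>K\<close>, is at
  least \<open>\<epsilon> / 2\<close>, and taking logarithms bounds the sum of the defects. The
  square roots come from returning to the true marginals.\<close>

lemma packing_bound:
  fixes S :: "'d::finite site set" and A G :: "'i \<Rightarrow> 'd site set"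
  assumes S: "finite S" and t: "0 \<le> t" "0 \<le> t'" and I: "I \<in> indep_sets S" "I' \<in> indep_sets S" and sep: "separated S K A G r"
    and e: "leak S t r \<le> e" "leak S t' r \<le> e" "4 * e \<le> \<epsilon>" "0 < \<epsilon>"
    and tv: "tv (law S t I) (law S t' I') \<le> 1 - \<epsilon>"
  shows "(\<Sum>i\<in>K. 1 - affinity (map_pmf (\<lambda>J. J \<inter> A i) (law S t I)) (map_pmf (\<lambda>J. J \<inter> A i) (law S t' I')))
    \<le> ln (2 / \<epsilon>) + real (card K) * (2 * sqrt (2 * e))"
proof -
  let ?p = "region_law t I A G" and ?q = "region_law t' I' A G"
  let ?b = "\<lambda>i. affinity (?p i) (?q i)"
  have K: "finite K" using sep by (simp add: separated_def)
  note fin = separatedD(2,3)[OF sep S]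
  have finp: "finite (set_pmf (?p i))" "finite (set_pmf (?q i))" if "i \<in> K" for i
    using fin[OF that] t by (auto intro: finite_set_region_law)
  have finP: "finite (set_pmf (Pi_pmf K {} ?p))" "finite (set_pmf (Pi_pmf K {} ?q))"
    using finp K by (auto intro: finite_set_Pi_pmf)
  have finL: "finite (set_pmf (law S t I))" "finite (set_pmf (law S t' I'))"
    using finite_set_law[OF S] t I by auto
  have "tv (Pi_pmf K {} ?p) (Pi_pmf K {} ?q) \<le> tv (Pi_pmf K {} ?p) (map_pmf (proj K A) (law S t I))
      + (tv (map_pmf (proj K A) (law S t I)) (map_pmf (proj K A) (law S t' I')) + tv (map_pmf (proj K A) (law S t' I')) (Pi_pmf K {} ?q))"
    using finP finL by (intro order_trans[OF tv_triangle add_left_mono[OF tv_triangle]]) auto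
  also have "\<dots> \<le> e + ((1 - \<epsilon>) + e)"
  proof (intro add_mono)
    show "tv (Pi_pmf K {} ?p) (map_pmf (proj K A) (law S t I)) \<le> e"
      using law_approx_product[OF S t(1) I(1) sep] e(1) by (subst tv_sym) simp
    show "tv (map_pmf (proj K A) (law S t' I')) (Pi_pmf K {} ?q) \<le> e"
      using law_approx_product[OF S t(2) I(2) sep] e(2) by simp
    show "tv (map_pmf (proj K A) (law S t I)) (map_pmf (proj K A) (law S t' I')) \<le> 1 - \<epsilon>"
      using tv_map[OF finL] tv by (rule order_trans)
  qed
  finally have "\<epsilon> / 2 \<le> 1 - tv (Pi_pmf K {} ?p) (Pi_pmf K {} ?q)" using e(3) by linarith
  also have "\<dots> \<le> (\<Prod>i\<in>K. ?b i)"
    using one_minus_tv_le_affinity[OF finP] affinity_Pi_pmf[OF K finp] by simp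
  finally have "(\<Sum>i\<in>K. 1 - ?b i) \<le> ln (1 / (\<epsilon> / 2))"
    using K e(4) affinity_nonneg by (intro sum_one_minus_le_ln_prod) auto
  moreover have "1 - affinity (map_pmf (\<lambda>J. J \<inter> A i) (law S t I)) (map_pmf (\<lambda>J. J \<inter> A i) (law S t' I'))
      \<le> (1 - ?b i) + 2 * sqrt (2 * e)" if i: "i \<in> K" for i
  proof -
    have "?b i \<le> affinity (map_pmf (\<lambda>J. J \<inter> A i) (law S t I)) (map_pmf (\<lambda>J. J \<inter> A i) (law S t' I')) + 2 * sqrt (2 * e)"
    proof (rule affinity_perturb_both)
      show "tv (?p i) (map_pmf (\<lambda>J. J \<inter> A i) (law S t I)) \<le> e"
        using region_law_approx[OF S t(1) I(1) sep i] e(1) by (subst tv_sym) simp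
      show "tv (?q i) (map_pmf (\<lambda>J. J \<inter> A i) (law S t' I')) \<le> e"
        using region_law_approx[OF S t(2) I(2) sep i] e(2) by (subst tv_sym) simp
    qed (use finp[OF i] finL in auto)
    then show ?thesis by linarith
  qed
  then have "(\<Sum>i\<in>K. 1 - affinity (map_pmf (\<lambda>J. J \<inter> A i) (law S t I)) (map_pmf (\<lambda>J. J \<inter> A i) (law S t' I')))
      \<le> (\<Sum>i\<in>K. (1 - ?b i) + 2 * sqrt (2 * e))" by (rule sum_mono)
  ultimately show ?thesis by (simp add: sum.distrib)
qed

text \<open>The opposite direction: small defects give small distance. From
  \<open>T^2 \<le> 2 * Y\<close> the free parameter \<open>\<delta>\<close> yields the bound
  \<open>\<delta> / 2 + Y / \<delta>\<close>, which is linear in the defects and can therefore be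
  averaged over a random set of regions.\<close>

lemma separated_tv_bound:
  fixes S :: "'d::finite site set" and A G :: "'i \<Rightarrow> 'd site set"
  assumes S: "finite S" and t: "0 \<le> t" "0 \<le> t'" and I: "I \<in> indep_sets S" "I' \<in> indep_sets S" and sep: "separated S K A G r"
    and e: "leak S t r \<le> e" "leak S t' r \<le> e" and \<delta>: "0 < \<delta>"
  shows "tv (map_pmf (proj K A) (law S t I)) (map_pmf (proj K A) (law S t' I')) \<le> 2 * e + \<delta> / 2
    + (\<Sum>i\<in>K. 1 - affinity (map_pmf (\<lambda>J. J \<inter> A i) (law S t I)) (map_pmf (\<lambda>J. J \<inter> A i) (law S t' I')) + 2 * sqrt (2 * e)) / \<delta>"
proof -
  let ?p = "region_law t I A G" and ?q = "region_law t' I' A G"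
  let ?b = "\<lambda>i. affinity (?p i) (?q i)"
  let ?c = "\<lambda>i. affinity (map_pmf (\<lambda>J. J \<inter> A i) (law S t I)) (map_pmf (\<lambda>J. J \<inter> A i) (law S t' I'))"
  have K: "finite K" using sep by (simp add: separated_def)
  note fin = separatedD(2,3)[OF sep S]
  have finp: "finite (set_pmf (?p i))" "finite (set_pmf (?q i))" if "i \<in> K" for i
    using fin[OF that] t by (auto intro: finite_set_region_law)
  have finP: "finite (set_pmf (Pi_pmf K {} ?p))" "finite (set_pmf (Pi_pmf K {} ?q))"
    using finp K by (auto intro: finite_set_Pi_pmf)
  have finL: "finite (set_pmf (law S t I))" "finite (set_pmf (law S t' I'))"
    using finite_set_law[OF S] t I by auto
  have b: "1 - ?b i \<le> 1 - ?c i + 2 * sqrt (2 * e)" if i: "i \<in> K" for i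
  proof -
    have "?c i \<le> ?b i + 2 * sqrt (2 * e)"
    proof (rule affinity_perturb_both)
      show "tv (map_pmf (\<lambda>J. J \<inter> A i) (law S t I)) (?p i) \<le> e"
        using region_law_approx[OF S t(1) I(1) sep i] e(1) by simp
      show "tv (map_pmf (\<lambda>J. J \<inter> A i) (law S t' I')) (?q i) \<le> e"
        using region_law_approx[OF S t(2) I(2) sep i] e(2) by simp
    qed (use finp[OF i] finL in auto)
    then show ?thesis by linarith
  qed
  define Y where "Y = (\<Sum>i\<in>K. 1 - ?c i + 2 * sqrt (2 * e))"
  have "(tv (Pi_pmf K {} ?p) (Pi_pmf K {} ?q))\<^sup>2 \<le> 2 * (1 - (\<Prod>i\<in>K. ?b i))"
    using tv_squared_le_affinity[OF finP] affinity_Pi_pmf[OF K finp] by simp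
  also have "1 - (\<Prod>i\<in>K. ?b i) \<le> (\<Sum>i\<in>K. 1 - ?b i)"
    by (intro one_minus_prod_le K affinity_nonneg affinity_le_1 finp)
  also have "\<dots> \<le> Y" unfolding Y_def using b by (intro sum_mono)
  finally have sq: "(tv (Pi_pmf K {} ?p) (Pi_pmf K {} ?q))\<^sup>2 \<le> 2 * Y" by simp
  have "tv (Pi_pmf K {} ?p) (Pi_pmf K {} ?q) \<le> \<delta> / 2 + Y / \<delta>"
  proof -
    let ?T = "tv (Pi_pmf K {} ?p) (Pi_pmf K {} ?q)"
    have "0 \<le> (?T - \<delta>)\<^sup>2" by simp
    then have "2 * \<delta> * ?T \<le> ?T\<^sup>2 + \<delta>\<^sup>2" by (simp add: power2_diff mult_ac)
    then have "2 * \<delta> * ?T \<le> 2 * Y + \<delta>\<^sup>2" using sq by linarith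
    then show ?thesis using \<delta> by (simp add: field_simps power2_eq_square)
  qed
  moreover have "tv (map_pmf (proj K A) (law S t I)) (map_pmf (proj K A) (law S t' I'))
    \<le> tv (map_pmf (proj K A) (law S t I)) (Pi_pmf K {} ?p) + (tv (Pi_pmf K {} ?p) (Pi_pmf K {} ?q) + tv (Pi_pmf K {} ?q) (map_pmf (proj K A) (law S t' I')))"
    using finP finL by (intro order_trans[OF tv_triangle add_left_mono[OF tv_triangle]]) auto
  moreover have "tv (map_pmf (proj K A) (law S t I)) (Pi_pmf K {} ?p) \<le> e"
    using law_approx_product[OF S t(1) I(1) sep] e(1) by simp
  moreover have "tv (Pi_pmf K {} ?q) (map_pmf (proj K A) (law S t' I')) \<le> e"
    using law_approx_product[OF S t(2) I(2) sep] e(2) by (subst tv_sym) simp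
  ultimately show ?thesis unfolding Y_def by linarith
qed

end

lemma expectation_weighted_sum:
  "measure_pmf.expectation M (\<lambda>l. \<Sum>x\<in>S. of_bool (P x l) * w x) = (\<Sum>x\<in>S. measure_pmf.prob M {l. P x l} * w x)"
proof -
  have "integrable (measure_pmf M) (\<lambda>l. of_bool (P x l) :: real)" for x
    by (rule integrable_pmf_bounded[where B = 1]) simp
  then have "measure_pmf.expectation M (\<lambda>l. \<Sum>x\<in>S. of_bool (P x l) * w x)
      = (\<Sum>x\<in>S. measure_pmf.expectation M (\<lambda>l. of_bool (P x l)) * w x)"
    by (subst Bochner_Integration.integral_sum) simp_all
  then show ?thesis by (simp only: expectation_of_bool)
qed

section \<open>Smoothing by the last updates\<close>

context hardcore
begin

definition region :: "'d::finite site set \<Rightarrow> nat \<Rightarrow> 'd site \<Rightarrow> 'd site set" where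
  "region S r x = S \<inter> lball x r"

text \<open>If the two extreme runs in \<open>B\<close> agree at \<open>x\<close>, the spin there is
  determined by the updates alone (\<open>run_coalesced_at\<close>).\<close>

definition undecided :: "'d::finite site set \<Rightarrow> 'd site \<Rightarrow> ('d site \<times> bool) list \<Rightarrow> bool" where
  "undecided B x l \<longleftrightarrow> (x \<in> run l (top_conf B)) \<noteq> (x \<in> run l (bot_conf B))"

definition bad_sites :: "'d::finite site set \<Rightarrow> nat \<Rightarrow> ('d site \<times> bool) list \<Rightarrow> 'd site set" where
  "bad_sites S r l = {x \<in> S. undecided (region S r x) x (restr (region S r x) l)}"

text \<open>A strictly local substitute for \<open>run\<close>: the spin at each site is computed
  from the updates and the initial spins in its own region. The resulting set need not be
  independent.\<close>

definition local_run :: "'d::finite site set \<Rightarrow> nat \<Rightarrow> ('d site \<times> bool) list \<Rightarrow> 'd site set \<Rightarrow> 'd site set" where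
  "local_run S r l J = {x \<in> S. x \<in> run (restr (region S r x) l) (J \<inter> region S r x)}"

lemma finite_region [simp]: "finite (region S r x)"
  by (simp add: region_def)

lemma region_subset: "region S r x \<subseteq> S"
  by (simp add: region_def)

lemma card_region: "card (region (S :: 'd::finite site set) r x) \<le> (2 * r + 1) ^ CARD('d)"
  using card_mono[of "lball x r" "region S r x"] card_lball[of x r] by (simp add: region_def)

lemma prob_undecided_le: "measure_pmf.prob (updates B s) {l. undecided B x l} \<le> not_coalesced B s"
  unfolding not_coalesced_def undecided_def by (intro measure_pmf.finite_measure_mono) auto

lemma prob_bad_site:
  assumes "finite S" "0 \<le> s"
  shows "measure_pmf.prob (updates S s) {l. x \<in> bad_sites S r l} \<le> not_coalesced (region S r x) s"
proof -
  have "measure_pmf.prob (updates S s) {l. x \<in> bad_sites S r l}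
      \<le> measure_pmf.prob (updates S s) (restr (region S r x) -` {l. undecided (region S r x) x l})"
    by (intro measure_pmf.finite_measure_mono) (auto simp: bad_sites_def)
  also have "\<dots> = measure_pmf.prob (map_pmf (restr (region S r x)) (updates S s)) {l. undecided (region S r x) x l}"
    by simp
  also have "\<dots> = measure_pmf.prob (updates (region S r x) s) {l. undecided (region S r x) x l}"
    by (simp only: updates_restr[OF assms(1) region_subset assms(2)])
  finally show ?thesis using prob_undecided_le by (rule order_trans)
qed

text \<open>Sites more than \<open>2 * r\<close> apart have disjoint regions, hence independent
  badness.\<close>

lemma prob_all_bad:
  assumes S: "finite S" and s: "0 \<le> s" and Y: "finite Y" and far: "\<And>y y'. y \<in> Y \<Longrightarrow> y' \<in> Y \<Longrightarrow> y \<noteq> y' \<Longrightarrow> 2 * r < ldist y y'"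
    and p: "\<And>y. not_coalesced (region S r y) s \<le> p"
  shows "measure_pmf.prob (updates S s) {l. Y \<subseteq> bad_sites S r l} \<le> p ^ card Y"
proof -
  let ?h = "\<lambda>y. undecided (region S r y) y"
  have disj: "region S r i \<inter> region S r j = {}" if "i \<in> Y" "j \<in> Y" "i \<noteq> j" for i j
    using disjoint_lballs[OF far[OF that]] by (auto simp: region_def)
  have "measure_pmf.prob (updates S s) {l. Y \<subseteq> bad_sites S r l}
      \<le> measure_pmf.prob (updates S s) ((\<lambda>l i. if i \<in> Y then ?h i (restr (region S r i) l) else False) -` Pi Y (\<lambda>_. {True}))"
    by (intro measure_pmf.finite_measure_mono) (auto simp: bad_sites_def)
  also have "\<dots> = measure_pmf.prob (map_pmf (\<lambda>l i. if i \<in> Y then ?h i (restr (region S r i) l) else False) (updates S s)) (Pi Y (\<lambda>_. {True}))"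
    by simp
  also have "\<dots> = measure_pmf.prob (Pi_pmf Y False (\<lambda>i. map_pmf (?h i) (updates (region S r i) s))) (Pi Y (\<lambda>_. {True}))"
    by (subst updates_split_family[where A = "region S r" and h = ?h, OF Y S s region_subset disj]) auto
  also have "\<dots> = (\<Prod>y\<in>Y. measure_pmf.prob (map_pmf (?h y) (updates (region S r y) s)) {True})"
    using Y by (rule measure_Pi_pmf_Pi)
  also have "\<dots> \<le> (\<Prod>y\<in>Y. p)"
  proof (rule prod_mono, intro conjI)
    fix y assume "y \<in> Y"
    have "measure_pmf.prob (map_pmf (?h y) (updates (region S r y) s)) {True} = measure_pmf.prob (updates (region S r y) s) {l. undecided (region S r y) y l}"
      by (simp add: vimage_def)
    also have "\<dots> \<le> p" using prob_undecided_le p by (rule order_trans)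
    finally show "measure_pmf.prob (map_pmf (?h y) (updates (region S r y) s)) {True} \<le> p" .
  qed simp
  finally show ?thesis by simp
qed

lemma local_run_approx:
  fixes S :: "'d::finite site set"
  assumes S: "finite S" and s: "0 \<le> s" and J: "J \<in> indep_sets S"
  shows "measure_pmf.prob (updates S s) {l. run l J \<noteq> local_run S r l J} \<le> leak S s r"
proof -
  let ?bad = "\<lambda>x l. (x \<in> run l J) \<noteq> (x \<in> run (restr (region S r x) l) (J \<inter> region S r x))"
  have "measure_pmf.prob (updates S s) {l. run l J \<noteq> local_run S r l J} \<le> measure_pmf.prob (updates S s) (\<Union>x\<in>S. {l. ?bad x l})"
  proof (rule measure_pmf.finite_measure_mono_AE, intro AE_pmfI impI)
    fix l assume l: "l \<in> set_pmf (updates S s)" "l \<in> {l. run l J \<noteq> local_run S r l J}"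
    have "run l J \<subseteq> S" using run_indep_sets[OF set_updates[OF S s l(1)] J] by (auto simp: indep_sets_def)
    then show "l \<in> (\<Union>x\<in>S. {l. ?bad x l})" using l(2) by (auto simp: local_run_def)
  qed simp
  also have "\<dots> \<le> (\<Sum>x\<in>S. measure_pmf.prob (updates S s) {l. ?bad x l})"
    using S by (intro measure_pmf.finite_measure_subadditive_finite) auto
  also have "\<dots> \<le> (\<Sum>x\<in>S. exp (2 * real CARD('d) * exp 1 * s - real r) * real (card S))"
    by (intro sum_mono propagation_bound[OF S s region_subset _ J]) (simp add: region_def)
  also have "\<dots> = leak S s r" by (simp add: leak_def power2_eq_square)
  finally show ?thesis .
qed

text \<open>At a site that is not bad, the sandwich between the extreme runs makes the initial spins
  irrelevant; only regions of bad sites read them.\<close>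

lemma local_run_support:
  "local_run S r l J = local_run S r l (J \<inter> (\<Union>x\<in>bad_sites S r l. region S r x))"
proof -
  let ?U = "\<Union>x\<in>bad_sites S r l. region S r x"
  have "x \<in> run (restr (region S r x) l) (J \<inter> region S r x) \<longleftrightarrow> x \<in> run (restr (region S r x) l) (J \<inter> ?U \<inter> region S r x)"
    if x: "x \<in> S" for x
  proof (cases "x \<in> bad_sites S r l")
    case True
    then have "J \<inter> ?U \<inter> region S r x = J \<inter> region S r x" by auto
    then show ?thesis by simp
  next
    case False
    then have "x \<in> run (restr (region S r x) l) (top_conf (region S r x)) \<longleftrightarrow> x \<in> run (restr (region S r x) l) (bot_conf (region S r x))"
      using x by (simp add: bad_sites_def undecided_def)
    from run_coalesced_at[OF this, of "J \<inter> region S r x"] run_coalesced_at[OF this, of "J \<inter> ?U \<inter> region S r x"]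
    show ?thesis by simp
  qed
  then show ?thesis by (auto simp: local_run_def)
qed

definition smoothed :: "'d::finite site set \<Rightarrow> nat \<Rightarrow> real \<Rightarrow> 'd site set pmf \<Rightarrow> 'd site set pmf" where
  "smoothed S r s M = bind_pmf (updates S s) (\<lambda>l. map_pmf (local_run S r l) M)"

lemma finite_set_smoothed: "finite S \<Longrightarrow> finite (set_pmf (smoothed S r s M))"
  by (rule finite_subset[of _ "Pow S"]) (auto simp: smoothed_def local_run_def)

lemma tv_law_smoothed:
  assumes S: "finite S" and s: "0 \<le> s" and t: "0 \<le> t" and I: "I \<in> indep_sets S"
  shows "tv (law S (t + s) I) (smoothed S r s (law S t I)) \<le> leak S s r"
proof -
  have fin: "finite (set_pmf (law S (t + s) I))" using finite_set_law[OF S _ I] s t by simp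
  have L: "law S (t + s) I = bind_pmf (law S t I) (\<lambda>J. map_pmf (\<lambda>l. run l J) (updates S s))"
    unfolding law_add[OF S s t] map_pmf_def by (rule bind_commute_pmf)
  have M: "smoothed S r s (law S t I) = bind_pmf (law S t I) (\<lambda>J. map_pmf (\<lambda>l. local_run S r l J) (updates S s))"
    unfolding smoothed_def map_pmf_def by (rule bind_commute_pmf)
  have "tv (law S (t + s) I) (smoothed S r s (law S t I)) \<le> measure_pmf.expectation (law S t I) (\<lambda>_. leak S s r)"
    unfolding L M
  proof (rule tv_bind_le)
    show "finite (set_pmf (bind_pmf (law S t I) (\<lambda>J. map_pmf (\<lambda>l. run l J) (updates S s))))"
      using fin unfolding L .
    show "finite (set_pmf (bind_pmf (law S t I) (\<lambda>J. map_pmf (\<lambda>l. local_run S r l J) (updates S s))))"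
      using finite_set_smoothed[OF S, of r s "law S t I"] unfolding M .
    fix J assume "J \<in> set_pmf (law S t I)"
    then have J: "J \<in> indep_sets S" using set_law[OF S t I] by blast
    show "tv (map_pmf (\<lambda>l. run l J) (updates S s)) (map_pmf (\<lambda>l. local_run S r l J) (updates S s)) \<le> leak S s r"
    proof (rule order_trans[OF tv_coupling local_run_approx[OF S s J]])
      show "finite (set_pmf (map_pmf (\<lambda>l. run l J) (updates S s)))"
        using finite_set_law[OF S s J] by (simp add: law_def)
      show "finite (set_pmf (map_pmf (\<lambda>l. local_run S r l J) (updates S s)))"
        by (rule finite_subset[of _ "Pow S"]) (use S in \<open>auto simp: local_run_def\<close>)
    qed
  qed simp
  then show ?thesis by simp
qed

definition local_gap :: "'d::finite site set \<Rightarrow> nat \<Rightarrow> 'd site set pmf \<Rightarrow> 'd site set pmf \<Rightarrow> 'd site \<Rightarrow> real" where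
  "local_gap S m M M' x = 1 - affinity (map_pmf (\<lambda>J. J \<inter> region S m x) M) (map_pmf (\<lambda>J. J \<inter> region S m x) M')"

lemma local_gap_nonneg: "finite (set_pmf M) \<Longrightarrow> finite (set_pmf M') \<Longrightarrow> 0 \<le> local_gap S m M M' x"
  unfolding local_gap_def using affinity_le_1[of "map_pmf (\<lambda>J. J \<inter> region S m x) M" "map_pmf (\<lambda>J. J \<inter> region S m x) M'"] by simp

lemma affinity_restrict_ge:
  assumes "finite (set_pmf M)" "finite (set_pmf M')" "A \<subseteq> region S m x"
  shows "1 - affinity (map_pmf (\<lambda>J. J \<inter> A) M) (map_pmf (\<lambda>J. J \<inter> A) M') \<le> local_gap S m M M' x"
proof -
  have "map_pmf (\<lambda>J. J \<inter> A) P = map_pmf (\<lambda>J. J \<inter> A) (map_pmf (\<lambda>J. J \<inter> region S m x) P)" for P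
  proof -
    have "J \<inter> region S m x \<inter> A = J \<inter> A" for J using assms(3) by blast
    then show ?thesis by (simp add: map_pmf_comp)
  qed
  then show ?thesis
    unfolding local_gap_def
    using affinity_map[of "map_pmf (\<lambda>J. J \<inter> region S m x) M" "map_pmf (\<lambda>J. J \<inter> region S m x) M'" "\<lambda>J. J \<inter> A"] assms(1,2)
    by simp
qed

text \<open>\<open>packing_bound\<close> needs disjoint halos of radius \<open>m + r\<close>, so it
  is applied to each residue class modulo \<open>2 * (m + r) + 1\<close>; the number of classes is
  the prefactor.\<close>

lemma sum_local_gap:
  fixes S :: "'d::finite site set"
  assumes S: "finite S" and t: "0 \<le> t" "0 \<le> t'" and I: "I \<in> indep_sets S" "I' \<in> indep_sets S"
    and e: "leak S t r \<le> e" "leak S t' r \<le> e" "4 * e \<le> \<epsilon>" "0 < \<epsilon>" "\<epsilon> \<le> 1"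
    and tv: "tv (law S t I) (law S t' I') \<le> 1 - \<epsilon>"
  shows "(\<Sum>x\<in>S. local_gap S m (law S t I) (law S t' I') x)
    \<le> real (2 * (m + r) + 1) ^ CARD('d) * (ln (2 / \<epsilon>) + real (card S) * (2 * sqrt (2 * e)))"
proof -
  let ?m = "2 * (m + r) + 1" and ?g = "local_gap S m (law S t I) (law S t' I')"
  let ?b = "ln (2 / \<epsilon>) + real (card S) * (2 * sqrt (2 * e))"
  have e0: "0 \<le> e" using e(1) leak_nonneg order_trans by blast
  have per_class: "(\<Sum>x | x \<in> S \<and> residue ?m x = \<rho>. ?g x) \<le> ?b" for \<rho>
  proof -
    let ?K = "{x \<in> S. residue ?m x = \<rho>}"
    have sep: "separated S ?K (region S m) (region S (m + r)) r"
      unfolding separated_def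
    proof (intro conjI ballI impI)
      fix i j assume ij: "i \<in> ?K" "j \<in> ?K" "i \<noteq> j"
      then have "?m \<le> ldist i j" by (intro ldist_ge_of_residue_eq) auto
      then show "region S (m + r) i \<inter> region S (m + r) j = {}"
        using disjoint_lballs[of "m + r" i j] by (auto simp: region_def)
    next
      fix i x assume "i \<in> ?K" "x \<in> region S m i"
      then show "x \<in> S" "S \<inter> lball x r \<subseteq> region S (m + r) i"
        using ldist_triangle[of i _ x] by (auto simp: region_def lball_def) (meson add_mono order_trans)
    qed (use S in \<open>auto simp: region_def\<close>)
    have "(\<Sum>x\<in>?K. ?g x) \<le> ln (2 / \<epsilon>) + real (card ?K) * (2 * sqrt (2 * e))"
      unfolding local_gap_def by (rule packing_bound[OF S t I sep e(1-4) tv])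
    also have "\<dots> \<le> ?b"
      using e0 S by (intro add_left_mono mult_right_mono) (auto intro!: card_mono)
    finally show ?thesis .
  qed
  have "(\<Sum>x\<in>S. ?g x) = (\<Sum>\<rho>\<in>residue ?m ` S. \<Sum>x | x \<in> S \<and> residue ?m x = \<rho>. ?g x)"
    by (rule sum.image_gen[OF S])
  also have "\<dots> \<le> (\<Sum>\<rho>\<in>residue ?m ` S. ?b)" by (intro sum_mono per_class)
  also have "\<dots> = real (card (residue ?m ` S)) * ?b" by simp
  also have "\<dots> \<le> real (?m ^ CARD('d)) * ?b"
  proof (rule mult_right_mono)
    show "real (card (residue ?m ` S)) \<le> real (?m ^ CARD('d))"
      using card_residues(2)[of ?m S] by (simp only: of_nat_le_iff)
    show "0 \<le> ?b" using e0 e(4,5) by (intro add_nonneg_nonneg mult_nonneg_nonneg) (auto simp: ln_ge_zero_iff)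
  qed
  finally show ?thesis by (simp only: of_nat_power)
qed

definition sparse :: "'d::finite site set \<Rightarrow> nat \<Rightarrow> nat \<Rightarrow> bool" where
  "sparse W D k \<longleftrightarrow> (\<forall>x\<in>W. card (W \<inter> lball x (D * k)) \<le> k)"

text \<open>Clusters of bad sites are more than \<open>4 * r\<close> apart, which leaves room for
  halos of radius \<open>2 * r\<close> around them. The region read by a cluster lies in a ball
  around its representative, itself a bad site, so the defects are bounded by a sum over bad sites.
  Its mean over the updates gains the small probability of being bad.\<close>

lemma tv_local_run_sparse:
  fixes S :: "'d::finite site set"
  assumes S: "finite S" and t: "0 \<le> t" "0 \<le> t'" and I: "I \<in> indep_sets S" "I' \<in> indep_sets S"
    and e: "leak S t r \<le> e" "leak S t' r \<le> e" and \<delta>: "0 < \<delta>"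
    and sparse: "sparse (bad_sites S r l) (4 * r) k"
  shows "tv (map_pmf (local_run S r l) (law S t I)) (map_pmf (local_run S r l) (law S t' I')) \<le> 2 * e + \<delta> / 2
    + (\<Sum>x\<in>bad_sites S r l. local_gap S (4 * r * k + r) (law S t I) (law S t' I') x + 2 * sqrt (2 * e)) / \<delta>"
proof -
  let ?W = "bad_sites S r l" and ?U = "\<Union>x\<in>bad_sites S r l. region S r x"
  let ?P = "law S t I" and ?Q = "law S t' I'"
  have WS: "?W \<subseteq> S" by (auto simp: bad_sites_def)
  have finW: "finite ?W" using WS S by (rule finite_subset)
  have finL: "finite (set_pmf ?P)" "finite (set_pmf ?Q)" using finite_set_law[OF S] t I by auto
  have e0: "0 \<le> e" using e(1) leak_nonneg order_trans by blast
  obtain R Cl where R: "R \<subseteq> ?W" and Cl: "\<And>x. x \<in> R \<Longrightarrow> Cl x \<subseteq> ?W \<inter> lball x (4 * r * k)"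
    and cover: "?W = (\<Union>x\<in>R. Cl x)"
    and far: "\<And>x x' y y'. x \<in> R \<Longrightarrow> x' \<in> R \<Longrightarrow> x \<noteq> x' \<Longrightarrow> y \<in> Cl x \<Longrightarrow> y' \<in> Cl x' \<Longrightarrow> 4 * r < ldist y y'"
    using clusters[OF finW, of "4 * r" k] sparse unfolding sparse_def by blast
  define A where "A x = (\<Union>y\<in>Cl x. region S r y)" for x
  define G where "G x = (\<Union>y\<in>Cl x. region S (2 * r) y)" for x
  have finR: "finite R" using R finW by (rule finite_subset)
  have sep: "separated S R A G r"
    unfolding separated_def
  proof (intro conjI ballI impI finR)
    show "G i \<subseteq> S" for i by (auto simp: G_def region_def)
    fix i j assume ij: "i \<in> R" "j \<in> R" "i \<noteq> j"
    have "lball y (2 * r) \<inter> lball y' (2 * r) = {}" if "y \<in> Cl i" "y' \<in> Cl j" for y y'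
      using far[OF ij that] by (intro disjoint_lballs) simp
    then show "G i \<inter> G j = {}" unfolding G_def region_def by blast
  next
    fix i x assume "i \<in> R" "x \<in> A i"
    then obtain y where y: "y \<in> Cl i" "x \<in> S" "ldist y x \<le> r" by (auto simp: A_def region_def lball_def)
    show "x \<in> S" by (rule y(2))
    show "S \<inter> lball x r \<subseteq> G i"
    proof
      fix z assume "z \<in> S \<inter> lball x r"
      then have "z \<in> region S (2 * r) y" using ldist_triangle[of y z x] y(3) by (simp add: region_def lball_def)
      then show "z \<in> G i" using y(1) by (auto simp: G_def)
    qed
  qed
  have AU: "J \<inter> ?U = (\<Union>i\<in>R. proj R A J i)" for J
    unfolding cover A_def proj_def by auto
  have Aball: "A x \<subseteq> region S (4 * r * k + r) x" if "x \<in> R" for x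
  proof
    fix z assume "z \<in> A x"
    then obtain y where y: "y \<in> Cl x" "z \<in> S" "ldist y z \<le> r" by (auto simp: A_def region_def lball_def)
    then have "ldist x y \<le> 4 * r * k" using Cl[OF that] by (auto simp: lball_def)
    then show "z \<in> region S (4 * r * k + r) x" using y ldist_triangle[of x z y] by (simp add: region_def lball_def)
  qed
  have eq: "map_pmf (local_run S r l) M = map_pmf (\<lambda>f. local_run S r l (\<Union>i\<in>R. f i)) (map_pmf (proj R A) M)" for M
    unfolding map_pmf_comp by (intro map_pmf_cong refl) (metis local_run_support AU)
  have "tv (map_pmf (local_run S r l) ?P) (map_pmf (local_run S r l) ?Q) \<le> tv (map_pmf (proj R A) ?P) (map_pmf (proj R A) ?Q)"
    unfolding eq[of ?P] eq[of ?Q] using finL by (intro tv_map) auto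
  also have "\<dots> \<le> 2 * e + \<delta> / 2
    + (\<Sum>i\<in>R. 1 - affinity (map_pmf (\<lambda>J. J \<inter> A i) ?P) (map_pmf (\<lambda>J. J \<inter> A i) ?Q) + 2 * sqrt (2 * e)) / \<delta>"
    by (rule separated_tv_bound[OF S t I sep e \<delta>])
  also have "\<dots> \<le> 2 * e + \<delta> / 2 + (\<Sum>x\<in>?W. local_gap S (4 * r * k + r) ?P ?Q x + 2 * sqrt (2 * e)) / \<delta>"
  proof (intro add_left_mono divide_right_mono)
    have "(\<Sum>i\<in>R. 1 - affinity (map_pmf (\<lambda>J. J \<inter> A i) ?P) (map_pmf (\<lambda>J. J \<inter> A i) ?Q) + 2 * sqrt (2 * e))
        \<le> (\<Sum>i\<in>R. local_gap S (4 * r * k + r) ?P ?Q i + 2 * sqrt (2 * e))"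
      using affinity_restrict_ge[OF finL Aball] by (intro sum_mono add_right_mono) auto
    also have "\<dots> \<le> (\<Sum>x\<in>?W. local_gap S (4 * r * k + r) ?P ?Q x + 2 * sqrt (2 * e))"
      using R finW e0 local_gap_nonneg[OF finL] by (intro sum_mono2) auto
    finally show "(\<Sum>i\<in>R. 1 - affinity (map_pmf (\<lambda>J. J \<inter> A i) ?P) (map_pmf (\<lambda>J. J \<inter> A i) ?Q) + 2 * sqrt (2 * e))
        \<le> (\<Sum>x\<in>?W. local_gap S (4 * r * k + r) ?P ?Q x + 2 * sqrt (2 * e))" .
  qed (use \<delta> in auto)
  finally show ?thesis .
qed

text \<open>A pigeonhole argument over the residue classes modulo \<open>2 r + 1\<close> extracts from a dense cluster
  many bad sites with disjoint regions, for which badness is independent.\<close>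

lemma prob_not_sparse:
  fixes S :: "'d::finite site set" and r q :: nat
  assumes S: "finite S" and s: "0 \<le> s" and p: "\<And>y. not_coalesced (region S r y) s \<le> p"
  defines "k \<equiv> (2 * r + 1) ^ CARD('d) * q"
  shows "measure_pmf.prob (updates S s) {l. \<not> sparse (bad_sites S r l) (4 * r) k}
    \<le> real (card S) * (real (2 * (4 * r * k) + 1) ^ CARD('d) * p) ^ q"
proof -
  let ?m = "2 * r + 1" and ?N = "(2 * (4 * r * k) + 1) ^ CARD('d)"
  define F where "F x = {Y. Y \<subseteq> lball x (4 * r * k) \<and> card Y = q \<and> (\<forall>y\<in>Y. \<forall>y'\<in>Y. y \<noteq> y' \<longrightarrow> 2 * r < ldist y y')}"
    for x :: "'d site"
  have p0: "0 \<le> p" using p[of undefined] by (rule order_trans[rotated]) (simp add: not_coalesced_def)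
  have finF: "finite (F x)" for x by (rule finite_subset[of _ "Pow (lball x (4 * r * k))"]) (auto simp: F_def)
  have cardF: "real (card (F x)) \<le> real ?N ^ q" for x
  proof -
    have "card (F x) \<le> card {Y. Y \<subseteq> lball x (4 * r * k) \<and> card Y = q}"
      by (rule card_mono) (auto simp: F_def)
    also have "\<dots> = card (lball x (4 * r * k)) choose q" by (rule n_subsets) simp
    also have "\<dots> \<le> card (lball x (4 * r * k)) ^ q" 
    proof (cases "q \<le> card (lball x (4 * r * k))")
      case True
      then show ?thesis by (rule binomial_le_pow)
    qed (simp add: binomial_eq_0)
    also have "\<dots> \<le> ?N ^ q" by (intro power_mono card_lball) simp
    finally show ?thesis by (simp only: of_nat_power[symmetric] of_nat_le_iff)
  qed
  have "{l. \<not> sparse (bad_sites S r l) (4 * r) k} \<subseteq> (\<Union>x\<in>S. \<Union>Y\<in>F x. {l. Y \<subseteq> bad_sites S r l})"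
  proof
    fix l assume "l \<in> {l. \<not> sparse (bad_sites S r l) (4 * r) k}"
    then obtain x where x: "x \<in> bad_sites S r l" and dense: "k < card (bad_sites S r l \<inter> lball x (4 * r * k))"
      by (auto simp: sparse_def not_le)
    let ?X = "bad_sites S r l \<inter> lball x (4 * r * k)"
    have "\<exists>\<rho>. q \<le> card {y \<in> ?X. residue ?m y = \<rho>}"
    proof (rule ccontr)
      assume "\<not> ?thesis"
      then have lt: "card {y \<in> ?X. residue ?m y = \<rho>} \<le> q" for \<rho> by (meson linear)
      have "card ?X = (\<Sum>y\<in>?X. 1)" by simp
      also have "\<dots> = (\<Sum>\<rho>\<in>residue ?m ` ?X. \<Sum>y | y \<in> ?X \<and> residue ?m y = \<rho>. 1)"
        by (rule sum.image_gen) simp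
      also have "\<dots> \<le> (\<Sum>\<rho>\<in>residue ?m ` ?X. q)"
        using lt by (intro sum_mono) simp
      also have "\<dots> = card (residue ?m ` ?X) * q" by simp
      also have "\<dots> \<le> ?m ^ CARD('d) * q" using card_residues(2)[of ?m ?X] by (intro mult_right_mono) auto
      finally show False using dense by (simp add: k_def)
    qed
    then obtain \<rho> where "q \<le> card {y \<in> ?X. residue ?m y = \<rho>}" by blast
    then obtain Y where Y: "Y \<subseteq> {y \<in> ?X. residue ?m y = \<rho>}" "card Y = q" "finite Y"
      by (rule obtain_subset_with_card_n)
    have far: "\<forall>y\<in>Y. \<forall>y'\<in>Y. y \<noteq> y' \<longrightarrow> 2 * r < ldist y y'"
    proof (intro ballI impI)
      fix y y' assume y: "y \<in> Y" "y' \<in> Y" "y \<noteq> y'"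
      have "residue ?m y = \<rho>" "residue ?m y' = \<rho>" using subsetD[OF Y(1)] y(1,2) by simp_all
      then have "?m \<le> ldist y y'" using y(3) by (intro ldist_ge_of_residue_eq) simp_all
      then show "2 * r < ldist y y'" by linarith
    qed
    have sub: "Y \<subseteq> lball x (4 * r * k)" "Y \<subseteq> bad_sites S r l"
      using Y(1) by (rule subset_trans, simp add: subset_iff)+
    have "Y \<in> F x" unfolding F_def mem_Collect_eq by (intro conjI sub(1) Y(2) far)
    moreover note sub(2)
    moreover have "x \<in> S" using x by (simp add: bad_sites_def)
    ultimately show "l \<in> (\<Union>x\<in>S. \<Union>Y\<in>F x. {l. Y \<subseteq> bad_sites S r l})" by blast
  qed
  then have "measure_pmf.prob (updates S s) {l. \<not> sparse (bad_sites S r l) (4 * r) k}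
      \<le> measure_pmf.prob (updates S s) (\<Union>x\<in>S. \<Union>Y\<in>F x. {l. Y \<subseteq> bad_sites S r l})"
    by (intro measure_pmf.finite_measure_mono) auto
  also have "\<dots> \<le> (\<Sum>x\<in>S. measure_pmf.prob (updates S s) (\<Union>Y\<in>F x. {l. Y \<subseteq> bad_sites S r l}))"
    using S by (intro measure_pmf.finite_measure_subadditive_finite) auto
  also have "\<dots> \<le> (\<Sum>x\<in>S. \<Sum>Y\<in>F x. measure_pmf.prob (updates S s) {l. Y \<subseteq> bad_sites S r l})"
    using finF by (intro sum_mono measure_pmf.finite_measure_subadditive_finite) auto
  also have "\<dots> \<le> (\<Sum>x\<in>S. \<Sum>Y\<in>F x. p ^ q)"
  proof (intro sum_mono)
    fix x Y assume "Y \<in> F x"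
    then have Y: "Y \<subseteq> lball x (4 * r * k)" "card Y = q" "\<And>y y'. y \<in> Y \<Longrightarrow> y' \<in> Y \<Longrightarrow> y \<noteq> y' \<Longrightarrow> 2 * r < ldist y y'"
      by (auto simp: F_def)
    have finY: "finite Y" using Y(1) by (rule finite_subset) simp
    have "measure_pmf.prob (updates S s) {l. Y \<subseteq> bad_sites S r l} \<le> p ^ card Y"
      by (rule prob_all_bad[OF S s finY _ p]) (rule Y(3))
    then show "measure_pmf.prob (updates S s) {l. Y \<subseteq> bad_sites S r l} \<le> p ^ q"
      unfolding Y(2) .
  qed
  also have "\<dots> = (\<Sum>x\<in>S. real (card (F x)) * p ^ q)" by simp
  also have "\<dots> \<le> (\<Sum>x\<in>S. real ?N ^ q * p ^ q)"
    using cardF p0 by (intro sum_mono mult_right_mono) auto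
  finally show ?thesis by (simp add: power_mult_distrib mult.assoc)
qed

text \<open>Given the updates of the last period, the configuration is nearly a fixed function of
  the one before, so the distance is averaged over these updates. Of \<open>4 * e\<close>, half
  comes from replacing the two laws by their smoothed versions and half from
  \<open>tv_local_run_sparse\<close>.\<close>

lemma tv_after_smoothing:
  fixes S :: "'d::finite site set" and r q :: nat
  assumes S: "finite S" and t: "0 \<le> t" "0 \<le> t'" and s: "0 \<le> s" and I: "I \<in> indep_sets S" "I' \<in> indep_sets S"
    and e: "leak S t r \<le> e" "leak S t' r \<le> e" "leak S s r \<le> e" and \<delta>: "0 < \<delta>"
    and p: "\<And>y. not_coalesced (region S r y) s \<le> p"
  defines "k \<equiv> (2 * r + 1) ^ CARD('d) * q"
  shows "tv (law S (t + s) I) (law S (t' + s) I') \<le> 4 * e + \<delta> / 2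
    + real (card S) * (real (2 * (4 * r * k) + 1) ^ CARD('d) * p) ^ q
    + p * (\<Sum>x\<in>S. local_gap S (4 * r * k + r) (law S t I) (law S t' I') x + 2 * sqrt (2 * e)) / \<delta>"
proof -
  let ?P = "law S t I" and ?Q = "law S t' I'"
  let ?h = "\<lambda>x. local_gap S (4 * r * k + r) ?P ?Q x + 2 * sqrt (2 * e)"
  let ?B = "bad_sites S r"
  \<comment> \<open>A bound on the distance for a given update list; lists whose bad sites are not
    sparse are charged the trivial bound 1.\<close>
  define g where "g l = of_bool (\<not> sparse (?B l) (4 * r) k) + (2 * e + \<delta> / 2 + (\<Sum>x\<in>S. of_bool (x \<in> ?B l) * ?h x) / \<delta>)" for l
  have e0: "0 \<le> e" using e(1) leak_nonneg order_trans by blast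
  have finL: "finite (set_pmf ?P)" "finite (set_pmf ?Q)" using finite_set_law[OF S] t I by auto
  have h0: "0 \<le> ?h x" for x using local_gap_nonneg[OF finL] e0 by simp
  have int1: "integrable (updates S s) (\<lambda>l. of_bool (Pr l) :: real)" for Pr
    by (rule integrable_pmf_bounded[where B = 1]) simp
  have int2: "integrable (updates S s) (\<lambda>l. (\<Sum>x\<in>S. of_bool (x \<in> ?B l) * ?h x) / \<delta>)"
    using int1 by (intro integrable_divide_zero Bochner_Integration.integrable_sum integrable_mult_left) auto
  have int: "integrable (updates S s) g"
    unfolding g_def using int1 int2 by (intro Bochner_Integration.integrable_add) auto
  have "tv (smoothed S r s ?P) (smoothed S r s ?Q) \<le> measure_pmf.expectation (updates S s) g"
    unfolding smoothed_def
  proof (rule tv_bind_le)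
    show "finite (set_pmf (updates S s \<bind> (\<lambda>l. map_pmf (local_run S r l) M)))" for M :: "'d site set pmf"
      using finite_set_smoothed[OF S] unfolding smoothed_def .
    then show "finite (set_pmf (updates S s \<bind> (\<lambda>l. map_pmf (local_run S r l) M)))" for M :: "'d site set pmf" .
    show "integrable (updates S s) g" by (rule int)
    fix l
    have sum_eq: "(\<Sum>x\<in>?B l. ?h x) = (\<Sum>x\<in>S. of_bool (x \<in> ?B l) * ?h x)"
      using S by (intro sum.mono_neutral_cong_left) (auto simp: bad_sites_def)
    have nn: "0 \<le> 2 * e + \<delta> / 2 + (\<Sum>x\<in>S. of_bool (x \<in> ?B l) * ?h x) / \<delta>"
    proof -
      have "0 \<le> (\<Sum>x\<in>S. of_bool (x \<in> ?B l) * ?h x)" by (intro sum_nonneg mult_nonneg_nonneg[OF _ h0]) simp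
      then show ?thesis using e0 \<delta> by simp
    qed
    show "tv (map_pmf (local_run S r l) ?P) (map_pmf (local_run S r l) ?Q) \<le> g l"
    proof (cases "sparse (?B l) (4 * r) k")
      case True
      then show ?thesis
        using tv_local_run_sparse[OF S t I e(1,2) \<delta> True] unfolding g_def sum_eq by simp
    next
      case False
      have "tv (map_pmf (local_run S r l) ?P) (map_pmf (local_run S r l) ?Q) \<le> 1"
        using finL by (intro tv_le_1) auto
      then show ?thesis using False nn by (simp add: g_def)
    qed
  qed
  also have "measure_pmf.expectation (updates S s) g = measure_pmf.prob (updates S s) {l. \<not> sparse (?B l) (4 * r) k}
      + (2 * e + \<delta> / 2 + (\<Sum>x\<in>S. measure_pmf.prob (updates S s) {l. x \<in> ?B l} * ?h x) / \<delta>)"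
  proof -
    have X: "measure_pmf.expectation (updates S s) (\<lambda>l. (\<Sum>x\<in>S. of_bool (x \<in> ?B l) * ?h x) / \<delta>)
        = (\<Sum>x\<in>S. measure_pmf.prob (updates S s) {l. x \<in> ?B l} * ?h x) / \<delta>"
      unfolding integral_divide_zero expectation_weighted_sum ..
    let ?X = "\<lambda>l. (\<Sum>x\<in>S. of_bool (x \<in> ?B l) * ?h x) / \<delta>"
    have const: "integrable (updates S s) (\<lambda>l. 2 * e + \<delta> / 2)" by simp
    have "measure_pmf.expectation (updates S s) g = measure_pmf.expectation (updates S s) (\<lambda>l. of_bool (\<not> sparse (?B l) (4 * r) k))
        + measure_pmf.expectation (updates S s) (\<lambda>l. (2 * e + \<delta> / 2) + ?X l)"
      unfolding g_def by (rule Bochner_Integration.integral_add[OF int1 Bochner_Integration.integrable_add[OF const int2]])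
    also have "measure_pmf.expectation (updates S s) (\<lambda>l. (2 * e + \<delta> / 2) + ?X l)
        = measure_pmf.expectation (updates S s) (\<lambda>l. 2 * e + \<delta> / 2) + measure_pmf.expectation (updates S s) ?X"
      by (rule Bochner_Integration.integral_add[OF const int2])
    also have "measure_pmf.expectation (updates S s) (\<lambda>l. 2 * e + \<delta> / 2) = 2 * e + \<delta> / 2" by simp
    finally show ?thesis unfolding X expectation_of_bool .
  qed
  also have "\<dots> \<le> real (card S) * (real (2 * (4 * r * k) + 1) ^ CARD('d) * p) ^ q
      + (2 * e + \<delta> / 2 + (\<Sum>x\<in>S. p * ?h x) / \<delta>)"
  proof (intro add_mono order_refl divide_right_mono sum_mono mult_right_mono)
    show "measure_pmf.prob (updates S s) {l. \<not> sparse (?B l) (4 * r) k}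
        \<le> real (card S) * (real (2 * (4 * r * k) + 1) ^ CARD('d) * p) ^ q"
      unfolding k_def by (rule prob_not_sparse[OF S s p])
    show "measure_pmf.prob (updates S s) {l. x \<in> ?B l} \<le> p" for x
      using prob_bad_site[OF S s] p by (rule order_trans)
  qed (use h0 \<delta> in auto)
  finally have main: "tv (smoothed S r s ?P) (smoothed S r s ?Q) \<le> real (card S) * (real (2 * (4 * r * k) + 1) ^ CARD('d) * p) ^ q
      + (2 * e + \<delta> / 2 + (\<Sum>x\<in>S. p * ?h x) / \<delta>)" .
  have fs: "finite (set_pmf (smoothed S r s M))" for M by (rule finite_set_smoothed[OF S])
  have fl: "finite (set_pmf (law S (t + s) I))" "finite (set_pmf (law S (t' + s) I'))"
    using finite_set_law[OF S] t s I by auto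
  have "tv (law S (t + s) I) (law S (t' + s) I') \<le> tv (law S (t + s) I) (smoothed S r s ?P)
      + (tv (smoothed S r s ?P) (smoothed S r s ?Q) + tv (smoothed S r s ?Q) (law S (t' + s) I'))"
    using fs fl by (intro order_trans[OF tv_triangle add_left_mono[OF tv_triangle]])
  moreover have "tv (law S (t + s) I) (smoothed S r s ?P) \<le> e"
    using tv_law_smoothed[OF S s t(1) I(1)] e(3) by (rule order_trans)
  moreover have "tv (smoothed S r s ?Q) (law S (t' + s) I') \<le> e"
    using tv_law_smoothed[OF S s t(2) I(2)] e(3) by (subst tv_sym) (rule order_trans)
  ultimately show ?thesis using main by (simp add: sum_distrib_left)
qed

end

section \<open>The law of the graphical construction\<close>

definition ring_measure :: "(real \<times> real) measure" where
  "ring_measure = density lborel (\<lambda>s. ennreal (exponential_density 1 s)) \<Otimes>\<^sub>M uniform_measure lborel {0..1}"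

lemma clock_space_eq: "clock_space \<Lambda> = (\<Pi>\<^sub>M i\<in>\<Lambda> \<times> UNIV. ring_measure)"
  by (simp add: clock_space_def ring_measure_def)

lemma prob_space_exp: "prob_space (density lborel (\<lambda>s. ennreal (exponential_density 1 s)))"
  by (rule prob_space_exponential_density) simp

lemma prob_space_unif: "prob_space (uniform_measure lborel {0..1 :: real})"
  by (rule prob_space_uniform_measure) auto

interpretation ring: pair_prob_space "density lborel (\<lambda>s. ennreal (exponential_density 1 s))" "uniform_measure lborel {0..1 :: real}"
  unfolding pair_prob_space_def pair_sigma_finite_def
  using prob_space_exp prob_space_unif by (simp add: prob_space_imp_sigma_finite)

lemma prob_space_ring_measure: "prob_space ring_measure"
  unfolding ring_measure_def by (rule ring.prob_space_axioms)

lemma space_ring_measure [simp]: "space ring_measure = UNIV"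
  by (simp add: ring_measure_def space_pair_measure)

lemma sets_ring_measure [measurable_cong]: "sets ring_measure = sets (borel \<Otimes>\<^sub>M borel)"
  unfolding ring_measure_def by (intro sets_pair_measure_cong) auto

lemma nn_integral_ring_measure:
  assumes [measurable]: "f \<in> borel_measurable borel" "g \<in> borel_measurable borel"
  shows "(\<integral>\<^sup>+z. f (fst z) * g (snd z) \<partial>ring_measure)
    = (\<integral>\<^sup>+s. ennreal (exponential_density 1 s) * f s \<partial>lborel) * (\<integral>\<^sup>+u. g u * indicator {0..1} u \<partial>lborel)"
proof -
  have "(\<integral>\<^sup>+z. f (fst z) * g (snd z) \<partial>ring_measure)
      = (\<integral>\<^sup>+s. \<integral>\<^sup>+u. f s * g u \<partial>uniform_measure lborel {0..1} \<partial>density lborel (\<lambda>s. ennreal (exponential_density 1 s)))"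
    unfolding ring_measure_def by (subst ring.M2.nn_integral_fst[symmetric]) auto
  also have "\<dots> = (\<integral>\<^sup>+s. f s * (\<integral>\<^sup>+u. g u * indicator {0..1} u \<partial>lborel) \<partial>density lborel (\<lambda>s. ennreal (exponential_density 1 s)))"
    by (simp add: nn_integral_cmult nn_integral_uniform_measure divide_ennreal_def)
  also have "\<dots> = (\<integral>\<^sup>+s. f s \<partial>density lborel (\<lambda>s. ennreal (exponential_density 1 s))) * (\<integral>\<^sup>+u. g u * indicator {0..1} u \<partial>lborel)"
    by (subst nn_integral_multc) auto
  finally show ?thesis by (simp add: nn_integral_density)
qed

lemma shift_sets:
  fixes s :: real
  assumes "F \<in> sets (borel \<Otimes>\<^sub>M (borel :: real measure))"
  shows "{z. s < fst z \<and> (fst z - s, snd z) \<in> F} \<in> sets (borel \<Otimes>\<^sub>M borel)"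
proof -
  have "(\<lambda>z :: real \<times> real. (fst z - s, snd z)) \<in> measurable (borel \<Otimes>\<^sub>M borel) (borel \<Otimes>\<^sub>M borel)" by measurable
  from measurable_sets[OF this assms]
  have A: "{z. (fst z - s, snd z) \<in> F} \<in> sets (borel \<Otimes>\<^sub>M borel)" by (simp add: vimage_def space_pair_measure)
  have "{z \<in> space (borel \<Otimes>\<^sub>M (borel :: real measure)). s < fst z} \<in> sets (borel \<Otimes>\<^sub>M borel)" by measurable
  then have B: "{z :: real \<times> real. s < fst z} \<in> sets (borel \<Otimes>\<^sub>M borel)" by (simp add: space_pair_measure)
  from sets.Int[OF B A] show ?thesis by (simp add: Collect_conj_eq[symmetric])
qed

text \<open>The memoryless property of the exponential law, with the mark carried along.\<close>

lemma ring_measure_shift: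
  assumes "0 \<le> s" and F: "F \<in> sets (borel \<Otimes>\<^sub>M borel)"
  shows "emeasure ring_measure {z. s < fst z \<and> (fst z - s, snd z) \<in> F} = ennreal (exp (- s)) * emeasure ring_measure F"
proof -
  have [measurable]: "F \<in> sets (borel \<Otimes>\<^sub>M borel)" by (rule F)
  let ?G = "{z. s < fst z \<and> (fst z - s, snd z) \<in> F}"
  have G[measurable]: "?G \<in> sets (borel \<Otimes>\<^sub>M borel)" by (rule shift_sets[OF F])
  have alt: "emeasure ring_measure H
      = (\<integral>\<^sup>+u. \<integral>\<^sup>+a. ennreal (exponential_density 1 a) * indicator H (a, u) \<partial>lborel \<partial>uniform_measure lborel {0..1})"
    if [measurable]: "H \<in> sets (borel \<Otimes>\<^sub>M borel)" for H :: "(real \<times> real) set"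
  proof -
    have "emeasure ring_measure H = (\<integral>\<^sup>+z. indicator H z \<partial>ring_measure)"
      using that by (simp add: sets_ring_measure)
    also have "\<dots> = (\<integral>\<^sup>+u. \<integral>\<^sup>+a. indicator H (a, u) \<partial>density lborel (\<lambda>s. ennreal (exponential_density 1 s)) \<partial>uniform_measure lborel {0..1})"
      unfolding ring_measure_def by (rule ring.nn_integral_snd[symmetric]) measurable
    finally show ?thesis by (simp add: nn_integral_density)
  qed
  have "(\<integral>\<^sup>+a. ennreal (exponential_density 1 a) * indicator ?G (a, u) \<partial>lborel)
      = ennreal (exp (- s)) * (\<integral>\<^sup>+a. ennreal (exponential_density 1 a) * indicator F (a, u) \<partial>lborel)" for u
  proof -
    have "(\<integral>\<^sup>+a. ennreal (exponential_density 1 a) * indicator ?G (a, u) \<partial>lborel)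
        = (\<integral>\<^sup>+a. ennreal (exponential_density 1 (s + 1 * a)) * indicator ?G (s + 1 * a, u) \<partial>lborel)"
      by (subst nn_integral_real_affine[where c = 1 and t = s]) auto
    also have "\<dots> = (\<integral>\<^sup>+a. ennreal (exp (- s)) * (ennreal (exponential_density 1 a) * indicator F (a, u)) \<partial>lborel)"
    proof (rule nn_integral_cong_AE)
      show "AE a in lborel. ennreal (exponential_density 1 (s + 1 * a)) * indicator ?G (s + 1 * a, u)
        = ennreal (exp (- s)) * (ennreal (exponential_density 1 a) * indicator F (a, u))"
        using AE_lborel_singleton[of "0 :: real"]
      proof eventually_elim
        case (elim a)
        show ?case
        proof (cases "a < 0")
          case False
          then have "0 < a" using elim by simp
          then show ?thesis using assms(1)
            by (auto simp: exponential_density_def indicator_def ennreal_mult''[symmetric] exp_add[symmetric] add.commute)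
        qed (simp add: exponential_density_def)
      qed
    qed
    also have "\<dots> = ennreal (exp (- s)) * (\<integral>\<^sup>+a. ennreal (exponential_density 1 a) * indicator F (a, u) \<partial>lborel)"
      by (rule nn_integral_cmult) measurable
    finally show ?thesis .
  qed
  then show ?thesis unfolding alt[OF G] alt[OF \<open>F \<in> sets (borel \<Otimes>\<^sub>M borel)\<close>] by (simp add: nn_integral_cmult)
qed

lemma ring_measure_greater: "0 \<le> s \<Longrightarrow> emeasure ring_measure {z. s < fst z} = ennreal (exp (- s))"
  using ring_measure_shift[of s UNIV] prob_space.emeasure_space_1[OF prob_space_ring_measure]
    sets.top[of "borel \<Otimes>\<^sub>M (borel :: real measure)"] by (simp add: space_pair_measure)

lemma AE_ring_measure_pos: "AE z in ring_measure. 0 < fst z"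
proof -
  have "emeasure ring_measure {z. 0 < fst z} = 1" using ring_measure_greater[of 0] by simp
  then have "prob_space.prob ring_measure {z. 0 < fst z} = 1" by (simp add: measure_def)
  then show ?thesis
    using prob_space.AE_prob_1[OF prob_space_ring_measure, of "{z. 0 < fst z}"] by simp
qed

text \<open>After the first ring, at site \<open>x\<close> and time \<open>s\<close>, the remaining waiting times form a fresh
  family once ring \<open>k + 1\<close> of \<open>x\<close> is renumbered \<open>k\<close> and \<open>s\<close> is subtracted from the first waiting
  time of every other site.\<close>

definition renumber :: "'d::finite site \<Rightarrow> 'd site \<times> nat \<Rightarrow> 'd site \<times> nat" where
  "renumber x = (\<lambda>(y, k). if y = x then (y, Suc k) else (y, k))"

definition later :: "'d::finite site set \<Rightarrow> 'd site \<Rightarrow> real \<Rightarrow> ('d site \<times> nat \<Rightarrow> real \<times> real) \<Rightarrow> 'd site \<times> nat \<Rightarrow> real \<times> real" where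
  "later \<Lambda> x s X = (\<lambda>i\<in>\<Lambda> \<times> UNIV. if fst i \<noteq> x \<and> snd i = 0
    then (fst (X (renumber x i)) - s, snd (X (renumber x i))) else X (renumber x i))"

lemma renumber_bij: "x \<in> \<Lambda> \<Longrightarrow> bij_betw (renumber x) (\<Lambda> \<times> UNIV) (\<Lambda> \<times> UNIV - {(x, 0)})"
proof -
  assume x: "x \<in> \<Lambda>"
  show ?thesis
    by (rule bij_betw_byWitness[where f' = "\<lambda>(y, k). if y = x then (y, k - 1) else (y, k)"])
      (use x in \<open>auto simp: renumber_def split: if_splits\<close>)
qed

text \<open>That the other \<open>card \<Lambda> - 1\<close> clocks do not ring up to time
  \<open>s\<close> has probability \<open>exp (- (card \<Lambda> - 1) * s)\<close>; given this,
  memorylessness makes the remaining waiting times a fresh copy of the whole family.\<close>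

lemma emeasure_later:
  fixes \<Lambda> :: "'d::finite site set"
  assumes fin: "finite \<Lambda>" and x: "x \<in> \<Lambda>" and s: "0 \<le> s" and E: "E \<in> sets (clock_space \<Lambda>)"
  defines "P \<equiv> (\<Pi>\<^sub>M i\<in>\<Lambda> \<times> UNIV - {(x, 0)}. ring_measure)"
  shows "{X \<in> space P. (\<forall>y\<in>\<Lambda> - {x}. s < fst (X (y, 0))) \<and> later \<Lambda> x s X \<in> E} \<in> sets P"
    and "emeasure P {X \<in> space P. (\<forall>y\<in>\<Lambda> - {x}. s < fst (X (y, 0))) \<and> later \<Lambda> x s X \<in> E}
      = ennreal (exp (- (real (card \<Lambda>) - 1) * s)) * emeasure (clock_space \<Lambda>) E"
proof -
  let ?I = "\<Lambda> \<times> (UNIV :: nat set)" and ?I' = "\<Lambda> \<times> UNIV - {(x, 0 :: nat)}"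
  define L0 where "L0 = (\<lambda>y. (y, 0 :: nat)) ` (\<Lambda> - {x})"
  interpret product_prob_space "\<lambda>_ :: 'd site \<times> nat. ring_measure" ?I
    using prob_space_ring_measure by (intro product_prob_spaceI)
  interpret Q: product_prob_space "\<lambda>_ :: 'd site \<times> nat. ring_measure" ?I'
    using prob_space_ring_measure by (intro product_prob_spaceI)
  have ren: "renumber x i \<in> ?I'" if "i \<in> ?I" for i
    using renumber_bij[OF x] that by (auto simp: bij_betw_def)
  have ren0: "renumber x i = i" if "i \<in> L0" for i using that by (auto simp: renumber_def L0_def split: if_splits)
  have later_meas[measurable]: "later \<Lambda> x s \<in> measurable P (clock_space \<Lambda>)"
    unfolding clock_space_eq later_def[abs_def]
  proof (rule measurable_restrict)
    fix i assume i: "i \<in> ?I"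
    have c[measurable]: "(\<lambda>X. X (renumber x i)) \<in> measurable P ring_measure"
      unfolding P_def by (rule measurable_component_singleton[OF ren[OF i]])
    have [measurable]: "(\<lambda>X. X (renumber x i)) \<in> measurable P (borel \<Otimes>\<^sub>M borel)"
      using c by (simp cong: measurable_cong_sets[OF refl sets_ring_measure])
    have "(\<lambda>X. if fst i \<noteq> x \<and> snd i = 0 then (fst (X (renumber x i)) - s, snd (X (renumber x i))) else X (renumber x i))
      \<in> measurable P (borel \<Otimes>\<^sub>M borel)" by measurable
    then show "(\<lambda>X. if fst i \<noteq> x \<and> snd i = 0 then (fst (X (renumber x i)) - s, snd (X (renumber x i))) else X (renumber x i))
      \<in> measurable P ring_measure"
      by (simp cong: measurable_cong_sets[OF refl sets_ring_measure])
  qed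
  define A where "A = {X \<in> space P. \<forall>y\<in>\<Lambda> - {x}. s < fst (X (y, 0))}"
  have A[measurable]: "A \<in> sets P"
  proof -
    have "{X \<in> space P. s < fst (X (y, 0))} \<in> sets P" if "y \<in> \<Lambda> - {x}" for y
    proof -
      have "(\<lambda>X. X (y, 0 :: nat)) \<in> measurable P ring_measure"
        unfolding P_def by (rule measurable_component_singleton) (use that in auto)
      then have [measurable]: "(\<lambda>X. X (y, 0 :: nat)) \<in> measurable P (borel \<Otimes>\<^sub>M borel)"
        by (simp cong: measurable_cong_sets[OF refl sets_ring_measure])
      show ?thesis by measurable
    qed
    then show ?thesis unfolding A_def using fin by (intro sets.sets_Collect_finite_All) auto
  qed
  have set_eq: "{X \<in> space P. (\<forall>y\<in>\<Lambda> - {x}. s < fst (X (y, 0))) \<and> later \<Lambda> x s X \<in> E'} = A \<inter> (later \<Lambda> x s -` E' \<inter> space P)" for E'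
    by (auto simp: A_def)
  show "{X \<in> space P. (\<forall>y\<in>\<Lambda> - {x}. s < fst (X (y, 0))) \<and> later \<Lambda> x s X \<in> E} \<in> sets P"
    unfolding set_eq using E by (intro sets.Int A measurable_sets[OF later_meas])
  let ?c = "ennreal (exp ((real (card \<Lambda>) - 1) * s))"
  have cc: "?c * ennreal (exp (- (real (card \<Lambda>) - 1) * s)) = 1"
    by (simp add: ennreal_mult''[symmetric] exp_add[symmetric] algebra_simps)
  \<comment> \<open>The image measure, rescaled by the inverse probability of the conditioning
    event. It is identified with the clock measure by comparing them on cylinder sets.\<close>
  define N where "N = scale_measure ?c (distr (density P (indicator A)) (clock_space \<Lambda>) (later \<Lambda> x s))"
  have N_em: "emeasure N E' = ?c * emeasure P (A \<inter> (later \<Lambda> x s -` E' \<inter> space P))" if E': "E' \<in> sets (clock_space \<Lambda>)" for E'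
  proof -
    have m: "later \<Lambda> x s -` E' \<inter> space P \<in> sets P" by (rule measurable_sets[OF later_meas E'])
    have "emeasure (distr (density P (indicator A)) (clock_space \<Lambda>) (later \<Lambda> x s)) E'
        = emeasure (density P (indicator A)) (later \<Lambda> x s -` E' \<inter> space P)"
      using E' later_meas by (subst emeasure_distr) (simp_all add: measurable_def)
    also have "\<dots> = (\<integral>\<^sup>+X. indicator A X * indicator (later \<Lambda> x s -` E' \<inter> space P) X \<partial>P)"
      using m by (subst emeasure_density) auto
    also have "\<dots> = emeasure P (A \<inter> (later \<Lambda> x s -` E' \<inter> space P))"
      using m A by (simp add: indicator_inter_arith[symmetric])
    finally show ?thesis by (simp add: N_def)
  qed
  have "N = (\<Pi>\<^sub>M i\<in>?I. ring_measure)"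
  proof (rule PiM_eq)
    show "sets N = sets (\<Pi>\<^sub>M i\<in>?I. ring_measure)" by (simp add: N_def clock_space_eq)
    fix J F assume J: "finite J" "J \<subseteq> ?I" and F: "\<And>j. j \<in> J \<Longrightarrow> F j \<in> sets ring_measure"
    let ?E = "prod_emb ?I (\<lambda>_. ring_measure) J (\<Pi>\<^sub>E j\<in>J. F j)"
    have E': "?E \<in> sets (clock_space \<Lambda>)" unfolding clock_space_eq using J F by (intro sets_PiM_I) auto
    \<comment> \<open>The cylinder condition on coordinate \<open>i\<close> pulled back to
      coordinate \<open>renumber x i\<close>. First waiting times of the other sites carry the extra
      condition that they exceed \<open>s\<close>, even when \<open>J\<close> does not test them;
      hence \<open>K\<close> below contains all of \<open>L0\<close>.\<close>
    define C where "C i = (if i \<in> L0 then {z. s < fst z \<and> (i \<in> J \<longrightarrow> (fst z - s, snd z) \<in> F i)} else F i)" for i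
    define K where "K = J \<union> L0"
    have K: "finite K" "K \<subseteq> ?I" using J fin by (auto simp: K_def L0_def)
    have inj: "inj_on (renumber x) K" using renumber_bij[OF x] K(2) by (auto simp: bij_betw_def intro: inj_on_subset)
    have Cm: "C i \<in> sets ring_measure" if "i \<in> K" for i
    proof -
      have "i \<in> J \<Longrightarrow> F i \<in> sets (borel \<Otimes>\<^sub>M borel)" using F[of i] by (simp add: sets_ring_measure)
      then have "C i \<in> sets (borel \<Otimes>\<^sub>M borel)"
        using that[unfolded K_def] shift_sets[of "F i" s] shift_sets[of UNIV s] sets.top[of "borel \<Otimes>\<^sub>M (borel :: real measure)"]
        unfolding C_def by (cases "i \<in> J"; cases "i \<in> L0") (simp_all add: space_pair_measure)
      then show ?thesis by (simp add: sets_ring_measure)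
    qed
    have later_val: "later \<Lambda> x s X i = (if i \<in> L0 then (fst (X i) - s, snd (X i)) else X (renumber x i))" if "i \<in> ?I" for X i
      using that by (cases i) (auto simp: later_def renumber_def L0_def)
    have eq: "A \<inter> (later \<Lambda> x s -` ?E \<inter> space P)
        = prod_emb ?I' (\<lambda>_. ring_measure) (renumber x ` K) (\<Pi>\<^sub>E j\<in>renumber x ` K. C (inv_into K (renumber x) j))"
    proof (rule set_eqI)
      fix X
      have l: "later \<Lambda> x s X \<in> extensional ?I" by (simp add: later_def)
      have "X \<in> A \<inter> (later \<Lambda> x s -` ?E \<inter> space P) \<longleftrightarrow>
          X \<in> space P \<and> (\<forall>i\<in>L0. s < fst (X i)) \<and> (\<forall>i\<in>J. later \<Lambda> x s X i \<in> F i)"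
        using J(2) l by (auto simp: A_def L0_def prod_emb_iff PiE_iff)
      also have "\<dots> \<longleftrightarrow> X \<in> space P \<and> (\<forall>i\<in>K. X (renumber x i) \<in> C i)"
      proof (intro conj_cong refl)
        have A1: "s < fst (X i) \<and> (i \<in> J \<longrightarrow> later \<Lambda> x s X i \<in> F i) \<longleftrightarrow> X (renumber x i) \<in> C i" if "i \<in> L0" for i
        proof -
          have "i \<in> ?I" using that K(2) by (auto simp: K_def)
          from later_val[OF this, of X] that show ?thesis by (simp only: C_def ren0[OF that] if_True mem_Collect_eq)
        qed
        have A2: "later \<Lambda> x s X i \<in> F i \<longleftrightarrow> X (renumber x i) \<in> C i" if "i \<in> J" "i \<notin> L0" for i
        proof -
          have "i \<in> ?I" using that J(2) by blast
          from later_val[OF this, of X] that(2) show ?thesis by (simp only: C_def if_False)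
        qed
        show "(\<forall>i\<in>L0. s < fst (X i)) \<and> (\<forall>i\<in>J. later \<Lambda> x s X i \<in> F i) \<longleftrightarrow> (\<forall>i\<in>K. X (renumber x i) \<in> C i)"
          (is "?l \<longleftrightarrow> ?r")
        proof
          assume l: ?l
          show ?r
          proof
            fix i assume "i \<in> K"
            then show "X (renumber x i) \<in> C i"
              using l A1[of i] A2[of i] by (cases "i \<in> L0") (simp_all add: K_def)
          qed
        next
          assume r: ?r
          show ?l
          proof (intro conjI ballI)
            show "s < fst (X i)" if "i \<in> L0" for i using r A1[of i] that by (simp add: K_def)
            show "later \<Lambda> x s X i \<in> F i" if "i \<in> J" for i
              using r A1[of i] A2[of i] that by (cases "i \<in> L0") (simp_all add: K_def)
          qed
        qed
      qed
      also have "\<dots> \<longleftrightarrow> X \<in> prod_emb ?I' (\<lambda>_. ring_measure) (renumber x ` K) (\<Pi>\<^sub>E j\<in>renumber x ` K. C (inv_into K (renumber x) j))"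
      proof -
        have "(\<forall>i\<in>K. X (renumber x i) \<in> C i) \<longleftrightarrow>
            restrict X (renumber x ` K) \<in> (\<Pi>\<^sub>E j\<in>renumber x ` K. C (inv_into K (renumber x) j))"
          by (simp add: restrict_PiE_iff Pi_iff inv_into_f_f[OF inj])
        then show ?thesis unfolding P_def space_PiM prod_emb_iff by (simp add: PiE_iff)
      qed
      finally show "X \<in> A \<inter> (later \<Lambda> x s -` ?E \<inter> space P) \<longleftrightarrow> \<dots>" .
    qed
    have "emeasure P (A \<inter> (later \<Lambda> x s -` ?E \<inter> space P))
        = (\<Prod>j\<in>renumber x ` K. emeasure ring_measure (C (inv_into K (renumber x) j)))"
      unfolding eq unfolding P_def
    proof (rule Q.emeasure_PiM_emb)
      show "renumber x ` K \<subseteq> ?I'"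
        by (rule image_subsetI, rule ren, rule subsetD[OF K(2)])
      fix j assume "j \<in> renumber x ` K"
      then obtain i where "i \<in> K" "j = renumber x i" by blast
      then show "C (inv_into K (renumber x) j) \<in> sets ring_measure" using Cm[of i] by (simp only: inv_into_f_f[OF inj])
    next
      show "finite (renumber x ` K)" using K(1) by (rule finite_imageI)
    qed
    also have "\<dots> = (\<Prod>i\<in>K. emeasure ring_measure (C i))"
      unfolding prod.reindex[OF inj] by (rule prod.cong[OF refl]) (simp only: o_apply inv_into_f_f[OF inj])
    also have "\<dots> = (\<Prod>i\<in>K. (if i \<in> L0 then ennreal (exp (- s)) else 1) * (if i \<in> J then emeasure ring_measure (F i) else 1))"
    proof (rule prod.cong[OF refl])
      fix i assume i: "i \<in> K"
      show "emeasure ring_measure (C i) = (if i \<in> L0 then ennreal (exp (- s)) else 1) * (if i \<in> J then emeasure ring_measure (F i) else 1)"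
      proof (cases "i \<in> L0")
        case True
        then show ?thesis
          using ring_measure_shift[OF s, of "F i"] ring_measure_greater[OF s] F[of i]
          by (auto simp: C_def sets_ring_measure)
      next
        case False
        then have "i \<in> J" using i by (auto simp: K_def)
        then show ?thesis using False by (auto simp: C_def)
      qed
    qed
    also have "\<dots> = (\<Prod>i\<in>K. if i \<in> L0 then ennreal (exp (- s)) else 1) * (\<Prod>i\<in>K. if i \<in> J then emeasure ring_measure (F i) else 1)"
      by (rule prod.distrib)
    also have "(\<Prod>i\<in>K. if i \<in> J then emeasure ring_measure (F i) else 1) = (\<Prod>j\<in>J. emeasure ring_measure (F j))"
      using K(1) by (intro prod.mono_neutral_cong_right) (auto simp: K_def)
    also have "(\<Prod>i\<in>K. if i \<in> L0 then ennreal (exp (- s)) else 1) = (\<Prod>i\<in>L0. ennreal (exp (- s)))"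
      using K(1) by (intro prod.mono_neutral_cong_right) (auto simp: K_def)
    also have "\<dots> = ennreal (exp (- (real (card \<Lambda>) - 1) * s))"
    proof -
      have "card L0 = card \<Lambda> - 1" unfolding L0_def using x fin by (subst card_image) (auto simp: inj_on_def)
      moreover have "1 \<le> card \<Lambda>" using x fin by (metis One_nat_def Suc_leI card_gt_0_iff empty_iff)
      ultimately have "real (card L0) = real (card \<Lambda>) - 1" by (simp add: of_nat_diff)
      have "(\<Prod>i\<in>L0. ennreal (exp (- s))) = ennreal (exp (- s) ^ card L0)" by (simp add: ennreal_power)
      also have "exp (- s) ^ card L0 = exp (real (card L0) * - s)" by (rule exp_of_nat_mult[symmetric])
      also have "real (card L0) * - s = - (real (card \<Lambda>) - 1) * s"
        unfolding \<open>real (card L0) = _\<close> by (simp add: algebra_simps)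
      finally show ?thesis .
    qed
    finally have PE: "emeasure P (A \<inter> (later \<Lambda> x s -` ?E \<inter> space P))
      = ennreal (exp (- (real (card \<Lambda>) - 1) * s)) * (\<Prod>j\<in>J. emeasure ring_measure (F j))" .
    have "emeasure N ?E = (?c * ennreal (exp (- (real (card \<Lambda>) - 1) * s))) * (\<Prod>j\<in>J. emeasure ring_measure (F j))"
      unfolding N_em[OF E'] PE by (rule mult.assoc[symmetric])
    also have "\<dots> = (\<Prod>j\<in>J. emeasure ring_measure (F j))"
      unfolding cc by (rule mult_1_left)
    finally show "emeasure N ?E = (\<Prod>j\<in>J. emeasure ring_measure (F j))" .
  qed
  then have "emeasure (clock_space \<Lambda>) E = ?c * emeasure P (A \<inter> (later \<Lambda> x s -` E \<inter> space P))"
    using N_em[OF E] by (simp only: clock_space_eq)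
  then have "ennreal (exp (- (real (card \<Lambda>) - 1) * s)) * emeasure (clock_space \<Lambda>) E
      = (?c * ennreal (exp (- (real (card \<Lambda>) - 1) * s))) * emeasure P (A \<inter> (later \<Lambda> x s -` E \<inter> space P))"
    by (simp only: ac_simps)
  then show "emeasure P {X \<in> space P. (\<forall>y\<in>\<Lambda> - {x}. s < fst (X (y, 0))) \<and> later \<Lambda> x s X \<in> E}
      = ennreal (exp (- (real (card \<Lambda>) - 1) * s)) * emeasure (clock_space \<Lambda>) E"
    unfolding set_eq cc by simp
qed

text \<open>A checkable characterisation of \<open>ring_list\<close> by a candidate list. There are
  only countably many candidates, so events about the ordered rings become countable unions of
  measurable ones.\<close>

definition rings_ok :: "'d::finite site set \<Rightarrow> ('d site \<times> nat \<Rightarrow> real \<times> real) \<Rightarrow> real \<Rightarrow> ('d site \<times> nat) list \<Rightarrow> bool" where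
  "rings_ok \<Lambda> \<omega> t rl \<longleftrightarrow> set rl = rings_upto \<Lambda> \<omega> t \<and> sorted_wrt (\<lambda>i j. ring_time \<omega> i < ring_time \<omega> j) rl"

lemma (in linorder) sorted_key_list_of_set_eq:
  assumes "sorted (map f xs)" "distinct xs" "inj_on f (set xs)"
  shows "sorted_key_list_of_set f (set xs) = xs"
proof -
  interpret folding_insort_key "(\<le>)" "(<)" "set xs" f by unfold_locales (rule assms(3))
  show ?thesis using assms by (intro idem_if_sorted_distinct) auto
qed

lemma ring_list_eq:
  assumes "rings_ok \<Lambda> \<omega> t rl"
  shows "ring_list \<Lambda> \<omega> t = rl"
proof -
  have s: "set rl = rings_upto \<Lambda> \<omega> t" "sorted_wrt (<) (map (ring_time \<omega>) rl)"
    using assms by (auto simp: rings_ok_def sorted_wrt_map)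
  then have d: "sorted (map (ring_time \<omega>) rl)" "distinct (map (ring_time \<omega>) rl)"
    by (auto simp: strict_sorted_iff)
  then have inj: "inj_on (ring_time \<omega>) (set rl)" and "distinct rl" by (auto simp: distinct_map)
  have "sorted_key_list_of_set (ring_time \<omega>) (set rl) = rl"
    using d(1) \<open>distinct rl\<close> inj by (rule sorted_key_list_of_set_eq)
  moreover have "finite (rings_upto \<Lambda> \<omega> t)" unfolding s(1)[symmetric] by simp
  ultimately show ?thesis using inj unfolding ring_list_def s(1)[symmetric] by simp
qed

lemma measurable_clock [measurable]: "(\<lambda>\<omega>. \<omega> i) \<in> measurable (clock_space \<Lambda>) (borel \<Otimes>\<^sub>M borel)"
proof (cases "i \<in> \<Lambda> \<times> UNIV")
  case True
  have "(\<lambda>\<omega>. \<omega> i) \<in> measurable (clock_space \<Lambda>) ring_measure"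
    unfolding clock_space_eq by (rule measurable_component_singleton[OF True])
  then show ?thesis by (simp cong: measurable_cong_sets[OF refl sets_ring_measure])
next
  case False
  then have "\<omega> i = undefined" if "\<omega> \<in> space (clock_space \<Lambda>)" for \<omega>
    using that by (cases i) (auto simp: clock_space_eq space_PiM PiE_iff extensional_def)
  then show ?thesis by (subst measurable_cong[where g = "\<lambda>_. undefined"]) (auto simp: space_pair_measure)
qed

lemma measurable_ring_time [measurable]: "(\<lambda>\<omega>. ring_time \<omega> i) \<in> borel_measurable (clock_space \<Lambda>)"
  unfolding ring_time_def by (cases i) simp

lemma measurable_rings_ok [measurable]: "Measurable.pred (clock_space \<Lambda>) (\<lambda>\<omega>. rings_ok \<Lambda> \<omega> t rl)"
proof -
  have "rings_ok \<Lambda> \<omega> t rl \<longleftrightarrow> (\<forall>i. i \<in> set rl \<longleftrightarrow> i \<in> \<Lambda> \<times> UNIV \<and> ring_time \<omega> i \<le> t) \<and>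
      (\<forall>a b. a < b \<longrightarrow> b < length rl \<longrightarrow> ring_time \<omega> (rl ! a) < ring_time \<omega> (rl ! b))" for \<omega>
    unfolding rings_ok_def rings_upto_def sorted_wrt_iff_nth_less set_eq_iff by auto
  then show ?thesis by simp
qed

text \<open>Almost sure; it guarantees that every ring of the later family comes strictly after the
  ring that was removed.\<close>

definition positive_clocks :: "'d::finite site set \<Rightarrow> ('d site \<times> nat \<Rightarrow> real \<times> real) \<Rightarrow> bool" where
  "positive_clocks \<Lambda> \<omega> \<longleftrightarrow> (\<forall>i\<in>\<Lambda> \<times> UNIV. 0 < fst (\<omega> i))"

lemma measurable_positive_clocks [measurable]: "Measurable.pred (clock_space \<Lambda>) (positive_clocks \<Lambda>)"
proof -
  have "positive_clocks \<Lambda> = (\<lambda>\<omega>. \<forall>i. i \<in> \<Lambda> \<times> UNIV \<longrightarrow> 0 < fst (\<omega> i))" by (auto simp: positive_clocks_def fun_eq_iff)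
  then show ?thesis by simp
qed

lemma ring_time_pos: "positive_clocks \<Lambda> \<omega> \<Longrightarrow> i \<in> \<Lambda> \<times> UNIV \<Longrightarrow> 0 < ring_time \<omega> i"
  unfolding ring_time_def positive_clocks_def by (cases i) (auto intro!: sum_pos)

lemma AE_positive_clocks: "AE \<omega> in clock_space \<Lambda>. positive_clocks \<Lambda> \<omega>"
proof -
  have "AE \<omega> in clock_space \<Lambda>. i \<in> \<Lambda> \<times> UNIV \<longrightarrow> 0 < fst (\<omega> i)" for i
  proof (cases "i \<in> \<Lambda> \<times> UNIV")
    case True
    then show ?thesis unfolding clock_space_eq
      using AE_PiM_component[where M = "\<lambda>_. ring_measure" and I = "\<Lambda> \<times> UNIV" and P = "\<lambda>z. 0 < fst z", OF prob_space_ring_measure True AE_ring_measure_pos]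
      by simp
  qed simp
  then have "AE \<omega> in clock_space \<Lambda>. \<forall>i. i \<in> \<Lambda> \<times> UNIV \<longrightarrow> 0 < fst (\<omega> i)" by (rule AE_all_countable[THEN iffD2, OF allI])
  then show ?thesis by (rule AE_mp) (auto simp: positive_clocks_def)
qed

lemma ring_time_renumber:
  assumes "x \<in> \<Lambda>" "fst (\<omega> (x, 0)) = s" "i \<in> \<Lambda> \<times> UNIV" "\<And>j. j \<in> \<Lambda> \<times> UNIV - {(x, 0)} \<Longrightarrow> \<omega> j = X j"
  shows "ring_time \<omega> (renumber x i) = s + ring_time (later \<Lambda> x s X) i"
proof -
  obtain y k where i: "i = (y, k)" "y \<in> \<Lambda>" using assms(3) by auto
  show ?thesis
  proof (cases "y = x")
    case True
    have "(\<Sum>j\<le>Suc k. fst (\<omega> (x, j))) = fst (\<omega> (x, 0)) + (\<Sum>j\<le>k. fst (\<omega> (x, Suc j)))"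
      by (rule sum.atMost_Suc_shift)
    also have "(\<Sum>j\<le>k. fst (\<omega> (x, Suc j))) = (\<Sum>j\<le>k. fst (later \<Lambda> x s X (x, j)))"
      using assms(1) by (intro sum.cong refl) (simp add: later_def renumber_def assms(4))
    finally show ?thesis using True i assms(2) by (simp add: ring_time_def renumber_def)
  next
    case False
    have "(\<Sum>j\<le>k. fst (\<omega> (y, j))) = (\<Sum>j\<le>k. fst (later \<Lambda> x s X (y, j)) + (if j = 0 then s else 0))"
      using i(2) False by (intro sum.cong refl) (simp add: later_def renumber_def assms(4))
    also have "\<dots> = s + (\<Sum>j\<le>k. fst (later \<Lambda> x s X (y, j)))"
      by (simp add: sum.distrib)
    finally show ?thesis using False i by (simp add: ring_time_def renumber_def)
  qed
qed

section \<open>Probability of a given list of marked rings\<close>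

context hardcore
begin

definition ring_mark :: "('d::finite site \<times> nat \<Rightarrow> real \<times> real) \<Rightarrow> 'd site \<times> nat \<Rightarrow> 'd site \<times> bool" where
  "ring_mark \<omega> i = (fst i, snd (\<omega> i) < mark_prob)"

text \<open>The event that the rings up to \<open>t\<close>, in chronological order and with each
  uniform mark cut at \<open>mark_prob\<close>, read as \<open>l\<close>.\<close>

definition history :: "'d::finite site set \<Rightarrow> real \<Rightarrow> ('d site \<times> bool) list \<Rightarrow> ('d site \<times> nat \<Rightarrow> real \<times> real) set" where
  "history \<Lambda> t l = {\<omega> \<in> space (clock_space \<Lambda>). positive_clocks \<Lambda> \<omega> \<and> (\<exists>rl. rings_ok \<Lambda> \<omega> t rl \<and> map (ring_mark \<omega>) rl = l)}"

lemma history_sets [measurable]: "history \<Lambda> t l \<in> sets (clock_space \<Lambda>)"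
proof -
  have "map (ring_mark \<omega>) rl = l \<longleftrightarrow> length rl = length l \<and> (\<forall>a. a < length rl \<longrightarrow> fst (rl ! a) = fst (l ! a) \<and> (snd (\<omega> (rl ! a)) < mark_prob) = snd (l ! a))"
    for rl and \<omega> :: "'a site \<times> nat \<Rightarrow> real \<times> real"
    unfolding list_eq_iff_nth_eq by (auto simp: ring_mark_def prod_eq_iff)
  then show ?thesis unfolding history_def by simp
qed

text \<open>The deterministic part of the first-ring decomposition: putting back a ring at
  \<open>x\<close> at time \<open>s\<close> before a history of length \<open>t - s\<close> of the
  later family.\<close>

lemma history_Cons:
  assumes x: "x \<in> \<Lambda>" and s: "0 < s" "s \<le> t" and X: "X \<in> space (\<Pi>\<^sub>M i\<in>\<Lambda> \<times> UNIV - {(x, 0)}. ring_measure)"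
    and later: "later \<Lambda> x s X \<in> history \<Lambda> (t - s) l" and first: "\<forall>y\<in>\<Lambda> - {x}. s < fst (X (y, 0))"
    and u: "(u < mark_prob) = b"
  shows "X((x, 0) := (s, u)) \<in> history \<Lambda> t ((x, b) # l)"
proof -
  define \<omega> where "\<omega> = X((x, 0) := (s, u))"
  let ?w = "later \<Lambda> x s X"
  obtain rl where rl: "rings_ok \<Lambda> ?w (t - s) rl" "map (ring_mark ?w) rl = l" and pos: "positive_clocks \<Lambda> ?w"
    using later by (auto simp: history_def)
  have sp: "\<omega> \<in> space (clock_space \<Lambda>)"
    using X x unfolding \<omega>_def clock_space_eq space_PiM by (auto simp: PiE_iff extensional_def)
  have rt: "ring_time \<omega> (renumber x i) = s + ring_time ?w i" if "i \<in> \<Lambda> \<times> UNIV" for i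
    by (rule ring_time_renumber[OF x _ that]) (auto simp: \<omega>_def)
  have rt0: "ring_time \<omega> (x, 0) = s" by (simp add: ring_time_def \<omega>_def)
  have all: "\<Lambda> \<times> UNIV = insert (x, 0) (renumber x ` (\<Lambda> \<times> UNIV))"
    using renumber_bij[OF x] x by (auto simp: bij_betw_def)
  have "rings_upto \<Lambda> \<omega> t = insert (x, 0) (renumber x ` rings_upto \<Lambda> ?w (t - s))"
  proof -
    have "rings_upto \<Lambda> \<omega> t = {j \<in> insert (x, 0) (renumber x ` (\<Lambda> \<times> UNIV)). ring_time \<omega> j \<le> t}"
      unfolding rings_upto_def all[symmetric] ..
    also have "\<dots> = insert (x, 0) {j \<in> renumber x ` (\<Lambda> \<times> UNIV). ring_time \<omega> j \<le> t}"
      using rt0 s by auto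
    also have "{j \<in> renumber x ` (\<Lambda> \<times> UNIV). ring_time \<omega> j \<le> t} = renumber x ` {i \<in> \<Lambda> \<times> UNIV. ring_time \<omega> (renumber x i) \<le> t}"
      by blast
    also have "{i \<in> \<Lambda> \<times> UNIV. ring_time \<omega> (renumber x i) \<le> t} = rings_upto \<Lambda> ?w (t - s)"
      unfolding rings_upto_def by (rule Collect_cong) (auto simp: rt)
    finally show ?thesis .
  qed
  moreover have set_rl: "set rl = rings_upto \<Lambda> ?w (t - s)" using rl(1) by (simp add: rings_ok_def)
  moreover have in_rl: "i \<in> \<Lambda> \<times> UNIV" if "i \<in> set rl" for i using that unfolding set_rl rings_upto_def by simp
  moreover have "sorted_wrt (\<lambda>i j. ring_time \<omega> i < ring_time \<omega> j) ((x, 0) # map (renumber x) rl)"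
  proof -
    have "sorted_wrt (\<lambda>i j. ring_time \<omega> (renumber x i) < ring_time \<omega> (renumber x j)) rl"
      by (rule sorted_wrt_mono_rel[of _ "\<lambda>i j. ring_time ?w i < ring_time ?w j"])
        (use rl(1) in_rl rt in \<open>auto simp: rings_ok_def\<close>)
    moreover have "ring_time \<omega> (x, 0) < ring_time \<omega> (renumber x i)" if "i \<in> set rl" for i
      using ring_time_pos[OF pos in_rl[OF that]] rt[OF in_rl[OF that]] rt0 by simp
    ultimately show ?thesis by (auto simp: sorted_wrt_map)
  qed
  ultimately have ok: "rings_ok \<Lambda> \<omega> t ((x, 0) # map (renumber x) rl)"
    unfolding rings_ok_def by simp
  have mk: "ring_mark \<omega> (renumber x i) = ring_mark ?w i" if "i \<in> \<Lambda> \<times> UNIV" for i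
    using that by (cases i) (auto simp: ring_mark_def \<omega>_def later_def renumber_def)
  have "map (\<lambda>i. ring_mark \<omega> (renumber x i)) rl = map (ring_mark ?w) rl"
    by (rule map_cong[OF refl], rule mk, rule in_rl)
  moreover have "ring_mark \<omega> (x, 0) = (x, b)" using u by (simp add: ring_mark_def \<omega>_def)
  ultimately have "map (ring_mark \<omega>) ((x, 0) # map (renumber x) rl) = (x, b) # l"
    using rl(2) by (simp add: o_def)
  moreover have "positive_clocks \<Lambda> \<omega>"
    unfolding positive_clocks_def
  proof
    fix j assume "j \<in> \<Lambda> \<times> (UNIV :: nat set)"
    with equalityD1[OF all] have "j \<in> insert (x, 0) (renumber x ` (\<Lambda> \<times> UNIV))" by (rule subsetD)
    then consider "j = (x, 0)" | i where "i \<in> \<Lambda> \<times> UNIV" "j = renumber x i" by auto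
    then show "0 < fst (\<omega> j)"
    proof cases
      case (2 i)
      then have "0 < fst (?w i)" using pos by (auto simp: positive_clocks_def)
      with 2 s show ?thesis by (cases i) (auto simp: later_def renumber_def \<omega>_def split: if_splits)
    qed (use s in \<open>simp add: \<omega>_def\<close>)
  qed
  ultimately show ?thesis
    unfolding history_def \<omega>_def[symmetric] mem_Collect_eq using ok sp by (intro conjI exI[of _ "(x, 0) # map (renumber x) rl"])
qed


lemma mark_prob_bounds: "0 < mark_prob" "mark_prob < 1"
  using lam_pos by (auto simp: mark_prob_def)

text \<open>If the first waiting time of every site exceeds \<open>t\<close>, there is no
  ring.\<close>

lemma emeasure_history_Nil:
  fixes \<Lambda> :: "'d::finite site set"
  assumes fin: "finite \<Lambda>" and t: "0 \<le> t"
  shows "ennreal (exp (- (real (card \<Lambda>) * t))) \<le> emeasure (clock_space \<Lambda>) (history \<Lambda> t [])"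
proof -
  let ?I = "\<Lambda> \<times> (UNIV :: nat set)" and ?J = "(\<lambda>y. (y, 0 :: nat)) ` \<Lambda>"
  let ?A = "prod_emb ?I (\<lambda>_. ring_measure) ?J (\<Pi>\<^sub>E j\<in>?J. {z. t < fst z})"
  have G: "{z :: real \<times> real. t < fst z} \<in> sets ring_measure"
  proof -
    have "{z \<in> space (borel \<Otimes>\<^sub>M (borel :: real measure)). t < fst z} \<in> sets (borel \<Otimes>\<^sub>M borel)" by measurable
    then show ?thesis by (simp add: sets_ring_measure space_pair_measure)
  qed
  have "emeasure (clock_space \<Lambda>) ?A = (\<Prod>j\<in>?J. emeasure ring_measure {z. t < fst z})"
    unfolding clock_space_eq
    by (rule emeasure_PiM_emb) (use fin G prob_space_ring_measure in auto)
  also have "\<dots> = ennreal (exp (- t)) ^ card \<Lambda>"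
    by (simp add: ring_measure_greater[OF t] card_image inj_on_def)
  also have "\<dots> = ennreal (exp (- (real (card \<Lambda>) * t)))"
    by (simp add: ennreal_power exp_of_nat_mult[symmetric])
  finally have A: "emeasure (clock_space \<Lambda>) ?A = ennreal (exp (- (real (card \<Lambda>) * t)))" .
  have "emeasure (clock_space \<Lambda>) ?A \<le> emeasure (clock_space \<Lambda>) (history \<Lambda> t [])"
  proof (rule emeasure_mono_AE[OF _ history_sets])
    show "AE \<omega> in clock_space \<Lambda>. \<omega> \<in> ?A \<longrightarrow> \<omega> \<in> history \<Lambda> t []"
      using AE_positive_clocks AE_space
    proof eventually_elim
      case (elim \<omega>)
      show ?case
      proof
        assume A: "\<omega> \<in> ?A"
        have "t < ring_time \<omega> (y, k)" if y: "y \<in> \<Lambda>" for y k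
        proof -
          have "t < fst (\<omega> (y, 0))"
            using A y by (auto simp: prod_emb_iff restrict_PiE_iff)
          also have "\<dots> \<le> (\<Sum>j\<le>k. fst (\<omega> (y, j)))"
            by (rule member_le_sum) (use elim(1) y in \<open>auto simp: positive_clocks_def intro: less_imp_le\<close>)
          finally show ?thesis by (simp add: ring_time_def)
        qed
        then have "\<not> ring_time \<omega> i \<le> t" if "i \<in> \<Lambda> \<times> UNIV" for i using that by (cases i) (simp add: not_le)
        then have "rings_upto \<Lambda> \<omega> t = {}" unfolding rings_upto_def by blast
        then have "rings_ok \<Lambda> \<omega> t []" by (simp add: rings_ok_def)
        then show "\<omega> \<in> history \<Lambda> t []"
          using elim unfolding history_def by auto
      qed
    qed
  qed
  then show ?thesis unfolding A .
qed

lemma nn_integral_mark: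
  "(\<integral>\<^sup>+u. indicator {u. (u < mark_prob) = b} u * indicator {0..1} u \<partial>lborel) = ennreal (mark_weight b)"
proof -
  have "(\<integral>\<^sup>+u. indicator {u. (u < mark_prob) = b} u * indicator {0..1} u \<partial>lborel)
      = (\<integral>\<^sup>+u. indicator (if b then {0..<mark_prob} else {mark_prob..1}) u \<partial>lborel)"
    using mark_prob_bounds by (intro nn_integral_cong) (auto simp: indicator_def)
  also have "\<dots> = ennreal (mark_weight b)"
    using mark_prob_bounds lam_pos by (auto simp: mark_weight_def mark_prob_def field_simps)
  finally show ?thesis .
qed

text \<open>Integrate over the time \<open>s\<close> and the mark of a first ring at
  \<open>x\<close>. The density \<open>exp (- s)\<close> of that ring and the factor for the silence
  of the other clocks combine to \<open>exp (- card \<Lambda> * s)\<close>; \<open>q\<close> bounds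
  the rest from below.\<close>

lemma emeasure_history_Cons:
  fixes \<Lambda> :: "'d::finite site set" and q :: "real \<Rightarrow> real"
  assumes fin: "finite \<Lambda>" and x: "x \<in> \<Lambda>" and t: "0 \<le> t"
    and q[measurable]: "q \<in> borel_measurable borel" and q0: "\<And>s. 0 \<le> s \<Longrightarrow> 0 \<le> q s"
    and le: "\<And>s. 0 \<le> s \<Longrightarrow> ennreal (q s) \<le> emeasure (clock_space \<Lambda>) (history \<Lambda> s l)"
  shows "(\<integral>\<^sup>+s. ennreal (exp (- (real (card \<Lambda>) * s)) * q (t - s)) * indicator {0..t} s \<partial>lborel) * ennreal (mark_weight b)
    \<le> emeasure (clock_space \<Lambda>) (history \<Lambda> t ((x, b) # l))"
proof -
  let ?I = "\<Lambda> \<times> (UNIV :: nat set)" and ?I' = "\<Lambda> \<times> UNIV - {(x, 0 :: nat)}"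
  define P :: "('d site \<times> nat \<Rightarrow> real \<times> real) measure" where "P = (\<Pi>\<^sub>M i\<in>?I'. ring_measure)"
  define f :: "(real \<times> real) \<times> ('d site \<times> nat \<Rightarrow> real \<times> real) \<Rightarrow> _" where "f = (\<lambda>(z, X). X((x, 0) := z))"
  let ?H = "history \<Lambda> t ((x, b) # l)"
  have ins: "insert (x, 0) ?I' = ?I" using x by auto
  have cs: "distr (ring_measure \<Otimes>\<^sub>M P) (clock_space \<Lambda>) f = clock_space \<Lambda>"
    using distr_pair_PiM_eq_PiM[of ?I' "\<lambda>_. ring_measure" "(x, 0)"] prob_space_ring_measure
    unfolding clock_space_eq P_def f_def ins by simp
  have f: "f \<in> measurable (ring_measure \<Otimes>\<^sub>M P) (clock_space \<Lambda>)"
  proof -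
    have "(\<lambda>p. (snd p)((x, 0) := fst p)) \<in> measurable (ring_measure \<Otimes>\<^sub>M P) (\<Pi>\<^sub>M i\<in>insert (x, 0) ?I'. ring_measure)"
      unfolding P_def by measurable
    then show ?thesis unfolding f_def clock_space_eq ins by (simp add: case_prod_unfold)
  qed
  interpret P: prob_space P unfolding P_def by (rule prob_space_PiM) (rule prob_space_ring_measure)
  define F :: "real \<Rightarrow> ennreal" where "F s = ennreal (exp (- (real (card \<Lambda>) - 1) * s) * q (t - s)) * indicator {0<..t} s" for s
  define G :: "real \<Rightarrow> ennreal" where "G u = indicator {u. (u < mark_prob) = b} u" for u
  have [measurable]: "F \<in> borel_measurable borel" unfolding F_def by measurable
  have "{u. (u < mark_prob) = b} = (if b then {..<mark_prob} else {mark_prob..})" by auto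
  then have [measurable]: "G \<in> borel_measurable borel" unfolding G_def by simp
  let ?V = "f -` ?H \<inter> space (ring_measure \<Otimes>\<^sub>M P)"
  have "(\<integral>\<^sup>+z. F (fst z) * G (snd z) \<partial>ring_measure) \<le> (\<integral>\<^sup>+z. emeasure P (Pair z -` ?V) \<partial>ring_measure)"
  proof (rule nn_integral_mono)
    fix z :: "real \<times> real"
    obtain s u where z: "z = (s, u)" by (cases z)
    show "F (fst z) * G (snd z) \<le> emeasure P (Pair z -` ?V)"
    proof (cases "0 < s \<and> s \<le> t \<and> (u < mark_prob) = b")
      case True
      then have s: "0 < s" "s \<le> t" and u: "(u < mark_prob) = b" by auto
      let ?E = "{X \<in> space P. (\<forall>y\<in>\<Lambda> - {x}. s < fst (X (y, 0))) \<and> later \<Lambda> x s X \<in> history \<Lambda> (t - s) l}"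
      note em = emeasure_later[OF fin x less_imp_le[OF s(1)] history_sets[of \<Lambda> "t - s" l], folded P_def]
      have "F (fst z) * G (snd z) = ennreal (exp (- (real (card \<Lambda>) - 1) * s)) * ennreal (q (t - s))"
        using s u q0[of "t - s"] by (simp add: z F_def G_def ennreal_mult)
      also have "\<dots> \<le> emeasure P ?E"
        unfolding em(2) using le[of "t - s"] s by (intro mult_left_mono) auto
      also have "\<dots> \<le> emeasure P (Pair z -` ?V)"
      proof (rule emeasure_mono)
        show "?E \<subseteq> Pair z -` ?V"
        proof
          fix X assume X: "X \<in> ?E"
          then have "X((x, 0) := (s, u)) \<in> ?H"
            using history_Cons[OF x s, of X l u b] u by (simp add: P_def)
          with X show "X \<in> Pair z -` ?V" by (simp add: f_def z space_pair_measure)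
        qed
        show "Pair z -` ?V \<in> sets P"
          by (rule sets_Pair1[OF measurable_sets[OF f history_sets]])
      qed
      finally show ?thesis .
    next
      case False
      then have "F (fst z) * G (snd z) = 0" by (auto simp: z F_def G_def)
      then show ?thesis by (simp only: zero_le)
    qed
  qed
  also have "\<dots> = emeasure (ring_measure \<Otimes>\<^sub>M P) ?V"
    by (rule P.emeasure_pair_measure_alt[symmetric, OF measurable_sets[OF f history_sets]])
  also have "\<dots> = emeasure (distr (ring_measure \<Otimes>\<^sub>M P) (clock_space \<Lambda>) f) ?H"
    by (rule emeasure_distr[symmetric, OF f history_sets])
  finally have "(\<integral>\<^sup>+s. ennreal (exponential_density 1 s) * F s \<partial>lborel) * (\<integral>\<^sup>+u. G u * indicator {0..1} u \<partial>lborel)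
      \<le> emeasure (clock_space \<Lambda>) ?H"
    unfolding cs by (simp add: nn_integral_ring_measure)
  moreover have "(\<integral>\<^sup>+s. ennreal (exponential_density 1 s) * F s \<partial>lborel)
      = (\<integral>\<^sup>+s. ennreal (exp (- (real (card \<Lambda>) * s)) * q (t - s)) * indicator {0..t} s \<partial>lborel)"
  proof (rule nn_integral_cong_AE)
    show "AE s in lborel. ennreal (exponential_density 1 s) * F s
      = ennreal (exp (- (real (card \<Lambda>) * s)) * q (t - s)) * indicator {0..t} s"
      using AE_lborel_singleton[of "0 :: real"]
    proof eventually_elim
      case (elim s)
      have "exp (- s) * exp (- (real (card \<Lambda>) - 1) * s) = exp (- (real (card \<Lambda>) * s))"
        unfolding exp_add[symmetric] by (simp add: algebra_simps)
      then have "0 < s \<Longrightarrow> s \<le> t \<Longrightarrow> ennreal (exp (- s)) * ennreal (exp (- (real (card \<Lambda>) - 1) * s) * q (t - s))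
          = ennreal (exp (- (real (card \<Lambda>) * s)) * q (t - s))"
        using q0[of "t - s"] by (simp only: ennreal_mult''[symmetric] mult_nonneg_nonneg exp_ge_zero diff_ge_0_iff_ge mult.assoc[symmetric])
      then show ?case using elim by (auto simp: F_def indicator_def exponential_density_def)
    qed
  qed
  ultimately show ?thesis unfolding G_def nn_integral_mark by simp
qed

text \<open>Integrating over the time of one more ring turns the volume of a simplex of ordered
  times into that of the next dimension.\<close>

lemma nn_integral_power:
  assumes "0 \<le> t" "0 \<le> c"
  shows "(\<integral>\<^sup>+s. ennreal (c * (t - s) ^ m / fact m) * indicator {0..t} s \<partial>lborel) = ennreal (c * t ^ Suc m / fact (Suc m))"
proof -
  let ?F = "\<lambda>s. - (c * (t - s) ^ Suc m / fact (Suc m))"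
  have "(\<integral>\<^sup>+s. ennreal (c * (t - s) ^ m / fact m) * indicator {0..t} s \<partial>lborel) = ennreal (?F t - ?F 0)"
  proof (rule nn_integral_FTC_Icc)
    fix s assume s: "s \<in> {0..t}"
    show "0 \<le> c * (t - s) ^ m / fact m" using s assms by auto
    show "(?F has_real_derivative c * (t - s) ^ m / fact m) (at s)"
    proof -
      have "real (Suc m) * (c * y) / fact (Suc m) = c * y / fact m" for y :: real
        unfolding fact_Suc by (simp only: of_nat_mult mult_divide_mult_cancel_left_if) simp
      moreover have "(?F has_real_derivative - (c * (real (Suc m) * (t - s) ^ m * - 1) / fact (Suc m))) (at s)"
        by (auto intro!: derivative_eq_intros simp del: fact_Suc power_Suc of_nat_Suc)
      moreover have "- (c * (real (Suc m) * (t - s) ^ m * - 1) / fact (Suc m)) = real (Suc m) * (c * (t - s) ^ m) / fact (Suc m)"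
        by (simp add: mult_ac del: fact_Suc of_nat_Suc)
      ultimately show ?thesis by (simp only:)
    qed
  qed (use assms in auto)
  then show ?thesis using assms by simp
qed

text \<open>A lower bound for every list is enough: histories are disjoint and the weights of
  \<open>updates\<close> sum to 1, so no mass can be missing. In particular, finiteness of the rings
  and the absence of ties need no separate argument.\<close>

theorem emeasure_history_ge:
  fixes \<Lambda> :: "'d::finite site set"
  assumes fin: "finite \<Lambda>" and t: "0 \<le> t"
  shows "ennreal (pmf (updates \<Lambda> t) l) \<le> emeasure (clock_space \<Lambda>) (history \<Lambda> t l)"
  using t
proof (induction l arbitrary: t)
  case Nil
  then show ?case using emeasure_history_Nil[OF fin] pmf_updates[OF fin] by simp
next
  case (Cons u l)
  let ?n = "real (card \<Lambda>)" and ?m = "length l"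
  let ?w = "prod_list (map (\<lambda>u. mark_weight (snd u)) l)"
  obtain x b where u: "u = (x, b)" by (cases u)
  have w: "0 \<le> ?w" by (induction l) auto
  show ?case
  proof (cases "fst ` set (u # l) \<subseteq> \<Lambda>")
    case True
    then have x: "x \<in> \<Lambda>" by (simp add: u)
    define q where "q s = exp (- (?n * s)) * s ^ ?m / fact ?m * ?w" for s
    have q: "ennreal (q s) \<le> emeasure (clock_space \<Lambda>) (history \<Lambda> s l)" if "0 \<le> s" for s
      using Cons.IH[OF that] pmf_updates[OF fin that, of l] True by (simp add: q_def)
    have "exp (- (?n * s)) * q (t - s) = (exp (- (?n * t)) * ?w) * (t - s) ^ ?m / fact ?m" for s
    proof -
      have "exp (- (?n * s)) * exp (- (?n * (t - s))) = exp (- (?n * t))"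
        unfolding exp_add[symmetric] by (simp add: algebra_simps)
      then show ?thesis unfolding q_def by (simp only: flip: mult.assoc times_divide_eq_right times_divide_eq_left) (simp only: mult.commute mult.left_commute times_divide_eq_right)
    qed
    note qe = this
    have "(\<integral>\<^sup>+s. ennreal (exp (- (?n * s)) * q (t - s)) * indicator {0..t} s \<partial>lborel)
        = ennreal ((exp (- (?n * t)) * ?w) * t ^ Suc ?m / fact (Suc ?m))"
      unfolding qe by (rule nn_integral_power[OF Cons.prems mult_nonneg_nonneg[OF exp_ge_zero w]])
    moreover have "(\<integral>\<^sup>+s. ennreal (exp (- (?n * s)) * q (t - s)) * indicator {0..t} s \<partial>lborel) * ennreal (mark_weight b)
        \<le> emeasure (clock_space \<Lambda>) (history \<Lambda> t ((x, b) # l))"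
      proof (rule emeasure_history_Cons[OF fin x Cons.prems _ _ q])
      show "q \<in> borel_measurable borel" unfolding q_def by measurable
      show "0 \<le> q s" if "0 \<le> s" for s using that w by (simp add: q_def)
    qed
    moreover have "pmf (updates \<Lambda> t) (u # l) = (exp (- (?n * t)) * ?w) * t ^ Suc ?m / fact (Suc ?m) * mark_weight b"
      using True pmf_updates[OF fin Cons.prems, of "u # l"] by (simp add: u mult_ac del: fact_Suc power_Suc)
    ultimately show ?thesis by (simp only: u ennreal_mult''[OF mark_weight_nonneg])
  next
    case False
    have "pmf (updates \<Lambda> t) (u # l) = 0" unfolding pmf_updates[OF fin Cons.prems] using False by (rule if_not_P)
    then show ?thesis by (simp only: ennreal_0 zero_le)
  qed
qed

end

lemma (in linorder) ex_strictly_sorted_list: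
  assumes "finite A" "inj_on f A"
  obtains xs where "sorted_wrt (<) (map f xs)" "set xs = A"
proof -
  interpret folding_insort_key "(\<le>)" "(<)" A f by unfold_locales (rule assms(2))
  show ?thesis by (rule finite_set_strict_sorted[OF subset_refl assms(1)]) (rule that)
qed

text \<open>An occupied boundary site keeps its neighbours empty; empty and free ones impose
  nothing. So the model with boundary condition is the free model on this subset.\<close>

definition free_sites :: "'d::finite site set \<Rightarrow> ('d site \<Rightarrow> nat option) \<Rightarrow> 'd site set" where
  "free_sites \<Lambda> \<tau> = {x \<in> \<Lambda>. \<forall>v\<in>outer_boundary \<Lambda>. adjacent x v \<longrightarrow> \<tau> v \<noteq> Some 1}"

definition conf :: "'d::finite site set \<Rightarrow> 'd site set \<Rightarrow> 'd site \<Rightarrow> nat" where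
  "conf \<Lambda> I = (\<lambda>x\<in>\<Lambda>. if x \<in> I then 1 else 0)"

lemma free_sites_subset: "free_sites \<Lambda> \<tau> \<subseteq> \<Lambda>"
  by (auto simp: free_sites_def)

lemma conf_occupied: "\<sigma> \<in> \<Lambda> \<rightarrow>\<^sub>E {0, 1} \<Longrightarrow> conf \<Lambda> {x \<in> \<Lambda>. \<sigma> x = 1} = \<sigma>"
  by (auto simp: conf_def fun_eq_iff PiE_iff extensional_def)

lemma conf_admissible_iff: "I \<subseteq> \<Lambda> \<Longrightarrow> conf \<Lambda> I \<in> admissible \<Lambda> \<tau> \<longleftrightarrow> I \<in> indep_sets (free_sites \<Lambda> \<tau>)"
  unfolding admissible_def indep_sets_def free_sites_def conf_def by (simp add: PiE_iff) blast

lemma inj_on_conf: "inj_on (conf \<Lambda>) (Pow \<Lambda>)"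
proof (rule inj_on_inverseI)
  fix I assume "I \<in> Pow \<Lambda>"
  then show "{x \<in> \<Lambda>. conf \<Lambda> I x = 1} = I" by (auto simp: conf_def)
qed

lemma bij_betw_conf: "bij_betw (conf \<Lambda>) (indep_sets (free_sites \<Lambda> \<tau>)) (admissible \<Lambda> \<tau>)"
proof (rule bij_betw_imageI)
  have sub: "I \<subseteq> \<Lambda>" if "I \<in> indep_sets (free_sites \<Lambda> \<tau>)" for I
    using that free_sites_subset[of \<Lambda> \<tau>] by (auto simp: indep_sets_def)
  then show "inj_on (conf \<Lambda>) (indep_sets (free_sites \<Lambda> \<tau>))" by (intro inj_on_subset[OF inj_on_conf]) auto
  show "conf \<Lambda> ` indep_sets (free_sites \<Lambda> \<tau>) = admissible \<Lambda> \<tau>"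
  proof
    show "conf \<Lambda> ` indep_sets (free_sites \<Lambda> \<tau>) \<subseteq> admissible \<Lambda> \<tau>"
      using conf_admissible_iff[OF sub] by auto
    show "admissible \<Lambda> \<tau> \<subseteq> conf \<Lambda> ` indep_sets (free_sites \<Lambda> \<tau>)"
    proof
      fix \<sigma> assume s: "\<sigma> \<in> admissible \<Lambda> \<tau>"
      then have "\<sigma> \<in> \<Lambda> \<rightarrow>\<^sub>E {0, 1}" by (simp add: admissible_def)
      then have eq: "conf \<Lambda> {x \<in> \<Lambda>. \<sigma> x = 1} = \<sigma>" by (rule conf_occupied)
      then have "{x \<in> \<Lambda>. \<sigma> x = 1} \<in> indep_sets (free_sites \<Lambda> \<tau>)"
        using s conf_admissible_iff[of "{x \<in> \<Lambda>. \<sigma> x = 1}" \<Lambda> \<tau>] by auto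
      then have "conf \<Lambda> {x \<in> \<Lambda>. \<sigma> x = 1} \<in> conf \<Lambda> ` indep_sets (free_sites \<Lambda> \<tau>)" by (rule imageI)
      then show "\<sigma> \<in> conf \<Lambda> ` indep_sets (free_sites \<Lambda> \<tau>)" unfolding eq .
    qed
  qed
qed

lemma sum_conf: "finite \<Lambda> \<Longrightarrow> I \<subseteq> \<Lambda> \<Longrightarrow> (\<Sum>u\<in>\<Lambda>. conf \<Lambda> I u) = card I"
  by (simp add: conf_def sum.If_cases Int_absorb1)

lemma conf_fun_upd: "x \<in> \<Lambda> \<Longrightarrow> (conf \<Lambda> I)(x := 1) = conf \<Lambda> (insert x I)"
  "x \<in> \<Lambda> \<Longrightarrow> (conf \<Lambda> I)(x := 0) = conf \<Lambda> (I - {x})"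
  by (auto simp: conf_def fun_eq_iff)

section \<open>Translation of the given chain into update lists\<close>

context hardcore
begin

lemma partition_function_eq:
  assumes "finite \<Lambda>"
  shows "partition_function \<Lambda> \<tau> lam = Zpart (free_sites \<Lambda> \<tau>)"
proof -
  have "partition_function \<Lambda> \<tau> lam = (\<Sum>I\<in>indep_sets (free_sites \<Lambda> \<tau>). lam ^ (\<Sum>u\<in>\<Lambda>. conf \<Lambda> I u))"
    unfolding partition_function_def by (rule sum.reindex_bij_betw[OF bij_betw_conf, symmetric])
  also have "\<dots> = Zpart (free_sites \<Lambda> \<tau>)"
    unfolding Zpart_def
    by (rule sum.cong[OF refl], subst sum_conf) (use assms free_sites_subset[of \<Lambda> \<tau>] in \<open>auto simp: indep_sets_def\<close>)
  finally show ?thesis .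
qed

lemma hard_core_conf:
  assumes "finite \<Lambda>" "I \<subseteq> \<Lambda>"
  shows "hard_core \<Lambda> \<tau> lam (conf \<Lambda> I)
    = (if I \<in> indep_sets (free_sites \<Lambda> \<tau>) then lam ^ card I / Zpart (free_sites \<Lambda> \<tau>) else 0)"
  unfolding hard_core_def conf_admissible_iff[OF assms(2)] sum_conf[OF assms] partition_function_eq[OF assms(1)] ..

text \<open>Only two values occur, so the comparison of a uniform mark with \<open>mark_prob\<close>
  can be made before the configuration is known.\<close>

lemma occupation_prob_conf:
  assumes fin: "finite \<Lambda>" and x: "x \<in> \<Lambda>" and I: "I \<in> indep_sets (free_sites \<Lambda> \<tau>)"
  shows "occupation_prob \<Lambda> \<tau> lam x (conf \<Lambda> I)
    = (if x \<in> free_sites \<Lambda> \<tau> \<and> (\<forall>y\<in>I. \<not> adjacent x y) then mark_prob else 0)"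
proof -
  let ?S = "free_sites \<Lambda> \<tau>" and ?J = "I - {x}"
  have IL: "I \<subseteq> \<Lambda>" using I free_sites_subset[of \<Lambda> \<tau>] by (auto simp: indep_sets_def)
  then have finI: "finite I" using fin by (rule finite_subset)
  have J: "?J \<in> indep_sets ?S" using I by (auto simp: indep_sets_def)
  have ins: "insert x I \<in> indep_sets ?S \<longleftrightarrow> x \<in> ?S \<and> (\<forall>y\<in>I. \<not> adjacent x y)"
    using I by (auto simp: indep_sets_def adjacent_commute)
  have Z: "0 < Zpart ?S" using finite_subset[OF free_sites_subset fin] by (rule Zpart_pos)
  have c: "card (insert x I) = Suc (card ?J)" using finI by (simp add: card.insert_remove)
  have "occupation_prob \<Lambda> \<tau> lam x (conf \<Lambda> I)
      = (if insert x I \<in> indep_sets ?S then lam ^ card (insert x I) / Zpart ?S else 0)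
        / (lam ^ card ?J / Zpart ?S + (if insert x I \<in> indep_sets ?S then lam ^ card (insert x I) / Zpart ?S else 0))"
    unfolding occupation_prob_def conf_fun_upd[OF x]
    using hard_core_conf[OF fin, of "insert x I" \<tau>] hard_core_conf[OF fin, of ?J \<tau>] x IL J by auto
  also have "\<dots> = (if insert x I \<in> indep_sets ?S then mark_prob else 0)"
  proof -
    have "lam ^ Suc k / z / (lam ^ k / z + lam ^ Suc k / z) = mark_prob" if "0 < z" for k z
    proof -
      define w where "w = lam ^ k / z"
      have w: "0 < w" using that lam_pos by (simp add: w_def)
      have "lam ^ Suc k / z = lam * w" by (simp add: w_def)
      moreover have "lam * w / (w + lam * w) = lam * w / ((1 + lam) * w)" by (simp add: distrib_right)
      ultimately show ?thesis using w unfolding mark_prob_def w_def[symmetric] by simp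
    qed
    then show ?thesis using Z by (simp add: c)
  qed
  finally show ?thesis unfolding ins .
qed

text \<open>Rings outside the free sites leave an empty site empty, which is why the list is
  restricted. Nonnegative marks are required because a blocked site is compared with the threshold
  0.\<close>

lemma fold_resample:
  assumes fin: "finite \<Lambda>" and rl: "fst ` set rl \<subseteq> \<Lambda>" and nn: "\<And>i. i \<in> set rl \<Longrightarrow> 0 \<le> snd (\<omega> i)"
    and I: "I \<in> indep_sets (free_sites \<Lambda> \<tau>)"
  shows "fold (resample \<Lambda> \<tau> lam \<omega>) rl (conf \<Lambda> I)
    = conf \<Lambda> (run (restr (free_sites \<Lambda> \<tau>) (map (ring_mark \<omega>) rl)) I)"
  using rl nn I
proof (induction rl arbitrary: I)
  case (Cons i rl)
  let ?S = "free_sites \<Lambda> \<tau>"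
  obtain x k where i: "i = (x, k)" by (cases i)
  have x: "x \<in> \<Lambda>" using Cons.prems(1) i by simp
  have u: "0 \<le> snd (\<omega> (x, k))" using Cons.prems(2)[of i] i by simp
  define I' where "I' = (if x \<in> ?S then upd (ring_mark \<omega> i) I else I)"
  have I': "I' \<in> indep_sets ?S"
    using Cons.prems(3) upd_indep_sets[of I ?S "ring_mark \<omega> i"] by (simp add: I'_def ring_mark_def i)
  have step: "resample \<Lambda> \<tau> lam \<omega> i (conf \<Lambda> I) = conf \<Lambda> I'"
  proof -
    have out: "I - {x} = I" if "x \<notin> ?S" using Cons.prems(3) that by (auto simp: indep_sets_def)
    have "resample \<Lambda> \<tau> lam \<omega> i (conf \<Lambda> I)
        = conf \<Lambda> (if snd (\<omega> (x, k)) < occupation_prob \<Lambda> \<tau> lam x (conf \<Lambda> I) then insert x I else I - {x})"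
      unfolding resample_def i prod.case
      by (cases "snd (\<omega> (x, k)) < occupation_prob \<Lambda> \<tau> lam x (conf \<Lambda> I)") (simp_all only: if_True if_False conf_fun_upd[OF x])
    also have "(if snd (\<omega> (x, k)) < occupation_prob \<Lambda> \<tau> lam x (conf \<Lambda> I) then insert x I else I - {x}) = I'"
    proof (cases "x \<in> ?S \<and> (\<forall>y\<in>I. \<not> adjacent x y)")
      case True
      then show ?thesis
        unfolding occupation_prob_conf[OF fin x Cons.prems(3)] if_P[OF True] I'_def upd_def ring_mark_def i by simp
    next
      case False
      have "\<not> snd (\<omega> (x, k)) < 0" using u by simp
      then show ?thesis
        unfolding occupation_prob_conf[OF fin x Cons.prems(3)] if_not_P[OF False]
        using False out unfolding I'_def upd_def ring_mark_def i by (cases "x \<in> ?S") auto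
    qed
    finally show ?thesis .
  qed
  have "run (restr ?S (map (ring_mark \<omega>) (i # rl))) I = run (restr ?S (map (ring_mark \<omega>) rl)) I'"
    by (simp add: I'_def ring_mark_def i)
  moreover have "fold (resample \<Lambda> \<tau> lam \<omega>) rl (conf \<Lambda> I') = conf \<Lambda> (run (restr ?S (map (ring_mark \<omega>) rl)) I')"
  proof (rule Cons.IH[OF _ _ I'])
    show "fst ` set rl \<subseteq> \<Lambda>" using Cons.prems(1) by simp
    show "0 \<le> snd (\<omega> j)" if "j \<in> set rl" for j using Cons.prems(2)[of j] that by simp
  qed
  ultimately show ?case by (simp only: fold_simps step)
qed simp

text \<open>A countable union over the possible ring lists; for a fixed list the result is a finite
  tree of comparisons of marks. When no list is valid, the empty list leaves the configuration
  unchanged.\<close>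

lemma measurable_heat_bath:
  fixes \<Lambda> :: "'d::finite site set"
  assumes fin: "finite \<Lambda>"
  shows "{\<omega> \<in> space (clock_space \<Lambda>). heat_bath \<Lambda> \<tau> lam \<sigma> t \<omega> = \<eta>} \<in> sets (clock_space \<Lambda>)"
proof -
  have r: "Measurable.pred (clock_space \<Lambda>) (\<lambda>\<omega>. fold (resample \<Lambda> \<tau> lam \<omega>) rl \<sigma> = \<eta>)" for rl \<sigma>
  proof (induction rl arbitrary: \<sigma>)
    case (Cons i rl)
    obtain x k where i: "i = (x, k)" by (cases i)
    note [measurable] = Cons.IH
    have "fold (resample \<Lambda> \<tau> lam \<omega>) (i # rl) \<sigma> = \<eta> \<longleftrightarrow>
        (snd (\<omega> (x, k)) < occupation_prob \<Lambda> \<tau> lam x \<sigma> \<and> fold (resample \<Lambda> \<tau> lam \<omega>) rl (\<sigma>(x := 1)) = \<eta>) \<or>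
        (\<not> snd (\<omega> (x, k)) < occupation_prob \<Lambda> \<tau> lam x \<sigma> \<and> fold (resample \<Lambda> \<tau> lam \<omega>) rl (\<sigma>(x := 0)) = \<eta>)" for \<omega>
      by (simp add: i resample_def)
    then show ?case by simp
  qed simp
  have "heat_bath \<Lambda> \<tau> lam \<sigma> t \<omega> = \<eta> \<longleftrightarrow>
      (\<exists>rl. rings_ok \<Lambda> \<omega> t rl \<and> fold (resample \<Lambda> \<tau> lam \<omega>) rl \<sigma> = \<eta>) \<or> (\<not> (\<exists>rl. rings_ok \<Lambda> \<omega> t rl) \<and> \<sigma> = \<eta>)" for \<omega>
  proof (cases "\<exists>rl. rings_ok \<Lambda> \<omega> t rl")
    case True
    then obtain rl where rl: "rings_ok \<Lambda> \<omega> t rl" ..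
    have "rl' = rl" if "rings_ok \<Lambda> \<omega> t rl'" for rl' using ring_list_eq[OF that] ring_list_eq[OF rl] by simp
    with rl show ?thesis unfolding heat_bath_def ring_list_eq[OF rl] by blast
  next
    case False
    let ?R = "rings_upto \<Lambda> \<omega> t"
    have "\<not> (finite ?R \<and> inj_on (ring_time \<omega>) ?R)"
    proof
      assume R: "finite ?R \<and> inj_on (ring_time \<omega>) ?R"
      obtain rl where "sorted_wrt (<) (map (ring_time \<omega>) rl)" "set rl = ?R"
        by (rule ex_strictly_sorted_list[OF conjunct1[OF R] conjunct2[OF R]])
      then have "rings_ok \<Lambda> \<omega> t rl" unfolding rings_ok_def sorted_wrt_map by (intro conjI)
      with False show False by blast
    qed
    then have "ring_list \<Lambda> \<omega> t = []" unfolding ring_list_def by (rule if_not_P)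
    then show ?thesis using False by (simp add: heat_bath_def)
  qed
  moreover have "Measurable.pred (clock_space \<Lambda>) (\<lambda>\<omega>. (\<exists>rl. rings_ok \<Lambda> \<omega> t rl \<and> fold (resample \<Lambda> \<tau> lam \<omega>) rl \<sigma> = \<eta>)
      \<or> (\<not> (\<exists>rl. rings_ok \<Lambda> \<omega> t rl) \<and> \<sigma> = \<eta>))"
    using r by measurable
  ultimately show ?thesis by simp
qed

lemma AE_marks_nonneg: "AE \<omega> in clock_space \<Lambda>. \<forall>i\<in>\<Lambda> \<times> UNIV. 0 \<le> snd (\<omega> i)"
proof -
  have "AE z in ring_measure. 0 \<le> snd z"
  proof -
    have m: "{z :: real \<times> real. snd z < 0} \<in> sets ring_measure"
    proof -
      have "{z \<in> space (borel \<Otimes>\<^sub>M (borel :: real measure)). snd z < (0 :: real)} \<in> sets (borel \<Otimes>\<^sub>M borel)" by measurable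
      then show ?thesis by (simp add: sets_ring_measure space_pair_measure)
    qed
    have "{z :: real \<times> real. snd z < 0} = UNIV \<times> {..<0}" by auto
    moreover have "emeasure (uniform_measure lborel {0..1 :: real}) {..<0} = 0"
    proof -
      have "{0..1} \<inter> {..<0} = ({} :: real set)" by auto
      then show ?thesis by (subst emeasure_uniform_measure) (simp_all only: sets.empty_sets emeasure_empty, auto)
    qed
    ultimately have "emeasure ring_measure {z. snd z < 0} = 0"
      unfolding ring_measure_def by (simp add: ring.M2.emeasure_pair_measure_Times)
    then show ?thesis using m by (intro AE_I[of _ _ "{z. snd z < 0}"]) auto
  qed
  note AE_PiM_component[where M = "\<lambda>_. ring_measure" and I = "\<Lambda> \<times> UNIV" and P = "\<lambda>z. 0 \<le> snd z", OF prob_space_ring_measure _ this]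
  then have "AE \<omega> in clock_space \<Lambda>. i \<in> \<Lambda> \<times> UNIV \<longrightarrow> 0 \<le> snd (\<omega> i)" for i
    unfolding clock_space_eq by (cases "i \<in> \<Lambda> \<times> UNIV") auto
  then have "AE \<omega> in clock_space \<Lambda>. \<forall>i. i \<in> \<Lambda> \<times> UNIV \<longrightarrow> 0 \<le> snd (\<omega> i)" by (rule AE_all_countable[THEN iffD2, OF allI])
  then show ?thesis by (rule AE_mp) auto
qed

lemma history_disjoint: "\<omega> \<in> history \<Lambda> t l \<Longrightarrow> \<omega> \<in> history \<Lambda> t l' \<Longrightarrow> l = l'"
  unfolding history_def using ring_list_eq by blast

lemma emeasure_histories_ge:
  fixes \<Lambda> :: "'d::finite site set"
  assumes fin: "finite \<Lambda>" and t: "0 \<le> t"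
  shows "(\<Union>l\<in>L. history \<Lambda> t l) \<in> sets (clock_space \<Lambda>)"
    and "emeasure (measure_pmf (updates \<Lambda> t)) L \<le> emeasure (clock_space \<Lambda>) (\<Union>l\<in>L. history \<Lambda> t l)"
proof -
  show "(\<Union>l\<in>L. history \<Lambda> t l) \<in> sets (clock_space \<Lambda>)"
    by (rule sets.countable_UN'') auto
  have "emeasure (measure_pmf (updates \<Lambda> t)) L = (\<integral>\<^sup>+l. ennreal (pmf (updates \<Lambda> t) l) \<partial>count_space L)"
    by (rule nn_integral_pmf[symmetric])
  also have "\<dots> \<le> (\<integral>\<^sup>+l. emeasure (clock_space \<Lambda>) (history \<Lambda> t l) \<partial>count_space L)"
    by (intro nn_integral_mono emeasure_history_ge[OF fin t])
  also have "\<dots> = emeasure (clock_space \<Lambda>) (\<Union>l\<in>L. history \<Lambda> t l)"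
  proof (rule emeasure_UN_countable[symmetric])
    show "disjoint_family_on (history \<Lambda> t) L"
      unfolding disjoint_family_on_def using history_disjoint by blast
  qed auto
  finally show "emeasure (measure_pmf (updates \<Lambda> t)) L \<le> emeasure (clock_space \<Lambda>) (\<Union>l\<in>L. history \<Lambda> t l)" .
qed

theorem heat_bath_prob_eq:
  fixes \<Lambda> :: "'d::finite site set"
  assumes fin: "finite \<Lambda>" and t: "0 \<le> t" and I: "I \<in> indep_sets (free_sites \<Lambda> \<tau>)"
  shows "heat_bath_prob \<Lambda> \<tau> lam (conf \<Lambda> I) t \<eta>
    = measure_pmf.prob (updates (free_sites \<Lambda> \<tau>) t) {l. conf \<Lambda> (run l I) = \<eta>}"
proof -
  let ?S = "free_sites \<Lambda> \<tau>" and ?C = "clock_space \<Lambda>"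
  interpret C: prob_space ?C unfolding clock_space_eq by (rule prob_space_PiM) (rule prob_space_ring_measure)
  define L where "L = {l. conf \<Lambda> (run (restr ?S l) I) = \<eta>}"
  define H where "H = {\<omega> \<in> space ?C. heat_bath \<Lambda> \<tau> lam (conf \<Lambda> I) t \<omega> = \<eta>}"
  have H: "H \<in> sets ?C" unfolding H_def by (rule measurable_heat_bath[OF fin])
  have val: "AE \<omega> in ?C. \<forall>l. \<omega> \<in> history \<Lambda> t l \<longrightarrow> heat_bath \<Lambda> \<tau> lam (conf \<Lambda> I) t \<omega> = conf \<Lambda> (run (restr ?S l) I)"
    using AE_marks_nonneg
  proof eventually_elim
    case (elim \<omega>)
    show ?case
    proof (intro allI impI)
      fix l assume "\<omega> \<in> history \<Lambda> t l"
      then obtain rl where rl: "rings_ok \<Lambda> \<omega> t rl" "map (ring_mark \<omega>) rl = l" by (auto simp: history_def)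
      then have "set rl \<subseteq> \<Lambda> \<times> UNIV" by (auto simp: rings_ok_def rings_upto_def)
      then have "fold (resample \<Lambda> \<tau> lam \<omega>) rl (conf \<Lambda> I) = conf \<Lambda> (run (restr ?S l) I)"
        unfolding rl(2)[symmetric] using elim by (intro fold_resample[OF fin _ _ I]) auto
      then show "heat_bath \<Lambda> \<tau> lam (conf \<Lambda> I) t \<omega> = conf \<Lambda> (run (restr ?S l) I)"
        unfolding heat_bath_def ring_list_eq[OF rl(1)] .
    qed
  qed
  have "emeasure (measure_pmf (updates \<Lambda> t)) L \<le> emeasure ?C (\<Union>l\<in>L. history \<Lambda> t l)"
    by (rule emeasure_histories_ge[OF fin t])
  also have "\<dots> \<le> emeasure ?C H"
  proof (rule emeasure_mono_AE[OF _ H])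
    show "AE \<omega> in ?C. \<omega> \<in> (\<Union>l\<in>L. history \<Lambda> t l) \<longrightarrow> \<omega> \<in> H"
      using val AE_space by eventually_elim (auto simp: L_def H_def)
  qed
  finally have 1: "measure_pmf.prob (updates \<Lambda> t) L \<le> C.prob H"
    by (simp add: measure_pmf.emeasure_eq_measure C.emeasure_eq_measure)
  \<comment> \<open>The same lower bound for the complementary lists. Since both sides have total
    mass 1, the two inequalities must be equalities.\<close>
  have "emeasure (measure_pmf (updates \<Lambda> t)) (- L) \<le> emeasure ?C (\<Union>l\<in>- L. history \<Lambda> t l)"
    by (rule emeasure_histories_ge[OF fin t])
  also have "\<dots> \<le> emeasure ?C (space ?C - H)"
  proof (rule emeasure_mono_AE)
    show "AE \<omega> in ?C. \<omega> \<in> (\<Union>l\<in>- L. history \<Lambda> t l) \<longrightarrow> \<omega> \<in> space ?C - H"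
      using val AE_space by eventually_elim (auto simp: L_def H_def)
  qed (use H in auto)
  finally have 2: "measure_pmf.prob (updates \<Lambda> t) (- L) \<le> C.prob (space ?C - H)"
    by (simp add: measure_pmf.emeasure_eq_measure C.emeasure_eq_measure)
  have "measure_pmf.prob (updates \<Lambda> t) (- L) = 1 - measure_pmf.prob (updates \<Lambda> t) L"
    using measure_pmf.prob_compl[of L "updates \<Lambda> t"] by (simp add: Compl_eq_Diff_UNIV)
  then have "C.prob H = measure_pmf.prob (updates \<Lambda> t) L"
    using 1 2 C.prob_compl[OF H] by simp
  also have "\<dots> = measure_pmf.prob (map_pmf (restr ?S) (updates \<Lambda> t)) {l. conf \<Lambda> (run l I) = \<eta>}"
    by (simp add: L_def vimage_def)
  also have "\<dots> = measure_pmf.prob (updates ?S t) {l. conf \<Lambda> (run l I) = \<eta>}"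
    unfolding updates_restr[OF fin free_sites_subset t] ..
  finally show ?thesis by (simp add: heat_bath_prob_def H_def)
qed

end

section \<open>Distance to equilibrium\<close>

context hardcore
begin

definition gibbs :: "'d::finite site set \<Rightarrow> 'd site set pmf" where
  "gibbs S = embed_pmf (\<lambda>I. if I \<in> indep_sets S then lam ^ card I / Zpart S else 0)"

definition mdist :: "'d::finite site set \<Rightarrow> real \<Rightarrow> real" where
  "mdist S t = (MAX I\<in>indep_sets S. tv (law S t I) (gibbs S))"

lemma pmf_gibbs:
  assumes "finite S"
  shows "pmf (gibbs S) I = (if I \<in> indep_sets S then lam ^ card I / Zpart S else 0)"
  unfolding gibbs_def
proof (rule pmf_embed_pmf)
  have Z: "0 < Zpart S" by (rule Zpart_pos[OF assms])
  show nn: "0 \<le> (if I \<in> indep_sets S then lam ^ card I / Zpart S else 0)" for I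
    using Z lam_pos by simp
  have "(\<integral>\<^sup>+I. ennreal (if I \<in> indep_sets S then lam ^ card I / Zpart S else 0) \<partial>count_space UNIV)
      = (\<Sum>I\<in>indep_sets S. ennreal (lam ^ card I / Zpart S))"
    using assms by (subst nn_integral_count_space'[of "indep_sets S"]) auto
  also have "\<dots> = ennreal (\<Sum>I\<in>indep_sets S. lam ^ card I / Zpart S)"
    using Z lam_pos by (intro sum_ennreal) simp
  also have "(\<Sum>I\<in>indep_sets S. lam ^ card I / Zpart S) = 1"
    using Z by (simp add: Zpart_def sum_divide_distrib[symmetric])
  finally show "(\<integral>\<^sup>+I. ennreal (if I \<in> indep_sets S then lam ^ card I / Zpart S else 0) \<partial>count_space UNIV) = 1" by simp
qed

lemma set_gibbs: "finite S \<Longrightarrow> set_pmf (gibbs S) \<subseteq> indep_sets S"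
  by (auto simp: set_pmf_iff pmf_gibbs split: if_splits)

lemma finite_set_gibbs: "finite S \<Longrightarrow> finite (set_pmf (gibbs S))"
  by (rule finite_subset[OF set_gibbs finite_indep_sets])

lemma expectation_gibbs:
  assumes "finite S"
  shows "measure_pmf.expectation (gibbs S) f = gibbs_sum S f / Zpart S"
proof -
  have "measure_pmf.expectation (gibbs S) f = (\<Sum>I\<in>indep_sets S. f I * pmf (gibbs S) I)"
    using assms set_gibbs[OF assms] by (intro integral_measure_pmf_real) auto
  then show ?thesis
    using assms by (simp add: gibbs_sum_def pmf_gibbs sum_divide_distrib mult.commute)
qed

lemma evolve_eq_law:
  assumes "finite S" "0 \<le> t"
  shows "evolve S S t f I = measure_pmf.expectation (law S t I) f"
proof -
  have "evolve S S t f I = measure_pmf.expectation (updates S t) (\<lambda>l. f (run l I))"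
    unfolding evolve_def
    by (intro integral_cong_AE AE_pmfI) (auto simp: restr_id[OF set_updates[OF assms]])
  then show ?thesis by (simp add: law_def)
qed

lemma bind_gibbs_law:
  assumes S: "finite S" and t: "0 \<le> t"
  shows "bind_pmf (gibbs S) (law S t) = gibbs S"
proof (rule pmf_eqI)
  fix I
  have "pmf (bind_pmf (gibbs S) (law S t)) I = measure_pmf.expectation (gibbs S) (\<lambda>J. pmf (law S t J) I)"
    by (rule pmf_bind)
  also have "\<dots> = measure_pmf.expectation (gibbs S) (evolve S S t (\<lambda>J. of_bool (J = I)))"
    by (rule arg_cong[where f = "measure_pmf.expectation (gibbs S)"])
      (simp add: fun_eq_iff evolve_eq_law[OF S t] expectation_of_bool measure_pmf_single)
  also have "\<dots> = gibbs_sum S (\<lambda>J. of_bool (J = I)) / Zpart S"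
    unfolding expectation_gibbs[OF S] gibbs_sum_evolve_invariant[OF S, where B = 1 and g = "\<lambda>J. of_bool (J = I)", simplified] ..
  also have "\<dots> = measure_pmf.expectation (gibbs S) (\<lambda>J. of_bool (J = I))"
    by (rule expectation_gibbs[OF S, symmetric])
  also have "\<dots> = pmf (gibbs S) I"
    by (simp add: expectation_of_bool measure_pmf_single)
  finally show "pmf (bind_pmf (gibbs S) (law S t)) I = pmf (gibbs S) I" .
qed

lemma bind_updates_gibbs:
  assumes "finite S" "0 \<le> t"
  shows "bind_pmf (updates S t) (\<lambda>l. map_pmf (run l) (gibbs S)) = gibbs S"
proof -
  have "bind_pmf (updates S t) (\<lambda>l. map_pmf (run l) (gibbs S))
      = bind_pmf (updates S t) (\<lambda>l. bind_pmf (gibbs S) (\<lambda>J. return_pmf (run l J)))"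
    by (simp add: map_pmf_def)
  also have "\<dots> = bind_pmf (gibbs S) (\<lambda>J. bind_pmf (updates S t) (\<lambda>l. return_pmf (run l J)))"
    by (rule bind_commute_pmf)
  also have "\<dots> = bind_pmf (gibbs S) (law S t)" by (simp add: map_pmf_def law_def[abs_def])
  finally show ?thesis using bind_gibbs_law[OF assms] by simp
qed

lemma tv_law_law_le:
  assumes S: "finite S" and t: "0 \<le> t" and I: "I \<in> indep_sets S" "J \<in> indep_sets S"
  shows "tv (law S t I) (law S t J) \<le> not_coalesced S t"
proof -
  have "tv (law S t I) (law S t J) \<le> measure_pmf.prob (updates S t) {l. run l I \<noteq> run l J}"
    unfolding law_def using finite_set_law[OF S t I(1)] finite_set_law[OF S t I(2)]
    by (intro tv_coupling) (simp_all add: law_def)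
  also have "\<dots> \<le> not_coalesced S t"
    unfolding not_coalesced_def
  proof (intro measure_pmf.finite_measure_mono subsetI)
    fix l assume "l \<in> {l. run l I \<noteq> run l J}"
    moreover have "I \<subseteq> S" "J \<subseteq> S" using I by (auto simp: indep_sets_def)
    ultimately show "l \<in> {l. run l (top_conf S) \<noteq> run l (bot_conf S)}"
      using run_coalesced[of l S I] run_coalesced[of l S J] by auto
  qed simp
  finally show ?thesis .
qed

text \<open>By stationarity the Gibbs measure is a mixture of the laws started from its own samples,
  each of which is close to \<open>law S t I\<close>.\<close>

lemma tv_law_gibbs_le:
  assumes S: "finite S" and t: "0 \<le> t" and I: "I \<in> indep_sets S"
  shows "tv (law S t I) (gibbs S) \<le> not_coalesced S t"
proof -
  have "tv (bind_pmf (gibbs S) (\<lambda>_. law S t I)) (bind_pmf (gibbs S) (law S t))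
      \<le> measure_pmf.expectation (gibbs S) (\<lambda>_. not_coalesced S t)"
  proof (rule tv_bind_le)
    show "tv (law S t I) (law S t J) \<le> not_coalesced S t" if "J \<in> set_pmf (gibbs S)" for J
      using tv_law_law_le[OF S t I] that set_gibbs[OF S] by blast
  qed (use finite_set_law[OF S t I] finite_set_gibbs[OF S] bind_gibbs_law[OF S t] in simp_all)
  then show ?thesis by (simp add: bind_gibbs_law[OF S t])
qed

lemma tv_gibbs_antimono:
  assumes S: "finite S" and t: "0 \<le> t" "0 \<le> s" and I: "I \<in> indep_sets S"
  shows "tv (law S (t + s) I) (gibbs S) \<le> tv (law S t I) (gibbs S)"
proof -
  note fin = finite_set_law[OF S _ I] finite_set_gibbs[OF S]
  have "tv (bind_pmf (updates S s) (\<lambda>l. map_pmf (run l) (law S t I))) (bind_pmf (updates S s) (\<lambda>l. map_pmf (run l) (gibbs S)))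
      \<le> measure_pmf.expectation (updates S s) (\<lambda>_. tv (law S t I) (gibbs S))"
  proof (rule tv_bind_le)
    show "finite (set_pmf (bind_pmf (updates S s) (\<lambda>l. map_pmf (run l) (law S t I))))"
      unfolding law_add[OF S t(2,1), symmetric] using fin(1)[of "t + s"] t by simp
    show "finite (set_pmf (bind_pmf (updates S s) (\<lambda>l. map_pmf (run l) (gibbs S))))"
      unfolding bind_updates_gibbs[OF S t(2)] by (rule fin(2))
    show "tv (map_pmf (run l) (law S t I)) (map_pmf (run l) (gibbs S)) \<le> tv (law S t I) (gibbs S)" for l
      by (rule tv_map[OF fin(1)[OF t(1)] fin(2)])
  qed simp
  then show ?thesis
    unfolding law_add[OF S t(2,1), symmetric] bind_updates_gibbs[OF S t(2)] by simp
qed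

lemma mdist_le_iff:
  assumes "finite S"
  shows "mdist S t \<le> \<epsilon> \<longleftrightarrow> (\<forall>I\<in>indep_sets S. tv (law S t I) (gibbs S) \<le> \<epsilon>)"
proof -
  have "finite ((\<lambda>I. tv (law S t I) (gibbs S)) ` indep_sets S)" "(\<lambda>I. tv (law S t I) (gibbs S)) ` indep_sets S \<noteq> {}"
    using assms empty_in_indep_sets[of S] by (simp, blast)
  then show ?thesis unfolding mdist_def by (subst Max_le_iff) auto
qed

lemma mdist_antimono:
  assumes "finite S" "0 \<le> s" "s \<le> t"
  shows "mdist S t \<le> mdist S s"
proof -
  have "tv (law S t I) (gibbs S) \<le> mdist S s" if "I \<in> indep_sets S" for I
  proof -
    have "tv (law S t I) (gibbs S) \<le> tv (law S s I) (gibbs S)"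
      using tv_gibbs_antimono[of S s "t - s" I] assms that by simp
    also have "\<dots> \<le> mdist S s" using mdist_le_iff[OF assms(1), of s "mdist S s"] that by blast
    finally show ?thesis .
  qed
  then show ?thesis unfolding mdist_le_iff[OF assms(1)] by blast
qed

lemma mdist_le_not_coalesced: "finite S \<Longrightarrow> 0 \<le> t \<Longrightarrow> mdist S t \<le> not_coalesced S t"
  using tv_law_gibbs_le unfolding mdist_le_iff by blast

lemma tv_dist_heat_bath:
  fixes \<Lambda> :: "'d::finite site set" and \<tau> :: "'d site \<Rightarrow> nat option"
  defines "S \<equiv> free_sites \<Lambda> \<tau>"
  assumes fin: "finite \<Lambda>" and t: "0 \<le> t" and I: "I \<in> indep_sets S"
  shows "tv_dist (admissible \<Lambda> \<tau>) (heat_bath_prob \<Lambda> \<tau> lam (conf \<Lambda> I) t) (hard_core \<Lambda> \<tau> lam) = tv (law S t I) (gibbs S)"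
proof -
  have S: "finite S" unfolding S_def using free_sites_subset fin by (rule finite_subset)
  have sub: "J \<subseteq> \<Lambda>" if "J \<in> indep_sets S" for J
    using that free_sites_subset[of \<Lambda> \<tau>] unfolding S_def indep_sets_def by blast
  have hb: "heat_bath_prob \<Lambda> \<tau> lam (conf \<Lambda> I) t (conf \<Lambda> J) = pmf (law S t I) J" if J: "J \<in> indep_sets S" for J
  proof -
    have "heat_bath_prob \<Lambda> \<tau> lam (conf \<Lambda> I) t (conf \<Lambda> J) = measure_pmf.prob (law S t I) {K. conf \<Lambda> K = conf \<Lambda> J}"
      using heat_bath_prob_eq[OF fin t I[unfolded S_def]] by (simp add: law_def S_def vimage_def)
    also have "\<dots> = sum (pmf (law S t I)) {J}"
    proof (rule prob_eq_sum_pmf)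
      fix K assume "K \<in> set_pmf (law S t I)"
      then have "K \<subseteq> \<Lambda>" using set_law[OF S t I] sub by blast
      then show "K \<in> {K. conf \<Lambda> K = conf \<Lambda> J} \<longleftrightarrow> K \<in> {J}"
        using inj_on_conf[of \<Lambda>] sub[OF J] by (auto simp: inj_on_def)
    qed simp
    finally show ?thesis by simp
  qed
  have "(\<Sum>\<eta>\<in>admissible \<Lambda> \<tau>. \<bar>heat_bath_prob \<Lambda> \<tau> lam (conf \<Lambda> I) t \<eta> - hard_core \<Lambda> \<tau> lam \<eta>\<bar>)
      = (\<Sum>J\<in>indep_sets S. \<bar>heat_bath_prob \<Lambda> \<tau> lam (conf \<Lambda> I) t (conf \<Lambda> J) - hard_core \<Lambda> \<tau> lam (conf \<Lambda> J)\<bar>)"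
    unfolding S_def by (rule sum.reindex_bij_betw[OF bij_betw_conf, symmetric])
  also have "\<dots> = (\<Sum>J\<in>indep_sets S. \<bar>pmf (law S t I) J - pmf (gibbs S) J\<bar>)"
    by (rule sum.cong[OF refl]) (simp add: hb hard_core_conf[OF fin sub] pmf_gibbs[OF S] S_def[symmetric])
  also have "\<dots> = 2 * tv (law S t I) (gibbs S)"
    using tv_eq_sum[of "indep_sets S", OF _ set_law[OF S t I] set_gibbs[OF S]] S by simp
  finally show ?thesis by (simp add: tv_dist_def)
qed

lemma t_mix_eq:
  fixes \<Lambda> :: "'d::finite site set"
  assumes "finite \<Lambda>"
  shows "t_mix \<Lambda> \<tau> lam \<epsilon> = Inf {t. 0 \<le> t \<and> mdist (free_sites \<Lambda> \<tau>) t \<le> \<epsilon>}"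
proof -
  have "(MAX \<sigma>\<in>admissible \<Lambda> \<tau>. tv_dist (admissible \<Lambda> \<tau>) (heat_bath_prob \<Lambda> \<tau> lam \<sigma> t) (hard_core \<Lambda> \<tau> lam))
      = mdist (free_sites \<Lambda> \<tau>) t" if t: "0 \<le> t" for t
  proof -
    have adm: "admissible \<Lambda> \<tau> = conf \<Lambda> ` indep_sets (free_sites \<Lambda> \<tau>)"
      using bij_betw_conf[of \<Lambda> \<tau>] by (simp add: bij_betw_def)
    have "(\<lambda>\<sigma>. tv_dist (admissible \<Lambda> \<tau>) (heat_bath_prob \<Lambda> \<tau> lam \<sigma> t) (hard_core \<Lambda> \<tau> lam)) ` admissible \<Lambda> \<tau>
        = (\<lambda>I. tv_dist (admissible \<Lambda> \<tau>) (heat_bath_prob \<Lambda> \<tau> lam (conf \<Lambda> I) t) (hard_core \<Lambda> \<tau> lam)) ` indep_sets (free_sites \<Lambda> \<tau>)"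
      using image_image[of "\<lambda>\<sigma>. tv_dist (admissible \<Lambda> \<tau>) (heat_bath_prob \<Lambda> \<tau> lam \<sigma> t) (hard_core \<Lambda> \<tau> lam)"
          "conf \<Lambda>" "indep_sets (free_sites \<Lambda> \<tau>)"] unfolding adm[symmetric] .
    also have "\<dots> = (\<lambda>I. tv (law (free_sites \<Lambda> \<tau>) t I) (gibbs (free_sites \<Lambda> \<tau>))) ` indep_sets (free_sites \<Lambda> \<tau>)"
      by (rule image_cong[OF refl]) (rule tv_dist_heat_bath[OF assms t])
    finally show ?thesis unfolding mdist_def by simp
  qed
  then have "{t. 0 \<le> t \<and> (MAX \<sigma>\<in>admissible \<Lambda> \<tau>. tv_dist (admissible \<Lambda> \<tau>) (heat_bath_prob \<Lambda> \<tau> lam \<sigma> t) (hard_core \<Lambda> \<tau> lam)) \<le> \<epsilon>}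
      = {t. 0 \<le> t \<and> mdist (free_sites \<Lambda> \<tau>) t \<le> \<epsilon>}"
    by (intro Collect_cong conj_cong refl) simp
  then show ?thesis unfolding t_mix_def by (rule arg_cong)
qed


text \<open>With \<open>b = 2d - 1\<close> one has \<open>b - 1 = 2d - 2\<close>, so the hypothesis
  is the subcriticality needed for the tree with \<open>b\<close> children. \<open>occ_decay\<close>
  gives \<open>\<kappa> ^ n\<close> at radius \<open>n + 1\<close>, hence the division by
  \<open>\<kappa>\<close> in \<open>C\<close>; the maximum with 1 covers radius 0.\<close>

lemma ex_coalescence_rate:
  assumes "CARD('d::finite) \<ge> 2 \<Longrightarrow>
    lam < 1 / (2 * real CARD('d) - 2) * (1 + 1 / (2 * real CARD('d) - 2)) ^ (2 * CARD('d) - 1)"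
  shows "\<exists>c>0. \<forall>(S :: 'd site set) t. finite S \<longrightarrow> 0 \<le> t \<longrightarrow>
    not_coalesced S t \<le> 4 * real (card S) * exp (- c * t)"
proof -
  define b where "b = 2 * CARD('d) - 1"
  have d: "CARD('d) \<ge> 1" by (simp add: Suc_leI)
  then have b: "Suc b = 2 * CARD('d)" "b \<ge> 1" unfolding b_def by arith+
  from arg_cong[OF b(1), of real] have b3: "real b - 1 = 2 * real CARD('d) - 2" by simp
  have sub: "lam < 1 / (real b - 1) * (1 + 1 / (real b - 1)) ^ b" if "b \<ge> 2"
    unfolding b3 using assms that unfolding b_def by simp
  obtain \<kappa> where \<kappa>: "0 < \<kappa>" "\<kappa> < 1"
    and contr: "\<And>z. 0 \<le> z \<Longrightarrow> z \<le> 1 \<Longrightarrow> lam * z ^ b * ((real b)\<^sup>2 * (1 - z)) \<le> \<kappa>\<^sup>2 * (1 + lam * z ^ b)"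
    using subcritical_contraction[OF lam_pos b(2) sub] by blast
  define K where "K = 4 * real CARD('d) * arsinh (sqrt lam)"
  define C where "C = max 1 (K / \<kappa>)"
  show ?thesis
  proof (rule coalescence_bound[OF \<kappa>])
    show "1 \<le> C" by (simp add: C_def)
    fix T T' :: "'d site set" and v r
    assume fin: "finite T" "finite T'" and eq: "T \<inter> lball v r = T' \<inter> lball v r"
    show "\<bar>occ T v - occ T' v\<bar> \<le> C * \<kappa> ^ r"
    proof (cases r)
      case 0
      then show ?thesis
        using occ_bounds[OF fin(1), of v] occ_bounds[OF fin(2), of v] \<open>1 \<le> C\<close> by simp
    next
      case (Suc n)
      have "\<bar>occ T v - occ T' v\<bar> \<le> K * \<kappa> ^ n"
        unfolding K_def by (rule occ_decay[OF b(1) \<kappa>(1) contr fin eq[unfolded Suc]])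
      also have "\<dots> = K / \<kappa> * \<kappa> ^ r" using \<kappa>(1) by (simp add: Suc)
      also have "\<dots> \<le> C * \<kappa> ^ r" using \<kappa>(1) by (intro mult_right_mono) (auto simp: C_def)
      finally show ?thesis .
    qed
  qed
qed

text \<open>Equilibrium is replaced by the law at time \<open>t1\<close> from the top configuration,
  at distance at most \<open>\<epsilon> / 2\<close>, so the two dynamic laws are at distance at most
  \<open>1 - \<epsilon> / 2\<close> at the start. \<open>sum_local_gap\<close> bounds their defects
  and \<open>tv_after_smoothing\<close> converts these into closeness after time
  \<open>s\<close>.\<close>

lemma mdist_smoothing:
  fixes S :: "'d::finite site set" and r q :: nat
  assumes S: "finite S" and t: "0 \<le> t" "t \<le> t1" and s: "0 \<le> s" "s \<le> t1"
    and e: "leak S t1 r \<le> e" "8 * e \<le> \<epsilon>" and \<epsilon>: "0 < \<epsilon>" "\<epsilon> < 1"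
    and nc: "not_coalesced S t1 \<le> \<epsilon> / 2" and p: "\<And>y. not_coalesced (region S r y) s \<le> p"
    and dist: "mdist S t \<le> 1 - \<epsilon>"
  defines "k \<equiv> (2 * r + 1) ^ CARD('d) * q"
  defines "h \<equiv> real (card S) * (2 * sqrt (2 * e))"
  shows "mdist S (t + s) \<le> 4 * e + \<epsilon> / 2 + real (card S) * (real (2 * (4 * r * k) + 1) ^ CARD('d) * p) ^ q
    + p * (real (2 * (4 * r * k + r + r) + 1) ^ CARD('d) * (ln (4 / \<epsilon>) + h) + h) / \<epsilon> + not_coalesced S t1"
  unfolding mdist_le_iff[OF S]
proof
  fix I assume I: "I \<in> indep_sets S"
  let ?T = "top_conf S"
  have t1: "0 \<le> t1" using t by simp
  have le: "leak S t r \<le> e" "leak S s r \<le> e"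
    using leak_mono[OF t(2), of S r] leak_mono[OF s(2), of S r] e(1) by auto
  note fin = finite_set_law[OF S _ I] finite_set_law[OF S _ top_conf_indep] finite_set_gibbs[OF S]
  have near: "tv (gibbs S) (law S u ?T) \<le> not_coalesced S t1" if "t1 \<le> u" for u
  proof -
    have "tv (law S u ?T) (gibbs S) \<le> not_coalesced S u"
      using t1 that by (intro tv_law_gibbs_le[OF S]) auto
    also have "\<dots> \<le> not_coalesced S t1" by (rule not_coalesced_antimono[OF S t1 that])
    finally show ?thesis by (simp add: tv_sym)
  qed
  have "tv (law S t I) (law S t1 ?T) \<le> tv (law S t I) (gibbs S) + tv (gibbs S) (law S t1 ?T)"
    using t t1 by (intro tv_triangle fin) auto
  also have "\<dots> \<le> 1 - \<epsilon> / 2"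
    using dist[unfolded mdist_le_iff[OF S]] I near[of t1] nc by force
  finally have "(\<Sum>x\<in>S. local_gap S (4 * r * k + r) (law S t I) (law S t1 ?T) x)
      \<le> real (2 * (4 * r * k + r + r) + 1) ^ CARD('d) * (ln (2 / (\<epsilon> / 2)) + real (card S) * (2 * sqrt (2 * e)))"
    using e \<epsilon> by (intro sum_local_gap[OF S t(1) t1 I top_conf_indep le(1) e(1)]) auto
  then have gap: "(\<Sum>x\<in>S. local_gap S (4 * r * k + r) (law S t I) (law S t1 ?T) x + 2 * sqrt (2 * e))
      \<le> real (2 * (4 * r * k + r + r) + 1) ^ CARD('d) * (ln (4 / \<epsilon>) + h) + h"
    by (simp add: sum.distrib h_def)
  have p0: "0 \<le> p" using p[of undefined] measure_nonneg[of "updates (region S r undefined) s"] order_trans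
    unfolding not_coalesced_def by blast
  have "tv (law S (t + s) I) (law S (t1 + s) ?T) \<le> 4 * e + \<epsilon> / 2
    + real (card S) * (real (2 * (4 * r * k) + 1) ^ CARD('d) * p) ^ q
    + p * (\<Sum>x\<in>S. local_gap S (4 * r * k + r) (law S t I) (law S t1 ?T) x + 2 * sqrt (2 * e)) / \<epsilon>"
    unfolding k_def by (rule tv_after_smoothing[OF S t(1) t1 s(1) I top_conf_indep le(1) e(1) le(2) \<epsilon>(1) p])
  also have "p * (\<Sum>x\<in>S. local_gap S (4 * r * k + r) (law S t I) (law S t1 ?T) x + 2 * sqrt (2 * e)) / \<epsilon>
      \<le> p * (real (2 * (4 * r * k + r + r) + 1) ^ CARD('d) * (ln (4 / \<epsilon>) + h) + h) / \<epsilon>"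
    using gap p0 \<epsilon>(1) by (intro divide_right_mono mult_left_mono) auto
  finally have "tv (law S (t + s) I) (law S (t1 + s) ?T) \<le> 4 * e + \<epsilon> / 2
    + real (card S) * (real (2 * (4 * r * k) + 1) ^ CARD('d) * p) ^ q
    + p * (real (2 * (4 * r * k + r + r) + 1) ^ CARD('d) * (ln (4 / \<epsilon>) + h) + h) / \<epsilon>" by simp
  moreover have "tv (law S (t + s) I) (gibbs S) \<le> tv (law S (t + s) I) (law S (t1 + s) ?T) + tv (law S (t1 + s) ?T) (gibbs S)"
    using t t1 s by (intro tv_triangle fin) auto
  moreover have "tv (law S (t1 + s) ?T) (gibbs S) \<le> not_coalesced S t1"
    using near[of "t1 + s"] s by (simp add: tv_sym)
  ultimately show "tv (law S (t + s) I) (gibbs S) \<le> 4 * e + \<epsilon> / 2 + real (card S) * (real (2 * (4 * r * k) + 1) ^ CARD('d) * p) ^ q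
    + p * (real (2 * (4 * r * k + r + r) + 1) ^ CARD('d) * (ln (4 / \<epsilon>) + h) + h) / \<epsilon> + not_coalesced S t1" by linarith
qed

text \<open>Started from the top configuration, an even site is still occupied if its clock has not rung.\<close>

lemma prob_top_ge:
  fixes S :: "'d::finite site set"
  assumes S: "finite S" and t: "0 \<le> t" and x: "x \<in> top_conf S"
  shows "measure_pmf.prob (gibbs S) {J. x \<in> J} + exp (- t) / (1 + lam) \<le> measure_pmf.prob (law S t (top_conf S)) {J. x \<in> J}"
proof -
  let ?top = "measure_pmf.prob (law S t (top_conf S)) {J. x \<in> J}"
  let ?g = "\<lambda>J. measure_pmf.prob (law S t J) {J. x \<in> J}"
  have ev: "even_site x" and xS: "x \<in> S" using x by (auto simp: top_conf_def)
  have ring: "measure_pmf.prob (updates S t) {l. x \<notin> fst ` set l} = exp (- t)"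
  proof -
    have "{l :: ('d site \<times> bool) list. x \<notin> fst ` set l} = restr {x} -` {[]}"
      by (force simp: restr_def filter_empty_conv)
    then have "measure_pmf.prob (updates S t) {l. x \<notin> fst ` set l} = measure_pmf.prob (map_pmf (restr {x}) (updates S t)) {[]}" by simp
    also have "\<dots> = pmf (updates {x} t) []"
      using updates_restr[OF S, of "{x}" t] xS t by (simp add: measure_pmf_single)
    finally show ?thesis using pmf_updates[of "{x}" t "[]"] t by simp
  qed
  have step: "?g J + exp (- t) * of_bool (x \<notin> J) \<le> ?top" if J: "J \<in> indep_sets S" for J
  proof -
    have JS: "J \<subseteq> S" using J by (simp add: indep_sets_def)
    have mono: "x \<in> run l J \<Longrightarrow> x \<in> run l (top_conf S)" for l
      using run_mono[OF conf_le_top[OF JS], of l] ev by (auto simp: conf_le_def)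
    have top: "x \<notin> fst ` set l \<Longrightarrow> x \<in> run l (top_conf S)" for l
      using run_other[of x l "top_conf S"] x by simp
    have "?g J + exp (- t) * of_bool (x \<notin> J) = measure_pmf.prob (updates S t) {l. x \<in> run l J}
        + measure_pmf.prob (updates S t) {l. x \<notin> fst ` set l \<and> x \<notin> J}"
      using ring by (cases "x \<in> J") (simp_all add: law_def vimage_def)
    also have "\<dots> = measure_pmf.prob (updates S t) ({l. x \<in> run l J} \<union> {l. x \<notin> fst ` set l \<and> x \<notin> J})"
      by (rule measure_pmf.finite_measure_Union[symmetric]) (auto simp: run_other)
    also have "\<dots> \<le> measure_pmf.prob (updates S t) {l. x \<in> run l (top_conf S)}"
      using mono top by (intro measure_pmf.finite_measure_mono) auto
    finally show ?thesis by (simp add: law_def vimage_def)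
  qed
  let ?b = "\<lambda>J. of_bool (x \<notin> J) :: real"
  have int: "integrable (gibbs S) f" for f :: "'d site set \<Rightarrow> real"
    by (rule integrable_measure_pmf_finite[OF finite_set_gibbs[OF S]])
  have "measure_pmf.expectation (gibbs S) (\<lambda>J. ?g J + exp (- t) * ?b J) \<le> measure_pmf.expectation (gibbs S) (\<lambda>_. ?top)"
  proof (intro integral_mono_AE int AE_pmfI)
    fix J assume "J \<in> set_pmf (gibbs S)"
    then show "?g J + exp (- t) * ?b J \<le> ?top" using step set_gibbs[OF S] by blast
  qed
  then have "measure_pmf.expectation (gibbs S) ?g + exp (- t) * measure_pmf.expectation (gibbs S) ?b \<le> ?top"
    using int by (simp add: Bochner_Integration.integral_add)
  moreover have "measure_pmf.expectation (gibbs S) ?g = measure_pmf.prob (gibbs S) {J. x \<in> J}"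
    unfolding prob_bind_pmf[symmetric] bind_gibbs_law[OF S t] ..
  moreover have "1 / (1 + lam) \<le> measure_pmf.expectation (gibbs S) ?b"
  proof -
    have "measure_pmf.expectation (gibbs S) ?b = measure_pmf.expectation (gibbs S) (\<lambda>J. 1 - of_bool (x \<in> J))"
      by (intro Bochner_Integration.integral_cong) auto
    also have "\<dots> = 1 - measure_pmf.expectation (gibbs S) (\<lambda>J. of_bool (x \<in> J))"
      using int by (subst Bochner_Integration.integral_diff) auto
    also have "\<dots> = 1 - occ S x"
      unfolding expectation_gibbs[OF S] gibbs_sum_of_bool[OF S] using Zpart_pos[OF S] by simp
    also have "\<dots> = 1 / (1 + ratio S x)"
      unfolding occ_eq_ratio[OF S xS] using ratio_nonneg[OF S, of x] by (simp add: field_simps)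
    also have "\<dots> \<ge> 1 / (1 + lam)"
      using ratio_nonneg[OF S, of x] ratio_le[OF S, of x] by (intro divide_left_mono) auto
    finally show ?thesis .
  qed
  ultimately show ?thesis
    using mult_left_mono[of "1 / (1 + lam)" "measure_pmf.expectation (gibbs S) ?b" "exp (- t)"] by simp
qed

text \<open>Each even site is biased at time \<open>t\<close> by at least
  \<open>exp (- t) / (1 + lam)\<close> relative to equilibrium. Half of this survives the
  replacement of equilibrium by the law at time \<open>t1\<close>, so by
  \<open>tv_squared_le_affinity\<close> every such site has a defect of at least half the square of
  that. The sum of the defects is bounded by \<open>sum_local_gap\<close>.\<close>

lemma even_sites_bound:
  fixes S :: "'d::finite site set" and r :: nat
  assumes S: "finite S" and t: "0 \<le> t" "t \<le> t1"
    and e: "leak S t1 r \<le> e" "8 * e \<le> \<epsilon>" and \<epsilon>: "0 < \<epsilon>" "\<epsilon> < 1"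
    and nc: "not_coalesced S t1 \<le> \<epsilon> / 2" "not_coalesced S t1 \<le> exp (- t) / (2 * (1 + lam))"
    and dist: "mdist S t \<le> 1 - \<epsilon>"
  shows "real (card (top_conf S)) * ((exp (- t) / (2 * (1 + lam)))\<^sup>2 / 2)
    \<le> real (2 * r + 1) ^ CARD('d) * (ln (4 / \<epsilon>) + real (card S) * (2 * sqrt (2 * e)))"
proof -
  let ?T = "top_conf S" and ?c = "exp (- t) / (2 * (1 + lam))"
  have t1: "0 \<le> t1" using t by simp
  have le: "leak S t r \<le> e" using leak_mono[OF t(2), of S r] e(1) by auto
  note fin = finite_set_law[OF S _ top_conf_indep] finite_set_gibbs[OF S]
  have near: "tv (gibbs S) (law S t1 ?T) \<le> not_coalesced S t1"
    using tv_law_gibbs_le[OF S t1 top_conf_indep] by (simp add: tv_sym)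
  have "tv (law S t ?T) (law S t1 ?T) \<le> tv (law S t ?T) (gibbs S) + tv (gibbs S) (law S t1 ?T)"
    using t t1 by (intro tv_triangle fin) auto
  also have "\<dots> \<le> 1 - \<epsilon> / 2"
    using dist[unfolded mdist_le_iff[OF S], rule_format, OF top_conf_indep] near nc(1) by simp
  finally have "(\<Sum>x\<in>S. local_gap S 0 (law S t ?T) (law S t1 ?T) x)
      \<le> real (2 * (0 + r) + 1) ^ CARD('d) * (ln (2 / (\<epsilon> / 2)) + real (card S) * (2 * sqrt (2 * e)))"
    using e \<epsilon> by (intro sum_local_gap[OF S t(1) t1 top_conf_indep top_conf_indep le e(1)]) auto
  moreover have "(\<Sum>x\<in>?T. ?c\<^sup>2 / 2) \<le> (\<Sum>x\<in>S. local_gap S 0 (law S t ?T) (law S t1 ?T) x)"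
  proof (rule order_trans[OF sum_mono sum_mono2])
    show "finite S" "?T \<subseteq> S" by (use S in \<open>auto simp: top_conf_def\<close>)
    show "0 \<le> local_gap S 0 (law S t ?T) (law S t1 ?T) x" for x
      using t t1 by (intro local_gap_nonneg fin) auto
    fix x assume x: "x \<in> ?T"
    \<comment> \<open>Balls of radius 0 suffice: the defect is visible in single spins.\<close>
    then have reg: "region S 0 x = {x}" by (auto simp: region_def lball_def top_conf_def)
    let ?M = "map_pmf (\<lambda>J. J \<inter> {x}) (law S t ?T)" and ?M' = "map_pmf (\<lambda>J. J \<inter> {x}) (law S t1 ?T)"
    have pr: "measure_pmf.prob (law S u ?T) {J. x \<in> J} = measure_pmf.prob (map_pmf (\<lambda>J. J \<inter> {x}) (law S u ?T)) {J. x \<in> J}" for u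
      by (simp add: vimage_def)
    have "measure_pmf.prob (law S t1 ?T) {J. x \<in> J} - measure_pmf.prob (gibbs S) {J. x \<in> J} \<le> tv (law S t1 ?T) (gibbs S)"
      by (rule prob_diff_le_tv[OF fin(1)[OF t1] fin(2)])
    then have "2 * ?c - not_coalesced S t1 \<le> measure_pmf.prob (law S t ?T) {J. x \<in> J} - measure_pmf.prob (law S t1 ?T) {J. x \<in> J}"
    proof -
      define w where "w = exp (- t) / (1 + lam)"
      have "2 * ?c = w" using lam_pos by (simp add: w_def field_simps)
      then show ?thesis
        using \<open>_ \<le> tv (law S t1 ?T) (gibbs S)\<close> prob_top_ge[OF S t(1) x, folded w_def] near
        unfolding tv_sym[of "gibbs S"] by linarith
    qed
    also have "\<dots> \<le> tv ?M ?M'"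
      unfolding pr using t t1 fin(1) by (intro prob_diff_le_tv) auto
    finally have "?c \<le> tv ?M ?M'" using nc(2) by simp
    then have "?c\<^sup>2 \<le> (tv ?M ?M')\<^sup>2" using lam_pos by (intro power_mono) auto
    also have "\<dots> \<le> 2 * (1 - affinity ?M ?M')"
      using t t1 fin(1) by (intro tv_squared_le_affinity) auto
    finally show "?c\<^sup>2 / 2 \<le> local_gap S 0 (law S t ?T) (law S t1 ?T) x"
      by (simp add: local_gap_def reg)
  qed
  ultimately show ?thesis by simp
qed

end

section \<open>Asymptotics\<close>

text \<open>The argument stands for \<open>ln n\<close>, so this means polylogarithmic in
  \<open>n\<close>. A pure power suffices, since a constant factor is absorbed by one more
  power.\<close>

definition poly_bounded :: "(real \<Rightarrow> real) \<Rightarrow> bool" where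
  "poly_bounded f \<longleftrightarrow> (\<exists>B :: nat. \<forall>\<^sub>F x in at_top. \<bar>f x\<bar> \<le> x ^ B)"

lemma poly_bounded_const: "poly_bounded (\<lambda>_. c)"
  unfolding poly_bounded_def
  by (rule exI[of _ 1]) (use eventually_ge_at_top[of "\<bar>c\<bar>"] in simp)

lemma poly_bounded_add:
  assumes "poly_bounded f" "poly_bounded g"
  shows "poly_bounded (\<lambda>x. f x + g x)"
proof -
  obtain a b :: nat where ab: "\<forall>\<^sub>F x in at_top. \<bar>f x\<bar> \<le> x ^ a" "\<forall>\<^sub>F x in at_top. \<bar>g x\<bar> \<le> x ^ b"
    using assms by (auto simp: poly_bounded_def)
  have "\<forall>\<^sub>F x in at_top. \<bar>f x + g x\<bar> \<le> x ^ (a + b + 1)"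
    using ab eventually_ge_at_top[of 2]
  proof eventually_elim
    case (elim x)
    have "\<bar>f x + g x\<bar> \<le> x ^ a + x ^ b" using elim by linarith
    also have "\<dots> \<le> x ^ (a + b) + x ^ (a + b)" using elim(3) by (intro add_mono power_increasing) auto
    also have "\<dots> = 2 * x ^ (a + b)" by simp
    also have "\<dots> \<le> x * x ^ (a + b)" using elim(3) by (intro mult_right_mono) auto
    finally show ?case by simp
  qed
  then show ?thesis unfolding poly_bounded_def by blast
qed

lemma poly_bounded_mult:
  assumes "poly_bounded f" "poly_bounded g"
  shows "poly_bounded (\<lambda>x. f x * g x)"
proof -
  obtain a b :: nat where ab: "\<forall>\<^sub>F x in at_top. \<bar>f x\<bar> \<le> x ^ a" "\<forall>\<^sub>F x in at_top. \<bar>g x\<bar> \<le> x ^ b"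
    using assms by (auto simp: poly_bounded_def)
  have "\<forall>\<^sub>F x in at_top. \<bar>f x * g x\<bar> \<le> x ^ (a + b)"
    using ab eventually_ge_at_top[of 0]
  proof eventually_elim
    case (elim x)
    then show ?case unfolding abs_mult power_add by (intro mult_mono) auto
  qed
  then show ?thesis unfolding poly_bounded_def by blast
qed

lemma poly_bounded_power: "poly_bounded f \<Longrightarrow> poly_bounded (\<lambda>x. f x ^ n)"
  by (induction n) (simp_all add: poly_bounded_const poly_bounded_mult)

lemma poly_bounded_nat_ceiling: "poly_bounded (\<lambda>x. real (nat \<lceil>x ^ m\<rceil>))"
proof -
  have "\<forall>\<^sub>F x :: real in at_top. \<bar>real (nat \<lceil>x ^ m\<rceil>)\<bar> \<le> x ^ Suc m"
    using eventually_ge_at_top[of 2]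
  proof eventually_elim
    case (elim x)
    have 1: "1 \<le> x ^ m" using elim by simp
    have "real (nat \<lceil>x ^ m\<rceil>) \<le> x ^ m + 1" using 1 by linarith
    also have "\<dots> \<le> 2 * x ^ m" using 1 by simp
    also have "\<dots> \<le> x * x ^ m" using elim 1 by (intro mult_right_mono) auto
    finally show ?case by simp
  qed
  then show ?thesis unfolding poly_bounded_def by blast
qed

lemmas poly_bounded_intros =
  poly_bounded_const poly_bounded_add poly_bounded_mult poly_bounded_power poly_bounded_nat_ceiling

text \<open>A cubic radius dominates both the distance of order \<open>x^2\<close> that information
  travels in time \<open>x^2\<close> and the logarithm of the number of sites, of order
  \<open>x\<close>.\<close>

definition range_at :: "real \<Rightarrow> nat" where
  "range_at x = nat \<lceil>x ^ 3\<rceil>"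

text \<open>The number \<open>q\<close> of simultaneously bad regions in a dense cluster. When each
  contributes a factor at most \<open>1 / x\<close>, including the choice of its position, about
  \<open>x\<close> of them outweigh the \<open>exp (d * x)\<close> possible centres.\<close>

definition size_at :: "real \<Rightarrow> nat" where
  "size_at x = nat \<lceil>x ^ 1\<rceil>"

lemma range_at_ge: "x ^ 3 \<le> real (range_at x)" and size_at_ge: "x \<le> real (size_at x)"
  unfolding range_at_def size_at_def power_one_right by linarith+

lemma poly_bounded_range_at: "poly_bounded (\<lambda>x. real (range_at x))" "poly_bounded (\<lambda>x. real (size_at x))"
  unfolding range_at_def size_at_def by (rule poly_bounded_nat_ceiling)+

text \<open>The value of \<open>leak\<close> for at most \<open>exp (d * x)\<close> sites, time
  \<open>x^2\<close> and radius \<open>x ^ 3\<close>.\<close>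

definition leak_at :: "nat \<Rightarrow> real \<Rightarrow> real" where
  "leak_at d x = exp (2 * real d * x + 2 * real d * exp 1 * x\<^sup>2 - x ^ 3)"

lemma (in hardcore) leak_le:
  fixes S :: "'d::finite site set"
  assumes "real (card S) \<le> exp (real CARD('d) * x)"
  shows "leak S (x\<^sup>2) (range_at x) \<le> leak_at CARD('d) x"
proof -
  have "leak S (x\<^sup>2) (range_at x) \<le> (exp (real CARD('d) * x))\<^sup>2 * exp (2 * real CARD('d) * exp 1 * x\<^sup>2 - x ^ 3)"
    unfolding leak_def using assms range_at_ge[of x] by (intro mult_mono power_mono) auto
  also have "\<dots> = leak_at CARD('d) x"
    by (simp add: leak_at_def exp_double[symmetric] exp_add[symmetric] algebra_simps)
  finally show ?thesis .
qed

lemma tendsto_0_eventually_le: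
  fixes f :: "'a \<Rightarrow> real"
  assumes "(f \<longlongrightarrow> 0) F" "0 < \<epsilon>"
  shows "\<forall>\<^sub>F x in F. f x \<le> \<epsilon>"
  using order_tendstoD(2)[OF assms] by (rule eventually_mono) simp

lemma eventually_leak_at:
  assumes "0 < \<epsilon>"
  shows "\<forall>\<^sub>F x in at_top. leak_at d x \<le> \<epsilon>"
    and "\<forall>\<^sub>F x in at_top. exp (real d * x) * (2 * sqrt (2 * leak_at d x)) \<le> \<epsilon>"
proof -
  have "((\<lambda>x. leak_at d x) \<longlongrightarrow> 0) at_top" unfolding leak_at_def by real_asymp
  then show "\<forall>\<^sub>F x in at_top. leak_at d x \<le> \<epsilon>"
    using assms by (rule tendsto_0_eventually_le)
  have "sqrt (leak_at d x) = exp (real d * x + real d * exp 1 * x\<^sup>2 - x ^ 3 / 2)" for x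
  proof -
    have "leak_at d x = (exp (real d * x + real d * exp 1 * x\<^sup>2 - x ^ 3 / 2))\<^sup>2"
      unfolding leak_at_def exp_double[symmetric] by (simp add: algebra_simps)
    then show ?thesis by simp
  qed
  then have "exp (real d * x) * (2 * sqrt (2 * leak_at d x))
      = 2 * sqrt 2 * exp (2 * real d * x + real d * exp 1 * x\<^sup>2 - x ^ 3 / 2)" for x
    by (simp add: real_sqrt_mult exp_add[symmetric] algebra_simps)
  moreover have "((\<lambda>x. 2 * sqrt 2 * exp (2 * real d * x + real d * exp 1 * x\<^sup>2 - x ^ 3 / 2)) \<longlongrightarrow> 0) at_top"
    by real_asymp
  ultimately have "((\<lambda>x. exp (real d * x) * (2 * sqrt (2 * leak_at d x))) \<longlongrightarrow> 0) at_top" by (simp only:)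
  then show "\<forall>\<^sub>F x in at_top. exp (real d * x) * (2 * sqrt (2 * leak_at d x)) \<le> \<epsilon>"
    using assms by (rule tendsto_0_eventually_le)
qed

lemma eventually_not_coalesced:
  fixes \<epsilon> c d A :: real
  assumes "0 < \<epsilon>" "0 < c"
  shows "\<forall>\<^sub>F x in at_top. 4 * exp (d * x) * exp (- c * x\<^sup>2) \<le> exp (- (A * ln x)) * \<epsilon>"
proof -
  have "filterlim (\<lambda>x. d * x - c * x\<^sup>2 + A * ln x) at_bot at_top" using assms(2) by real_asymp
  then have "\<forall>\<^sub>F x in at_top. d * x - c * x\<^sup>2 + A * ln x \<le> ln (\<epsilon> / 4)"
    by (simp add: filterlim_at_bot)
  then show ?thesis
  proof eventually_elim
    case (elim x)
    then have "exp (d * x - c * x\<^sup>2) \<le> exp (- (A * ln x) + ln (\<epsilon> / 4))" by simp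
    also have "\<dots> = exp (- (A * ln x)) * (\<epsilon> / 4)" unfolding exp_add using assms(1) by simp
    finally have "4 * exp (d * x - c * x\<^sup>2) \<le> exp (- (A * ln x)) * \<epsilon>" by simp
    moreover have "exp (d * x) * exp (- c * x\<^sup>2) = exp (d * x - c * x\<^sup>2)" unfolding exp_add[symmetric] by simp
    ultimately show ?case by (simp only: mult.assoc)
  qed
qed

lemma eventually_power_less_exp:
  fixes A w :: real
  assumes "0 < w"
  shows "\<forall>\<^sub>F x in at_top. x ^ B < exp x / 8 * ((exp (- (A * ln x)) * w)\<^sup>2 / 2)"
proof -
  define M where "M = real B + 2 * A"
  have "filterlim (\<lambda>x. x - M * ln x) at_top at_top" by real_asymp
  then have "\<forall>\<^sub>F x in at_top. ln (17 / w\<^sup>2) \<le> x - M * ln x"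
    by (simp add: filterlim_at_top)
  then show ?thesis using eventually_gt_at_top[of 0]
  proof eventually_elim
    case (elim x)
    define u where "u = exp (- (A * ln x))"
    have u: "exp (2 * - (A * ln x)) = u\<^sup>2" unfolding u_def by (rule exp_double)
    have w: "exp (ln (17 / w\<^sup>2)) = 17 / w\<^sup>2" using assms by simp
    have "x ^ B = exp (real B * ln x)" using elim(2) by (simp add: exp_of_nat_mult)
    also have "\<dots> \<le> exp (x + 2 * - (A * ln x) - ln (17 / w\<^sup>2))" using elim(1) by (simp add: M_def algebra_simps)
    also have "\<dots> = exp x * u\<^sup>2 * (w\<^sup>2 / 17)" unfolding exp_diff exp_add u w by simp
    \<comment> \<open>The exact constant is 16; the number 17 above leaves room for the strict
      inequality.\<close>
    also have "\<dots> < exp x * u\<^sup>2 * (w\<^sup>2 / 16)"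
      using assms by (intro mult_strict_left_mono) (auto simp: u_def)
    also have "\<dots> = exp x / 8 * ((u * w)\<^sup>2 / 2)" by (simp add: power_mult_distrib)
    finally show ?case unfolding u_def .
  qed
qed

section \<open>The smoothing estimate and the lower bound for large systems\<close>

context hardcore
begin

text \<open>The bound is uniform over all regions of the given size. For \<open>t\<close> beyond
  \<open>x^2\<close> the chain has mixed already. Otherwise \<open>mdist_smoothing\<close> gives
  \<open>\<epsilon> / 2\<close> plus four terms, each eventually at most
  \<open>\<epsilon> / 10\<close>.\<close>

lemma mdist_smoothing_eventually:
  fixes c \<epsilon> :: real
  assumes c: "0 < c" and rate: "\<And>(S :: 'd::finite site set) t. finite S \<Longrightarrow> 0 \<le> t \<Longrightarrow> not_coalesced S t \<le> 4 * real (card S) * exp (- c * t)"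
    and \<epsilon>: "0 < \<epsilon>" "\<epsilon> < 1"
  shows "\<exists>C>0. \<forall>\<^sub>F x in at_top. \<forall>S :: 'd site set. finite S \<longrightarrow> real (card S) \<le> exp (real CARD('d) * x) \<longrightarrow>
    (\<forall>t\<ge>0. mdist S t \<le> 1 - \<epsilon> \<longrightarrow> mdist S (t + C * ln x) \<le> \<epsilon>)"
proof -
  define d where "d = CARD('d)"
  define k where "k x = (2 * range_at x + 1) ^ d * size_at x" for x
  define Y where "Y x = real (2 * (4 * range_at x * k x) + 1) ^ d" for x
  define Y' where "Y' x = real (2 * (4 * range_at x * k x + range_at x + range_at x) + 1) ^ d" for x
  define X where "X x = 4 * real (2 * range_at x + 1) ^ d" for x
  have "poly_bounded (\<lambda>x. (Y x + Y' x + 1) * X x)"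
    unfolding Y_def Y'_def X_def k_def of_nat_add of_nat_mult of_nat_power of_nat_numeral of_nat_1
    by (intro poly_bounded_intros poly_bounded_range_at)
  then obtain B :: nat where B: "\<forall>\<^sub>F x in at_top. \<bar>(Y x + Y' x + 1) * X x\<bar> \<le> x ^ B"
    by (auto simp: poly_bounded_def)
  \<comment> \<open>With this choice \<open>exp (- c * (C * ln x))\<close> is \<open>x\<close> to
    the power \<open>- (B + 1)\<close>, which cancels all polynomial factors and leaves a gain of
    \<open>1 / x\<close>.\<close>
  define C where "C = (real B + 1) / c"
  have C: "0 < C" using c by (simp add: C_def)
  define L where "L = ln (4 / \<epsilon>)"
  have L: "0 \<le> L" using \<epsilon> by (simp add: L_def)
  have ev1: "\<forall>\<^sub>F x in at_top. C * ln x \<le> x\<^sup>2" using C by real_asymp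
  have ev4: "\<forall>\<^sub>F x in at_top. exp (real d * x) * exp (- (x * ln x)) \<le> \<epsilon> / 10"
  proof (rule tendsto_0_eventually_le)
    have "filterlim (\<lambda>x. real d * x - x * ln x) at_bot at_top" by real_asymp
    then have "((\<lambda>x. exp (real d * x - x * ln x)) \<longlongrightarrow> 0) at_top" by (rule filterlim_compose[OF exp_at_bot])
    then show "((\<lambda>x. exp (real d * x) * exp (- (x * ln x))) \<longlongrightarrow> 0) at_top" by (simp add: exp_add[symmetric])
  qed (use \<epsilon> in simp)
  have ev5: "\<forall>\<^sub>F x in at_top. (L + 2) / (x * \<epsilon>) \<le> \<epsilon> / 10"
  proof (rule tendsto_0_eventually_le)
    show "((\<lambda>x. (L + 2) / (x * \<epsilon>)) \<longlongrightarrow> 0) at_top" using \<epsilon> by real_asymp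
  qed (use \<epsilon> in simp)
  have ev3: "\<forall>\<^sub>F x in at_top. 4 * exp (real d * x) * exp (- c * x\<^sup>2) \<le> exp (- (0 * ln x)) * (\<epsilon> / 10)"
    using \<epsilon> c by (intro eventually_not_coalesced) auto
  have ev2: "\<forall>\<^sub>F x in at_top. leak_at d x \<le> \<epsilon> / 40" using \<epsilon> by (intro eventually_leak_at) simp
  have "\<forall>\<^sub>F x in at_top. \<forall>S :: 'd site set. finite S \<longrightarrow> real (card S) \<le> exp (real CARD('d) * x) \<longrightarrow>
    (\<forall>t\<ge>0. mdist S t \<le> 1 - \<epsilon> \<longrightarrow> mdist S (t + C * ln x) \<le> \<epsilon>)"
    using B ev1 ev2 eventually_leak_at(2)[of 1 d, OF zero_less_one] ev3 ev4 ev5 eventually_ge_at_top[of 1]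
  proof eventually_elim
    case (elim x)
    note poly = elim(1) and h1 = elim(4) and nc0 = elim(5) and last = elim(6) and small = elim(7) and x = elim(8)
    show ?case
    proof (intro allI impI)
      fix S :: "'d site set" and t :: real
      assume S: "finite S" and card: "real (card S) \<le> exp (real CARD('d) * x)"
        and t: "0 \<le> t" and dist: "mdist S t \<le> 1 - \<epsilon>"
      define s where "s = C * ln x"
      define e where "e = leak_at d x"
      define p where "p = X x * exp (- c * s)"
      define h where "h = real (card S) * (2 * sqrt (2 * e))"
      let ?r = "range_at x" and ?q = "size_at x"
      have s: "0 \<le> s" "s \<le> x\<^sup>2" using C x elim(2) by (auto simp: s_def)
      have e0: "0 \<le> e" by (simp add: e_def leak_at_def)
      have "not_coalesced S (x\<^sup>2) \<le> 4 * real (card S) * exp (- c * x\<^sup>2)" by (rule rate[OF S]) simp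
      also have "\<dots> \<le> 4 * exp (real d * x) * exp (- c * x\<^sup>2)"
        using card by (intro mult_right_mono mult_left_mono) (auto simp: d_def)
      finally have nc: "not_coalesced S (x\<^sup>2) \<le> \<epsilon> / 10" using nc0 by simp
      show "mdist S (t + C * ln x) \<le> \<epsilon>"
      proof (cases "t \<le> x\<^sup>2")
        case False
        then have "mdist S (t + C * ln x) \<le> mdist S (x\<^sup>2)"
          using s by (intro mdist_antimono[OF S]) (auto simp: s_def)
        also have "\<dots> \<le> \<epsilon> / 10" using mdist_le_not_coalesced[OF S, of "x\<^sup>2"] nc by simp
        finally show ?thesis using \<epsilon> by simp
      next
        case True
        have nonneg: "0 \<le> X x" "0 \<le> Y x" "0 \<le> Y' x" by (simp_all add: X_def Y_def Y'_def)
        have g: "x ^ B * exp (- c * s) = 1 / x"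
        proof -
          have "- c * s = - (real (Suc B) * ln x)" using c by (simp add: s_def C_def)
          then have "exp (- c * s) = inverse (x ^ Suc B)"
            using x by (simp only: exp_minus exp_of_nat_mult) simp
          then show ?thesis using x by (simp add: field_simps)
        qed
        have bound: "z * p \<le> 1 / x" if z: "0 \<le> z" "z \<le> Y x + Y' x + 1" for z
        proof -
          have "z * X x \<le> (Y x + Y' x + 1) * X x" using z nonneg by (intro mult_right_mono) auto
          also have "\<dots> \<le> x ^ B" using poly by linarith
          finally have "z * X x * exp (- c * s) \<le> x ^ B * exp (- c * s)" by (intro mult_right_mono) auto
          then show ?thesis unfolding g p_def by (simp only: mult.assoc)
        qed
        have p0: "0 \<le> p" using nonneg by (simp add: p_def)
        have p: "not_coalesced (region S ?r y) s \<le> p" for y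
        proof -
          have "real (card (region S ?r y)) \<le> real (2 * ?r + 1) ^ d"
            using card_region[of S ?r y] unfolding d_def of_nat_power[symmetric] of_nat_le_iff .
          then have "4 * real (card (region S ?r y)) * exp (- c * s) \<le> X x * exp (- c * s)"
            unfolding X_def by (intro mult_right_mono) auto
          then show ?thesis
            using rate[of "region S ?r y" s] s finite_region[of S ?r y] unfolding p_def by linarith
        qed
        have h: "0 \<le> h" "h \<le> 1"
        proof -
          show "0 \<le> h" using e0 by (simp add: h_def)
          have "h \<le> exp (real d * x) * (2 * sqrt (2 * leak_at d x))"
            unfolding h_def e_def using card e0 by (intro mult_right_mono) (auto simp: d_def e_def)
          then show "h \<le> 1" using h1 by simp
        qed
        have "mdist S (t + s) \<le> 4 * e + \<epsilon> / 2 + real (card S) * (Y x * p) ^ ?q + p * (Y' x * (L + h) + h) / \<epsilon> + not_coalesced S (x\<^sup>2)"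
          unfolding Y_def Y'_def k_def L_def h_def d_def
        proof (rule mdist_smoothing[OF S t True s _ _ \<epsilon> _ p dist])
          show "leak S (x\<^sup>2) ?r \<le> e" unfolding e_def d_def by (rule leak_le[OF card])
        qed (use elim(3) nc \<epsilon> in \<open>simp_all add: e_def\<close>)
        moreover have "4 * e \<le> \<epsilon> / 10" using elim(3) by (simp add: e_def)
        moreover have "real (card S) * (Y x * p) ^ ?q \<le> \<epsilon> / 10"
        proof -
          have "(Y x * p) ^ ?q \<le> (1 / x) ^ ?q"
            using bound[of "Y x"] nonneg p0 by (intro power_mono) auto
          also have "\<dots> = exp (- (real ?q * ln x))"
            using x by (simp add: exp_minus exp_of_nat_mult power_one_over inverse_eq_divide)
          also have "\<dots> \<le> exp (- (x * ln x))"
            using x size_at_ge[of x] by (simp add: mult_right_mono)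
          finally have "real (card S) * (Y x * p) ^ ?q \<le> exp (real d * x) * exp (- (x * ln x))"
            using card nonneg p0 by (intro mult_mono) (auto simp: d_def)
          then show ?thesis using last by simp
        qed
        moreover have "p * (Y' x * (L + h) + h) / \<epsilon> \<le> \<epsilon> / 10"
        proof -
          have "p * (Y' x * (L + h) + h) = (Y' x * p) * (L + h) + (1 * p) * h" by (simp add: algebra_simps)
          also have "\<dots> \<le> (1 / x) * (L + 1) + (1 / x) * 1"
            using bound[of "Y' x"] bound[of 1] nonneg h L p0 x by (intro add_mono mult_mono) auto
          also have "\<dots> = (L + 2) / x" using x by (simp add: field_simps)
          finally have "p * (Y' x * (L + h) + h) / \<epsilon> \<le> (L + 2) / x / \<epsilon>" using \<epsilon> by (intro divide_right_mono) auto
          then show ?thesis using small unfolding divide_divide_eq_left by (rule order_trans)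
        qed
        ultimately have "mdist S (t + s) \<le> \<epsilon>" using nc \<epsilon> by linarith
        then show ?thesis by (simp add: s_def)
      qed
    qed
  qed
  with C show ?thesis by blast
qed

text \<open>If the distance were at most \<open>1 - \<epsilon>\<close> at time
  \<open>A * ln x\<close>, the defects of the even sites, each a fixed negative power of
  \<open>x\<close>, would have a sum polynomial in \<open>x\<close>. But there are at least
  \<open>exp x / 8\<close> such sites.\<close>

lemma mdist_lower_eventually:
  fixes c \<epsilon> A :: real
  assumes c: "0 < c" and rate: "\<And>(S :: 'd::finite site set) t. finite S \<Longrightarrow> 0 \<le> t \<Longrightarrow> not_coalesced S t \<le> 4 * real (card S) * exp (- c * t)"
    and \<epsilon>: "0 < \<epsilon>" "\<epsilon> < 1" and A: "0 < A"
  shows "\<forall>\<^sub>F x in at_top. \<forall>S :: 'd site set. finite S \<longrightarrow> real (card S) \<le> exp (real CARD('d) * x) \<longrightarrow>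
    exp x / 8 \<le> real (card (top_conf S)) \<longrightarrow> 1 - \<epsilon> < mdist S (A * ln x)"
proof -
  define d where "d = CARD('d)"
  define w where "w = 1 / (2 * (1 + lam))"
  have w: "0 < w" using lam_pos by (simp add: w_def)
  define L where "L = ln (4 / \<epsilon>)"
  have "poly_bounded (\<lambda>x. real (2 * range_at x + 1) ^ d * (L + 1))"
    unfolding of_nat_add of_nat_mult of_nat_numeral of_nat_1
    by (intro poly_bounded_intros poly_bounded_range_at)
  then obtain B :: nat where B: "\<forall>\<^sub>F x in at_top. \<bar>real (2 * range_at x + 1) ^ d * (L + 1)\<bar> \<le> x ^ B"
    by (auto simp: poly_bounded_def)
  have ev1: "\<forall>\<^sub>F x in at_top. A * ln x \<le> x\<^sup>2" using A by real_asymp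
  have ev2: "\<forall>\<^sub>F x in at_top. leak_at d x \<le> \<epsilon> / 8" using \<epsilon> by (intro eventually_leak_at) simp
  have ev3: "\<forall>\<^sub>F x in at_top. 4 * exp (real d * x) * exp (- c * x\<^sup>2) \<le> exp (- (0 * ln x)) * (\<epsilon> / 2)"
    using \<epsilon> c by (intro eventually_not_coalesced) auto
  have ev4: "\<forall>\<^sub>F x in at_top. 4 * exp (real d * x) * exp (- c * x\<^sup>2) \<le> exp (- (A * ln x)) * w"
    using w c by (intro eventually_not_coalesced)
  show ?thesis
    using B ev1 ev2 eventually_leak_at(2)[of 1 d, OF zero_less_one] ev3 ev4 eventually_power_less_exp[OF w, of B A] eventually_ge_at_top[of 1]
  proof eventually_elim
    case (elim x)
    note poly = elim(1) and h1 = elim(4) and growth = elim(7) and x = elim(8)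
    show ?case
    proof (intro allI impI)
      fix S :: "'d site set"
      assume S: "finite S" and card: "real (card S) \<le> exp (real CARD('d) * x)"
        and many: "exp x / 8 \<le> real (card (top_conf S))"
      define t where "t = A * ln x"
      have t: "0 \<le> t" "t \<le> x\<^sup>2" using A x elim(2) by (auto simp: t_def)
      have "not_coalesced S (x\<^sup>2) \<le> 4 * real (card S) * exp (- c * x\<^sup>2)" by (rule rate[OF S]) simp
      also have "\<dots> \<le> 4 * exp (real d * x) * exp (- c * x\<^sup>2)"
        using card by (intro mult_right_mono mult_left_mono) (auto simp: d_def)
      finally have nc: "not_coalesced S (x\<^sup>2) \<le> 4 * exp (real d * x) * exp (- c * x\<^sup>2)" .
      have nc': "not_coalesced S (x\<^sup>2) \<le> \<epsilon> / 2" "not_coalesced S (x\<^sup>2) \<le> exp (- t) / (2 * (1 + lam))"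
        using nc elim(5,6) by (simp_all add: t_def w_def)
      show "1 - \<epsilon> < mdist S (A * ln x)"
      proof (rule ccontr)
        assume "\<not> 1 - \<epsilon> < mdist S (A * ln x)"
        then have "mdist S t \<le> 1 - \<epsilon>" by (simp add: t_def)
        have "real (card (top_conf S)) * ((exp (- t) / (2 * (1 + lam)))\<^sup>2 / 2)
          \<le> real (2 * range_at x + 1) ^ CARD('d) * (ln (4 / \<epsilon>) + real (card S) * (2 * sqrt (2 * leak_at d x)))"
        proof (rule even_sites_bound[OF S t _ _ \<epsilon> nc' \<open>mdist S t \<le> 1 - \<epsilon>\<close>])
          show "leak S (x\<^sup>2) (range_at x) \<le> leak_at d x" unfolding d_def by (rule leak_le[OF card])
        qed (use elim(3) in simp)
        also have "\<dots> \<le> real (2 * range_at x + 1) ^ d * (L + 1)"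
        proof -
          have "real (card S) * (2 * sqrt (2 * leak_at d x)) \<le> exp (real d * x) * (2 * sqrt (2 * leak_at d x))"
            using card by (intro mult_right_mono) (auto simp: d_def leak_at_def)
          then show ?thesis unfolding L_def d_def[symmetric] using h1 by (intro mult_left_mono) auto
        qed
        also have "\<dots> \<le> x ^ B" using poly by linarith
        also have "\<dots> < exp x / 8 * ((exp (- (A * ln x)) * w)\<^sup>2 / 2)" by (rule growth)
        also have "\<dots> \<le> real (card (top_conf S)) * ((exp (- t) / (2 * (1 + lam)))\<^sup>2 / 2)"
        proof -
          have "exp (- (A * ln x)) * w = exp (- t) / (2 * (1 + lam))" by (simp add: t_def w_def)
          then show ?thesis using many by (simp only:) (intro mult_right_mono, auto)
        qed
        finally show False by simp
      qed
    qed
  qed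
qed

end

text \<open>\<open>smooth\<close> bounds \<open>T n \<epsilon> - T n (1 - \<epsilon>)\<close> from
  above. Exchanging \<open>\<epsilon>\<close> and \<open>1 - \<epsilon>\<close> bounds it from
  below, without asking which of the two is smaller. \<open>lower\<close> makes every mixing time
  much larger than \<open>w\<close>, so the window also gives cutoff.\<close>

lemma cutoff_of_smoothing:
  fixes D :: "nat \<Rightarrow> real \<Rightarrow> real" and w :: "nat \<Rightarrow> real"
  assumes anti: "\<And>n s t. 0 \<le> s \<Longrightarrow> s \<le> t \<Longrightarrow> D n t \<le> D n s"
    and reach: "\<And>n \<epsilon>. 0 < \<epsilon> \<Longrightarrow> \<exists>t\<ge>0. D n t \<le> \<epsilon>"
    and smooth: "\<And>\<epsilon>. 0 < \<epsilon> \<Longrightarrow> \<epsilon> < 1 \<Longrightarrow> \<exists>C>0. \<forall>\<^sub>F n in sequentially. \<forall>t\<ge>0. D n t \<le> 1 - \<epsilon> \<longrightarrow> D n (t + C * w n) \<le> \<epsilon>"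
    and lower: "\<And>\<epsilon> A. 0 < \<epsilon> \<Longrightarrow> \<epsilon> < 1 \<Longrightarrow> 0 < A \<Longrightarrow> \<forall>\<^sub>F n in sequentially. 1 - \<epsilon> < D n (A * w n)"
    and w: "filterlim w at_top sequentially"
  defines "T n \<epsilon> \<equiv> Inf {t. 0 \<le> t \<and> D n t \<le> \<epsilon>}"
  shows "cutoff T \<and> cutoff_window T w"
proof -
  have w1: "\<forall>\<^sub>F n in sequentially. 1 \<le> w n" using w by (simp add: filterlim_at_top)
  have bdd: "bdd_below {t. 0 \<le> t \<and> D n t \<le> \<epsilon>}" for n \<epsilon> by (rule bdd_belowI[of _ 0]) auto
  have ne: "{t. 0 \<le> t \<and> D n t \<le> \<epsilon>} \<noteq> {}" if "0 < \<epsilon>" for n \<epsilon> using reach[OF that] by blast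
  have upper: "\<exists>K>0. \<forall>\<^sub>F n in sequentially. T n \<epsilon> \<le> T n (1 - \<epsilon>) + K * w n" if \<epsilon>: "0 < \<epsilon>" "\<epsilon> < 1" for \<epsilon>
  proof -
    obtain C where C: "0 < C" and ev: "\<forall>\<^sub>F n in sequentially. \<forall>t\<ge>0. D n t \<le> 1 - \<epsilon> \<longrightarrow> D n (t + C * w n) \<le> \<epsilon>"
      using smooth[OF \<epsilon>] by blast
    have "\<forall>\<^sub>F n in sequentially. T n \<epsilon> \<le> T n (1 - \<epsilon>) + (C + 1) * w n"
      using ev w1
    proof eventually_elim
      case (elim n)
      have "0 < 1 - \<epsilon>" using \<epsilon> by simp
      \<comment> \<open>The infimum need not be attained, which costs one unit of time.\<close>
      obtain t where t: "t \<in> {t. 0 \<le> t \<and> D n t \<le> 1 - \<epsilon>}" "t < T n (1 - \<epsilon>) + 1"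
        using cInf_lessD[OF ne[OF \<open>0 < 1 - \<epsilon>\<close>], of n "T n (1 - \<epsilon>) + 1"] unfolding T_def by auto
      have "T n \<epsilon> \<le> t + C * w n"
        unfolding T_def using t(1) elim C by (intro cInf_lower[OF _ bdd]) auto
      then show ?case using t(2) elim(2) by (simp add: algebra_simps)
    qed
    then show ?thesis using C by (intro exI[of _ "C + 1"]) simp
  qed
  have window: "\<exists>K>0. \<forall>\<^sub>F n in sequentially. \<bar>T n \<epsilon> - T n (1 - \<epsilon>)\<bar> \<le> K * w n" if \<epsilon>: "0 < \<epsilon>" "\<epsilon> < 1" for \<epsilon>
  proof -
    obtain K K' where K: "0 < K" "0 < K'" and ev: "\<forall>\<^sub>F n in sequentially. T n \<epsilon> \<le> T n (1 - \<epsilon>) + K * w n"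
      "\<forall>\<^sub>F n in sequentially. T n (1 - \<epsilon>) \<le> T n \<epsilon> + K' * w n"
      using upper[OF \<epsilon>] upper[of "1 - \<epsilon>"] \<epsilon> by auto
    have "\<forall>\<^sub>F n in sequentially. \<bar>T n \<epsilon> - T n (1 - \<epsilon>)\<bar> \<le> (K + K') * w n"
      using ev w1
    proof eventually_elim
      case (elim n)
      have "0 \<le> K * w n" "0 \<le> K' * w n" using K elim(3) by auto
      then show ?case using elim unfolding distrib_right by linarith
    qed
    then show ?thesis using K by (intro exI[of _ "K + K'"]) simp
  qed
  have large: "\<forall>\<^sub>F n in sequentially. A * w n \<le> T n (1 - \<epsilon>)" if \<epsilon>: "0 < \<epsilon>" "\<epsilon> < 1" and A: "0 < A" for \<epsilon> A
    using lower[OF \<epsilon> A]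
  proof eventually_elim
    case (elim n)
    have "0 < 1 - \<epsilon>" using \<epsilon> by simp
    show ?case
      unfolding T_def
    proof (rule cInf_greatest[OF ne[OF \<open>0 < 1 - \<epsilon>\<close>]])
      fix t assume "t \<in> {t. 0 \<le> t \<and> D n t \<le> 1 - \<epsilon>}"
      then show "A * w n \<le> t" using anti[of t "A * w n" n] elim by (cases "A * w n \<le> t") auto
    qed
  qed
  have "cutoff T"
    unfolding cutoff_def
  proof (intro allI impI)
    fix \<epsilon> :: real assume "0 < \<epsilon> \<and> \<epsilon> < 1"
    then have \<epsilon>: "0 < \<epsilon>" "\<epsilon> < 1" by auto
    obtain K where K: "0 < K" and ev: "\<forall>\<^sub>F n in sequentially. \<bar>T n \<epsilon> - T n (1 - \<epsilon>)\<bar> \<le> K * w n"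
      using window[OF \<epsilon>] by blast
    show "(\<lambda>n. T n \<epsilon> / T n (1 - \<epsilon>)) \<longlonglongrightarrow> 1"
    proof (rule tendstoI)
      fix \<eta> :: real assume \<eta>: "0 < \<eta>"
      have "0 < 2 * K / \<eta>" using K \<eta> by simp
      show "\<forall>\<^sub>F n in sequentially. dist (T n \<epsilon> / T n (1 - \<epsilon>)) 1 < \<eta>"
        using ev large[OF \<epsilon> \<open>0 < 2 * K / \<eta>\<close>] w1
      proof eventually_elim
        case (elim n)
        have "0 < 2 * K / \<eta> * w n" using K \<eta> elim(3) by simp
        then have pos: "0 < T n (1 - \<epsilon>)" using elim(2) by linarith
        have "dist (T n \<epsilon> / T n (1 - \<epsilon>)) 1 = \<bar>T n \<epsilon> - T n (1 - \<epsilon>)\<bar> / T n (1 - \<epsilon>)"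
          using pos by (simp add: dist_real_def diff_divide_distrib[symmetric] abs_divide divide_diff_eq_iff)
        also have "\<dots> \<le> K * w n / T n (1 - \<epsilon>)" using elim(1) pos by (intro divide_right_mono) auto
        also have "\<dots> \<le> K * w n / (2 * K / \<eta> * w n)"
          using elim(2,3) K mult_pos_pos[OF pos \<open>0 < 2 * K / \<eta> * w n\<close>] by (intro divide_left_mono) auto
        also have "\<dots> = \<eta> / 2" using K \<eta> elim(3) by (simp add: field_simps)
        finally show ?case using \<eta> by simp
      qed
    qed
  qed
  moreover have "cutoff_window T w"
    unfolding cutoff_window_def
  proof (intro conjI allI impI)
    show "w \<in> o(\<lambda>n. T n (1 / exp 1))"
    proof (rule landau_o.smallI)
      fix c :: real assume c: "0 < c"
      \<comment> \<open>\<open>large\<close> is stated for \<open>1 - \<epsilon>\<close>, so the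
        level \<open>1 / exp 1\<close> is reached with
        \<open>\<epsilon> = 1 - 1 / exp 1\<close>.\<close>
      have e: "1 - (1 - 1 / exp 1) = (1 / exp 1 :: real)" "0 < 1 - 1 / exp (1 :: real)" "1 - 1 / exp (1 :: real) < 1"
        by simp_all
      have "0 < 1 / c" using c by simp
      show "\<forall>\<^sub>F n in sequentially. norm (w n) \<le> c * norm (T n (1 / exp 1))"
        using large[OF e(2,3) \<open>0 < 1 / c\<close>] w1 unfolding e(1)
      proof eventually_elim
        case (elim n)
        then have "w n \<le> c * T n (1 / exp 1)" using c by (simp add: field_simps)
        also have "\<dots> \<le> c * \<bar>T n (1 / exp 1)\<bar>" using c by simp
        finally show ?case using elim(2) by simp
      qed
    qed
    fix \<epsilon> :: real assume "0 < \<epsilon> \<and> \<epsilon> < 1"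
    then obtain K where K: "0 < K" and ev: "\<forall>\<^sub>F n in sequentially. \<bar>T n \<epsilon> - T n (1 - \<epsilon>)\<bar> \<le> K * w n"
      using window by blast
    show "(\<lambda>n. T n \<epsilon> - T n (1 - \<epsilon>)) \<in> O(w)"
    proof (rule bigoI)
      show "\<forall>\<^sub>F n in sequentially. norm (T n \<epsilon> - T n (1 - \<epsilon>)) \<le> K * norm (w n)"
        using ev w1 by eventually_elim simp
    qed
  qed
  ultimately show ?thesis ..
qed

text \<open>The sites lie on a line that keeps one step away from every face of the box. All their
  neighbours are in the box, so no boundary condition can block them. A one-dimensional family is
  enough, since linear growth in \<open>n\<close> beats every power of \<open>ln n\<close>.\<close>

lemma card_top_conf_free_sites:
  fixes a :: "'d::finite site"
  shows "(n - 2) div 2 \<le> card (top_conf (free_sites (lattice_box a n) \<tau>))"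
proof -
  \<comment> \<open>Corrects the parity of the starting point, so that steps of 2 along the line
    visit even sites only.\<close>
  define b :: int where "b = (if even (\<Sum>i\<in>UNIV. a $ i + 1) then 0 else 1)"
  define i0 :: 'd where "i0 = undefined"
  define pt :: "nat \<Rightarrow> 'd site" where "pt j = (\<chi> i. a $ i + 1 + (if i = i0 then 2 * int j + b else 0))" for j
  have b: "0 \<le> b" "b \<le> 1" by (auto simp: b_def)
  have inj: "inj_on pt {..<(n - 2) div 2}"
  proof (rule inj_onI)
    fix j j' assume "pt j = pt j'"
    then have "pt j $ i0 = pt j' $ i0" by simp
    then show "j = j'" by (simp add: pt_def)
  qed
  have mem: "pt j \<in> top_conf (free_sites (lattice_box a n) \<tau>)" if "j < (n - 2) div 2" for j
  proof -
    have n: "2 * int j + b + 3 \<le> int n" using that b by linarith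
    have range: "a $ i + 1 \<le> pt j $ i" "pt j $ i \<le> a $ i + int n - 2" for i
      using n b by (auto simp: pt_def)
    have nbr: "v \<in> lattice_box a n" if "adjacent (pt j) v" for v
    proof -
      have "\<bar>pt j $ i - v $ i\<bar> \<le> 1" for i
        using abs_component_le_ldist[where u = "pt j" and v = v and i = i] that by (simp add: adjacent_iff_ldist)
      then have "a $ i \<le> v $ i \<and> v $ i < a $ i + int n" for i
        using range[of i] by (smt (verit))
      then show ?thesis by (simp add: lattice_box_def)
    qed
    have "a $ i \<le> pt j $ i \<and> pt j $ i < a $ i + int n" for i
      using range[of i] by linarith
    then have "pt j \<in> lattice_box a n" by (simp add: lattice_box_def)
    with nbr have "pt j \<in> free_sites (lattice_box a n) \<tau>"
      unfolding free_sites_def outer_boundary_def by blast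
    moreover have "even_site (pt j)"
    proof -
      have "(\<Sum>i\<in>UNIV. pt j $ i) = (\<Sum>i\<in>UNIV. a $ i + 1) + (2 * int j + b)"
        unfolding pt_def by (simp add: sum.distrib)
      then show ?thesis unfolding even_site_def by (simp add: b_def)
    qed
    ultimately show ?thesis by (simp add: top_conf_def)
  qed
  have "finite (top_conf (free_sites (lattice_box a n) \<tau>))"
    using finite_card_lattice_box(1)[of a n] by (rule rev_finite_subset) (auto simp: top_conf_def free_sites_def)
  then have "card (pt ` {..<(n - 2) div 2}) \<le> card (top_conf (free_sites (lattice_box a n) \<tau>))"
    using mem by (intro card_mono) auto
  then show ?thesis by (simp add: card_image[OF inj])
qed

theorem theorem4:
  fixes lam :: real
    and a :: "nat \<Rightarrow> (int ^ 'd::finite)"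
    and \<tau> :: "nat \<Rightarrow> (int ^ 'd \<Rightarrow> nat option)"
  assumes "0 < lam"
    and "CARD('d) \<ge> 2 \<Longrightarrow>
      lam < 1 / (2 * real CARD('d) - 2) * (1 + 1 / (2 * real CARD('d) - 2)) ^ (2 * CARD('d) - 1)"
    and "\<And>n. \<tau> n \<in> boundary_conditions (lattice_box (a n) n)"
  shows "cutoff (\<lambda>n. t_mix (lattice_box (a n) n) (\<tau> n) lam) \<and>
         cutoff_window (\<lambda>n. t_mix (lattice_box (a n) n) (\<tau> n) lam) (\<lambda>n. ln (ln (real n)))"
proof -
  interpret hardcore lam by unfold_locales (rule assms(1))
  \<comment> \<open>This absorbs the boundary condition; afterwards only the size of the region and
    its number of even sites enter.\<close>
  define S where "S n = free_sites (lattice_box (a n) n) (\<tau> n)" for n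
  have sub: "S n \<subseteq> lattice_box (a n) n" for n unfolding S_def by (rule free_sites_subset)
  have fin: "finite (S n)" for n using sub finite_card_lattice_box(1) by (rule finite_subset)
  have card: "card (S n) \<le> n ^ CARD('d)" for n
    using card_mono[OF finite_card_lattice_box(1) sub] by (simp add: finite_card_lattice_box(2))
  obtain c where c: "0 < c" and rate: "\<And>(S :: 'd site set) t. finite S \<Longrightarrow> 0 \<le> t \<Longrightarrow>
      not_coalesced S t \<le> 4 * real (card S) * exp (- c * t)"
    using ex_coalescence_rate[where 'd = 'd, OF assms(2)] by blast
  \<comment> \<open>The eventual bounds are stated in the real variable \<open>x = ln n\<close>,
    uniformly over regions, and are transferred to the sequence along this limit.\<close>
  have lim: "filterlim (\<lambda>n. ln (real n)) at_top sequentially"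
    by (intro filterlim_compose[OF ln_at_top filterlim_real_sequentially])
  have cardS: "\<forall>\<^sub>F n in sequentially. real (card (S n)) \<le> exp (real CARD('d) * ln (real n))"
    using eventually_gt_at_top[of 0]
  proof eventually_elim
    case (elim n)
    then have "exp (real CARD('d) * ln (real n)) = real n ^ CARD('d)" by (simp add: exp_of_nat_mult)
    then show ?case using card[of n] by (simp only: of_nat_power[symmetric] of_nat_le_iff)
  qed
  have many: "\<forall>\<^sub>F n in sequentially. exp (ln (real n)) / 8 \<le> real (card (top_conf (S n)))"
    using eventually_ge_at_top[of 4]
  proof eventually_elim
    case (elim n)
    have "real n / 8 \<le> real ((n - 2) div 2)" using elim by linarith
    also have "\<dots> \<le> real (card (top_conf (S n)))"
      unfolding S_def of_nat_le_iff by (rule card_top_conf_free_sites)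
    finally show ?case using elim by simp
  qed
  have "cutoff (\<lambda>n \<epsilon>. Inf {t. 0 \<le> t \<and> mdist (S n) t \<le> \<epsilon>}) \<and>
      cutoff_window (\<lambda>n \<epsilon>. Inf {t. 0 \<le> t \<and> mdist (S n) t \<le> \<epsilon>}) (\<lambda>n. ln (ln (real n)))"
  proof (rule cutoff_of_smoothing)
    show "mdist (S n) t \<le> mdist (S n) s" if "0 \<le> s" "s \<le> t" for n s t
      by (rule mdist_antimono[OF fin that])
    show "\<exists>t\<ge>0. mdist (S n) t \<le> \<epsilon>" if "0 < \<epsilon>" for n \<epsilon>
    proof -
      have "((\<lambda>t. 4 * real (card (S n)) * exp (- c * t)) \<longlongrightarrow> 0) at_top" using c by real_asymp
      from tendsto_0_eventually_le[OF this that] eventually_ge_at_top[of 0]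
      have "\<forall>\<^sub>F t in at_top. 0 \<le> t \<and> mdist (S n) t \<le> \<epsilon>"
      proof eventually_elim
        case (elim t)
        then show ?case using mdist_le_not_coalesced[OF fin, of t n] rate[OF fin, of t n] by simp
      qed
      then show ?thesis using eventually_happens'[OF trivial_limit_at_top_linorder] by blast
    qed
    show "\<exists>C>0. \<forall>\<^sub>F n in sequentially. \<forall>t\<ge>0. mdist (S n) t \<le> 1 - \<epsilon> \<longrightarrow> mdist (S n) (t + C * ln (ln (real n))) \<le> \<epsilon>"
      if \<epsilon>: "0 < \<epsilon>" "\<epsilon> < 1" for \<epsilon>
    proof -
      obtain C where C: "0 < C" and ev: "\<forall>\<^sub>F x in at_top. \<forall>S :: 'd site set. finite S \<longrightarrow> real (card S) \<le> exp (real CARD('d) * x) \<longrightarrow>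
          (\<forall>t\<ge>0. mdist S t \<le> 1 - \<epsilon> \<longrightarrow> mdist S (t + C * ln x) \<le> \<epsilon>)"
        using mdist_smoothing_eventually[OF c rate \<epsilon>] by blast
      have "\<forall>\<^sub>F n in sequentially. \<forall>t\<ge>0. mdist (S n) t \<le> 1 - \<epsilon> \<longrightarrow> mdist (S n) (t + C * ln (ln (real n))) \<le> \<epsilon>"
        using eventually_compose_filterlim[OF ev lim] cardS by eventually_elim (use fin in blast)
      with C show ?thesis by blast
    qed
    show "\<forall>\<^sub>F n in sequentially. 1 - \<epsilon> < mdist (S n) (A * ln (ln (real n)))" if \<epsilon>: "0 < \<epsilon>" "\<epsilon> < 1" "0 < A" for \<epsilon> A
    proof -
      have ev: "\<forall>\<^sub>F x in at_top. \<forall>S :: 'd site set. finite S \<longrightarrow> real (card S) \<le> exp (real CARD('d) * x) \<longrightarrow>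
          exp x / 8 \<le> real (card (top_conf S)) \<longrightarrow> 1 - \<epsilon> < mdist S (A * ln x)"
        by (rule mdist_lower_eventually[OF c rate \<epsilon>])
      show ?thesis
        using eventually_compose_filterlim[OF ev lim] cardS many by eventually_elim (use fin in blast)
    qed
    show "filterlim (\<lambda>n. ln (ln (real n))) at_top sequentially"
      by (rule filterlim_compose[OF ln_at_top lim])
  qed
  then show ?thesis
    unfolding S_def t_mix_eq[OF finite_card_lattice_box(1), symmetric] .
qed

end
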